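(* Let $K$ be a field of characteristic $\neq 2$, let $A$ be a commutative Hopf superalgebra over $K$ and let $B\subseteq A$ be a left coideal supersubalgebra. Then $A$ is a flat left $B$-module.
   Context: A commutative Hopf superalgebra is a Hopf algebra object in $\mathbf{Z}_2$-graded vector spaces (with the usual sign rule) which is supercommutative: $ab=(-1)^{|a||b|}ba$ for homogeneous $a,b$. Its comultiplication is denoted $\delta_A$. A supersubalgebra ($\mathbf{Z}_2$-graded subalgebra) $B\subseteq A$ is a left coideal if it is a left $A$-supercomodule via $\delta_A$, i.e. $\delta_A(B)\subseteq A\otimes B$. "Flat left $B$-module" is meant in the usual ungraded sense: $-\otimes_B A$ is exact on the category of all right modules over the ring $B$. *)

theory Defs
  imports "HOL-Algebra.Algebra" "HOL-Library.Z2"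
begin

section \<open>Modules over a not necessarily commutative ring\<close>

text \<open>The library locale \<^locale>\<open>module\<close> requires a commutative ring of scalars.\<close>

locale left_module = R?: ring R + N?: abelian_group N
  for R :: "('r, 'x) ring_scheme" (structure)
    and N :: "('r, 'n, 'y) module_scheme" (structure) +
  assumes smult_closed:
      "\<lbrakk>r \<in> carrier R; x \<in> carrier N\<rbrakk> \<Longrightarrow> r \<odot>\<^bsub>N\<^esub> x \<in> carrier N"
    and smult_l_distr:
      "\<lbrakk>r \<in> carrier R; s \<in> carrier R; x \<in> carrier N\<rbrakk> \<Longrightarrow>
        (r \<oplus>\<^bsub>R\<^esub> s) \<odot>\<^bsub>N\<^esub> x = r \<odot>\<^bsub>N\<^esub> x \<oplus>\<^bsub>N\<^esub> s \<odot>\<^bsub>N\<^esub> x"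
    and smult_r_distr:
      "\<lbrakk>r \<in> carrier R; x \<in> carrier N; y \<in> carrier N\<rbrakk> \<Longrightarrow>
        r \<odot>\<^bsub>N\<^esub> (x \<oplus>\<^bsub>N\<^esub> y) = r \<odot>\<^bsub>N\<^esub> x \<oplus>\<^bsub>N\<^esub> r \<odot>\<^bsub>N\<^esub> y"
    and smult_assoc:
      "\<lbrakk>r \<in> carrier R; s \<in> carrier R; x \<in> carrier N\<rbrakk> \<Longrightarrow>
        (r \<otimes>\<^bsub>R\<^esub> s) \<odot>\<^bsub>N\<^esub> x = r \<odot>\<^bsub>N\<^esub> (s \<odot>\<^bsub>N\<^esub> x)"
    and smult_one: "x \<in> carrier N \<Longrightarrow> \<one>\<^bsub>R\<^esub> \<odot>\<^bsub>N\<^esub> x = x"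

record ('r, 'm) right_module = "'m ring" +
  ract :: "'m \<Rightarrow> 'r \<Rightarrow> 'm"  (infixl \<open>\<triangleleft>\<index>\<close> 70)

locale right_module = R?: ring R + M?: abelian_group M
  for R :: "('r, 'x) ring_scheme" (structure)
    and M :: "('r, 'm, 'y) right_module_scheme" (structure) +
  assumes ract_closed:
      "\<lbrakk>x \<in> carrier M; r \<in> carrier R\<rbrakk> \<Longrightarrow> x \<triangleleft>\<^bsub>M\<^esub> r \<in> carrier M"
    and ract_r_distr:
      "\<lbrakk>x \<in> carrier M; r \<in> carrier R; s \<in> carrier R\<rbrakk> \<Longrightarrow>
        x \<triangleleft>\<^bsub>M\<^esub> (r \<oplus>\<^bsub>R\<^esub> s) = x \<triangleleft>\<^bsub>M\<^esub> r \<oplus>\<^bsub>M\<^esub> x \<triangleleft>\<^bsub>M\<^esub> s"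
    and ract_l_distr:
      "\<lbrakk>x \<in> carrier M; y \<in> carrier M; r \<in> carrier R\<rbrakk> \<Longrightarrow>
        (x \<oplus>\<^bsub>M\<^esub> y) \<triangleleft>\<^bsub>M\<^esub> r = x \<triangleleft>\<^bsub>M\<^esub> r \<oplus>\<^bsub>M\<^esub> y \<triangleleft>\<^bsub>M\<^esub> r"
    and ract_assoc:
      "\<lbrakk>x \<in> carrier M; r \<in> carrier R; s \<in> carrier R\<rbrakk> \<Longrightarrow>
        x \<triangleleft>\<^bsub>M\<^esub> (r \<otimes>\<^bsub>R\<^esub> s) = (x \<triangleleft>\<^bsub>M\<^esub> r) \<triangleleft>\<^bsub>M\<^esub> s"
    and ract_one: "x \<in> carrier M \<Longrightarrow> x \<triangleleft>\<^bsub>M\<^esub> \<one>\<^bsub>R\<^esub> = x"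

definition right_module_hom ::
  "('r, 'x) ring_scheme \<Rightarrow> ('r, 'm, 'y) right_module_scheme \<Rightarrow>
    ('r, 'n, 'z) right_module_scheme \<Rightarrow> ('m \<Rightarrow> 'n) set" where
  "right_module_hom R M N =
    {f \<in> hom (add_monoid M) (add_monoid N).
      \<forall>x \<in> carrier M. \<forall>r \<in> carrier R. f (x \<triangleleft>\<^bsub>M\<^esub> r) = f x \<triangleleft>\<^bsub>N\<^esub> r}"


section \<open>Tensor products\<close>

text \<open>
  Given abelian groups \<open>G\<close> and \<open>H\<close> (written as monoids, so that the monoid operation is
  their addition), a right action \<open>ra\<close> of a set \<open>S\<close> of scalars on \<open>G\<close> and a left action
  \<open>la\<close> on \<open>H\<close>, the tensor product of \<open>G\<close> and \<open>H\<close> over \<open>S\<close> is the free abelian group on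
  pairs modulo the usual relations. Its elements are cosets of formal integer
  combinations of pairs.
\<close>

definition tensor_relations ::
  "'r set \<Rightarrow> ('m, 'x) monoid_scheme \<Rightarrow> ('m \<Rightarrow> 'r \<Rightarrow> 'm) \<Rightarrow>
    ('n, 'y) monoid_scheme \<Rightarrow> ('r \<Rightarrow> 'n \<Rightarrow> 'n) \<Rightarrow> (('m \<times> 'n) \<Rightarrow>\<^sub>0 int) set" where
  "tensor_relations S G ra H la =
    {frag_of (x \<otimes>\<^bsub>G\<^esub> x', y) - frag_of (x, y) - frag_of (x', y) | x x' y.
       x \<in> carrier G \<and> x' \<in> carrier G \<and> y \<in> carrier H} \<union>
    {frag_of (x, y \<otimes>\<^bsub>H\<^esub> y') - frag_of (x, y) - frag_of (x, y') | x y y'.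
       x \<in> carrier G \<and> y \<in> carrier H \<and> y' \<in> carrier H} \<union>
    {frag_of (ra x r, y) - frag_of (x, la r y) | x r y.
       x \<in> carrier G \<and> r \<in> S \<and> y \<in> carrier H}"

definition tensor_kernel ::
  "'r set \<Rightarrow> ('m, 'x) monoid_scheme \<Rightarrow> ('m \<Rightarrow> 'r \<Rightarrow> 'm) \<Rightarrow>
    ('n, 'y) monoid_scheme \<Rightarrow> ('r \<Rightarrow> 'n \<Rightarrow> 'n) \<Rightarrow> (('m \<times> 'n) \<Rightarrow>\<^sub>0 int) set" where
  "tensor_kernel S G ra H la =
    generate (free_Abelian_group (carrier G \<times> carrier H)) (tensor_relations S G ra H la)"

definition tensor_group ::
  "'r set \<Rightarrow> ('m, 'x) monoid_scheme \<Rightarrow> ('m \<Rightarrow> 'r \<Rightarrow> 'm) \<Rightarrow>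
    ('n, 'y) monoid_scheme \<Rightarrow> ('r \<Rightarrow> 'n \<Rightarrow> 'n) \<Rightarrow> (('m \<times> 'n) \<Rightarrow>\<^sub>0 int) set monoid" where
  "tensor_group S G ra H la =
    free_Abelian_group (carrier G \<times> carrier H) Mod tensor_kernel S G ra H la"

definition pure_tensor ::
  "'r set \<Rightarrow> ('m, 'x) monoid_scheme \<Rightarrow> ('m \<Rightarrow> 'r \<Rightarrow> 'm) \<Rightarrow>
    ('n, 'y) monoid_scheme \<Rightarrow> ('r \<Rightarrow> 'n \<Rightarrow> 'n) \<Rightarrow> 'm \<Rightarrow> 'n \<Rightarrow> (('m \<times> 'n) \<Rightarrow>\<^sub>0 int) set" where
  "pure_tensor S G ra H la x y =
    tensor_kernel S G ra H la #>\<^bsub>free_Abelian_group (carrier G \<times> carrier H)\<^esub> frag_of (x, y)"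

text \<open>
  The homomorphism into the abelian group \<open>L\<close> induced by a balanced map \<open>f\<close>. For such \<open>f\<close>
  the value does not depend on the representative of the coset \<open>U\<close>, so the image below is
  a singleton.
\<close>

definition tensor_lift ::
  "('l, 'z) monoid_scheme \<Rightarrow> ('m \<Rightarrow> 'n \<Rightarrow> 'l) \<Rightarrow> (('m \<times> 'n) \<Rightarrow>\<^sub>0 int) set \<Rightarrow> 'l" where
  "tensor_lift L f U =
    the_elem ((\<lambda>u. finprod L (\<lambda>(x, y). f x y [^]\<^bsub>L\<^esub> Poly_Mapping.lookup u (x, y))
                    (Poly_Mapping.keys u)) ` U)"


section \<open>Flatness\<close>

definition module_tensor ::
  "('r, 'x) ring_scheme \<Rightarrow> ('r, 'm, 'y) right_module_scheme \<Rightarrow>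
    ('r, 'n, 'z) module_scheme \<Rightarrow> (('m \<times> 'n) \<Rightarrow>\<^sub>0 int) set monoid" where
  "module_tensor R M N = tensor_group (carrier R) (add_monoid M) (ract M) (add_monoid N) (smult N)"

definition module_tensor_map ::
  "('r, 'x) ring_scheme \<Rightarrow> ('r, 'm, 'y) right_module_scheme \<Rightarrow>
    ('r, 'n, 'z) module_scheme \<Rightarrow> ('l \<Rightarrow> 'm) \<Rightarrow>
    (('l \<times> 'n) \<Rightarrow>\<^sub>0 int) set \<Rightarrow> (('m \<times> 'n) \<Rightarrow>\<^sub>0 int) set" where
  "module_tensor_map R M N f =
    tensor_lift (module_tensor R M N)
      (\<lambda>x y. pure_tensor (carrier R) (add_monoid M) (ract M) (add_monoid N) (smult N) (f x) y)"

definition short_exact ::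
  "('a, 'x) monoid_scheme \<Rightarrow> ('b, 'y) monoid_scheme \<Rightarrow> ('c, 'z) monoid_scheme \<Rightarrow>
    ('a \<Rightarrow> 'b) \<Rightarrow> ('b \<Rightarrow> 'c) \<Rightarrow> bool" where
  "short_exact G H L f g \<longleftrightarrow>
    f \<in> hom G H \<and> g \<in> hom H L \<and>
    inj_on f (carrier G) \<and> f ` carrier G = kernel H L g \<and> g ` carrier H = carrier L"

text \<open>
  HOL cannot quantify over types inside a formula, so the carrier types of the three
  modules in a short exact sequence are parameters. A theorem concluding flatness with
  these type variables free covers all right modules.
\<close>

definition flat_left_module ::
  "'m1 itself \<Rightarrow> 'm2 itself \<Rightarrow> 'm3 itself \<Rightarrow>
    ('r, 'x) ring_scheme \<Rightarrow> ('r, 'n, 'y) module_scheme \<Rightarrow> bool" where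
  "flat_left_module T1 T2 T3 R N \<longleftrightarrow>
    left_module R N \<and>
    (\<forall>(M1 :: ('r, 'm1) right_module) (M2 :: ('r, 'm2) right_module)
        (M3 :: ('r, 'm3) right_module) f g.
      right_module R M1 \<and> right_module R M2 \<and> right_module R M3 \<and>
      f \<in> right_module_hom R M1 M2 \<and> g \<in> right_module_hom R M2 M3 \<and>
      short_exact (add_monoid M1) (add_monoid M2) (add_monoid M3) f g \<longrightarrow>
      short_exact (module_tensor R M1 N) (module_tensor R M2 N) (module_tensor R M3 N)
        (module_tensor_map R M2 N f) (module_tensor_map R M3 N g))"

definition regular_left_module :: "('a, 'x) ring_scheme \<Rightarrow> ('a, 'a) module" where
  "regular_left_module A =
    \<lparr>carrier = carrier A, monoid.mult = (\<otimes>\<^bsub>A\<^esub>), monoid.one = \<one>\<^bsub>A\<^esub>,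
     ring.zero = \<zero>\<^bsub>A\<^esub>, ring.add = (\<oplus>\<^bsub>A\<^esub>), smult = (\<otimes>\<^bsub>A\<^esub>)\<rparr>"


section \<open>Superalgebras\<close>

text \<open>The grading group \<open>Z\<^sub>2\<close> is the type \<^typ>\<open>bit\<close>: degree 0 is even, degree 1 is odd.\<close>

record ('k, 'a) superalgebra = "('k, 'a) module" +
  homog :: "bit \<Rightarrow> 'a set"

definition superalgebra ::
  "('k, 'x) ring_scheme \<Rightarrow> ('k, 'a, 'y) superalgebra_scheme \<Rightarrow> bool" where
  "superalgebra K A \<longleftrightarrow>
    field K \<and> module K A \<and> ring A \<and>
    (\<forall>k \<in> carrier K. \<forall>x \<in> carrier A. \<forall>y \<in> carrier A.
      (k \<odot>\<^bsub>A\<^esub> x) \<otimes>\<^bsub>A\<^esub> y = k \<odot>\<^bsub>A\<^esub> (x \<otimes>\<^bsub>A\<^esub> y) \<and>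
      x \<otimes>\<^bsub>A\<^esub> (k \<odot>\<^bsub>A\<^esub> y) = k \<odot>\<^bsub>A\<^esub> (x \<otimes>\<^bsub>A\<^esub> y)) \<and>
    (\<forall>i. subgroup (homog A i) (add_monoid A) \<and>
      (\<forall>k \<in> carrier K. \<forall>x \<in> homog A i. k \<odot>\<^bsub>A\<^esub> x \<in> homog A i)) \<and>
    homog A 0 \<inter> homog A 1 = {\<zero>\<^bsub>A\<^esub>} \<and>
    carrier A = homog A 0 <+>\<^bsub>A\<^esub> homog A 1 \<and>
    \<one>\<^bsub>A\<^esub> \<in> homog A 0 \<and>
    (\<forall>i j. \<forall>x \<in> homog A i. \<forall>y \<in> homog A j. x \<otimes>\<^bsub>A\<^esub> y \<in> homog A (i + j))"

definition hom_comp :: "('k, 'a, 'y) superalgebra_scheme \<Rightarrow> bit \<Rightarrow> 'a \<Rightarrow> 'a" where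
  "hom_comp A i x = (THE y. y \<in> homog A i \<and> (\<exists>z \<in> homog A (i + 1). x = y \<oplus>\<^bsub>A\<^esub> z))"

text \<open>\<open>super_sign A i j x\<close> is \<open>(-1)\<^sup>i\<^sup>j x\<close>.\<close>

definition super_sign :: "('a, 'x) ring_scheme \<Rightarrow> bit \<Rightarrow> bit \<Rightarrow> 'a \<Rightarrow> 'a" where
  "super_sign A i j x = (if i * j = 1 then \<ominus>\<^bsub>A\<^esub> x else x)"

definition supercommutative :: "('k, 'a, 'y) superalgebra_scheme \<Rightarrow> bool" where
  "supercommutative A \<longleftrightarrow>
    (\<forall>i j. \<forall>x \<in> homog A i. \<forall>y \<in> homog A j. x \<otimes>\<^bsub>A\<^esub> y = super_sign A i j (y \<otimes>\<^bsub>A\<^esub> x))"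

definition super_linear ::
  "('k, 'x) ring_scheme \<Rightarrow> ('k, 'a, 'y) superalgebra_scheme \<Rightarrow>
    ('k, 'b, 'z) superalgebra_scheme \<Rightarrow> ('a \<Rightarrow> 'b) set" where
  "super_linear K A B =
    {f \<in> hom (add_monoid A) (add_monoid B).
      (\<forall>k \<in> carrier K. \<forall>x \<in> carrier A. f (k \<odot>\<^bsub>A\<^esub> x) = k \<odot>\<^bsub>B\<^esub> f x) \<and>
      (\<forall>i. f ` homog A i \<subseteq> homog B i)}"

definition superalgebra_hom ::
  "('k, 'x) ring_scheme \<Rightarrow> ('k, 'a, 'y) superalgebra_scheme \<Rightarrow>
    ('k, 'b, 'z) superalgebra_scheme \<Rightarrow> ('a \<Rightarrow> 'b) set" where
  "superalgebra_hom K A B = super_linear K A B \<inter> ring_hom A B"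

definition base_superalgebra :: "('k, 'x) ring_scheme \<Rightarrow> ('k, 'k) superalgebra" where
  "base_superalgebra K =
    \<lparr>carrier = carrier K, monoid.mult = (\<otimes>\<^bsub>K\<^esub>), monoid.one = \<one>\<^bsub>K\<^esub>,
     ring.zero = \<zero>\<^bsub>K\<^esub>, ring.add = (\<oplus>\<^bsub>K\<^esub>), smult = (\<otimes>\<^bsub>K\<^esub>), homog = (\<lambda>i. if i = 0 then carrier K else {\<zero>\<^bsub>K\<^esub>})\<rparr>"

definition super_tensor_group ::
  "('k, 'x) ring_scheme \<Rightarrow> ('k, 'a, 'y) superalgebra_scheme \<Rightarrow>
    ('k, 'b, 'z) superalgebra_scheme \<Rightarrow> (('a \<times> 'b) \<Rightarrow>\<^sub>0 int) set monoid" where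
  "super_tensor_group K A B =
    tensor_group (carrier K) (add_monoid A) (\<lambda>x k. k \<odot>\<^bsub>A\<^esub> x) (add_monoid B) (smult B)"

definition super_pure ::
  "('k, 'x) ring_scheme \<Rightarrow> ('k, 'a, 'y) superalgebra_scheme \<Rightarrow>
    ('k, 'b, 'z) superalgebra_scheme \<Rightarrow> 'a \<Rightarrow> 'b \<Rightarrow> (('a \<times> 'b) \<Rightarrow>\<^sub>0 int) set" where
  "super_pure K A B =
    pure_tensor (carrier K) (add_monoid A) (\<lambda>x k. k \<odot>\<^bsub>A\<^esub> x) (add_monoid B) (smult B)"

text \<open>
  The product is the biadditive extension of
  \<open>(a \<otimes> b) (c \<otimes> d) = (-1)\<^sup>i\<^sup>j ac \<otimes> bd\<close> for \<open>b\<close> of degree \<open>i\<close> and \<open>c\<close> of degree \<open>j\<close>; general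
  \<open>b\<close> and \<open>c\<close> are split into their homogeneous components.
\<close>

definition super_tensor ::
  "('k, 'x) ring_scheme \<Rightarrow> ('k, 'a, 'y) superalgebra_scheme \<Rightarrow>
    ('k, 'b, 'z) superalgebra_scheme \<Rightarrow> ('k, (('a \<times> 'b) \<Rightarrow>\<^sub>0 int) set) superalgebra" where
  "super_tensor K A B =
    (let T = super_tensor_group K A B; t = super_pure K A B in
      \<lparr>carrier = carrier T,
       monoid.mult = (\<lambda>U V. tensor_lift T (\<lambda>a b. tensor_lift T (\<lambda>c d.
          finprod T (\<lambda>(i, j). t (super_sign A i j (a \<otimes>\<^bsub>A\<^esub> hom_comp A j c))
                                (hom_comp B i b \<otimes>\<^bsub>B\<^esub> d)) UNIV) V) U),
       monoid.one = t \<one>\<^bsub>A\<^esub> \<one>\<^bsub>B\<^esub>,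
       ring.zero = \<one>\<^bsub>T\<^esub>,
       ring.add = (\<otimes>\<^bsub>T\<^esub>),
       smult = (\<lambda>k. tensor_lift T (\<lambda>a b. t (k \<odot>\<^bsub>A\<^esub> a) b)),
       homog = (\<lambda>i. generate T {t a b | a b. \<exists>j l. j + l = i \<and> a \<in> homog A j \<and> b \<in> homog B l})\<rparr>)"

definition super_tensor_map ::
  "('k, 'x) ring_scheme \<Rightarrow> ('k, 'c, 'y) superalgebra_scheme \<Rightarrow>
    ('k, 'd, 'z) superalgebra_scheme \<Rightarrow> ('a \<Rightarrow> 'c) \<Rightarrow> ('b \<Rightarrow> 'd) \<Rightarrow>
    (('a \<times> 'b) \<Rightarrow>\<^sub>0 int) set \<Rightarrow> (('c \<times> 'd) \<Rightarrow>\<^sub>0 int) set" where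
  "super_tensor_map K C D f g =
    tensor_lift (super_tensor_group K C D) (\<lambda>a b. super_pure K C D (f a) (g b))"

text \<open>The canonical isomorphism from \<open>(A \<otimes> B) \<otimes> C\<close> to \<open>A \<otimes> (B \<otimes> C)\<close>.\<close>

definition super_assoc ::
  "('k, 'x) ring_scheme \<Rightarrow> ('k, 'a, 'u) superalgebra_scheme \<Rightarrow>
    ('k, 'b, 'v) superalgebra_scheme \<Rightarrow> ('k, 'c, 'w) superalgebra_scheme \<Rightarrow>
    (((('a \<times> 'b) \<Rightarrow>\<^sub>0 int) set \<times> 'c) \<Rightarrow>\<^sub>0 int) set \<Rightarrow>
    (('a \<times> (('b \<times> 'c) \<Rightarrow>\<^sub>0 int) set) \<Rightarrow>\<^sub>0 int) set" where
  "super_assoc K A B C =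
    (let D = super_tensor K B C; T = super_tensor_group K A D in
      tensor_lift T (\<lambda>U c. tensor_lift T (\<lambda>a b. super_pure K A D a (super_pure K B C b c)) U))"


section \<open>Commutative Hopf superalgebras and coideal subalgebras\<close>

record ('k, 'a) hopf_superalgebra = "('k, 'a) superalgebra" +
  comult :: "'a \<Rightarrow> (('a \<times> 'a) \<Rightarrow>\<^sub>0 int) set"
  counit :: "'a \<Rightarrow> 'k"
  antipode :: "'a \<Rightarrow> 'a"

definition hopf_superalgebra ::
  "('k, 'x) ring_scheme \<Rightarrow> ('k, 'a, 'y) hopf_superalgebra_scheme \<Rightarrow> bool" where
  "hopf_superalgebra K A \<longleftrightarrow>
    superalgebra K A \<and>
    comult A \<in> superalgebra_hom K A (super_tensor K A A) \<and>
    counit A \<in> superalgebra_hom K A (base_superalgebra K) \<and>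
    antipode A \<in> super_linear K A A \<and>
    (\<forall>a \<in> carrier A.
      super_assoc K A A A (super_tensor_map K (super_tensor K A A) A (comult A) id (comult A a)) =
        super_tensor_map K A (super_tensor K A A) id (comult A) (comult A a) \<and>
      tensor_lift (add_monoid A) (\<lambda>x y. counit A x \<odot>\<^bsub>A\<^esub> y) (comult A a) = a \<and>
      tensor_lift (add_monoid A) (\<lambda>x y. counit A y \<odot>\<^bsub>A\<^esub> x) (comult A a) = a \<and>
      tensor_lift (add_monoid A) (\<lambda>x y. antipode A x \<otimes>\<^bsub>A\<^esub> y) (comult A a) =
        counit A a \<odot>\<^bsub>A\<^esub> \<one>\<^bsub>A\<^esub> \<and>
      tensor_lift (add_monoid A) (\<lambda>x y. x \<otimes>\<^bsub>A\<^esub> antipode A y) (comult A a) =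
        counit A a \<odot>\<^bsub>A\<^esub> \<one>\<^bsub>A\<^esub>)"

definition commutative_hopf_superalgebra ::
  "('k, 'x) ring_scheme \<Rightarrow> ('k, 'a, 'y) hopf_superalgebra_scheme \<Rightarrow> bool" where
  "commutative_hopf_superalgebra K A \<longleftrightarrow> hopf_superalgebra K A \<and> supercommutative A"

definition supersubalgebra ::
  "('k, 'x) ring_scheme \<Rightarrow> ('k, 'a, 'y) superalgebra_scheme \<Rightarrow> 'a set \<Rightarrow> bool" where
  "supersubalgebra K A B \<longleftrightarrow>
    subring B A \<and>
    (\<forall>k \<in> carrier K. \<forall>b \<in> B. k \<odot>\<^bsub>A\<^esub> b \<in> B) \<and>
    B = (B \<inter> homog A 0) <+>\<^bsub>A\<^esub> (B \<inter> homog A 1)"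

text \<open>Over a field, \<open>A \<otimes> B\<close> is the subspace of \<open>A \<otimes> A\<close> spanned by the \<open>a \<otimes> b\<close>.\<close>

definition left_coideal ::
  "('k, 'x) ring_scheme \<Rightarrow> ('k, 'a, 'y) hopf_superalgebra_scheme \<Rightarrow> 'a set \<Rightarrow> bool" where
  "left_coideal K A B \<longleftrightarrow>
    comult A ` B \<subseteq> generate (super_tensor_group K A A)
                     {super_pure K A A a b | a b. a \<in> carrier A \<and> b \<in> B}"

text \<open>The additive order of 1, which is 0 if that order is infinite.\<close>

definition ring_characteristic :: "('k, 'x) ring_scheme \<Rightarrow> nat" where
  "ring_characteristic K = group.ord (add_monoid K) \<one>\<^bsub>K\<^esub>"

end

theory Submission
  imports Defs
begin

text \<open>
  Flatness is tested on finitely many relations at a time. A vanishing element of a tensor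
  product over \<open>B\<close> vanishes because of finitely many relations, and these mention finitely many
  elements of \<open>A\<close>. Hence \<open>A\<close> is flat as soon as every finite subset of \<open>A\<close> lies in a \<open>B\<close>-submodule
  \<open>M \<subseteq> A\<close> whose inclusion factors through a free module, that is,
  \<open>y = (\<Sum>l. \<phi>\<^sub>l(y) u\<^sub>l)\<close> for all \<open>y \<in> M\<close>, with \<open>B\<close>-linear \<open>\<phi>\<^sub>l : M \<rightarrow> B\<close> and \<open>u\<^sub>l \<in> A\<close>
  (\<open>locally_dual_basis_imp_flat\<close>).

  Every finite subset of \<open>A\<close> lies in a finite dimensional left subcomodule. Let \<open>D\<close> be a basis of
  it and write \<open>\<delta>(d) = (\<Sum>k. \<tau>\<^sub>d\<^sub>k \<otimes> k)\<close>; the antipode makes the matrix \<open>\<tau>\<close> invertible. Take for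
  \<open>M\<close> the \<open>B\<close>-module generated by \<open>D\<close>, and let \<open>Z \<subseteq> B\<^sup>D\<close> consist of the relations
  \<open>(\<Sum>d. z\<^sub>d d) = 0\<close>. A vector \<open>C \<in> B\<^sup>D\<close> that annihilates \<open>Z\<close> is the same thing as a linear form on
  \<open>M\<close>, namely \<open>(\<Sum>d. z\<^sub>d d) \<mapsto> (\<Sum>d. z\<^sub>d C\<^sub>d)\<close>. So the task is to write the tautological vector
  \<open>(d)\<^sub>d\<close> as a sum of vectors \<open>C u\<close> with \<open>C\<close> annihilating \<open>Z\<close> and \<open>u \<in> A\<close> (\<open>span_orth_id\<close>).

  The first step is generic: the vector \<open>(F\<^sub>0 d)\<^sub>d\<close> is such a sum for some nonzero even
  \<open>F\<^sub>0 \<in> B\<close> (\<open>ex_generic_coordinates\<close>). Choose \<open>Q \<subseteq> D\<close> minimal such that some even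
  non-nilpotent \<open>f \<in> B\<close> satisfies \<open>f D \<subseteq> (\<Sum>l\<in>Q. B l)\<close>. Minimality forces all coefficients of
  relations between elements of \<open>Q\<close> to become nilpotent after multiplication by \<open>f\<close>; here one uses
  that odd elements square to zero, which is where the characteristic enters. The coaction,
  on the other hand, rewrites every relation \<open>z\<close> as \<open>(\<Sum>s. (\<Sum>i. z\<^sub>i a\<^sub>s\<^sub>i) y\<^sub>s)\<close> with finitely
  many fixed relations \<open>y\<^sub>s\<close> (\<open>relations_split\<close>). Substituting the \<open>y\<^sub>s\<close> into this formula yields
  \<open>f y = N y\<close> with a matrix \<open>N\<close> built from nilpotent elements, so a power of \<open>f\<close> kills all
  relations between elements of \<open>Q\<close> that come from \<open>Z\<close>, and the coordinates along \<open>Q\<close> become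
  linear forms on \<open>M\<close>.

  The second step is translation: if \<open>(d p)\<^sub>d\<close> is such a sum, then so is \<open>(d h(\<delta>(p)))\<^sub>d\<close>, for
  every additive \<open>h : A \<otimes> A \<rightarrow> A\<close> that is left linear over the second factor
  (\<open>span_orth_translate_mult\<close>). A functional with value \<open>1\<close> at \<open>F\<^sub>0\<close> moves \<open>F\<^sub>0\<close> to an element
  with counit \<open>1\<close>, and the antipode moves that element to \<open>1\<close>.

  Signs never appear in the matrix computations: they take place in the noncommutative ring
  \<open>A \<otimes> A\<close>, in which \<open>x \<otimes> 1\<close> and \<open>1 \<otimes> y\<close> commute only up to the parity automorphism.
\<close>

section \<open>Finite sums and additive maps\<close>

abbreviation Hom where "Hom G H \<equiv> hom (add_monoid G) (add_monoid H)"

lemma Hom_closed: "\<lbrakk>h \<in> Hom G H; x \<in> carrier G\<rbrakk> \<Longrightarrow> h x \<in> carrier H"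
  by (simp add: hom_def Pi_def)

lemma Hom_add:
  "\<lbrakk>h \<in> Hom G H; x \<in> carrier G; y \<in> carrier G\<rbrakk> \<Longrightarrow> h (x \<oplus>\<^bsub>G\<^esub> y) = h x \<oplus>\<^bsub>H\<^esub> h y"
  by (simp add: hom_def)

lemma HomI:
  "\<lbrakk>\<And>x. x \<in> carrier G \<Longrightarrow> h x \<in> carrier H;
    \<And>x y. \<lbrakk>x \<in> carrier G; y \<in> carrier G\<rbrakk> \<Longrightarrow> h (x \<oplus>\<^bsub>G\<^esub> y) = h x \<oplus>\<^bsub>H\<^esub> h y\<rbrakk> \<Longrightarrow> h \<in> Hom G H"
  by (simp add: hom_def)

lemma Hom_comp: "\<lbrakk>h \<in> Hom G H; k \<in> Hom H L\<rbrakk> \<Longrightarrow> (\<lambda>x. k (h x)) \<in> Hom G L"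
  by (auto simp: hom_def Pi_def)

lemma Hom_group_hom:
  assumes "abelian_group G" "abelian_group H" "h \<in> Hom G H"
  shows "group_hom (add_monoid G) (add_monoid H) h"
  using assms by (simp add: group_hom_def group_hom_axioms_def abelian_group.a_group)

lemma Hom_zero:
  assumes "abelian_group G" "abelian_group H" "h \<in> Hom G H"
  shows "h \<zero>\<^bsub>G\<^esub> = \<zero>\<^bsub>H\<^esub>"
  using group_hom.hom_one[OF Hom_group_hom[OF assms]] by simp

lemma Hom_minus:
  assumes "abelian_group G" "abelian_group H" "h \<in> Hom G H" "x \<in> carrier G"
  shows "h (\<ominus>\<^bsub>G\<^esub> x) = \<ominus>\<^bsub>H\<^esub> h x"
  using group_hom.hom_inv[OF Hom_group_hom[OF assms(1-3)]] assms(4) by (simp add: a_inv_def)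

lemma Hom_finsum:
  assumes G: "abelian_group G" and H: "abelian_group H" and h: "h \<in> Hom G H"
    and "finite I" "f \<in> I \<rightarrow> carrier G"
  shows "h (finsum G f I) = finsum H (\<lambda>i. h (f i)) I"
  using assms(4,5)
proof (induction I)
  interpret G: abelian_group G by fact
  interpret H: abelian_group H by fact
  case empty
  then show ?case by (simp add: Hom_zero[OF G H h])
next
  interpret G: abelian_group G by fact
  interpret H: abelian_group H by fact
  case (insert x I)
  then show ?case
    by (subst G.finsum_insert, simp_all add: Pi_def Hom_add[OF h] Hom_closed[OF h])
qed

lemma (in abelian_monoid) finsum_swap:
  assumes "finite I" "finite J" "\<And>i j. \<lbrakk>i \<in> I; j \<in> J\<rbrakk> \<Longrightarrow> f i j \<in> carrier G"
  shows "(\<Oplus>i\<in>I. \<Oplus>j\<in>J. f i j) = (\<Oplus>j\<in>J. \<Oplus>i\<in>I. f i j)"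
  using assms(1,3)
proof (induction I)
  case empty
  then show ?case by (simp add: finsum_zero)
next
  case (insert x I)
  have "(\<Oplus>i\<in>insert x I. \<Oplus>j\<in>J. f i j) = (\<Oplus>j\<in>J. f x j) \<oplus> (\<Oplus>i\<in>I. \<Oplus>j\<in>J. f i j)"
    by (rule finsum_insert) (use insert in \<open>auto intro!: finsum_closed\<close>)
  also have "\<dots> = (\<Oplus>j\<in>J. f x j) \<oplus> (\<Oplus>j\<in>J. \<Oplus>i\<in>I. f i j)"
    using insert by simp
  also have "\<dots> = (\<Oplus>j\<in>J. f x j \<oplus> (\<Oplus>i\<in>I. f i j))"
    by (rule finsum_addf[symmetric]) (use insert in \<open>auto intro!: finsum_closed\<close>)
  also have "\<dots> = (\<Oplus>j\<in>J. \<Oplus>i\<in>insert x I. f i j)"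
    by (rule finsum_cong') (use insert in \<open>auto simp: Pi_def intro!: finsum_closed\<close>)
  finally show ?case .
qed

lemma (in abelian_monoid) finsum_Sigma_prod:
  assumes "finite I" "finite J" "\<And>i j. \<lbrakk>i \<in> I; j \<in> J\<rbrakk> \<Longrightarrow> f i j \<in> carrier G"
  shows "(\<Oplus>i\<in>I. \<Oplus>j\<in>J. f i j) = (\<Oplus>p\<in>I \<times> J. f (fst p) (snd p))"
  using assms(1,3)
proof (induction I)
  case empty
  then show ?case by simp
next
  case (insert x I)
  have "(\<Oplus>p\<in>insert x I \<times> J. f (fst p) (snd p)) =
      (\<Oplus>p\<in>({x} \<times> J) \<union> (I \<times> J). f (fst p) (snd p))"
    by (rule arg_cong2[where f = "finsum G"]) auto
  also have "\<dots> = (\<Oplus>p\<in>{x} \<times> J. f (fst p) (snd p)) \<oplus> (\<Oplus>p\<in>I \<times> J. f (fst p) (snd p))"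
    by (rule finsum_Un_disjoint) (use insert assms(2) in auto)
  also have "(\<Oplus>p\<in>{x} \<times> J. f (fst p) (snd p)) = (\<Oplus>j\<in>J. f x j)"
  proof -
    have "{x} \<times> J = Pair x ` J" by auto
    then show ?thesis
      by (simp, subst finsum_reindex) (use insert in \<open>auto simp: inj_on_def\<close>)
  qed
  finally show ?case
    using insert by (simp add: finsum_closed)
qed

lemma (in abelian_monoid) finsum_delta:
  assumes "finite D" "i \<in> D" "f \<in> D \<rightarrow> carrier G"
  shows "(\<Oplus>j\<in>D. if i = j then f j else \<zero>) = f i"
  using finsum_singleton[of i D f] assms by simp


section \<open>The tensor square of a Hopf superalgebra with a coideal\<close>

text \<open>
  The ring \<open>R\<close> is \<open>A \<otimes> A\<close> with the sign rule, \<open>t x y\<close> is the pure tensor, \<open>dl\<close> the comultiplication,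
  \<open>ev\<close> and \<open>od\<close> are the projections to the homogeneous components, \<open>F\<close> is the image \<open>K 1\<close> of the
  ground field, and \<open>e\<close> is the counit followed by \<open>K \<rightarrow> K 1\<close>. With scalars inside \<open>A\<close>, linearity is
  compatibility with multiplication by \<open>F\<close>, and functionals are maps \<open>A \<rightarrow> A\<close> with values in \<open>F\<close>.

  The universal property of \<open>A \<otimes> A\<close> is stated for the targets \<open>A\<close> and \<open>A \<otimes> A\<close>. Coassociativity is
  stated after a functional has been applied to an outer leg (\<open>coassoc_l\<close>, \<open>coassoc_r\<close>); in this
  form it involves only twofold tensors. A rule for \<open>P (dl b)\<close> expresses the left coideal property.
\<close>

locale super_hopf_coideal = A?: ring A + R: ring R
  for A :: "('a, 'x) ring_scheme" (structure) and R :: "('r, 'y) ring_scheme" +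
  fixes F B :: "'a set" and ev od e S :: "'a \<Rightarrow> 'a" and dl :: "'a \<Rightarrow> 'r" and t :: "'a \<Rightarrow> 'a \<Rightarrow> 'r"
  assumes F_sub: "subring F A" and B_sub: "subring B A" and F_B: "F \<subseteq> B"
    and one_not_zero: "\<one> \<noteq> \<zero>"
    and F_inv: "\<lbrakk>c \<in> F; c \<noteq> \<zero>\<rbrakk> \<Longrightarrow> \<exists>d\<in>F. c \<otimes> d = \<one>"
    and ev_Hom: "ev \<in> Hom A A" and od_Hom: "od \<in> Hom A A"
    and ev_od: "x \<in> carrier A \<Longrightarrow> ev x \<oplus> od x = x"
    and ev_ev: "x \<in> carrier A \<Longrightarrow> ev (ev x) = ev x"
    and od_od: "x \<in> carrier A \<Longrightarrow> od (od x) = od x"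
    and ev_mult: "\<lbrakk>x \<in> carrier A; y \<in> carrier A\<rbrakk> \<Longrightarrow> ev (x \<otimes> y) = ev x \<otimes> ev y \<oplus> od x \<otimes> od y"
    and od_mult: "\<lbrakk>x \<in> carrier A; y \<in> carrier A\<rbrakk> \<Longrightarrow> od (x \<otimes> y) = ev x \<otimes> od y \<oplus> od x \<otimes> ev y"
    and ev_F: "c \<in> F \<Longrightarrow> ev c = c"
    and ev_B: "b \<in> B \<Longrightarrow> ev b \<in> B"
    and ev_central: "\<lbrakk>x \<in> carrier A; y \<in> carrier A\<rbrakk> \<Longrightarrow> ev x \<otimes> y = y \<otimes> ev x"
    and od_anti: "\<lbrakk>x \<in> carrier A; y \<in> carrier A\<rbrakk> \<Longrightarrow> od x \<otimes> od y = \<ominus> (od y \<otimes> od x)"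
    and od_square: "x \<in> carrier A \<Longrightarrow> od x \<otimes> od x = \<zero>"
    and e_Hom: "e \<in> Hom A A" and e_F: "x \<in> carrier A \<Longrightarrow> e x \<in> F"
    and e_mult: "\<lbrakk>x \<in> carrier A; y \<in> carrier A\<rbrakk> \<Longrightarrow> e (x \<otimes> y) = e x \<otimes> e y"
    and e_id: "c \<in> F \<Longrightarrow> e c = c"
    and e_od: "x \<in> carrier A \<Longrightarrow> e (od x) = \<zero>"
    and S_Hom: "S \<in> Hom A A"
    and S_lin: "\<lbrakk>c \<in> F; x \<in> carrier A\<rbrakk> \<Longrightarrow> S (c \<otimes> x) = c \<otimes> S x"
    and S_ev: "x \<in> carrier A \<Longrightarrow> S (ev x) = ev (S x)"
    and t_closed: "\<lbrakk>x \<in> carrier A; y \<in> carrier A\<rbrakk> \<Longrightarrow> t x y \<in> carrier R"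
    and t_add_l: "\<lbrakk>x \<in> carrier A; x' \<in> carrier A; y \<in> carrier A\<rbrakk> \<Longrightarrow> t (x \<oplus> x') y = t x y \<oplus>\<^bsub>R\<^esub> t x' y"
    and t_add_r: "\<lbrakk>x \<in> carrier A; y \<in> carrier A; y' \<in> carrier A\<rbrakk> \<Longrightarrow> t x (y \<oplus> y') = t x y \<oplus>\<^bsub>R\<^esub> t x y'"
    and t_bal: "\<lbrakk>c \<in> F; x \<in> carrier A; y \<in> carrier A\<rbrakk> \<Longrightarrow> t (c \<otimes> x) y = t x (c \<otimes> y)"
    and t_mult: "\<lbrakk>a \<in> carrier A; b \<in> carrier A; x \<in> carrier A; y \<in> carrier A\<rbrakk> \<Longrightarrow>
      t a b \<otimes>\<^bsub>R\<^esub> t x y = t (a \<otimes> ev x) (b \<otimes> y) \<oplus>\<^bsub>R\<^esub> t (a \<otimes> od x) ((ev b \<ominus> od b) \<otimes> y)"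
    and R_induct [consumes 1, case_names pure add]:
      "\<lbrakk>r \<in> carrier R; \<And>x y. \<lbrakk>x \<in> carrier A; y \<in> carrier A\<rbrakk> \<Longrightarrow> P (t x y);
        \<And>u v. \<lbrakk>u \<in> carrier R; v \<in> carrier R; P u; P v\<rbrakk> \<Longrightarrow> P (u \<oplus>\<^bsub>R\<^esub> v)\<rbrakk> \<Longrightarrow> P r"
    and lift_A:
      "\<lbrakk>\<And>x y. \<lbrakk>x \<in> carrier A; y \<in> carrier A\<rbrakk> \<Longrightarrow> f x y \<in> carrier A;
        \<And>x x' y. \<lbrakk>x \<in> carrier A; x' \<in> carrier A; y \<in> carrier A\<rbrakk> \<Longrightarrow> f (x \<oplus> x') y = f x y \<oplus> f x' y;
        \<And>x y y'. \<lbrakk>x \<in> carrier A; y \<in> carrier A; y' \<in> carrier A\<rbrakk> \<Longrightarrow> f x (y \<oplus> y') = f x y \<oplus> f x y';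
        \<And>c x y. \<lbrakk>c \<in> F; x \<in> carrier A; y \<in> carrier A\<rbrakk> \<Longrightarrow> f (c \<otimes> x) y = f x (c \<otimes> y)\<rbrakk> \<Longrightarrow>
       \<exists>h \<in> Hom R A. \<forall>x\<in>carrier A. \<forall>y\<in>carrier A. h (t x y) = f x y"
    and lift_R:
      "\<lbrakk>\<And>x y. \<lbrakk>x \<in> carrier A; y \<in> carrier A\<rbrakk> \<Longrightarrow> g x y \<in> carrier R;
        \<And>x x' y. \<lbrakk>x \<in> carrier A; x' \<in> carrier A; y \<in> carrier A\<rbrakk> \<Longrightarrow> g (x \<oplus> x') y = g x y \<oplus>\<^bsub>R\<^esub> g x' y;
        \<And>x y y'. \<lbrakk>x \<in> carrier A; y \<in> carrier A; y' \<in> carrier A\<rbrakk> \<Longrightarrow> g x (y \<oplus> y') = g x y \<oplus>\<^bsub>R\<^esub> g x y';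
        \<And>c x y. \<lbrakk>c \<in> F; x \<in> carrier A; y \<in> carrier A\<rbrakk> \<Longrightarrow> g (c \<otimes> x) y = g x (c \<otimes> y)\<rbrakk> \<Longrightarrow>
       \<exists>h \<in> Hom R R. \<forall>x\<in>carrier A. \<forall>y\<in>carrier A. h (t x y) = g x y"
    and dl_Hom: "dl \<in> Hom A R"
    and dl_mult: "\<lbrakk>x \<in> carrier A; y \<in> carrier A\<rbrakk> \<Longrightarrow> dl (x \<otimes> y) = dl x \<otimes>\<^bsub>R\<^esub> dl y"
    and dl_lin: "\<lbrakk>c \<in> F; x \<in> carrier A\<rbrakk> \<Longrightarrow> dl (c \<otimes> x) = t c \<one> \<otimes>\<^bsub>R\<^esub> dl x"
    and dl_coideal:
      "\<lbrakk>b \<in> B; \<And>x y. \<lbrakk>x \<in> carrier A; y \<in> B\<rbrakk> \<Longrightarrow> P (t x y);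
        \<And>u v. \<lbrakk>u \<in> carrier R; v \<in> carrier R; P u; P v\<rbrakk> \<Longrightarrow> P (u \<oplus>\<^bsub>R\<^esub> v)\<rbrakk> \<Longrightarrow> P (dl b)"
    and coassoc_l:
      "\<lbrakk>\<phi> \<in> Hom A A; \<And>x. x \<in> carrier A \<Longrightarrow> \<phi> x \<in> F;
        \<And>c x. \<lbrakk>c \<in> F; x \<in> carrier A\<rbrakk> \<Longrightarrow> \<phi> (c \<otimes> x) = c \<otimes> \<phi> x;
        h \<in> Hom R A; \<And>x y. \<lbrakk>x \<in> carrier A; y \<in> carrier A\<rbrakk> \<Longrightarrow> h (t x y) = \<phi> x \<otimes> y;
        k \<in> Hom R R; \<And>x y. \<lbrakk>x \<in> carrier A; y \<in> carrier A\<rbrakk> \<Longrightarrow> k (t x y) = t (h (dl x)) y;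
        a \<in> carrier A\<rbrakk> \<Longrightarrow> dl (h (dl a)) = k (dl a)"
    and coassoc_r:
      "\<lbrakk>\<phi> \<in> Hom A A; \<And>x. x \<in> carrier A \<Longrightarrow> \<phi> x \<in> F;
        \<And>c x. \<lbrakk>c \<in> F; x \<in> carrier A\<rbrakk> \<Longrightarrow> \<phi> (c \<otimes> x) = c \<otimes> \<phi> x;
        h \<in> Hom R A; \<And>x y. \<lbrakk>x \<in> carrier A; y \<in> carrier A\<rbrakk> \<Longrightarrow> h (t x y) = \<phi> y \<otimes> x;
        k \<in> Hom R R; \<And>x y. \<lbrakk>x \<in> carrier A; y \<in> carrier A\<rbrakk> \<Longrightarrow> k (t x y) = t x (h (dl y));
        a \<in> carrier A\<rbrakk> \<Longrightarrow> dl (h (dl a)) = k (dl a)"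
    and counit_l:
      "\<lbrakk>h \<in> Hom R A; \<And>x y. \<lbrakk>x \<in> carrier A; y \<in> carrier A\<rbrakk> \<Longrightarrow> h (t x y) = e x \<otimes> y;
        a \<in> carrier A\<rbrakk> \<Longrightarrow> h (dl a) = a"
    and counit_r:
      "\<lbrakk>h \<in> Hom R A; \<And>x y. \<lbrakk>x \<in> carrier A; y \<in> carrier A\<rbrakk> \<Longrightarrow> h (t x y) = e y \<otimes> x;
        a \<in> carrier A\<rbrakk> \<Longrightarrow> h (dl a) = a"
    and antipode_l:
      "\<lbrakk>h \<in> Hom R A; \<And>x y. \<lbrakk>x \<in> carrier A; y \<in> carrier A\<rbrakk> \<Longrightarrow> h (t x y) = S x \<otimes> y;
        a \<in> carrier A\<rbrakk> \<Longrightarrow> h (dl a) = e a"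
    and antipode_r:
      "\<lbrakk>h \<in> Hom R A; \<And>x y. \<lbrakk>x \<in> carrier A; y \<in> carrier A\<rbrakk> \<Longrightarrow> h (t x y) = x \<otimes> S y;
        a \<in> carrier A\<rbrakk> \<Longrightarrow> h (dl a) = e a"
begin

text \<open>
  The parity automorphism, which is what moving \<open>1 \<otimes> y\<close> past an odd \<open>x \<otimes> 1\<close> does to \<open>y\<close>.
\<close>

definition th :: "'a \<Rightarrow> 'a" where "th x = ev x \<ominus> od x"

abbreviation lf :: "'a \<Rightarrow> 'r" where "lf x \<equiv> t x \<one>"
abbreviation rt :: "'a \<Rightarrow> 'r" where "rt y \<equiv> t \<one> y"

lemma F_carr [simp]: "c \<in> F \<Longrightarrow> c \<in> carrier A"
  using subringE(1)[OF F_sub] by auto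
lemma B_carr [simp]: "b \<in> B \<Longrightarrow> b \<in> carrier A"
  using subringE(1)[OF B_sub] by auto
lemma F_in_B [simp]: "c \<in> F \<Longrightarrow> c \<in> B" using F_B by auto
lemma F_closed [simp, intro]:
  "\<zero> \<in> F" "\<one> \<in> F" "c \<in> F \<Longrightarrow> \<ominus> c \<in> F" "\<lbrakk>c \<in> F; d \<in> F\<rbrakk> \<Longrightarrow> c \<oplus> d \<in> F"
  "\<lbrakk>c \<in> F; d \<in> F\<rbrakk> \<Longrightarrow> c \<otimes> d \<in> F" "\<lbrakk>c \<in> F; d \<in> F\<rbrakk> \<Longrightarrow> c \<ominus> d \<in> F"
  using subringE[OF F_sub] by (auto simp: a_minus_def)
lemma B_closed [simp, intro]:
  "\<zero> \<in> B" "\<one> \<in> B" "c \<in> B \<Longrightarrow> \<ominus> c \<in> B" "\<lbrakk>c \<in> B; d \<in> B\<rbrakk> \<Longrightarrow> c \<oplus> d \<in> B"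
  "\<lbrakk>c \<in> B; d \<in> B\<rbrakk> \<Longrightarrow> c \<otimes> d \<in> B" "\<lbrakk>c \<in> B; d \<in> B\<rbrakk> \<Longrightarrow> c \<ominus> d \<in> B"
  using subringE[OF B_sub] by (auto simp: a_minus_def)

lemma finsum_sub:
  assumes U: "\<zero> \<in> U" "\<And>c d. \<lbrakk>c \<in> U; d \<in> U\<rbrakk> \<Longrightarrow> c \<oplus> d \<in> U" "U \<subseteq> carrier A"
    and "\<And>i. i \<in> I \<Longrightarrow> f i \<in> U"
  shows "(\<Oplus>i\<in>I. f i) \<in> U"
proof (cases "finite I")
  case True
  then show ?thesis using assms(4)
  proof (induction I)
    case (insert x I)
    then have "(\<Oplus>i\<in>insert x I. f i) = f x \<oplus> (\<Oplus>i\<in>I. f i)"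
      by (intro finsum_insert) (use U in auto)
    with insert U show ?case by auto
  qed (simp add: U)
qed (simp add: finsum_infinite U)

lemma finsum_B [intro]: "(\<And>i. i \<in> I \<Longrightarrow> f i \<in> B) \<Longrightarrow> (\<Oplus>i\<in>I. f i) \<in> B"
  by (rule finsum_sub) auto
lemma abA: "abelian_group A" ..
lemma abR: "abelian_group R" ..

lemmas AA_simps = Hom_closed[where G = A and H = A] Hom_add[where G = A and H = A]
  Hom_zero[OF abA abA] Hom_minus[OF abA abA]

lemma ev_od_simps [simp]:
  "x \<in> carrier A \<Longrightarrow> ev x \<in> carrier A" "x \<in> carrier A \<Longrightarrow> od x \<in> carrier A"
  "\<lbrakk>x \<in> carrier A; y \<in> carrier A\<rbrakk> \<Longrightarrow> ev (x \<oplus> y) = ev x \<oplus> ev y"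
  "\<lbrakk>x \<in> carrier A; y \<in> carrier A\<rbrakk> \<Longrightarrow> od (x \<oplus> y) = od x \<oplus> od y"
  "ev \<zero> = \<zero>" "od \<zero> = \<zero>"
  "x \<in> carrier A \<Longrightarrow> ev (\<ominus> x) = \<ominus> ev x" "x \<in> carrier A \<Longrightarrow> od (\<ominus> x) = \<ominus> od x"
  "x \<in> carrier A \<Longrightarrow> ev (ev x) = ev x" "x \<in> carrier A \<Longrightarrow> od (od x) = od x"
  using AA_simps[OF ev_Hom] AA_simps[OF od_Hom] ev_ev od_od by auto

lemma ev_of_od [simp]: "x \<in> carrier A \<Longrightarrow> ev (od x) = \<zero>"
  using ev_od[of x] ev_od_simps(3)[of "ev x" "od x"] ev_od_simps(9)[of x]
  by (metis add.l_cancel_one ev_od_simps(1,2))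
lemma od_of_ev [simp]: "x \<in> carrier A \<Longrightarrow> od (ev x) = \<zero>"
  using ev_od[of x] ev_od_simps(4)[of "ev x" "od x"] ev_od_simps(10)[of x]
  by (metis add.r_cancel_one ev_od_simps(1,2))

lemma od_F [simp]: "c \<in> F \<Longrightarrow> od c = \<zero>"
  by (metis F_carr ev_F od_of_ev)
lemma F_central: "\<lbrakk>c \<in> F; x \<in> carrier A\<rbrakk> \<Longrightarrow> x \<otimes> c = c \<otimes> x"
  by (metis F_carr ev_F ev_central)
lemma od_B: "b \<in> B \<Longrightarrow> od b \<in> B"
proof -
  assume b: "b \<in> B"
  have "(ev b \<oplus> od b) \<ominus> ev b = od b" using b a_comm[of "ev b" "od b"] by (simp add: a_minus_def a_assoc r_neg)
  then have "od b = b \<ominus> ev b" using ev_od[of b] b by simp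
  then show ?thesis using b ev_B[OF b] by auto
qed

lemma od_comm: "\<lbrakk>x \<in> carrier A; y \<in> carrier A\<rbrakk> \<Longrightarrow> od x \<otimes> y = th y \<otimes> od x"
proof -
  assume x: "x \<in> carrier A" and y: "y \<in> carrier A"
  have "od x \<otimes> y = od x \<otimes> (ev y \<oplus> od y)" using y by (simp add: ev_od)
  also have "\<dots> = od x \<otimes> ev y \<oplus> od x \<otimes> od y" using x y by (simp add: r_distr)
  also have "od x \<otimes> ev y = ev y \<otimes> od x" using x y by (simp add: ev_central)
  also have "od x \<otimes> od y = \<ominus> (od y \<otimes> od x)" using x y by (rule od_anti)
  finally show ?thesis using x y by (simp add: th_def a_minus_def l_distr l_minus)
qed

lemma th_simps [simp]:
  "x \<in> carrier A \<Longrightarrow> th x \<in> carrier A"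
  "\<lbrakk>x \<in> carrier A; y \<in> carrier A\<rbrakk> \<Longrightarrow> th (x \<oplus> y) = th x \<oplus> th y"
  "c \<in> F \<Longrightarrow> th c = c" "b \<in> B \<Longrightarrow> th b \<in> B"
  "x \<in> carrier A \<Longrightarrow> th (ev x) = ev x" "x \<in> carrier A \<Longrightarrow> th (od x) = \<ominus> od x"
  "x \<in> carrier A \<Longrightarrow> ev (th x) = ev x" "x \<in> carrier A \<Longrightarrow> od (th x) = \<ominus> od x"
  by (simp_all add: th_def a_minus_def minus_add a_ac ev_F ev_B od_B B_closed)

lemma th_th [simp]: "x \<in> carrier A \<Longrightarrow> th (th x) = x"
  unfolding th_def[of "th x"] by (simp add: a_minus_def ev_od)

lemma th_mult [simp]: "\<lbrakk>x \<in> carrier A; y \<in> carrier A\<rbrakk> \<Longrightarrow> th (x \<otimes> y) = th x \<otimes> th y"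
  by (simp add: th_def ev_mult od_mult a_minus_def l_distr r_distr l_minus r_minus minus_add a_ac)

lemma S_simps [simp]:
  "x \<in> carrier A \<Longrightarrow> S x \<in> carrier A"
  "\<lbrakk>x \<in> carrier A; y \<in> carrier A\<rbrakk> \<Longrightarrow> S (x \<oplus> y) = S x \<oplus> S y" "S \<zero> = \<zero>"
  using AA_simps[OF S_Hom] by auto

lemma S_od: "x \<in> carrier A \<Longrightarrow> S (od x) = od (S x)"
proof -
  assume x: "x \<in> carrier A"
  have "ev (S x) \<oplus> S (od x) = S (ev x \<oplus> od x)" using x by (simp only: S_simps(2) ev_od_simps S_ev)
  also have "\<dots> = ev (S x) \<oplus> od (S x)" using x by (simp add: ev_od del: S_simps(2))
  finally show ?thesis using x by simp
qed

lemma e_simps [simp]: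
  "x \<in> carrier A \<Longrightarrow> e x \<in> carrier A" "x \<in> carrier A \<Longrightarrow> e x \<in> F"
  "\<lbrakk>x \<in> carrier A; y \<in> carrier A\<rbrakk> \<Longrightarrow> e (x \<oplus> y) = e x \<oplus> e y" "e \<zero> = \<zero>" "e \<one> = \<one>"
  "x \<in> carrier A \<Longrightarrow> e (\<ominus> x) = \<ominus> e x"
  "c \<in> F \<Longrightarrow> e c = c" "x \<in> carrier A \<Longrightarrow> e (od x) = \<zero>"
  "\<lbrakk>x \<in> carrier A; y \<in> carrier A\<rbrakk> \<Longrightarrow> e (x \<otimes> y) = e x \<otimes> e y"
  using AA_simps[OF e_Hom] by (auto simp: e_F e_id e_od e_mult)

lemma e_th [simp]: "x \<in> carrier A \<Longrightarrow> e (th x) = e x"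
proof -
  assume x: "x \<in> carrier A"
  have "e x = e (ev x \<oplus> od x)" using x by (simp only: ev_od)
  also have "\<dots> = e (th x)" using x by (simp add: th_def a_minus_def)
  finally show ?thesis ..
qed

lemma t_simps [simp]:
  "\<lbrakk>x \<in> carrier A; y \<in> carrier A\<rbrakk> \<Longrightarrow> t x y \<in> carrier R"
  "y \<in> carrier A \<Longrightarrow> t \<zero> y = \<zero>\<^bsub>R\<^esub>" "x \<in> carrier A \<Longrightarrow> t x \<zero> = \<zero>\<^bsub>R\<^esub>"
proof -
  show "t x y \<in> carrier R" if "x \<in> carrier A" "y \<in> carrier A" for x y using that by (rule t_closed)
  show "t \<zero> y = \<zero>\<^bsub>R\<^esub>" if "y \<in> carrier A" for y
    using t_add_l[of \<zero> \<zero> y] that t_closed[of \<zero> y] by simp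
  show "t x \<zero> = \<zero>\<^bsub>R\<^esub>" if "x \<in> carrier A" for x
    using t_add_r[of x \<zero> \<zero>] that t_closed[of x \<zero>] by simp
qed

lemma t_Hom_l: "y \<in> carrier A \<Longrightarrow> (\<lambda>x. t x y) \<in> Hom A R"
  by (rule HomI) (simp_all add: t_add_l)
lemma t_Hom_r: "x \<in> carrier A \<Longrightarrow> t x \<in> Hom A R"
  by (rule HomI) (simp_all add: t_add_r)

lemma lf_t: "\<lbrakk>x \<in> carrier A; a \<in> carrier A; b \<in> carrier A\<rbrakk> \<Longrightarrow> lf x \<otimes>\<^bsub>R\<^esub> t a b = t (x \<otimes> a) b"
  using t_mult[of x \<one> a b]
  by (simp add: ev_F a_minus_def t_add_l[symmetric] r_distr[symmetric] ev_od)
lemma t_rt: "\<lbrakk>a \<in> carrier A; b \<in> carrier A; y \<in> carrier A\<rbrakk> \<Longrightarrow> t a b \<otimes>\<^bsub>R\<^esub> rt y = t a (b \<otimes> y)"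
  using t_mult[of a b \<one> y] by (simp add: ev_F)
lemma t_lf: "\<lbrakk>a \<in> carrier A; b \<in> carrier A; x \<in> carrier A\<rbrakk> \<Longrightarrow>
    t a b \<otimes>\<^bsub>R\<^esub> lf x = t (a \<otimes> ev x) b \<oplus>\<^bsub>R\<^esub> t (a \<otimes> od x) (th b)"
  using t_mult[of a b x \<one>] by (simp add: th_def)
lemma rt_t: "\<lbrakk>a \<in> carrier A; b \<in> carrier A; y \<in> carrier A\<rbrakk> \<Longrightarrow>
    rt y \<otimes>\<^bsub>R\<^esub> t a b = t (ev a) (y \<otimes> b) \<oplus>\<^bsub>R\<^esub> t (od a) (th y \<otimes> b)"
  using t_mult[of \<one> y a b] by (simp add: th_def)
lemma lf_rt: "\<lbrakk>x \<in> carrier A; y \<in> carrier A\<rbrakk> \<Longrightarrow> lf x \<otimes>\<^bsub>R\<^esub> rt y = t x y"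
  by (simp add: lf_t)
lemma lf_mult: "\<lbrakk>x \<in> carrier A; y \<in> carrier A\<rbrakk> \<Longrightarrow> lf (x \<otimes> y) = lf x \<otimes>\<^bsub>R\<^esub> lf y"
  by (simp add: lf_t)
lemma rt_mult: "\<lbrakk>x \<in> carrier A; y \<in> carrier A\<rbrakk> \<Longrightarrow> rt (x \<otimes> y) = rt x \<otimes>\<^bsub>R\<^esub> rt y"
  by (simp add: t_rt)
lemma dl_simps [simp]: "x \<in> carrier A \<Longrightarrow> dl x \<in> carrier R" "dl \<zero> = \<zero>\<^bsub>R\<^esub>"
  "\<lbrakk>x \<in> carrier A; y \<in> carrier A\<rbrakk> \<Longrightarrow> dl (x \<oplus> y) = dl x \<oplus>\<^bsub>R\<^esub> dl y"
  using Hom_closed[OF dl_Hom] Hom_zero[OF abA abR dl_Hom] Hom_add[OF dl_Hom] by auto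
lemma lf_add: "\<lbrakk>x \<in> carrier A; y \<in> carrier A\<rbrakk> \<Longrightarrow> lf (x \<oplus> y) = lf x \<oplus>\<^bsub>R\<^esub> lf y"
  by (simp add: t_add_l)

lemma Hom_R_eqI:
  assumes "h \<in> Hom R H" "k \<in> Hom R H" "r \<in> carrier R"
    and "\<And>x y. \<lbrakk>x \<in> carrier A; y \<in> carrier A\<rbrakk> \<Longrightarrow> h (t x y) = k (t x y)"
  shows "h r = k r"
  using assms(3) by (induction rule: R_induct) (simp_all add: assms(4) Hom_add[OF assms(1)] Hom_add[OF assms(2)])

lemma R_finsum_mult_Hom:
  "u \<in> carrier R \<Longrightarrow> (\<lambda>r. u \<otimes>\<^bsub>R\<^esub> r) \<in> Hom R R" "u \<in> carrier R \<Longrightarrow> (\<lambda>r. r \<otimes>\<^bsub>R\<^esub> u) \<in> Hom R R"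
  by (auto intro!: HomI simp: R.r_distr R.l_distr)


section \<open>Functionals and slices\<close>

definition functional :: "('a \<Rightarrow> 'a) \<Rightarrow> bool" where
  "functional \<phi> \<longleftrightarrow> \<phi> \<in> Hom A A \<and> (\<forall>x\<in>carrier A. \<phi> x \<in> F) \<and>
    (\<forall>c\<in>F. \<forall>x\<in>carrier A. \<phi> (c \<otimes> x) = c \<otimes> \<phi> x)"

lemma functionalD:
  assumes "functional \<phi>"
  shows "\<phi> \<in> Hom A A" "x \<in> carrier A \<Longrightarrow> \<phi> x \<in> F" "x \<in> carrier A \<Longrightarrow> \<phi> x \<in> carrier A"
    "\<lbrakk>c \<in> F; x \<in> carrier A\<rbrakk> \<Longrightarrow> \<phi> (c \<otimes> x) = c \<otimes> \<phi> x"
    "\<lbrakk>x \<in> carrier A; y \<in> carrier A\<rbrakk> \<Longrightarrow> \<phi> (x \<oplus> y) = \<phi> x \<oplus> \<phi> y" "\<phi> \<zero> = \<zero>"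
    "x \<in> carrier A \<Longrightarrow> \<phi> (\<ominus> x) = \<ominus> \<phi> x"
    "\<lbrakk>x \<in> carrier A; y \<in> carrier A\<rbrakk> \<Longrightarrow> \<phi> (x \<ominus> y) = \<phi> x \<ominus> \<phi> y"
  using assms AA_simps[of \<phi>] by (auto simp: functional_def a_minus_def)

lemma functional_e: "functional e"
  by (simp add: functional_def e_Hom e_mult)

definition lift :: "('a \<Rightarrow> 'a \<Rightarrow> 'a) \<Rightarrow> 'r \<Rightarrow> 'a" where
  "lift f = (SOME h. h \<in> Hom R A \<and> (\<forall>x\<in>carrier A. \<forall>y\<in>carrier A. h (t x y) = f x y))"

lemma lift:
  assumes "\<And>x y. \<lbrakk>x \<in> carrier A; y \<in> carrier A\<rbrakk> \<Longrightarrow> f x y \<in> carrier A"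
    "\<And>x x' y. \<lbrakk>x \<in> carrier A; x' \<in> carrier A; y \<in> carrier A\<rbrakk> \<Longrightarrow> f (x \<oplus> x') y = f x y \<oplus> f x' y"
    "\<And>x y y'. \<lbrakk>x \<in> carrier A; y \<in> carrier A; y' \<in> carrier A\<rbrakk> \<Longrightarrow> f x (y \<oplus> y') = f x y \<oplus> f x y'"
    "\<And>c x y. \<lbrakk>c \<in> F; x \<in> carrier A; y \<in> carrier A\<rbrakk> \<Longrightarrow> f (c \<otimes> x) y = f x (c \<otimes> y)"
  shows "lift f \<in> Hom R A \<and> (\<forall>x\<in>carrier A. \<forall>y\<in>carrier A. lift f (t x y) = f x y)"
proof -
  have "\<exists>h. h \<in> Hom R A \<and> (\<forall>x\<in>carrier A. \<forall>y\<in>carrier A. h (t x y) = f x y)"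
    using lift_A[of f] assms by blast
  from someI_ex[OF this] show ?thesis unfolding lift_def .
qed

lemma F_swap: "\<lbrakk>c \<in> F; x \<in> carrier A; y \<in> carrier A\<rbrakk> \<Longrightarrow> x \<otimes> (c \<otimes> y) = c \<otimes> (x \<otimes> y)"
  using F_central[of c x] by (simp add: m_assoc[symmetric])

text \<open>
  These are \<open>\<phi> \<otimes> id\<close>, its variant with signs, \<open>id \<otimes> \<phi>\<close>, and the two antipode convolutions.
  The map \<open>sl \<phi>\<close> is linear for right multiplication by \<open>1 \<otimes> y\<close>, but for left multiplication only
  up to sign; \<open>sr \<phi>\<close> inserts the sign that makes it linear for left multiplication.
\<close>

definition sl where "sl \<phi> = lift (\<lambda>x y. \<phi> x \<otimes> y)"
definition sr where "sr \<phi> = lift (\<lambda>x y. \<phi> (ev x) \<otimes> y \<oplus> \<phi> (od x) \<otimes> th y)"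
definition mb where "mb \<phi> = lift (\<lambda>x y. \<phi> y \<otimes> x)"
definition mS where "mS = lift (\<lambda>x y. S x \<otimes> y)"
definition mS' where "mS' = lift (\<lambda>x y. x \<otimes> S y)"

lemma
  assumes f: "functional \<phi>"
  shows sl_Hom: "sl \<phi> \<in> Hom R A"
    and sl_t: "\<lbrakk>x \<in> carrier A; y \<in> carrier A\<rbrakk> \<Longrightarrow> sl \<phi> (t x y) = \<phi> x \<otimes> y"
proof -
  note f' = functionalD[OF f]
  have "sl \<phi> \<in> Hom R A \<and> (\<forall>x\<in>carrier A. \<forall>y\<in>carrier A. sl \<phi> (t x y) = \<phi> x \<otimes> y)"
    unfolding sl_def by (rule lift) (simp_all add: f' l_distr r_distr m_assoc F_swap[of _ "\<phi> _"])
  then show "sl \<phi> \<in> Hom R A"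
    "\<lbrakk>x \<in> carrier A; y \<in> carrier A\<rbrakk> \<Longrightarrow> sl \<phi> (t x y) = \<phi> x \<otimes> y" by auto
qed

lemma
  assumes f: "functional \<phi>"
  shows sr_Hom: "sr \<phi> \<in> Hom R A"
    and sr_t: "\<lbrakk>x \<in> carrier A; y \<in> carrier A\<rbrakk> \<Longrightarrow> sr \<phi> (t x y) = \<phi> (ev x) \<otimes> y \<oplus> \<phi> (od x) \<otimes> th y"
proof -
  note f' = functionalD[OF f]
  have "sr \<phi> \<in> Hom R A \<and> (\<forall>x\<in>carrier A. \<forall>y\<in>carrier A. sr \<phi> (t x y) = \<phi> (ev x) \<otimes> y \<oplus> \<phi> (od x) \<otimes> th y)"
    unfolding sr_def by (rule lift) (simp_all add: f' l_distr r_distr a_ac m_assoc ev_mult od_mult ev_F F_swap[of _ "\<phi> _"])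
  then show "sr \<phi> \<in> Hom R A"
    "\<lbrakk>x \<in> carrier A; y \<in> carrier A\<rbrakk> \<Longrightarrow> sr \<phi> (t x y) = \<phi> (ev x) \<otimes> y \<oplus> \<phi> (od x) \<otimes> th y" by auto
qed

lemma
  assumes f: "functional \<phi>"
  shows mb_Hom: "mb \<phi> \<in> Hom R A"
    and mb_t: "\<lbrakk>x \<in> carrier A; y \<in> carrier A\<rbrakk> \<Longrightarrow> mb \<phi> (t x y) = \<phi> y \<otimes> x"
proof -
  note f' = functionalD[OF f]
  have "mb \<phi> \<in> Hom R A \<and> (\<forall>x\<in>carrier A. \<forall>y\<in>carrier A. mb \<phi> (t x y) = \<phi> y \<otimes> x)"
    unfolding mb_def by (rule lift) (simp_all add: f' l_distr r_distr m_assoc F_swap[of _ "\<phi> _"])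
  then show "mb \<phi> \<in> Hom R A"
    "\<lbrakk>x \<in> carrier A; y \<in> carrier A\<rbrakk> \<Longrightarrow> mb \<phi> (t x y) = \<phi> y \<otimes> x" by auto
qed

lemma
  shows mS_Hom: "mS \<in> Hom R A"
    and mS_t: "\<lbrakk>x \<in> carrier A; y \<in> carrier A\<rbrakk> \<Longrightarrow> mS (t x y) = S x \<otimes> y"
proof -
  have "mS \<in> Hom R A \<and> (\<forall>x\<in>carrier A. \<forall>y\<in>carrier A. mS (t x y) = S x \<otimes> y)"
    unfolding mS_def by (rule lift) (simp_all add: l_distr r_distr m_assoc S_lin F_swap[of _ "S _"])
  then show "mS \<in> Hom R A"
    "\<lbrakk>x \<in> carrier A; y \<in> carrier A\<rbrakk> \<Longrightarrow> mS (t x y) = S x \<otimes> y" by auto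
qed

lemma
  shows mS'_Hom: "mS' \<in> Hom R A"
    and mS'_t: "\<lbrakk>x \<in> carrier A; y \<in> carrier A\<rbrakk> \<Longrightarrow> mS' (t x y) = x \<otimes> S y"
proof -
  have "mS' \<in> Hom R A \<and> (\<forall>x\<in>carrier A. \<forall>y\<in>carrier A. mS' (t x y) = x \<otimes> S y)"
    unfolding mS'_def by (rule lift) (simp_all add: l_distr r_distr m_assoc S_lin F_swap)
  then show "mS' \<in> Hom R A"
    "\<lbrakk>x \<in> carrier A; y \<in> carrier A\<rbrakk> \<Longrightarrow> mS' (t x y) = x \<otimes> S y" by auto
qed

lemma dl_counit: "a \<in> carrier A \<Longrightarrow> mb e (dl a) = a" "a \<in> carrier A \<Longrightarrow> sl e (dl a) = a"
  using counit_r[of "mb e" a] counit_l[of "sl e" a] functional_e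
  by (auto simp: mb_t mb_Hom sl_t sl_Hom)

lemma dl_antipode: "a \<in> carrier A \<Longrightarrow> mS (dl a) = e a" "a \<in> carrier A \<Longrightarrow> mS' (dl a) = e a"
  using antipode_l[of mS a] antipode_r[of mS' a] by (auto simp: mS_t mS_Hom mS'_t mS'_Hom)

lemma sl_rt:
  assumes f: "functional \<phi>" and "r \<in> carrier R" "y \<in> carrier A"
  shows "sl \<phi> (r \<otimes>\<^bsub>R\<^esub> rt y) = sl \<phi> r \<otimes> y"
  using assms(2)
proof (induction rule: R_induct)
  case (pure a b)
  then show ?case using assms(3) functionalD[OF f] by (simp add: t_rt sl_t[OF f] m_assoc)
next
  case (add u v)
  then show ?case using assms(3) sl_Hom[OF f] by (simp add: R.l_distr Hom_add Hom_closed l_distr)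
qed

lemma sr_rt:
  assumes f: "functional \<phi>" and "r \<in> carrier R" "y \<in> carrier A"
  shows "sr \<phi> (rt y \<otimes>\<^bsub>R\<^esub> r) = y \<otimes> sr \<phi> r"
  using assms(2)
proof (induction rule: R_induct)
  case (pure a b)
  note f' = functionalD[OF f]
  show ?case using pure assms(3) f' F_central[of "\<phi> (ev a)" y] F_central[of "\<phi> (od a)" y]
    by (simp add: rt_t Hom_add[OF sr_Hom[OF f]] sr_t[OF f] r_distr m_assoc[symmetric])
next
  case (add u v)
  then show ?case using assms(3) sr_Hom[OF f] by (simp add: R.r_distr Hom_add Hom_closed r_distr)
qed

lemma mS_rt:
  assumes "r \<in> carrier R" "y \<in> carrier A"
  shows "mS (r \<otimes>\<^bsub>R\<^esub> rt y) = mS r \<otimes> y"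
  using assms(1)
proof (induction rule: R_induct)
  case (pure a b)
  then show ?case using assms(2) by (simp add: t_rt mS_t m_assoc)
next
  case (add u v)
  then show ?case using assms(2) mS_Hom by (simp add: R.l_distr Hom_add Hom_closed l_distr)
qed

text \<open>
  Moving \<open>1 \<otimes> y\<close> past \<open>a \<otimes> 1\<close> and then past \<open>S a\<close> produces the same sign twice, because the antipode
  preserves parity.
\<close>

lemma mS_rt_l:
  assumes "r \<in> carrier R" "y \<in> carrier A"
  shows "mS (rt y \<otimes>\<^bsub>R\<^esub> r) = y \<otimes> mS r"
  using assms(1)
proof (induction rule: R_induct)
  case (pure a b)
  have "y \<otimes> S a = y \<otimes> ev (S a) \<oplus> y \<otimes> od (S a)"
    using pure assms(2) by (simp add: r_distr[symmetric] ev_od)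
  then have "y \<otimes> S a \<otimes> b = ev (S a) \<otimes> y \<otimes> b \<oplus> od (S a) \<otimes> th y \<otimes> b"
    using pure assms(2) od_comm[of "S a" "th y"] ev_central[of "S a" y] by (simp add: l_distr)
  then show ?case using pure assms(2)
    by (simp add: rt_t Hom_add[OF mS_Hom] mS_t S_ev S_od m_assoc)
next
  case (add u v)
  then show ?case using assms(2) mS_Hom by (simp add: R.r_distr Hom_add Hom_closed r_distr)
qed

lemma mb_e_lf:
  assumes "r \<in> carrier R" "x \<in> carrier A"
  shows "mb e (r \<otimes>\<^bsub>R\<^esub> lf x) = mb e r \<otimes> x"
  using assms(1)
proof (induction rule: R_induct)
  case (pure a b)
  have "e b \<otimes> (a \<otimes> ev x) \<oplus> e b \<otimes> (a \<otimes> od x) = e b \<otimes> a \<otimes> x"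
    using pure assms(2) by (simp add: m_assoc r_distr[symmetric] ev_od)
  then show ?case using pure assms(2)
    by (simp add: t_lf Hom_add[OF mb_Hom[OF functional_e]] mb_t[OF functional_e])
next
  case (add u v)
  then show ?case using assms(2) mb_Hom[OF functional_e] by (simp add: R.l_distr Hom_add Hom_closed l_distr)
qed

lemma mb_lf:
  assumes f: "functional \<phi>" and "r \<in> carrier R" "x \<in> carrier A"
  shows "mb \<phi> (lf x \<otimes>\<^bsub>R\<^esub> r) = x \<otimes> mb \<phi> r"
  using assms(2)
proof (induction rule: R_induct)
  case (pure a b)
  then show ?case using assms(3) functionalD[OF f] F_central[of "\<phi> b" x]
    by (simp add: lf_t mb_t[OF f] m_assoc[symmetric])
next
  case (add u v)
  then show ?case using assms(3) mb_Hom[OF f] by (simp add: R.r_distr Hom_add Hom_closed r_distr)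
qed

lemma e_sl:
  assumes f: "functional \<phi>" and r: "r \<in> carrier R"
  shows "e (sl \<phi> r) = \<phi> (mb e r)"
  using r
proof (induction rule: R_induct)
  case (pure a b)
  note f' = functionalD[OF f]
  show ?case using pure f' F_central[of "e b" "\<phi> a"] by (simp add: sl_t[OF f] mb_t[OF functional_e])
next
  case (add u v)
  then show ?case using sl_Hom[OF f] mb_Hom[OF functional_e] functionalD[OF f] by (simp add: Hom_add Hom_closed)
qed

lemma e_sr:
  assumes f: "functional \<phi>" and r: "r \<in> carrier R"
  shows "e (sr \<phi> r) = \<phi> (mb e r)"
  using r
proof (induction rule: R_induct)
  case (pure a b)
  note f' = functionalD[OF f]
  have "\<phi> a = \<phi> (ev a) \<oplus> \<phi> (od a)" using pure f'(5)[of "ev a" "od a"] by (simp add: ev_od)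
  then show ?case using pure f' F_central[of "e b" "\<phi> (ev a)"] F_central[of "e b" "\<phi> (od a)"]
    by (simp add: sr_t[OF f] mb_t[OF functional_e] r_distr)
next
  case (add u v)
  then show ?case using sr_Hom[OF f] mb_Hom[OF functional_e] functionalD[OF f] by (simp add: Hom_add Hom_closed)
qed


section \<open>The subring spanned by A and B\<close>

text \<open>
  The image of \<open>A \<otimes> B\<close> in \<open>A \<otimes> A\<close>. The left coideal property says that it contains \<open>dl b\<close> for
  \<open>b \<in> B\<close>, and slicing off its first leg lands in \<open>B\<close>.
\<close>

inductive_set RB :: "'r set" where
  RB_t: "\<lbrakk>x \<in> carrier A; b \<in> B\<rbrakk> \<Longrightarrow> t x b \<in> RB"
| RB_add: "\<lbrakk>u \<in> RB; v \<in> RB\<rbrakk> \<Longrightarrow> u \<oplus>\<^bsub>R\<^esub> v \<in> RB"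

lemma RB_R: "r \<in> RB \<Longrightarrow> r \<in> carrier R"
  by (induction rule: RB.induct) auto

lemma RB_dl: "b \<in> B \<Longrightarrow> dl b \<in> RB"
  by (rule dl_coideal[where P = "\<lambda>r. r \<in> RB"]) (auto intro: RB.intros)

lemma RB_lf: "r \<in> RB \<Longrightarrow> x \<in> carrier A \<Longrightarrow> r \<otimes>\<^bsub>R\<^esub> lf x \<in> RB"
  by (induction rule: RB.induct) (auto simp: t_lf R.l_distr RB_R intro!: RB.intros)

lemma RB_lf_l: "r \<in> RB \<Longrightarrow> x \<in> carrier A \<Longrightarrow> lf x \<otimes>\<^bsub>R\<^esub> r \<in> RB"
  by (induction rule: RB.induct) (auto simp: lf_t R.r_distr RB_R intro!: RB.intros)

lemma RB_zero: "\<zero>\<^bsub>R\<^esub> \<in> RB"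
  using RB_t[of \<zero> \<zero>] by simp

lemma RB_finsum: "(\<And>i. i \<in> I \<Longrightarrow> f i \<in> RB) \<Longrightarrow> (\<Oplus>\<^bsub>R\<^esub>i\<in>I. f i) \<in> RB"
proof (induction I rule: infinite_finite_induct)
  case (insert x I)
  then have "(\<Oplus>\<^bsub>R\<^esub>i\<in>insert x I. f i) = f x \<oplus>\<^bsub>R\<^esub> (\<Oplus>\<^bsub>R\<^esub>i\<in>I. f i)"
    by (intro R.finsum_insert) (auto simp: RB_R)
  with insert show ?case by (auto intro: RB_add)
qed (simp_all add: RB_zero R.finsum_infinite)

lemma sl_B: "\<lbrakk>functional \<phi>; r \<in> RB\<rbrakk> \<Longrightarrow> sl \<phi> r \<in> B"
  by (rotate_tac 1, induction rule: RB.induct)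
    (auto simp: sl_t functionalD Hom_add[OF sl_Hom] RB_R intro!: B_closed)

lemma sr_B: "\<lbrakk>functional \<phi>; r \<in> RB\<rbrakk> \<Longrightarrow> sr \<phi> r \<in> B"
  by (rotate_tac 1, induction rule: RB.induct)
    (auto simp: sr_t functionalD Hom_add[OF sr_Hom] RB_R intro!: B_closed)


section \<open>Linear algebra over the ground field\<close>

definition subspace :: "'a set \<Rightarrow> bool" where
  "subspace U \<longleftrightarrow> U \<subseteq> carrier A \<and> \<zero> \<in> U \<and> (\<forall>x\<in>U. \<forall>y\<in>U. x \<oplus> y \<in> U) \<and> (\<forall>c\<in>F. \<forall>x\<in>U. c \<otimes> x \<in> U)"

lemma subspaceD:
  assumes "subspace U"
  shows "x \<in> U \<Longrightarrow> x \<in> carrier A" "\<zero> \<in> U" "\<lbrakk>x \<in> U; y \<in> U\<rbrakk> \<Longrightarrow> x \<oplus> y \<in> U"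
    "\<lbrakk>c \<in> F; x \<in> U\<rbrakk> \<Longrightarrow> c \<otimes> x \<in> U" "x \<in> U \<Longrightarrow> \<ominus> x \<in> U" "\<lbrakk>x \<in> U; y \<in> U\<rbrakk> \<Longrightarrow> x \<ominus> y \<in> U"
proof -
  show *: "x \<in> U \<Longrightarrow> x \<in> carrier A" "\<zero> \<in> U" "\<lbrakk>x \<in> U; y \<in> U\<rbrakk> \<Longrightarrow> x \<oplus> y \<in> U"
    "\<lbrakk>c \<in> F; x \<in> U\<rbrakk> \<Longrightarrow> c \<otimes> x \<in> U" for x y c using assms by (auto simp: subspace_def)
  show **: "x \<in> U \<Longrightarrow> \<ominus> x \<in> U" for x
    using *(4)[of "\<ominus> \<one>" x] *(1) by (simp add: l_minus)
  show "\<lbrakk>x \<in> U; y \<in> U\<rbrakk> \<Longrightarrow> x \<ominus> y \<in> U" using *(3) ** by (simp add: a_minus_def)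
qed

lemma subspace_finsum: "\<lbrakk>subspace U; \<And>i. i \<in> I \<Longrightarrow> f i \<in> U\<rbrakk> \<Longrightarrow> (\<Oplus>i\<in>I. f i) \<in> U"
  by (rule finsum_sub) (auto dest: subspaceD)

lemma minus_diff_cancel:
  assumes "p \<in> carrier A" "q \<in> carrier A" "x \<in> carrier A"
  shows "(x \<ominus> p) \<ominus> (x \<ominus> q) = q \<ominus> p"
proof -
  have "(x \<ominus> p) \<ominus> (x \<ominus> q) = (\<ominus> p \<oplus> x) \<oplus> (\<ominus> x \<oplus> q)"
    using assms by (simp add: a_minus_def minus_add a_comm[of x "\<ominus> p"])
  also have "\<dots> = \<ominus> p \<oplus> q"
    using assms by (simp add: a_assoc r_neg2)
  finally show ?thesis using assms by (simp add: a_minus_def a_comm[of "\<ominus> p"])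
qed

text \<open>
  A subspace that is maximal among those not containing \<open>d\<close> is a complement of the line through
  \<open>d\<close>; the functional is the coefficient of \<open>d\<close>.
\<close>

lemma ex_functional:
  assumes d: "d \<in> carrier A" "d \<noteq> \<zero>"
  shows "\<exists>\<phi>. functional \<phi> \<and> \<phi> d = \<one>"
proof -
  let ?Q = "{U. subspace U \<and> d \<notin> U}"
  have "\<exists>M\<in>?Q. \<forall>Y\<in>?Q. M \<subseteq> Y \<longrightarrow> Y = M"
  proof (rule subset_Zorn_nonempty)
    have "subspace {\<zero>}" by (auto simp: subspace_def)
    then show "?Q \<noteq> {}" using d by blast
  next
    fix C assume C: "C \<noteq> {}" "subset.chain ?Q C"
    have sub: "subspace U" "d \<notin> U" if "U \<in> C" for U using that C by (auto simp: subset.chain_def)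
    have ch: "U \<subseteq> V \<or> V \<subseteq> U" if "U \<in> C" "V \<in> C" for U V
      using that C by (auto simp: subset_chain_def)
    have "subspace (\<Union>C)"
      unfolding subspace_def
    proof (intro conjI ballI)
      show "\<Union>C \<subseteq> carrier A" using subspaceD(1)[OF sub(1)] by blast
      show "\<zero> \<in> \<Union>C" using sub C by (auto simp: subspace_def)
      show "c \<otimes> x \<in> \<Union>C" if "c \<in> F" "x \<in> \<Union>C" for c x
        using that sub by (auto dest: subspaceD)
      show "x \<oplus> y \<in> \<Union>C" if xy: "x \<in> \<Union>C" "y \<in> \<Union>C" for x y
      proof -
        obtain U V where UV: "x \<in> U" "U \<in> C" "y \<in> V" "V \<in> C" using xy by blast
        from ch[OF UV(2,4)] show ?thesis
          using UV sub subspaceD(3)[of U x y] subspaceD(3)[of V x y] by blast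
      qed
    qed
    then show "\<Union>C \<in> ?Q" using sub by auto
  qed
  then obtain U where U: "subspace U" "d \<notin> U" and max: "\<And>Y. \<lbrakk>subspace Y; d \<notin> Y; U \<subseteq> Y\<rbrakk> \<Longrightarrow> Y = U" by blast
  note UD = subspaceD[OF U(1)]
  have ex: "\<exists>c\<in>F. x \<ominus> c \<otimes> d \<in> U" if x: "x \<in> carrier A" for x
  proof (cases "x \<in> U")
    case True
    then show ?thesis using d x by (intro bexI[of _ \<zero>]) (auto simp: a_minus_def)
  next
    case False
    let ?X = "{u \<oplus> k \<otimes> x | u k. u \<in> U \<and> k \<in> F}"
    have "subspace ?X"
      unfolding subspace_def
    proof (intro conjI ballI)
      show "?X \<subseteq> carrier A" using UD x by auto
      show "\<zero> \<in> ?X" using UD x by (auto intro!: exI[of _ \<zero>])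
      fix y z assume "y \<in> ?X" "z \<in> ?X"
      then obtain u k u' k' where *: "y = u \<oplus> k \<otimes> x" "z = u' \<oplus> k' \<otimes> x" "u \<in> U" "k \<in> F" "u' \<in> U" "k' \<in> F" by blast
      then have "y \<oplus> z = (u \<oplus> u') \<oplus> (k \<oplus> k') \<otimes> x" using UD x by (simp add: l_distr a_ac)
      moreover have "u \<oplus> u' \<in> U" "k \<oplus> k' \<in> F" using * UD(3) by auto
      ultimately show "y \<oplus> z \<in> ?X" by blast
    next
      fix c y assume "c \<in> F" "y \<in> ?X"
      then obtain u k where *: "y = u \<oplus> k \<otimes> x" "u \<in> U" "k \<in> F" by blast
      then have "c \<otimes> y = (c \<otimes> u) \<oplus> (c \<otimes> k) \<otimes> x" using UD x \<open>c \<in> F\<close> by (simp add: r_distr m_assoc)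
      moreover have "c \<otimes> u \<in> U" "c \<otimes> k \<in> F" using * UD(4) \<open>c \<in> F\<close> by auto
      ultimately show "c \<otimes> y \<in> ?X" by blast
    qed
    moreover have "U \<subseteq> ?X"
    proof
      fix u assume u: "u \<in> U"
      then have "u = u \<oplus> \<zero> \<otimes> x" using UD x by simp
      then show "u \<in> ?X" using u F_closed(1) by blast
    qed
    moreover have "x \<in> ?X"
    proof -
      have "x = \<zero> \<oplus> \<one> \<otimes> x" using x by simp
      then show ?thesis using UD(2) F_closed(2) by blast
    qed
    ultimately have "d \<in> ?X" using max[of ?X] False by blast
    then obtain u k where uk: "d = u \<oplus> k \<otimes> x" "u \<in> U" "k \<in> F" by blast
    have "k \<noteq> \<zero>" using uk U UD x by auto
    then obtain k' where k': "k' \<in> F" "k \<otimes> k' = \<one>" using F_inv uk by blast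
    then have "k' \<otimes> k = \<one>" using F_central[of k k'] uk by simp
    then have "k' \<otimes> d = k' \<otimes> u \<oplus> x"
      using uk k' x UD by (simp add: r_distr m_assoc[symmetric])
    moreover have "x \<ominus> (v \<oplus> x) = \<ominus> v" if v: "v \<in> carrier A" for v
    proof -
      have "x \<ominus> (v \<oplus> x) = \<ominus> v \<oplus> (\<ominus> x \<oplus> x)"
        using v x by (simp only: a_minus_def minus_add a_assoc a_inv_closed a_comm[of x] a_closed)
      then show ?thesis using v x by (simp add: l_neg)
    qed
    ultimately have "x \<ominus> k' \<otimes> d = \<ominus> (k' \<otimes> u)" using k' uk UD by simp
    then show ?thesis using k' uk UD by (intro bexI[of _ k']) auto
  qed
  have uniq: "c = c'" if "c \<in> F" "c' \<in> F" "x \<in> carrier A" "x \<ominus> c \<otimes> d \<in> U" "x \<ominus> c' \<otimes> d \<in> U" for c c' x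
  proof (rule ccontr)
    assume "c \<noteq> c'"
    then have "c' \<ominus> c \<noteq> \<zero>" using that by auto
    moreover have ccF: "c' \<ominus> c \<in> F" using that by simp
    ultimately obtain k where k: "k \<in> F" "(c' \<ominus> c) \<otimes> k = \<one>" using F_inv[of "c' \<ominus> c"] by blast
    have "(x \<ominus> c \<otimes> d) \<ominus> (x \<ominus> c' \<otimes> d) \<in> U" by (rule UD(6)[OF that(4,5)])
    also have "(x \<ominus> c \<otimes> d) \<ominus> (x \<ominus> c' \<otimes> d) = (c' \<ominus> c) \<otimes> d"
      using that d minus_diff_cancel[of "c \<otimes> d" "c' \<otimes> d" x] by (simp add: a_minus_def l_distr l_minus)
    finally have "k \<otimes> ((c' \<ominus> c) \<otimes> d) \<in> U" using UD(4)[OF k(1)] by blast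
    moreover have "k \<otimes> ((c' \<ominus> c) \<otimes> d) = d"
      using k that d F_central[of k "c' \<ominus> c"] by (simp add: m_assoc[symmetric])
    ultimately show False using U by simp
  qed
  define \<phi> where "\<phi> x = (THE c. c \<in> F \<and> x \<ominus> c \<otimes> d \<in> U)" for x
  have \<phi>: "\<phi> x \<in> F" "x \<ominus> \<phi> x \<otimes> d \<in> U" if "x \<in> carrier A" for x
  proof -
    have "\<exists>!c. c \<in> F \<and> x \<ominus> c \<otimes> d \<in> U" using ex[OF that] uniq[OF _ _ that] by blast
    from theI'[OF this] show "\<phi> x \<in> F" "x \<ominus> \<phi> x \<otimes> d \<in> U" by (auto simp: \<phi>_def)
  qed
  have \<phi>_eq: "\<phi> x = c" if "x \<in> carrier A" "c \<in> F" "x \<ominus> c \<otimes> d \<in> U" for x c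
    using uniq[of "\<phi> x" c x] \<phi>[of x] that by blast
  have "functional \<phi>"
    unfolding functional_def
  proof (intro conjI ballI HomI)
    fix x y assume xy: "x \<in> carrier A" "y \<in> carrier A"
    note c = F_carr[OF \<phi>(1)[OF xy(1)]] F_carr[OF \<phi>(1)[OF xy(2)]]
    have "(x \<oplus> y) \<ominus> (\<phi> x \<oplus> \<phi> y) \<otimes> d = (x \<ominus> \<phi> x \<otimes> d) \<oplus> (y \<ominus> \<phi> y \<otimes> d)"
      using xy d c by (simp add: a_minus_def l_distr minus_add a_ac)
    then show "\<phi> (x \<oplus> y) = \<phi> x \<oplus> \<phi> y" using xy \<phi> UD by (intro \<phi>_eq) auto
  next
    fix c x assume cx: "c \<in> F" "x \<in> carrier A"
    have "(c \<otimes> x) \<ominus> (c \<otimes> \<phi> x) \<otimes> d = c \<otimes> (x \<ominus> \<phi> x \<otimes> d)"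
      using cx d F_carr[OF cx(1)] F_carr[OF \<phi>(1)[OF cx(2)]]
      by (simp add: a_minus_def r_distr r_minus m_assoc)
    then show "\<phi> (c \<otimes> x) = c \<otimes> \<phi> x" using cx \<phi> UD by (intro \<phi>_eq) auto
  qed (use \<phi> in auto)
  moreover have "\<phi> d = \<one>" using d UD by (intro \<phi>_eq) (auto simp: a_minus_def r_neg)
  ultimately show ?thesis by blast
qed

lemma functional_separates:
  assumes "x \<in> carrier A" "\<And>\<phi>. functional \<phi> \<Longrightarrow> \<phi> x = \<zero>"
  shows "x = \<zero>"
proof (rule ccontr)
  assume "x \<noteq> \<zero>"
  then obtain \<phi> where "functional \<phi>" "\<phi> x = \<one>" using ex_functional assms(1) by blast
  then show False using assms(2)[of \<phi>] one_not_zero by simp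
qed

lemma functional_finsum:
  "\<lbrakk>functional \<phi>; finite I; \<And>i. i \<in> I \<Longrightarrow> f i \<in> carrier A\<rbrakk> \<Longrightarrow> \<phi> (\<Oplus>i\<in>I. f i) = (\<Oplus>i\<in>I. \<phi> (f i))"
  by (rule Hom_finsum[OF abA abA]) (auto dest: functionalD)

text \<open>
  A finite linearly independent set with a biorthogonal family of functionals defined on all of
  \<open>A\<close>. It is indexed by its own elements, so that matrices are functions on \<open>D \<times> D\<close>.
\<close>

definition dual :: "'a set \<Rightarrow> ('a \<Rightarrow> 'a \<Rightarrow> 'a) \<Rightarrow> bool" where
  "dual D \<phi> \<longleftrightarrow> finite D \<and> D \<subseteq> carrier A \<and> (\<forall>d\<in>D. functional (\<phi> d)) \<and>
    (\<forall>d\<in>D. \<forall>d'\<in>D. \<phi> d d' = (if d = d' then \<one> else \<zero>))"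

definition spans :: "'a set \<Rightarrow> ('a \<Rightarrow> 'a \<Rightarrow> 'a) \<Rightarrow> 'a \<Rightarrow> bool" where
  "spans D \<phi> x \<longleftrightarrow> x = (\<Oplus>d\<in>D. \<phi> d x \<otimes> d)"

lemma dual_span_base:
  assumes "dual D \<phi>" "d \<in> D" shows "spans D \<phi> d"
proof -
  have "(\<Oplus>d'\<in>D. \<phi> d' d \<otimes> d') = (\<Oplus>d'\<in>D. if d = d' then d' else \<zero>)"
    by (rule finsum_cong') (use assms in \<open>auto simp: dual_def\<close>)
  also have "\<dots> = d" using assms by (subst finsum_delta) (auto simp: dual_def)
  finally show ?thesis by (simp add: spans_def)
qed

text \<open>
  Gram-Schmidt: the part of a new vector outside the span of \<open>D\<close> is added to \<open>D\<close>, with a functional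
  that kills the span. The last conjunct says that \<open>D\<close> lies in the subspace generated by \<open>Y\<close>; it
  later keeps \<open>D\<close> inside subcomodules.
\<close>

lemma ex_dual:
  assumes "finite Y" "Y \<subseteq> carrier A"
  shows "\<exists>D \<phi>. dual D \<phi> \<and> (\<forall>x\<in>Y. spans D \<phi> x) \<and> (\<forall>U. subspace U \<longrightarrow> Y \<subseteq> U \<longrightarrow> D \<subseteq> U)"
  using assms
proof (induction Y)
  case empty
  then show ?case by (intro exI[of _ "{}"]) (auto simp: dual_def)
next
  case (insert x Y)
  then obtain D \<phi> where D: "dual D \<phi>" and Y: "\<forall>x\<in>Y. spans D \<phi> x" and sub: "\<And>U. \<lbrakk>subspace U; Y \<subseteq> U\<rbrakk> \<Longrightarrow> D \<subseteq> U"
    by auto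
  have x: "x \<in> carrier A" using insert by auto
  have fin: "finite D" and DA: "\<And>d. d \<in> D \<Longrightarrow> d \<in> carrier A" and fn: "\<And>d. d \<in> D \<Longrightarrow> functional (\<phi> d)"
    and du: "\<And>d d'. \<lbrakk>d \<in> D; d' \<in> D\<rbrakk> \<Longrightarrow> \<phi> d d' = (if d = d' then \<one> else \<zero>)"
    using D by (auto simp: dual_def)
  define pr where "pr y = (\<Oplus>d\<in>D. \<phi> d y \<otimes> d)" for y
  have pr_c [simp]: "pr y \<in> carrier A" if "y \<in> carrier A" for y
    unfolding pr_def using fn that DA by (auto intro!: finsum_closed simp: functionalD)
  have \<phi>pr: "\<phi> d (pr y) = \<phi> d y" if "d \<in> D" "y \<in> carrier A" for d y
  proof -
    have "\<phi> d (pr y) = (\<Oplus>d'\<in>D. \<phi> d (\<phi> d' y \<otimes> d'))"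
      unfolding pr_def using fn that DA by (intro functional_finsum fin) (auto simp: functionalD)
    also have "\<dots> = (\<Oplus>d'\<in>D. if d = d' then \<phi> d' y else \<zero>)"
      using fn that DA by (intro finsum_cong') (auto simp: functionalD du)
    also have "\<dots> = \<phi> d y" using fn that DA fin by (subst finsum_delta) (auto simp: functionalD)
    finally show ?thesis .
  qed
  have pr_add: "pr (y \<oplus> z) = pr y \<oplus> pr z" if "y \<in> carrier A" "z \<in> carrier A" for y z
  proof -
    have "pr (y \<oplus> z) = (\<Oplus>d\<in>D. \<phi> d y \<otimes> d \<oplus> \<phi> d z \<otimes> d)"
      unfolding pr_def using fn that DA by (intro finsum_cong') (auto simp: functionalD l_distr)
    also have "\<dots> = pr y \<oplus> pr z"
      unfolding pr_def using fn that DA by (intro finsum_addf) (auto simp: functionalD)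
    finally show ?thesis .
  qed
  have pr_sm: "pr (c \<otimes> y) = c \<otimes> pr y" if "c \<in> F" "y \<in> carrier A" for y c
    unfolding pr_def using fn that DA fin
    by (subst finsum_rdistr) (auto intro!: finsum_cong' simp: functionalD m_assoc)
  define n where "n = x \<ominus> pr x"
  have n: "n \<in> carrier A" using x by (simp add: n_def)
  show ?case
  proof (cases "n = \<zero>")
    case True
    then have "spans D \<phi> x" using x by (simp add: n_def spans_def pr_def[symmetric])
    then show ?thesis using D Y sub by (intro exI[of _ D] exI[of _ \<phi>]) auto
  next
    case False
    then obtain \<psi> where \<psi>: "functional \<psi>" "\<psi> n = \<one>" using ex_functional n by blast
    note \<psi>D = functionalD[OF \<psi>(1)]
    have \<phi>n: "\<phi> d n = \<zero>" if "d \<in> D" for d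
      using \<phi>pr[OF that x] x functionalD[OF fn[OF that]] by (simp add: n_def)
    have prn: "pr n = \<zero>" unfolding pr_def
      using DA by (intro add.finprod_one_eqI) (simp add: \<phi>n)
    have nD: "n \<notin> D"
    proof
      assume "n \<in> D"
      then have "\<phi> n n = \<one>" using du by simp
      then show False using \<phi>n[OF \<open>n \<in> D\<close>] one_not_zero by simp
    qed
    define \<phi>' where "\<phi>' d = (if d = n then (\<lambda>y. \<psi> (y \<ominus> pr y)) else \<phi> d)" for d
    have f1: "functional (\<lambda>y. \<psi> (y \<ominus> pr y))"
      unfolding functional_def
    proof (intro conjI ballI HomI)
      fix y z assume yz: "y \<in> carrier A" "z \<in> carrier A"
      have "(y \<oplus> z) \<ominus> pr (y \<oplus> z) = (y \<ominus> pr y) \<oplus> (z \<ominus> pr z)"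
        using yz by (simp add: pr_add a_minus_def minus_add a_ac)
      then show "\<psi> ((y \<oplus> z) \<ominus> pr (y \<oplus> z)) = \<psi> (y \<ominus> pr y) \<oplus> \<psi> (z \<ominus> pr z)"
        using yz by (simp add: \<psi>D)
    next
      fix c y assume cy: "c \<in> F" "y \<in> carrier A"
      have "(c \<otimes> y) \<ominus> pr (c \<otimes> y) = c \<otimes> (y \<ominus> pr y)"
        using cy by (simp add: pr_sm a_minus_def r_distr r_minus)
      then show "\<psi> ((c \<otimes> y) \<ominus> pr (c \<otimes> y)) = c \<otimes> \<psi> (y \<ominus> pr y)"
        using cy by (simp add: \<psi>D)
    qed (auto simp: \<psi>D)
    have prd: "pr d = d" if "d \<in> D" for d
      using dual_span_base[OF D that] by (simp add: spans_def pr_def)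
    have D': "dual (insert n D) \<phi>'"
      unfolding dual_def
    proof (intro conjI ballI)
      fix d d' assume dd: "d \<in> insert n D" "d' \<in> insert n D"
      show "\<phi>' d d' = (if d = d' then \<one> else \<zero>)"
        using dd nD du \<phi>n prd DA prn n by (auto simp: \<phi>'_def \<psi> \<psi>D a_minus_def r_neg)
    qed (use fin DA n f1 fn in \<open>auto simp: \<phi>'_def\<close>)
    have sp: "(\<Oplus>d\<in>insert n D. \<phi>' d y \<otimes> d) = \<psi> (y \<ominus> pr y) \<otimes> n \<oplus> pr y" if y: "y \<in> carrier A" for y
    proof -
      have "(\<Oplus>d\<in>insert n D. \<phi>' d y \<otimes> d) = \<phi>' n y \<otimes> n \<oplus> (\<Oplus>d\<in>D. \<phi>' d y \<otimes> d)"
        using fin nD n y f1 fn DA by (intro finsum_insert) (auto simp: \<phi>'_def functionalD \<psi>D)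
      also have "(\<Oplus>d\<in>D. \<phi>' d y \<otimes> d) = pr y"
        unfolding pr_def using nD fn y DA by (intro finsum_cong') (auto simp: \<phi>'_def functionalD)
      finally show ?thesis by (simp add: \<phi>'_def)
    qed
    have "spans (insert n D) \<phi>' x"
      using sp[OF x] x n \<psi> by (simp add: spans_def n_def[symmetric]) (simp add: n_def a_minus_def a_assoc l_neg)
    moreover have "spans (insert n D) \<phi>' y" if "y \<in> Y" for y
    proof -
      have y: "y \<in> carrier A" "pr y = y" using that Y insert by (auto simp: spans_def pr_def)
      then show ?thesis using sp[OF y(1)] n by (simp add: spans_def \<psi>D a_minus_def r_neg)
    qed
    moreover have "insert n D \<subseteq> U" if U: "subspace U" "insert x Y \<subseteq> U" for U
    proof -
      have DU: "D \<subseteq> U" using sub[of U] U by auto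
      have "pr x \<in> U" unfolding pr_def
        using DU x fn by (intro subspace_finsum U) (auto intro!: subspaceD[OF U(1)] simp: functionalD)
      then show ?thesis using DU U subspaceD[OF U(1)] by (auto simp: n_def)
    qed
    ultimately show ?thesis using D' by (intro exI[of _ "insert n D"] exI[of _ \<phi>']) auto
  qed
qed


section \<open>Expansions of tensors along a dual family\<close>

lemma Hom_sum_fun:
  assumes "finite D" "\<And>d. d \<in> D \<Longrightarrow> h d \<in> Hom R R"
  shows "(\<lambda>r. \<Oplus>\<^bsub>R\<^esub>d\<in>D. h d r) \<in> Hom R R"
proof (rule HomI)
  fix x assume "x \<in> carrier R"
  then show "(\<Oplus>\<^bsub>R\<^esub>d\<in>D. h d x) \<in> carrier R" by (intro R.finsum_closed Pi_I Hom_closed[OF assms(2)])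
next
  fix x y assume xy: "x \<in> carrier R" "y \<in> carrier R"
  have "(\<Oplus>\<^bsub>R\<^esub>d\<in>D. h d (x \<oplus>\<^bsub>R\<^esub> y)) = (\<Oplus>\<^bsub>R\<^esub>d\<in>D. h d x \<oplus>\<^bsub>R\<^esub> h d y)"
    using xy by (intro R.finsum_cong') (auto simp: Hom_add[OF assms(2)] Hom_closed[OF assms(2)])
  also have "\<dots> = (\<Oplus>\<^bsub>R\<^esub>d\<in>D. h d x) \<oplus>\<^bsub>R\<^esub> (\<Oplus>\<^bsub>R\<^esub>d\<in>D. h d y)"
    using xy by (intro R.finsum_addf) (auto simp: Hom_closed[OF assms(2)])
  finally show "(\<Oplus>\<^bsub>R\<^esub>d\<in>D. h d (x \<oplus>\<^bsub>R\<^esub> y)) = (\<Oplus>\<^bsub>R\<^esub>d\<in>D. h d x) \<oplus>\<^bsub>R\<^esub> (\<Oplus>\<^bsub>R\<^esub>d\<in>D. h d y)" .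
qed

lemma t_sum_l:
  "\<lbrakk>finite D; \<And>d. d \<in> D \<Longrightarrow> f d \<in> carrier A; y \<in> carrier A\<rbrakk> \<Longrightarrow> t (\<Oplus>d\<in>D. f d) y = (\<Oplus>\<^bsub>R\<^esub>d\<in>D. t (f d) y)"
  by (rule Hom_finsum[OF abA abR t_Hom_l]) auto
lemma t_sum_r:
  "\<lbrakk>finite D; \<And>d. d \<in> D \<Longrightarrow> f d \<in> carrier A; x \<in> carrier A\<rbrakk> \<Longrightarrow> t x (\<Oplus>d\<in>D. f d) = (\<Oplus>\<^bsub>R\<^esub>d\<in>D. t x (f d))"
  by (rule Hom_finsum[OF abA abR t_Hom_r]) auto

text \<open>
  Reconstruction of a tensor from its slices: the first leg is expanded along \<open>D\<close>, with the
  coefficient to its right (\<open>xl\<close>) or to its left (\<open>xr\<close>), or the second leg is expanded (\<open>xm\<close>).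
\<close>

definition xl where "xl D \<phi> r = (\<Oplus>\<^bsub>R\<^esub>d\<in>D. t d (sl (\<phi> d) r))"
definition xr where "xr D \<phi> r = (\<Oplus>\<^bsub>R\<^esub>d\<in>D. rt (sr (\<phi> d) r) \<otimes>\<^bsub>R\<^esub> lf d)"
definition xm where "xm D \<phi> r = (\<Oplus>\<^bsub>R\<^esub>d\<in>D. t (mb (\<phi> d) r) d)"

lemma dualD:
  assumes "dual D \<phi>"
  shows "finite D" "d \<in> D \<Longrightarrow> d \<in> carrier A" "d \<in> D \<Longrightarrow> functional (\<phi> d)"
    "\<lbrakk>d \<in> D; d' \<in> D\<rbrakk> \<Longrightarrow> \<phi> d d' = (if d = d' then \<one> else \<zero>)"
    "\<lbrakk>d \<in> D; x \<in> carrier A\<rbrakk> \<Longrightarrow> \<phi> d x \<in> F" "\<lbrakk>d \<in> D; x \<in> carrier A\<rbrakk> \<Longrightarrow> \<phi> d x \<in> carrier A"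
  using assms by (auto simp: dual_def functionalD)

lemma xl_Hom: assumes D: "dual D \<phi>" shows "xl D \<phi> \<in> Hom R R"
proof -
  have "(\<lambda>r. \<Oplus>\<^bsub>R\<^esub>d\<in>D. t d (sl (\<phi> d) r)) \<in> Hom R R"
    by (intro Hom_sum_fun) (auto intro!: Hom_comp[OF sl_Hom t_Hom_r] dualD[OF D])
  then show ?thesis unfolding xl_def[abs_def] .
qed

lemma xr_Hom: assumes D: "dual D \<phi>" shows "xr D \<phi> \<in> Hom R R"
proof -
  have "(\<lambda>r. \<Oplus>\<^bsub>R\<^esub>d\<in>D. rt (sr (\<phi> d) r) \<otimes>\<^bsub>R\<^esub> lf d) \<in> Hom R R"
  proof (rule Hom_sum_fun)
    fix d assume "d \<in> D"
    then have "functional (\<phi> d)" "lf d \<in> carrier R" using dualD[OF D] by auto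
    then show "(\<lambda>r. rt (sr (\<phi> d) r) \<otimes>\<^bsub>R\<^esub> lf d) \<in> Hom R R"
      by (intro Hom_comp[OF Hom_comp[OF sr_Hom t_Hom_r] R_finsum_mult_Hom(2)]) auto
  qed (rule dualD[OF D])
  then show ?thesis unfolding xr_def[abs_def] .
qed

lemma xm_Hom: assumes D: "dual D \<phi>" shows "xm D \<phi> \<in> Hom R R"
proof -
  have "(\<lambda>r. \<Oplus>\<^bsub>R\<^esub>d\<in>D. t (mb (\<phi> d) r) d) \<in> Hom R R"
    by (intro Hom_sum_fun) (auto intro!: Hom_comp[OF mb_Hom t_Hom_l] dualD[OF D])
  then show ?thesis unfolding xm_def[abs_def] .
qed

lemma xl_t:
  assumes D: "dual D \<phi>" and x: "x \<in> carrier A" "y \<in> carrier A" "spans D \<phi> x"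
  shows "xl D \<phi> (t x y) = t x y"
proof -
  note d = dualD[OF D]
  have "xl D \<phi> (t x y) = (\<Oplus>\<^bsub>R\<^esub>d\<in>D. t (\<phi> d x \<otimes> d) y)"
    unfolding xl_def using x d by (intro R.finsum_cong') (auto simp: sl_t t_bal)
  also have "\<dots> = t x y" using d x by (subst t_sum_l[symmetric]) (auto simp: spans_def)
  finally show ?thesis .
qed

lemma xm_t:
  assumes D: "dual D \<phi>" and x: "x \<in> carrier A" "y \<in> carrier A" "spans D \<phi> y"
  shows "xm D \<phi> (t x y) = t x y"
proof -
  note d = dualD[OF D]
  have "xm D \<phi> (t x y) = (\<Oplus>\<^bsub>R\<^esub>d\<in>D. t x (\<phi> d y \<otimes> d))"
    unfolding xm_def using x d by (intro R.finsum_cong') (auto simp: mb_t t_bal)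
  also have "\<dots> = t x y" using d x by (subst t_sum_r[symmetric]) (auto simp: spans_def)
  finally show ?thesis .
qed

lemma rt_lf: "\<lbrakk>x \<in> carrier A; y \<in> carrier A\<rbrakk> \<Longrightarrow> rt y \<otimes>\<^bsub>R\<^esub> lf x = t (ev x) y \<oplus>\<^bsub>R\<^esub> t (od x) (th y)"
  by (simp add: rt_t)

lemma rt_lf_bal:
  "\<lbrakk>c \<in> F; x \<in> carrier A; y \<in> carrier A\<rbrakk> \<Longrightarrow> rt (c \<otimes> y) \<otimes>\<^bsub>R\<^esub> lf x = rt y \<otimes>\<^bsub>R\<^esub> lf (c \<otimes> x)"
  using rt_lf[of x "c \<otimes> y"] rt_lf[of "c \<otimes> x" y] by (simp add: ev_mult od_mult ev_F t_bal)

lemma xr_t: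
  assumes D: "dual D \<phi>" and x: "x \<in> carrier A" "y \<in> carrier A" "spans D \<phi> (ev x)" "spans D \<phi> (od x)"
  shows "xr D \<phi> (t x y) = t x y"
proof -
  note d = dualD[OF D]
  have "xr D \<phi> (t x y) = (\<Oplus>\<^bsub>R\<^esub>d\<in>D. rt y \<otimes>\<^bsub>R\<^esub> lf (\<phi> d (ev x) \<otimes> d) \<oplus>\<^bsub>R\<^esub> rt (th y) \<otimes>\<^bsub>R\<^esub> lf (\<phi> d (od x) \<otimes> d))"
    unfolding xr_def using x d
    by (intro R.finsum_cong') (auto simp: sr_t t_add_r R.l_distr rt_lf_bal)
  also have "\<dots> = (\<Oplus>\<^bsub>R\<^esub>d\<in>D. rt y \<otimes>\<^bsub>R\<^esub> lf (\<phi> d (ev x) \<otimes> d)) \<oplus>\<^bsub>R\<^esub> (\<Oplus>\<^bsub>R\<^esub>d\<in>D. rt (th y) \<otimes>\<^bsub>R\<^esub> lf (\<phi> d (od x) \<otimes> d))"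
    using x d by (intro R.finsum_addf) auto
  also have "(\<Oplus>\<^bsub>R\<^esub>d\<in>D. rt y \<otimes>\<^bsub>R\<^esub> lf (\<phi> d (ev x) \<otimes> d)) = rt y \<otimes>\<^bsub>R\<^esub> lf (ev x)"
    using d x by (subst (2) x(3)[unfolded spans_def], subst t_sum_l) (auto simp: R.finsum_rdistr)
  also have "(\<Oplus>\<^bsub>R\<^esub>d\<in>D. rt (th y) \<otimes>\<^bsub>R\<^esub> lf (\<phi> d (od x) \<otimes> d)) = rt (th y) \<otimes>\<^bsub>R\<^esub> lf (od x)"
    using d x by (subst (2) x(4)[unfolded spans_def], subst t_sum_l) (auto simp: R.finsum_rdistr)
  also have "rt y \<otimes>\<^bsub>R\<^esub> lf (ev x) \<oplus>\<^bsub>R\<^esub> rt (th y) \<otimes>\<^bsub>R\<^esub> lf (od x) = t x y"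
    using x t_add_l[of "ev x" "od x" y] by (simp add: rt_lf ev_od)
  finally show ?thesis .
qed

text \<open>
  A tensor is a sum of finitely many pure ones, so its first legs span a finite dimensional space.
\<close>

lemma ex_support:
  assumes "r \<in> carrier R"
  shows "\<exists>Y. finite Y \<and> Y \<subseteq> carrier A \<and>
    (\<forall>D \<phi>. dual D \<phi> \<longrightarrow> (\<forall>y\<in>Y. spans D \<phi> y) \<longrightarrow> xl D \<phi> r = r \<and> xr D \<phi> r = r)"
  using assms
proof (induction rule: R_induct)
  case (pure x y)
  then show ?case
    by (intro exI[of _ "{x, ev x, od x}"]) (simp add: xl_t xr_t)
next
  case (add u v)
  then obtain Y Z where Y: "finite Y" "Y \<subseteq> carrier A"
      "\<And>D \<phi>. \<lbrakk>dual D \<phi>; \<forall>y\<in>Y. spans D \<phi> y\<rbrakk> \<Longrightarrow> xl D \<phi> u = u \<and> xr D \<phi> u = u"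
    and Z: "finite Z" "Z \<subseteq> carrier A"
      "\<And>D \<phi>. \<lbrakk>dual D \<phi>; \<forall>y\<in>Z. spans D \<phi> y\<rbrakk> \<Longrightarrow> xl D \<phi> v = v \<and> xr D \<phi> v = v"
    by metis
  show ?case
  proof (intro exI[of _ "Y \<union> Z"] conjI allI impI)
    fix D \<phi> assume D: "dual D \<phi>" "\<forall>y\<in>Y \<union> Z. spans D \<phi> y"
    show "xl D \<phi> (u \<oplus>\<^bsub>R\<^esub> v) = u \<oplus>\<^bsub>R\<^esub> v" "xr D \<phi> (u \<oplus>\<^bsub>R\<^esub> v) = u \<oplus>\<^bsub>R\<^esub> v"
      using D Y(3)[OF D(1)] Z(3)[OF D(1)] add
      by (simp_all add: Hom_add[OF xl_Hom[OF D(1)]] Hom_add[OF xr_Hom[OF D(1)]])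
  qed (use Y Z in auto)
qed

lemma ex_expansion:
  assumes "finite I" "\<And>i. i \<in> I \<Longrightarrow> r i \<in> carrier R"
  shows "\<exists>D \<phi>. dual D \<phi> \<and> (\<forall>i\<in>I. xl D \<phi> (r i) = r i \<and> xr D \<phi> (r i) = r i)"
proof -
  have "\<forall>i\<in>I. \<exists>Y. finite Y \<and> Y \<subseteq> carrier A \<and>
    (\<forall>D \<phi>. dual D \<phi> \<longrightarrow> (\<forall>y\<in>Y. spans D \<phi> y) \<longrightarrow> xl D \<phi> (r i) = r i \<and> xr D \<phi> (r i) = r i)"
    using ex_support assms(2) by blast
  then obtain Y where Y: "\<And>i. i \<in> I \<Longrightarrow> finite (Y i) \<and> Y i \<subseteq> carrier A \<and>
    (\<forall>D \<phi>. dual D \<phi> \<longrightarrow> (\<forall>y\<in>Y i. spans D \<phi> y) \<longrightarrow> xl D \<phi> (r i) = r i \<and> xr D \<phi> (r i) = r i)"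
    by metis
  have "finite (\<Union>i\<in>I. Y i)" "(\<Union>i\<in>I. Y i) \<subseteq> carrier A" using Y assms(1) by auto
  from ex_dual[OF this] obtain D \<phi> where D: "dual D \<phi>" "\<forall>x\<in>(\<Union>i\<in>I. Y i). spans D \<phi> x" by blast
  then have "xl D \<phi> (r i) = r i \<and> xr D \<phi> (r i) = r i" if "i \<in> I" for i
    using Y[OF that] that by blast
  then show ?thesis using D(1) by blast
qed

lemma sl_separates:
  assumes "r \<in> carrier R" "\<And>\<phi>. functional \<phi> \<Longrightarrow> sl \<phi> r = \<zero>"
  shows "r = \<zero>\<^bsub>R\<^esub>"
proof -
  obtain D \<phi> where D: "dual D \<phi>" "xl D \<phi> r = r"
    using ex_expansion[of "{()}" "\<lambda>_. r"] assms(1) by auto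
  have "xl D \<phi> r = (\<Oplus>\<^bsub>R\<^esub>d\<in>D. \<zero>\<^bsub>R\<^esub>)"
    unfolding xl_def using assms dualD[OF D(1)] by (intro R.finsum_cong') auto
  then show ?thesis using D by (simp add: R.finsum_zero)
qed

lemma e_mb:
  assumes f: "functional \<phi>" and r: "r \<in> carrier R"
  shows "e (mb \<phi> r) = \<phi> (sl e r)"
  using r
proof (induction rule: R_induct)
  case (pure a b)
  note f' = functionalD[OF f]
  show ?case using pure f' F_central[of "e a" "\<phi> b"] by (simp add: mb_t[OF f] sl_t[OF functional_e])
next
  case (add u v)
  then show ?case using mb_Hom[OF f] sl_Hom[OF functional_e] functionalD[OF f] by (simp add: Hom_add Hom_closed)
qed


section \<open>Matrix coefficients\<close>

text \<open>
  The matrix coefficients of the left subcomodule with basis \<open>D\<close>: comultiplication of \<open>\<tau>\<close> is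
  matrix multiplication and its counit is the identity matrix.
\<close>

definition comatrix :: "'a set \<Rightarrow> ('a \<Rightarrow> 'a \<Rightarrow> 'a) \<Rightarrow> bool" where
  "comatrix D \<tau> \<longleftrightarrow> finite D \<and> D \<subseteq> carrier A \<and> (\<forall>i\<in>D. \<forall>j\<in>D. \<tau> i j \<in> carrier A) \<and>
    (\<forall>i\<in>D. dl i = (\<Oplus>\<^bsub>R\<^esub>k\<in>D. t (\<tau> i k) k)) \<and>
    (\<forall>i\<in>D. \<forall>j\<in>D. dl (\<tau> i j) = (\<Oplus>\<^bsub>R\<^esub>k\<in>D. t (\<tau> i k) (\<tau> k j))) \<and>
    (\<forall>i\<in>D. \<forall>j\<in>D. e (\<tau> i j) = (if i = j then \<one> else \<zero>))"

lemma xm_lf: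
  assumes D: "dual D \<phi>" and "x \<in> carrier A" "r \<in> carrier R"
  shows "xm D \<phi> (lf x \<otimes>\<^bsub>R\<^esub> r) = lf x \<otimes>\<^bsub>R\<^esub> xm D \<phi> r"
proof -
  note d = dualD[OF D] and c = Hom_closed[OF mb_Hom]
  have "lf x \<otimes>\<^bsub>R\<^esub> xm D \<phi> r = (\<Oplus>\<^bsub>R\<^esub>d\<in>D. lf x \<otimes>\<^bsub>R\<^esub> t (mb (\<phi> d) r) d)"
    unfolding xm_def using assms d c by (intro R.finsum_rdistr) auto
  also have "\<dots> = xm D \<phi> (lf x \<otimes>\<^bsub>R\<^esub> r)"
    unfolding xm_def using assms d c by (intro R.finsum_cong') (auto simp: lf_t mb_lf)
  finally show ?thesis ..
qed

lemma spans_subspace: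
  assumes D: "dual D \<phi>"
  shows "subspace {u \<in> carrier A. spans D \<phi> u}"
  unfolding subspace_def spans_def mem_Collect_eq
proof (intro conjI ballI)
  note d = dualD[OF D] and f = functionalD[OF dualD(3)[OF D]]
  show "\<zero> = (\<Oplus>d\<in>D. \<phi> d \<zero> \<otimes> d)" using d f by (intro add.finprod_one_eqI[symmetric]) auto
  fix x assume x: "x \<in> {u \<in> carrier A. u = (\<Oplus>d\<in>D. \<phi> d u \<otimes> d)}"
  {
    fix y assume y: "y \<in> {u \<in> carrier A. u = (\<Oplus>d\<in>D. \<phi> d u \<otimes> d)}"
    show "x \<oplus> y \<in> carrier A" using x y by auto
    have "(\<Oplus>d\<in>D. \<phi> d (x \<oplus> y) \<otimes> d) = (\<Oplus>d\<in>D. \<phi> d x \<otimes> d \<oplus> \<phi> d y \<otimes> d)"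
      using x y d by (intro finsum_cong') (auto simp: f l_distr)
    also have "\<dots> = (\<Oplus>d\<in>D. \<phi> d x \<otimes> d) \<oplus> (\<Oplus>d\<in>D. \<phi> d y \<otimes> d)"
      using x y d by (intro finsum_addf) (auto simp: f)
    finally show "x \<oplus> y = (\<Oplus>d\<in>D. \<phi> d (x \<oplus> y) \<otimes> d)" using x y by auto
  }
  {
    fix c assume c: "c \<in> F"
    show "c \<otimes> x \<in> carrier A" using x c by auto
    have "(\<Oplus>d\<in>D. \<phi> d (c \<otimes> x) \<otimes> d) = (\<Oplus>d\<in>D. c \<otimes> (\<phi> d x \<otimes> d))"
      using x c d by (intro finsum_cong') (auto simp: f m_assoc)
    also have "\<dots> = c \<otimes> (\<Oplus>d\<in>D. \<phi> d x \<otimes> d)"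
      using x c d by (intro finsum_rdistr[symmetric]) (auto simp: f)
    finally show "c \<otimes> x = (\<Oplus>d\<in>D. \<phi> d (c \<otimes> x) \<otimes> d)" using x by auto
  }
qed auto

lemma lift_t_l:
  assumes h: "h \<in> Hom A A" "\<And>c x. \<lbrakk>c \<in> F; x \<in> carrier A\<rbrakk> \<Longrightarrow> h (c \<otimes> x) = c \<otimes> h x"
  shows "\<exists>k\<in>Hom R R. \<forall>x\<in>carrier A. \<forall>y\<in>carrier A. k (t x y) = t (h x) y"
  by (rule lift_R) (use AA_simps[OF h(1)] h(2) in \<open>auto simp: t_add_l t_add_r t_bal\<close>)

lemma lift_t_r:
  assumes h: "h \<in> Hom A A" "\<And>c x. \<lbrakk>c \<in> F; x \<in> carrier A\<rbrakk> \<Longrightarrow> h (c \<otimes> x) = c \<otimes> h x"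
  shows "\<exists>k\<in>Hom R R. \<forall>x\<in>carrier A. \<forall>y\<in>carrier A. k (t x y) = t x (h y)"
  by (rule lift_R) (use AA_simps[OF h(1)] h(2) in \<open>auto simp: t_add_l t_add_r t_bal\<close>)

lemma sl_lf_F:
  assumes f: "functional \<phi>" and "c \<in> F" "r \<in> carrier R"
  shows "sl \<phi> (lf c \<otimes>\<^bsub>R\<^esub> r) = c \<otimes> sl \<phi> r"
  using assms(3)
proof (induction rule: R_induct)
  case (pure a b)
  then show ?case using assms(2) functionalD[OF f] by (simp add: lf_t sl_t[OF f] m_assoc)
next
  case (add u v)
  then show ?case using assms(2) sl_Hom[OF f] by (simp add: R.r_distr Hom_add Hom_closed r_distr)
qed

text \<open>
  The local finiteness of comodules. Expand \<open>dl a\<close> along a dual family; by coassociativity the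
  second legs \<open>y\<close> span a subcomodule, which contains \<open>a\<close> by the counit axiom. A dual basis of this
  span gives \<open>D\<close>, and slicing \<open>dl i\<close> in the second leg gives the matrix.
\<close>

lemma ex_comatrix:
  assumes Y: "finite Y" "Y \<subseteq> carrier A"
  shows "\<exists>D \<tau> \<phi>. dual D \<phi> \<and> comatrix D \<tau> \<and> (\<forall>y\<in>Y. spans D \<phi> y) \<and> (Y \<subseteq> B \<longrightarrow> D \<subseteq> B)"
proof -
  obtain D0 \<phi>0 where D0: "dual D0 \<phi>0" and x0: "\<And>a. a \<in> Y \<Longrightarrow> xl D0 \<phi>0 (dl a) = dl a"
  proof -
    have dlY: "dl i \<in> carrier R" if "i \<in> Y" for i using Y that by auto
    show ?thesis using ex_expansion[OF Y(1), of dl, OF dlY] that by blast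
  qed
  note d0 = dualD[OF D0]
  define y where "y d a = sl (\<phi>0 d) (dl a)" for d a
  have yA: "y d a \<in> carrier A" if "d \<in> D0" "a \<in> Y" for d a
    using Hom_closed[OF sl_Hom[OF d0(3)[OF that(1)]]] that Y by (auto simp: y_def)
  have dla: "dl a = (\<Oplus>\<^bsub>R\<^esub>d\<in>D0. t d (y d a))" if "a \<in> Y" for a
    using x0[OF that] by (simp add: xl_def y_def)
  define Y2 where "Y2 = (\<lambda>(d, a). y d a) ` (D0 \<times> Y)"
  have "finite Y2" "Y2 \<subseteq> carrier A" using d0 Y yA by (auto simp: Y2_def)
  from ex_dual[OF this] obtain D \<phi> where D: "dual D \<phi>" and sp: "\<And>x. x \<in> Y2 \<Longrightarrow> spans D \<phi> x"
    and DU: "\<And>U. \<lbrakk>subspace U; Y2 \<subseteq> U\<rbrakk> \<Longrightarrow> D \<subseteq> U" by blast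
  have spY: "spans D \<phi> (y d1 a)" if "d1 \<in> D0" "a \<in> Y" for d1 a
    by (rule sp) (use that in \<open>auto simp: Y2_def\<close>)
  note d = dualD[OF D] and f = functionalD[OF dualD(3)[OF D]]
  \<comment> \<open>Elements whose comultiplication has its second legs in the span of \<open>D\<close>.\<close>
  let ?U = "{u \<in> carrier A. xm D \<phi> (dl u) = dl u}"
  have U: "subspace ?U"
    unfolding subspace_def
  proof (intro conjI ballI)
    show "\<zero> \<in> ?U" using Hom_zero[OF abR abR xm_Hom[OF D]] by simp
    show "x \<oplus> z \<in> ?U" if "x \<in> ?U" "z \<in> ?U" for x z
      using that by (simp add: Hom_add[OF xm_Hom[OF D]])
    show "c \<otimes> x \<in> ?U" if "c \<in> F" "x \<in> ?U" for c x
      using that xm_lf[OF D] by (simp add: dl_lin)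
  qed auto
  have "Y2 \<subseteq> ?U"
  proof
    fix u assume "u \<in> Y2"
    then obtain d1 a where u: "u = y d1 a" "d1 \<in> D0" "a \<in> Y" by (auto simp: Y2_def)
    note f1 = functionalD[OF d0(3)[OF u(2)]]
    let ?h = "sl (\<phi>0 d1)"
    note h = sl_Hom[OF d0(3)[OF u(2)]]
    have "(\<lambda>x. ?h (dl x)) \<in> Hom A A" by (rule Hom_comp[OF dl_Hom h])
    from lift_t_l[OF this] obtain k where k: "k \<in> Hom R R"
      "\<And>x y. \<lbrakk>x \<in> carrier A; y \<in> carrier A\<rbrakk> \<Longrightarrow> k (t x y) = t (?h (dl x)) y"
      using sl_lf_F[OF d0(3)[OF u(2)]] by (auto simp: dl_lin)
    have a: "a \<in> carrier A" using u Y by auto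
    have "dl u = k (dl a)"
      unfolding u(1) y_def
      by (rule coassoc_l[OF f1(1) f1(2) f1(4) h sl_t k a]) (use u d0 in auto)
    also have "\<dots> = (\<Oplus>\<^bsub>R\<^esub>d\<in>D0. t (?h (dl d)) (y d a))"
    proof -
      have "k (dl a) = (\<Oplus>\<^bsub>R\<^esub>d\<in>D0. k (t d (y d a)))"
        unfolding dla[OF u(3)] using d0 yA u by (intro Hom_finsum[OF abR abR k(1)]) auto
      also have "\<dots> = (\<Oplus>\<^bsub>R\<^esub>d\<in>D0. t (?h (dl d)) (y d a))"
        using d0 yA u k(2) Hom_closed[OF h] by (intro R.finsum_cong') auto
      finally show ?thesis .
    qed
    finally have dlu: "dl u = (\<Oplus>\<^bsub>R\<^esub>d\<in>D0. t (?h (dl d)) (y d a))" .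
    have "xm D \<phi> (dl u) = (\<Oplus>\<^bsub>R\<^esub>d\<in>D0. xm D \<phi> (t (?h (dl d)) (y d a)))"
      unfolding dlu using d0 yA u Hom_closed[OF h] by (intro Hom_finsum[OF abR abR xm_Hom[OF D]]) auto
    also have "\<dots> = dl u"
      unfolding dlu using d0 yA u Hom_closed[OF h] spY
      by (intro R.finsum_cong') (auto simp: xm_t[OF D])
    finally show "u \<in> ?U" using u yA by auto
  qed
  then have DinU: "D \<subseteq> ?U" using DU[OF U] by blast
  define \<tau> where "\<tau> i k = mb (\<phi> k) (dl i)" for i k
  have \<tau>A: "\<tau> i k \<in> carrier A" if "i \<in> carrier A" "k \<in> D" for i k
    using that Hom_closed[OF mb_Hom[OF d(3)]] by (auto simp: \<tau>_def)
  have dlD: "dl i = (\<Oplus>\<^bsub>R\<^esub>k\<in>D. t (\<tau> i k) k)" if "i \<in> D" for i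
    using DinU that unfolding xm_def \<tau>_def by fastforce
  have "comatrix D \<tau>"
    unfolding comatrix_def
  proof (intro conjI ballI)
    fix i j assume ij: "i \<in> D" "j \<in> D"
    note fj = functionalD[OF d(3)[OF ij(2)]] and h = mb_Hom[OF d(3)[OF ij(2)]]
    let ?h = "mb (\<phi> j)"
    have "(\<lambda>x. ?h (dl x)) \<in> Hom A A" by (rule Hom_comp[OF dl_Hom h])
    from lift_t_r[OF this] obtain k where k: "k \<in> Hom R R"
      "\<And>x y. \<lbrakk>x \<in> carrier A; y \<in> carrier A\<rbrakk> \<Longrightarrow> k (t x y) = t x (?h (dl y))"
      using mb_lf[OF d(3)[OF ij(2)]] by (auto simp: dl_lin)
    have "dl (\<tau> i j) = k (dl i)"
      unfolding \<tau>_def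
      by (rule coassoc_r[OF fj(1) fj(2) fj(4) h mb_t k]) (use ij d in auto)
    also have "\<dots> = (\<Oplus>\<^bsub>R\<^esub>l\<in>D. k (t (\<tau> i l) l))"
      unfolding dlD[OF ij(1)] using d \<tau>A ij by (intro Hom_finsum[OF abR abR k(1)]) auto
    also have "\<dots> = (\<Oplus>\<^bsub>R\<^esub>l\<in>D. t (\<tau> i l) (\<tau> l j))"
      using d \<tau>A ij k(2) by (intro R.finsum_cong') (auto simp: \<tau>_def)
    finally show "dl (\<tau> i j) = (\<Oplus>\<^bsub>R\<^esub>l\<in>D. t (\<tau> i l) (\<tau> l j))" .
    show "e (\<tau> i j) = (if i = j then \<one> else \<zero>)"
      using ij d e_mb[OF d(3)[OF ij(2)], of "dl i"] by (auto simp: \<tau>_def dl_counit)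
  qed (use d \<tau>A dlD in auto)
  moreover have "spans D \<phi> a" if a: "a \<in> Y" for a
  proof -
    have aA: "a \<in> carrier A" using a Y by auto
    have "a = sl e (dl a)" using dl_counit aA by simp
    also have "\<dots> = (\<Oplus>d\<in>D0. sl e (t d (y d a)))"
      unfolding dla[OF a] using d0 yA a by (intro Hom_finsum[OF abR abA sl_Hom[OF functional_e]]) auto
    also have "\<dots> = (\<Oplus>d\<in>D0. e d \<otimes> y d a)"
      using d0 yA a by (intro finsum_cong') (auto simp: sl_t functional_e)
    also have "\<dots> \<in> {u \<in> carrier A. spans D \<phi> u}"
    proof (rule subspace_finsum[OF spans_subspace[OF D]])
      fix d assume "d \<in> D0"
      then have "y d a \<in> {u \<in> carrier A. spans D \<phi> u}" using spY a yA by simp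
      then show "e d \<otimes> y d a \<in> {u \<in> carrier A. spans D \<phi> u}"
        by (intro subspaceD(4)[OF spans_subspace[OF D]]) (simp add: d0 \<open>d \<in> D0\<close>)
    qed
    finally show ?thesis by auto
  qed
  moreover have "D \<subseteq> B" if "Y \<subseteq> B"
  proof (rule DU)
    show "subspace B" by (auto simp: subspace_def)
    show "Y2 \<subseteq> B" using that d0 by (auto simp: Y2_def y_def intro!: sl_B RB_dl)
  qed
  ultimately show ?thesis using D by blast
qed

lemma comatrixD:
  assumes "comatrix D \<tau>"
  shows "finite D" "i \<in> D \<Longrightarrow> i \<in> carrier A" "\<lbrakk>i \<in> D; j \<in> D\<rbrakk> \<Longrightarrow> \<tau> i j \<in> carrier A"
    "i \<in> D \<Longrightarrow> dl i = (\<Oplus>\<^bsub>R\<^esub>k\<in>D. t (\<tau> i k) k)"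
    "\<lbrakk>i \<in> D; j \<in> D\<rbrakk> \<Longrightarrow> dl (\<tau> i j) = (\<Oplus>\<^bsub>R\<^esub>k\<in>D. t (\<tau> i k) (\<tau> k j))"
    "\<lbrakk>i \<in> D; j \<in> D\<rbrakk> \<Longrightarrow> e (\<tau> i j) = (if i = j then \<one> else \<zero>)"
  using assms by (auto simp: comatrix_def)

text \<open>
  The antipode axioms, read off entry by entry.
\<close>

lemma comatrix_inverse:
  assumes D: "comatrix D \<tau>" and ij: "i \<in> D" "j \<in> D"
  shows "(\<Oplus>k\<in>D. S (\<tau> i k) \<otimes> \<tau> k j) = (if i = j then \<one> else \<zero>)"
    and "(\<Oplus>k\<in>D. \<tau> i k \<otimes> S (\<tau> k j)) = (if i = j then \<one> else \<zero>)"
proof -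
  note d = comatrixD[OF D]
  have "(\<Oplus>k\<in>D. S (\<tau> i k) \<otimes> \<tau> k j) = (\<Oplus>k\<in>D. mS (t (\<tau> i k) (\<tau> k j)))"
    using d ij by (intro finsum_cong') (auto simp: mS_t)
  also have "\<dots> = mS (dl (\<tau> i j))"
    using d ij by (subst d(5)[OF ij]) (intro Hom_finsum[OF abR abA mS_Hom, symmetric]; auto)
  finally show "(\<Oplus>k\<in>D. S (\<tau> i k) \<otimes> \<tau> k j) = (if i = j then \<one> else \<zero>)"
    using dl_antipode(1)[OF d(3)[OF ij]] d(6)[OF ij] by simp
  have "(\<Oplus>k\<in>D. \<tau> i k \<otimes> S (\<tau> k j)) = (\<Oplus>k\<in>D. mS' (t (\<tau> i k) (\<tau> k j)))"
    using d ij by (intro finsum_cong') (auto simp: mS'_t)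
  also have "\<dots> = mS' (dl (\<tau> i j))"
    using d ij by (subst d(5)[OF ij]) (intro Hom_finsum[OF abR abA mS'_Hom, symmetric]; auto)
  finally show "(\<Oplus>k\<in>D. \<tau> i k \<otimes> S (\<tau> k j)) = (if i = j then \<one> else \<zero>)"
    using dl_antipode(2)[OF d(3)[OF ij]] d(6)[OF ij] by simp
qed

text \<open>
  The equations \<open>dl j = (\<Sum>l. \<tau>\<^sub>j\<^sub>l \<otimes> l)\<close>, solved for \<open>1 \<otimes> k\<close> by inverting the matrix.
\<close>

lemma comatrix_rt:
  assumes D: "comatrix D \<tau>" and k: "k \<in> D"
  shows "(\<Oplus>\<^bsub>R\<^esub>j\<in>D. lf (S (\<tau> k j)) \<otimes>\<^bsub>R\<^esub> dl j) = rt k"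
proof -
  note d = comatrixD[OF D]
  have "(\<Oplus>\<^bsub>R\<^esub>j\<in>D. lf (S (\<tau> k j)) \<otimes>\<^bsub>R\<^esub> dl j) = (\<Oplus>\<^bsub>R\<^esub>j\<in>D. \<Oplus>\<^bsub>R\<^esub>l\<in>D. t (S (\<tau> k j) \<otimes> \<tau> j l) l)"
  proof (rule R.finsum_cong')
    fix j assume j: "j \<in> D"
    have "lf (S (\<tau> k j)) \<otimes>\<^bsub>R\<^esub> dl j = (\<Oplus>\<^bsub>R\<^esub>l\<in>D. lf (S (\<tau> k j)) \<otimes>\<^bsub>R\<^esub> t (\<tau> j l) l)"
      unfolding d(4)[OF j] using d k j by (intro R.finsum_rdistr) auto
    also have "\<dots> = (\<Oplus>\<^bsub>R\<^esub>l\<in>D. t (S (\<tau> k j) \<otimes> \<tau> j l) l)"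
      using d k j by (intro R.finsum_cong') (auto simp: lf_t)
    finally show "lf (S (\<tau> k j)) \<otimes>\<^bsub>R\<^esub> dl j = \<dots>" .
  qed (use d k in \<open>auto intro!: R.finsum_closed\<close>)
  also have "\<dots> = (\<Oplus>\<^bsub>R\<^esub>l\<in>D. \<Oplus>\<^bsub>R\<^esub>j\<in>D. t (S (\<tau> k j) \<otimes> \<tau> j l) l)"
    using d k by (intro R.finsum_swap) auto
  also have "\<dots> = (\<Oplus>\<^bsub>R\<^esub>l\<in>D. if k = l then rt l else \<zero>\<^bsub>R\<^esub>)"
  proof (rule R.finsum_cong')
    fix l assume l: "l \<in> D"
    have "(\<Oplus>\<^bsub>R\<^esub>j\<in>D. t (S (\<tau> k j) \<otimes> \<tau> j l) l) = t (\<Oplus>j\<in>D. S (\<tau> k j) \<otimes> \<tau> j l) l"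
      using d k l by (intro t_sum_l[symmetric]) auto
    then show "(\<Oplus>\<^bsub>R\<^esub>j\<in>D. t (S (\<tau> k j) \<otimes> \<tau> j l) l) = (if k = l then rt l else \<zero>\<^bsub>R\<^esub>)"
      using comatrix_inverse(1)[OF D k l] d l by simp
  qed (use d in auto)
  also have "\<dots> = rt k" using d k by (subst R.finsum_delta) auto
  finally show ?thesis .
qed

end


section \<open>Relations with coefficients in the coideal\<close>

lemma (in ring) vec_mat_assoc:
  assumes "finite D" "finite E" "\<And>i. i \<in> D \<Longrightarrow> u i \<in> carrier R"
    "\<And>i j. \<lbrakk>i \<in> D; j \<in> E\<rbrakk> \<Longrightarrow> M i j \<in> carrier R" "\<And>j. j \<in> E \<Longrightarrow> N j \<in> carrier R"
  shows "(\<Oplus>j\<in>E. (\<Oplus>i\<in>D. u i \<otimes> M i j) \<otimes> N j) = (\<Oplus>i\<in>D. u i \<otimes> (\<Oplus>j\<in>E. M i j \<otimes> N j))"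
proof -
  have "(\<Oplus>j\<in>E. (\<Oplus>i\<in>D. u i \<otimes> M i j) \<otimes> N j) = (\<Oplus>j\<in>E. \<Oplus>i\<in>D. u i \<otimes> (M i j \<otimes> N j))"
    using assms by (intro finsum_cong') (auto simp: finsum_ldistr m_assoc intro!: finsum_closed finsum_cong')
  also have "\<dots> = (\<Oplus>i\<in>D. \<Oplus>j\<in>E. u i \<otimes> (M i j \<otimes> N j))"
    using assms by (intro finsum_swap) auto
  also have "\<dots> = (\<Oplus>i\<in>D. u i \<otimes> (\<Oplus>j\<in>E. M i j \<otimes> N j))"
    using assms by (intro finsum_cong') (auto simp: finsum_rdistr intro!: finsum_closed)
  finally show ?thesis .
qed

lemma (in ring) vec_delta:
  assumes "finite D" "l \<in> D" "\<And>i. i \<in> D \<Longrightarrow> u i \<in> carrier R"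
  shows "(\<Oplus>k\<in>D. u k \<otimes> (if k = l then \<one> else \<zero>)) = u l"
proof -
  have "(\<Oplus>k\<in>D. u k \<otimes> (if k = l then \<one> else \<zero>)) = (\<Oplus>k\<in>D. if l = k then u k else \<zero>)"
    using assms by (intro finsum_cong') auto
  also have "\<dots> = u l" using assms by (intro finsum_delta) auto
  finally show ?thesis .
qed

locale coideal_comatrix = super_hopf_coideal +
  fixes D :: "'a set" and \<tau> :: "'a \<Rightarrow> 'a \<Rightarrow> 'a"
  assumes comatrix: "comatrix D \<tau>"
begin

lemmas cm = comatrixD[OF comatrix]

lemma fin_D [simp]: "finite D" by (rule cm)
lemma D_carr [simp]: "d \<in> D \<Longrightarrow> d \<in> carrier A" by (rule cm)
lemma tau_carr [simp]: "\<lbrakk>i \<in> D; j \<in> D\<rbrakk> \<Longrightarrow> \<tau> i j \<in> carrier A" by (rule cm)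

text \<open>
  The relations between the elements of \<open>D\<close> with coefficients in \<open>B\<close>.
\<close>

definition Z :: "('a \<Rightarrow> 'a) set" where
  "Z = {z. (\<forall>d\<in>D. z d \<in> B) \<and> (\<Oplus>d\<in>D. z d \<otimes> d) = \<zero>}"

lemma Z_B: "\<lbrakk>z \<in> Z; d \<in> D\<rbrakk> \<Longrightarrow> z d \<in> B" by (simp add: Z_def)
lemma Z_carr: "\<lbrakk>z \<in> Z; d \<in> D\<rbrakk> \<Longrightarrow> z d \<in> carrier A" using Z_B by simp
lemma Z_sum: "z \<in> Z \<Longrightarrow> (\<Oplus>d\<in>D. z d \<otimes> d) = \<zero>" by (simp add: Z_def)

lemma Z_zero: "(\<lambda>d. \<zero>) \<in> Z"
  by (auto simp: Z_def intro!: add.finprod_one_eqI)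

lemma Z_add: "\<lbrakk>z \<in> Z; y \<in> Z\<rbrakk> \<Longrightarrow> (\<lambda>d. z d \<oplus> y d) \<in> Z"
proof -
  assume *: "z \<in> Z" "y \<in> Z"
  have "(\<Oplus>d\<in>D. (z d \<oplus> y d) \<otimes> d) = (\<Oplus>d\<in>D. z d \<otimes> d \<oplus> y d \<otimes> d)"
    using * by (intro finsum_cong') (auto simp: Z_carr l_distr)
  also have "\<dots> = (\<Oplus>d\<in>D. z d \<otimes> d) \<oplus> (\<Oplus>d\<in>D. y d \<otimes> d)"
    using * by (intro finsum_addf) (auto simp: Z_carr)
  finally show ?thesis using * by (auto simp: Z_def)
qed

lemma Z_smult: "\<lbrakk>b \<in> B; z \<in> Z\<rbrakk> \<Longrightarrow> (\<lambda>d. b \<otimes> z d) \<in> Z"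
proof -
  assume *: "b \<in> B" "z \<in> Z"
  have "(\<Oplus>d\<in>D. b \<otimes> z d \<otimes> d) = (\<Oplus>d\<in>D. b \<otimes> (z d \<otimes> d))"
    using * by (intro finsum_cong') (auto simp: Z_carr m_assoc)
  also have "\<dots> = b \<otimes> (\<Oplus>d\<in>D. z d \<otimes> d)"
    using * by (intro finsum_rdistr[symmetric]) (auto simp: Z_carr)
  finally show ?thesis using * by (auto simp: Z_def)
qed

lemma Z_minus: "\<lbrakk>z \<in> Z; y \<in> Z\<rbrakk> \<Longrightarrow> (\<lambda>d. z d \<ominus> y d) \<in> Z"
proof -
  assume *: "z \<in> Z" "y \<in> Z"
  have "(\<lambda>d. z d \<oplus> \<ominus> \<one> \<otimes> y d) \<in> Z"
    by (rule Z_add[OF *(1) Z_smult[OF _ *(2)]]) auto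
  moreover have "z d \<oplus> \<ominus> \<one> \<otimes> y d = z d \<ominus> y d" if "d \<in> D" for d
    using that * by (simp add: Z_carr l_minus a_minus_def)
  ultimately show ?thesis
  proof -
    assume **: "(\<lambda>d. z d \<oplus> \<ominus> \<one> \<otimes> y d) \<in> Z" "\<And>d. d \<in> D \<Longrightarrow> z d \<oplus> \<ominus> \<one> \<otimes> y d = z d \<ominus> y d"
    have "(\<Oplus>d\<in>D. (z d \<ominus> y d) \<otimes> d) = (\<Oplus>d\<in>D. (z d \<oplus> \<ominus> \<one> \<otimes> y d) \<otimes> d)"
      using * ** by (intro finsum_cong') (auto simp: Z_carr)
    then show ?thesis using * ** by (auto simp: Z_def)
  qed
qed

lemma Z_finsum:
  assumes "finite I" "\<And>i. i \<in> I \<Longrightarrow> z i \<in> Z"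
  shows "(\<lambda>d. \<Oplus>i\<in>I. z i d) \<in> Z"
proof -
  have "(\<Oplus>d\<in>D. (\<Oplus>i\<in>I. z i d) \<otimes> d) = (\<Oplus>d\<in>D. \<Oplus>i\<in>I. z i d \<otimes> d)"
    using assms by (intro finsum_cong') (auto simp: Z_carr finsum_ldistr intro!: finsum_closed)
  also have "\<dots> = (\<Oplus>i\<in>I. \<Oplus>d\<in>D. z i d \<otimes> d)"
    using assms by (intro finsum_swap) (auto simp: Z_carr)
  also have "\<dots> = \<zero>" by (rule add.finprod_one_eqI) (use assms Z_sum in auto)
  finally have "(\<Oplus>d\<in>D. (\<Oplus>i\<in>I. z i d) \<otimes> d) = \<zero>" .
  moreover have "(\<Oplus>i\<in>I. z i d) \<in> B" if "d \<in> D" for d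
    using assms(2) Z_B that by (intro finsum_B) auto
  ultimately show ?thesis by (simp add: Z_def)
qed

text \<open>
  All relations used below arise by this rule: a relation over the larger ring \<open>RB\<close> between the
  elements \<open>1 \<otimes> k\<close> is sliced to relations over \<open>B\<close>.
\<close>

lemma slice_Z:
  assumes q: "\<And>k. k \<in> D \<Longrightarrow> q k \<in> RB" and z: "(\<Oplus>\<^bsub>R\<^esub>k\<in>D. q k \<otimes>\<^bsub>R\<^esub> rt k) = \<zero>\<^bsub>R\<^esub>" and f: "functional \<phi>"
  shows "(\<lambda>k. sl \<phi> (q k)) \<in> Z"
proof -
  note h = sl_Hom[OF f]
  have "(\<Oplus>k\<in>D. sl \<phi> (q k) \<otimes> k) = (\<Oplus>k\<in>D. sl \<phi> (q k \<otimes>\<^bsub>R\<^esub> rt k))"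
    using q by (intro finsum_cong') (auto simp: sl_rt[OF f] RB_R Hom_closed[OF h])
  also have "\<dots> = sl \<phi> (\<Oplus>\<^bsub>R\<^esub>k\<in>D. q k \<otimes>\<^bsub>R\<^esub> rt k)"
    using q by (intro Hom_finsum[OF abR abA h, symmetric]) (auto simp: RB_R)
  also have "\<dots> = \<zero>" by (simp add: z Hom_zero[OF abR abA h])
  finally show ?thesis using q by (auto simp: Z_def sl_B[OF f])
qed

text \<open>
  The row vector \<open>dl(z) (\<tau> \<otimes> 1)\<close>. It is a relation between the \<open>1 \<otimes> k\<close> because its product with the
  column \<open>(1 \<otimes> k)\<^sub>k\<close> is \<open>dl\<close> applied to \<open>(\<Sum>i. z\<^sub>i i) = 0\<close>.
\<close>

definition xz where "xz z k = (\<Oplus>\<^bsub>R\<^esub>i\<in>D. dl (z i) \<otimes>\<^bsub>R\<^esub> lf (\<tau> i k))"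

lemma xz_RB: "\<lbrakk>z \<in> Z; k \<in> D\<rbrakk> \<Longrightarrow> xz z k \<in> RB"
  unfolding xz_def by (intro RB_finsum RB_lf RB_dl) (auto simp: Z_B)

lemma xz_sum: assumes z: "z \<in> Z" shows "(\<Oplus>\<^bsub>R\<^esub>k\<in>D. xz z k \<otimes>\<^bsub>R\<^esub> rt k) = \<zero>\<^bsub>R\<^esub>"
proof -
  have "(\<Oplus>\<^bsub>R\<^esub>k\<in>D. xz z k \<otimes>\<^bsub>R\<^esub> rt k) =
      (\<Oplus>\<^bsub>R\<^esub>i\<in>D. dl (z i) \<otimes>\<^bsub>R\<^esub> (\<Oplus>\<^bsub>R\<^esub>k\<in>D. lf (\<tau> i k) \<otimes>\<^bsub>R\<^esub> rt k))"
    unfolding xz_def using z by (intro R.vec_mat_assoc) (auto simp: Z_carr)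
  also have "\<dots> = (\<Oplus>\<^bsub>R\<^esub>i\<in>D. dl (z i \<otimes> i))"
  proof (rule R.finsum_cong')
    fix i assume i: "i \<in> D"
    have "(\<Oplus>\<^bsub>R\<^esub>k\<in>D. lf (\<tau> i k) \<otimes>\<^bsub>R\<^esub> rt k) = dl i"
      unfolding cm(4)[OF i] using i by (intro R.finsum_cong') (auto simp: lf_rt)
    then show "dl (z i) \<otimes>\<^bsub>R\<^esub> (\<Oplus>\<^bsub>R\<^esub>k\<in>D. lf (\<tau> i k) \<otimes>\<^bsub>R\<^esub> rt k) = dl (z i \<otimes> i)"
      using i z by (simp add: dl_mult Z_carr)
  qed (use z in \<open>auto simp: Z_carr\<close>)
  also have "\<dots> = dl (\<Oplus>i\<in>D. z i \<otimes> i)"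
    using z by (intro Hom_finsum[OF abA abR dl_Hom, symmetric]) (auto simp: Z_carr)
  finally show ?thesis using z by (simp add: Z_sum)
qed

lemma xz_mb: assumes z: "z \<in> Z" and k: "k \<in> D" shows "mb e (xz z k) = (\<Oplus>i\<in>D. z i \<otimes> \<tau> i k)"
proof -
  note h = mb_Hom[OF functional_e]
  have "mb e (xz z k) = (\<Oplus>i\<in>D. mb e (dl (z i) \<otimes>\<^bsub>R\<^esub> lf (\<tau> i k)))"
    unfolding xz_def using z k by (intro Hom_finsum[OF abR abA h]) (auto simp: Z_carr)
  also have "\<dots> = (\<Oplus>i\<in>D. z i \<otimes> \<tau> i k)"
    using z k by (intro finsum_cong') (auto simp: Z_carr mb_e_lf dl_counit)
  finally show ?thesis .
qed

text \<open>
  Multiplying the row \<open>(mS (dl z (\<tau>\<^sub>i\<^sub>k \<otimes> 1)))\<^sub>k\<close> by the matrix \<open>\<tau>\<close> on the right gives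
  \<open>mS (dl (z \<tau>\<^sub>i\<^sub>j)) = e z e \<tau>\<^sub>i\<^sub>j\<close>, which is \<open>e z\<close> times a row of the identity matrix. Since \<open>\<tau>\<close> has
  the inverse \<open>S \<tau>\<close>, the claim follows.
\<close>

lemma mS_dl_tau:
  assumes z: "z \<in> carrier A" and i: "i \<in> D" and l: "l \<in> D"
  shows "mS (dl z \<otimes>\<^bsub>R\<^esub> lf (\<tau> i l)) = e z \<otimes> S (\<tau> i l)"
proof -
  note h = mS_Hom
  define g where "g k = mS (dl z \<otimes>\<^bsub>R\<^esub> lf (\<tau> i k))" for k
  have gA: "g k \<in> carrier A" if "k \<in> D" for k
    using that z i by (auto simp: g_def Hom_closed[OF h])
  have g1: "(\<Oplus>k\<in>D. g k \<otimes> \<tau> k j) = e z \<otimes> (if i = j then \<one> else \<zero>)" if j: "j \<in> D" for j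
  proof -
    have "(\<Oplus>k\<in>D. g k \<otimes> \<tau> k j) = (\<Oplus>k\<in>D. mS (dl z \<otimes>\<^bsub>R\<^esub> t (\<tau> i k) (\<tau> k j)))"
    proof (rule finsum_cong')
      fix k assume k: "k \<in> D"
      have "g k \<otimes> \<tau> k j = mS (dl z \<otimes>\<^bsub>R\<^esub> lf (\<tau> i k) \<otimes>\<^bsub>R\<^esub> rt (\<tau> k j))"
        using z i j k by (simp add: g_def mS_rt)
      also have "dl z \<otimes>\<^bsub>R\<^esub> lf (\<tau> i k) \<otimes>\<^bsub>R\<^esub> rt (\<tau> k j) = dl z \<otimes>\<^bsub>R\<^esub> t (\<tau> i k) (\<tau> k j)"
        using z i j k by (simp add: R.m_assoc lf_rt)
      finally show "g k \<otimes> \<tau> k j = mS (dl z \<otimes>\<^bsub>R\<^esub> t (\<tau> i k) (\<tau> k j))" .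
    qed (use z i j in \<open>auto intro!: Hom_closed[OF h]\<close>)
    also have "\<dots> = mS (\<Oplus>\<^bsub>R\<^esub>k\<in>D. dl z \<otimes>\<^bsub>R\<^esub> t (\<tau> i k) (\<tau> k j))"
      using z i j by (intro Hom_finsum[OF abR abA h, symmetric]) auto
    also have "(\<Oplus>\<^bsub>R\<^esub>k\<in>D. dl z \<otimes>\<^bsub>R\<^esub> t (\<tau> i k) (\<tau> k j)) = dl (z \<otimes> \<tau> i j)"
      using z i j by (subst dl_mult, simp_all add: cm(5)) (intro R.finsum_rdistr[symmetric]; auto)
    finally show ?thesis using z i j by (simp add: dl_antipode cm(6))
  qed
  have "g l = (\<Oplus>k\<in>D. g k \<otimes> (\<Oplus>j\<in>D. \<tau> k j \<otimes> S (\<tau> j l)))"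
  proof -
    have "(\<Oplus>k\<in>D. g k \<otimes> (\<Oplus>j\<in>D. \<tau> k j \<otimes> S (\<tau> j l))) = (\<Oplus>k\<in>D. g k \<otimes> (if k = l then \<one> else \<zero>))"
      using l gA by (intro finsum_cong') (auto simp: comatrix_inverse(2)[OF comatrix])
    then show ?thesis using vec_delta[of D l g] l gA by simp
  qed
  also have "\<dots> = (\<Oplus>j\<in>D. (\<Oplus>k\<in>D. g k \<otimes> \<tau> k j) \<otimes> S (\<tau> j l))"
    using l gA by (intro vec_mat_assoc[symmetric]) auto
  also have "\<dots> = (\<Oplus>j\<in>D. if i = j then e z \<otimes> S (\<tau> j l) else \<zero>)"
    using l z by (intro finsum_cong') (auto simp: g1)
  also have "\<dots> = e z \<otimes> S (\<tau> i l)"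
    using l z i by (intro finsum_delta) auto
  finally show ?thesis by (simp add: g_def)
qed

lemma xz_mS: assumes z: "z \<in> Z" and k: "k \<in> D" shows "mS (xz z k) = (\<Oplus>i\<in>D. e (z i) \<otimes> S (\<tau> i k))"
proof -
  have "mS (xz z k) = (\<Oplus>i\<in>D. mS (dl (z i) \<otimes>\<^bsub>R\<^esub> lf (\<tau> i k)))"
    unfolding xz_def using z k by (intro Hom_finsum[OF abR abA mS_Hom]) (auto simp: Z_carr)
  also have "\<dots> = (\<Oplus>i\<in>D. e (z i) \<otimes> S (\<tau> i k))"
    using z k by (intro finsum_cong') (auto simp: Z_carr mS_dl_tau)
  finally show ?thesis .
qed

text \<open>
  The counit maps \<open>Z\<close> onto a subspace of \<open>F\<^sup>D\<close>. The matrix with rows \<open>e (pz i)\<close> is a projection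
  onto it: its rows lie in the subspace and it fixes the subspace. To get it, take \<open>J \<subseteq> D\<close> minimal
  such that modulo the coordinates in \<open>J\<close> every unit vector comes from \<open>Z\<close>; then an element of the
  subspace that vanishes outside \<open>J\<close> is zero, for otherwise it could be used to shrink \<open>J\<close>.
\<close>

lemma ex_projection:
  "\<exists>pz. (\<forall>i\<in>D. pz i \<in> Z) \<and>
    (\<forall>z\<in>Z. \<forall>k\<in>D. (\<Oplus>i\<in>D. e (z i) \<otimes> e (pz i k)) = e (z k))"
proof -
  define P where "P J \<longleftrightarrow> J \<subseteq> D \<and> (\<forall>i\<in>D. \<exists>z\<in>Z. \<forall>k\<in>D - J. e (z k) = (if i = k then \<one> else \<zero>))" for J
  have "P D" using Z_zero by (auto simp: P_def)
  then obtain J where J: "P J" and min: "\<And>J'. P J' \<Longrightarrow> card J \<le> card J'"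
    using ex_has_least_nat[of P D card] by blast
  have JD: "J \<subseteq> D" using J by (simp add: P_def)
  have "\<forall>i\<in>D. \<exists>z. z \<in> Z \<and> (\<forall>k\<in>D - J. e (z k) = (if i = k then \<one> else \<zero>))"
    using J unfolding P_def by blast
  then obtain pz where pz: "\<And>i. i \<in> D \<Longrightarrow> pz i \<in> Z"
    "\<And>i k. \<lbrakk>i \<in> D; k \<in> D - J\<rbrakk> \<Longrightarrow> e (pz i k) = (if i = k then \<one> else \<zero>)" by metis
  have key: "e (y j) = \<zero>" if y: "y \<in> Z" and y0: "\<And>k. k \<in> D - J \<Longrightarrow> e (y k) = \<zero>" and j: "j \<in> J" for y j
  proof (rule ccontr)
    assume "e (y j) \<noteq> \<zero>"
    moreover have jD: "j \<in> D" using j JD by auto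
    then have yj: "y j \<in> carrier A" using y by (simp add: Z_carr)
    ultimately obtain c where c: "c \<in> F" "e (y j) \<otimes> c = \<one>" using F_inv[of "e (y j)"] by auto
    have c': "c \<otimes> e (y j) = \<one>" using F_central[of c "e (y j)"] c yj by simp
    have "P (J - {j})"
      unfolding P_def
    proof (intro conjI ballI)
      show "J - {j} \<subseteq> D" using JD by auto
      fix i assume i: "i \<in> D"
      define a where "a = e (pz i j) \<ominus> (if i = j then \<one> else \<zero>)"
      have a: "a \<in> F" using pz i jD by (auto simp: a_def Z_carr)
      define z where "z k = pz i k \<ominus> (a \<otimes> c) \<otimes> y k" for k
      have zZ: "z \<in> Z" unfolding z_def using a c y pz i by (intro Z_minus Z_smult) auto
      have ez: "e (z k) = e (pz i k) \<ominus> a \<otimes> c \<otimes> e (y k)" if "k \<in> D" for k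
        using that a c y pz(1)[OF i] by (simp add: z_def Z_carr a_minus_def)
      have ezj: "e (z j) = (if i = j then \<one> else \<zero>)"
        using ez[OF jD] a c c' yj pz(1)[OF i] jD
        by (simp add: m_assoc Z_carr a_def a_minus_def minus_add r_neg2)
      have "e (z k) = (if i = k then \<one> else \<zero>)" if "k \<in> D - J" for k
        using ez[of k] that pz(2)[OF i that] y0[OF that] a c by (auto simp: a_minus_def)
      then show "\<exists>z\<in>Z. \<forall>k\<in>D - (J - {j}). e (z k) = (if i = k then \<one> else \<zero>)"
        using zZ ezj by blast
    qed
    from min[OF this] have "card J \<le> card (J - {j})" .
    moreover have "finite J" using JD finite_subset fin_D by blast
    ultimately show False using j by (metis card_Diff1_less not_le)
  qed
  have "(\<Oplus>i\<in>D. e (z i) \<otimes> e (pz i k)) = e (z k)" if z: "z \<in> Z" and k: "k \<in> D" for z k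
  proof -
    define s where "s k = (\<Oplus>i\<in>D. e (z i) \<otimes> pz i k)" for k
    have sZ: "s \<in> Z" unfolding s_def[abs_def] using pz z by (intro Z_finsum Z_smult) (auto simp: Z_carr)
    have es: "e (s l) = (\<Oplus>i\<in>D. e (z i) \<otimes> e (pz i l))" if "l \<in> D" for l
    proof -
      have "e (s l) = (\<Oplus>i\<in>D. e (e (z i) \<otimes> pz i l))"
        unfolding s_def using pz z that by (intro Hom_finsum[OF abA abA e_Hom]) (auto simp: Z_carr)
      also have "\<dots> = (\<Oplus>i\<in>D. e (z i) \<otimes> e (pz i l))"
        using pz z that by (intro finsum_cong') (auto simp: Z_carr)
      finally show ?thesis .
    qed
    have yZ: "(\<lambda>k. z k \<ominus> s k) \<in> Z" by (rule Z_minus[OF z sZ])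
    have out: "e (s l) = e (z l)" if l: "l \<in> D - J" for l
    proof -
      have "e (s l) = (\<Oplus>i\<in>D. e (z i) \<otimes> (if i = l then \<one> else \<zero>))"
        unfolding es[OF DiffD1[OF l]] using z l pz by (intro finsum_cong') (auto simp: Z_carr)
      also have "\<dots> = e (z l)" using l z by (intro vec_delta) (auto simp: Z_carr)
      finally show ?thesis .
    qed
    have ey: "e (z l \<ominus> s l) = e (z l) \<ominus> e (s l)" if "l \<in> D" for l
      using that z sZ by (simp add: Z_carr a_minus_def)
    have "e (z k \<ominus> s k) = \<zero>"
    proof (cases "k \<in> J")
      case True
      show ?thesis
        by (rule key[OF yZ _ True]) (use z sZ in \<open>simp add: ey out Z_carr\<close>)
    next
      case False
      then show ?thesis using k z sZ by (simp add: ey out Z_carr)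
    qed
    then have "e (z k) = e (s k)" using ey[OF k] z sZ k by (simp add: Z_carr)
    then show ?thesis using es[OF k] by simp
  qed
  then show ?thesis using pz(1) by blast
qed

text \<open>
  The fixed relations \<open>zs\<close> are the slices of \<open>xz (pz j)\<close> along a dual family \<open>E\<close>, indexed by
  \<open>s = (j, \<epsilon>)\<close>. For \<open>z \<in> Z\<close>, all functionals applied to the row \<open>z \<tau>\<close> give counits of relations,
  so the projection of \<open>ex_projection\<close> fixes it. Therefore \<open>z = z \<tau> S(\<tau>)\<close> is a
  combination of the rows \<open>(\<Sum>i. e (pz j i) S \<tau>\<^sub>i\<^sub>k)\<^sub>k\<close>, and these are combinations of the \<open>zs\<close>
  by \<open>xz_mS\<close>.
\<close>

lemma relations_split:
  "\<exists>(I :: ('a \<times> 'a) set) zs a. finite I \<and> (\<forall>s\<in>I. zs s \<in> Z) \<and> (\<forall>s\<in>I. \<forall>i\<in>D. a s i \<in> carrier A) \<and>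
    (\<forall>z\<in>Z. \<forall>k\<in>D. z k = (\<Oplus>s\<in>I. (\<Oplus>i\<in>D. z i \<otimes> a s i) \<otimes> zs s k))"
proof -
  obtain pz where pz: "\<And>i. i \<in> D \<Longrightarrow> pz i \<in> Z"
    "\<And>z k. \<lbrakk>z \<in> Z; k \<in> D\<rbrakk> \<Longrightarrow> (\<Oplus>i\<in>D. e (z i) \<otimes> e (pz i k)) = e (z k)" using ex_projection by auto
  have "\<exists>E \<phi>. dual E \<phi> \<and> (\<forall>p\<in>D \<times> D. xl E \<phi> (xz (pz (fst p)) (snd p)) = xz (pz (fst p)) (snd p) \<and>
     xr E \<phi> (xz (pz (fst p)) (snd p)) = xz (pz (fst p)) (snd p))"
    by (rule ex_expansion) (auto intro!: RB_R xz_RB pz)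
  then obtain E \<phi> where E: "dual E \<phi>" and
    xp: "\<And>j k. \<lbrakk>j \<in> D; k \<in> D\<rbrakk> \<Longrightarrow> xl E \<phi> (xz (pz j) k) = xz (pz j) k" by auto
  note d = dualD[OF E]
  define zs where "zs s k = sl (\<phi> (snd s)) (xz (pz (fst s)) k)" for s k
  define a where "a s i = \<tau> i (fst s) \<otimes> S (snd s)" for s i
  have zsZ: "zs s \<in> Z" if "s \<in> D \<times> E" for s
  proof -
    have "fst s \<in> D" "functional (\<phi> (snd s))" using that d by auto
    then show ?thesis
      unfolding zs_def[abs_def] by (intro slice_Z xz_RB xz_sum pz)
  qed
  have sumE: "(\<Oplus>\<epsilon>\<in>E. S \<epsilon> \<otimes> zs (j, \<epsilon>) k) = (\<Oplus>i\<in>D. e (pz j i) \<otimes> S (\<tau> i k))" if jk: "j \<in> D" "k \<in> D" for j k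
  proof -
    have zA: "zs (j, \<epsilon>) k \<in> carrier A" if "\<epsilon> \<in> E" for \<epsilon> using zsZ[of "(j, \<epsilon>)"] that jk by (auto simp: Z_carr)
    have "(\<Oplus>\<epsilon>\<in>E. S \<epsilon> \<otimes> zs (j, \<epsilon>) k) = (\<Oplus>\<epsilon>\<in>E. mS (t \<epsilon> (zs (j, \<epsilon>) k)))"
      using d zA by (intro finsum_cong') (auto simp: mS_t)
    also have "\<dots> = mS (\<Oplus>\<^bsub>R\<^esub>\<epsilon>\<in>E. t \<epsilon> (zs (j, \<epsilon>) k))"
      using d zA by (intro Hom_finsum[OF abR abA mS_Hom, symmetric]) auto
    also have "(\<Oplus>\<^bsub>R\<^esub>\<epsilon>\<in>E. t \<epsilon> (zs (j, \<epsilon>) k)) = xz (pz j) k"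
      using xp[OF jk] by (simp add: xl_def zs_def)
    finally show ?thesis using xz_mS[OF pz(1)[OF jk(1)] jk(2)] by simp
  qed
  have main: "z k = (\<Oplus>s\<in>D \<times> E. (\<Oplus>i\<in>D. z i \<otimes> a s i) \<otimes> zs s k)" if z: "z \<in> Z" and k: "k \<in> D" for z k
  proof -
    define u where "u j = (\<Oplus>i\<in>D. z i \<otimes> \<tau> i j)" for j
    have uA: "u j \<in> carrier A" if "j \<in> D" for j using that z by (auto simp: u_def Z_carr intro!: finsum_closed)
    have pzA: "pz i j \<in> carrier A" if "i \<in> D" "j \<in> D" for i j using pz(1) that by (simp add: Z_carr)
    have u_pi: "(\<Oplus>i\<in>D. u i \<otimes> e (pz i j)) = u j" if j: "j \<in> D" for j
    proof -
      have sA: "(\<Oplus>i\<in>D. u i \<otimes> e (pz i j)) \<in> carrier A" using uA pzA j by (intro finsum_closed) auto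
      have "(\<Oplus>i\<in>D. u i \<otimes> e (pz i j)) \<ominus> u j = \<zero>"
      proof (rule functional_separates)
        fix \<psi> assume \<psi>: "functional \<psi>"
        note f = functionalD[OF \<psi>]
        have sZ: "(\<lambda>k. sl \<psi> (xz z k)) \<in> Z" using z by (intro slice_Z xz_RB xz_sum \<psi>)
        have slA: "sl \<psi> (xz z i) \<in> carrier A" if "i \<in> D" for i using Z_carr[OF sZ that] .
        have \<psi>u: "\<psi> (u i) = e (sl \<psi> (xz z i))" if "i \<in> D" for i
          using that z e_sl[OF \<psi>, of "xz z i"] xz_mb[OF z that] by (simp add: u_def RB_R xz_RB)
        have "\<psi> (\<Oplus>i\<in>D. u i \<otimes> e (pz i j)) = (\<Oplus>i\<in>D. \<psi> (u i \<otimes> e (pz i j)))"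
          using uA pzA j by (intro functional_finsum[OF \<psi>]) auto
        also have "\<dots> = (\<Oplus>i\<in>D. e (sl \<psi> (xz z i)) \<otimes> e (pz i j))"
        proof (rule finsum_cong')
          fix i assume i: "i \<in> D"
          have "\<psi> (u i \<otimes> e (pz i j)) = \<psi> (e (pz i j) \<otimes> u i)"
            using F_central[of "e (pz i j)" "u i"] uA pzA i j by simp
          also have "\<dots> = \<psi> (u i) \<otimes> e (pz i j)"
            using F_central[of "e (pz i j)" "\<psi> (u i)"] uA pzA i j f by simp
          finally show "\<psi> (u i \<otimes> e (pz i j)) = e (sl \<psi> (xz z i)) \<otimes> e (pz i j)" by (simp add: \<psi>u i)
        qed (use slA pzA j in auto)
        also have "\<dots> = \<psi> (u j)" using pz(2)[OF sZ j] \<psi>u[OF j] by simp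
        finally show "\<psi> ((\<Oplus>i\<in>D. u i \<otimes> e (pz i j)) \<ominus> u j) = \<zero>" using sA uA j f by simp
      qed (use sA uA j in auto)
      then show ?thesis using sA uA j by simp
    qed
    have "z k = (\<Oplus>i\<in>D. z i \<otimes> (if i = k then \<one> else \<zero>))"
      using vec_delta[of D k z] z k by (simp add: Z_carr)
    also have "\<dots> = (\<Oplus>i\<in>D. z i \<otimes> (\<Oplus>j\<in>D. \<tau> i j \<otimes> S (\<tau> j k)))"
      using z k by (intro finsum_cong') (auto simp: comatrix_inverse(2)[OF comatrix] Z_carr intro!: finsum_closed)
    also have "\<dots> = (\<Oplus>j\<in>D. u j \<otimes> S (\<tau> j k))"
      unfolding u_def using z k by (intro vec_mat_assoc[symmetric]) (auto simp: Z_carr)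
    also have "\<dots> = (\<Oplus>j\<in>D. (\<Oplus>i\<in>D. u i \<otimes> e (pz i j)) \<otimes> S (\<tau> j k))"
      using uA k by (intro finsum_cong') (auto simp: u_pi)
    also have "\<dots> = (\<Oplus>i\<in>D. u i \<otimes> (\<Oplus>j\<in>D. e (pz i j) \<otimes> S (\<tau> j k)))"
      using uA pzA k by (intro vec_mat_assoc) auto
    also have "\<dots> = (\<Oplus>i\<in>D. \<Oplus>\<epsilon>\<in>E. u i \<otimes> (S \<epsilon> \<otimes> zs (i, \<epsilon>) k))"
    proof (rule finsum_cong')
      fix i assume i: "i \<in> D"
      have zA: "zs (i, \<epsilon>) k \<in> carrier A" if "\<epsilon> \<in> E" for \<epsilon> using zsZ[of "(i, \<epsilon>)"] that i k by (auto simp: Z_carr)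
      show "u i \<otimes> (\<Oplus>j\<in>D. e (pz i j) \<otimes> S (\<tau> j k)) = (\<Oplus>\<epsilon>\<in>E. u i \<otimes> (S \<epsilon> \<otimes> zs (i, \<epsilon>) k))"
        unfolding sumE[OF i k, symmetric] using uA i d zA by (intro finsum_rdistr) auto
    next
      have zA: "zs (i, \<epsilon>) k \<in> carrier A" if "i \<in> D" "\<epsilon> \<in> E" for i \<epsilon> using zsZ[of "(i, \<epsilon>)"] that k by (auto simp: Z_carr)
      then show "(\<lambda>i. \<Oplus>\<epsilon>\<in>E. u i \<otimes> (S \<epsilon> \<otimes> zs (i, \<epsilon>) k)) \<in> D \<rightarrow> carrier A"
        using uA d by (auto intro!: finsum_closed)
    qed simp
    also have "\<dots> = (\<Oplus>s\<in>D \<times> E. u (fst s) \<otimes> (S (snd s) \<otimes> zs (fst s, snd s) k))"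
    proof (rule finsum_Sigma_prod)
      fix i \<epsilon> assume *: "i \<in> D" "\<epsilon> \<in> E"
      then have "zs (i, \<epsilon>) k \<in> carrier A" using zsZ[of "(i, \<epsilon>)"] k by (auto simp: Z_carr)
      then show "u i \<otimes> (S \<epsilon> \<otimes> zs (i, \<epsilon>) k) \<in> carrier A" using * uA d by auto
    qed (use d in auto)
    also have "\<dots> = (\<Oplus>s\<in>D \<times> E. (\<Oplus>i\<in>D. z i \<otimes> a s i) \<otimes> zs s k)"
    proof (rule finsum_cong')
      fix s assume s: "s \<in> D \<times> E"
      have zA: "zs s k \<in> carrier A" using zsZ[OF s] k by (auto simp: Z_carr)
      have sA: "fst s \<in> D" "snd s \<in> carrier A" using s d by auto
      have "u (fst s) \<otimes> S (snd s) = (\<Oplus>i\<in>D. z i \<otimes> \<tau> i (fst s) \<otimes> S (snd s))"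
        unfolding u_def using z sA by (intro finsum_ldistr) (auto simp: Z_carr)
      also have "\<dots> = (\<Oplus>i\<in>D. z i \<otimes> a s i)"
        using z sA by (intro finsum_cong') (auto simp: Z_carr a_def m_assoc)
      finally show "u (fst s) \<otimes> (S (snd s) \<otimes> zs (fst s, snd s) k) = (\<Oplus>i\<in>D. z i \<otimes> a s i) \<otimes> zs s k"
        using uA sA zA by (simp add: m_assoc[symmetric])
    next
      show "(\<lambda>s. (\<Oplus>i\<in>D. z i \<otimes> a s i) \<otimes> zs s k) \<in> D \<times> E \<rightarrow> carrier A"
      proof
        fix s assume s: "s \<in> D \<times> E"
        have zA: "zs s k \<in> carrier A" using zsZ[OF s] k by (auto simp: Z_carr)
        then show "(\<Oplus>i\<in>D. z i \<otimes> a s i) \<otimes> zs s k \<in> carrier A"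
          using s z d by (auto simp: Z_carr a_def intro!: finsum_closed)
      qed
    qed simp
    finally show ?thesis .
  qed
  show ?thesis
    by (rule exI[of _ "D \<times> E"], rule exI[of _ zs], rule exI[of _ a])
      (use d zsZ main in \<open>auto simp: a_def\<close>)
qed

end

context super_hopf_coideal begin


section \<open>Generic coordinates\<close>

definition homogeneous :: "'a \<Rightarrow> bool" where
  "homogeneous x \<longleftrightarrow> x \<in> carrier A \<and> (ev x = x \<or> od x = x)"

lemma homogeneous_carr [simp]: "homogeneous x \<Longrightarrow> x \<in> carrier A" by (simp add: homogeneous_def)

lemma even_comm: "\<lbrakk>ev x = x; x \<in> carrier A; y \<in> carrier A\<rbrakk> \<Longrightarrow> x \<otimes> y = y \<otimes> x"
  using ev_central[of x y] by simp

text \<open>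
  Homogeneous elements are normal: the right and left ideals they generate agree.
\<close>

lemma homogeneous_normal: assumes "homogeneous x" "y \<in> carrier A" shows "\<exists>y'\<in>carrier A. x \<otimes> y = y' \<otimes> x"
proof (cases "ev x = x")
  case True
  then show ?thesis using even_comm[OF True _ assms(2)] assms by auto
next
  case False
  then have "od x = x" using assms by (simp add: homogeneous_def)
  then have "x \<otimes> y = th y \<otimes> x" using od_comm[of x y] assms by simp
  then show ?thesis using assms(2) th_simps(1) by blast
qed

lemma homogeneous_comm:
  assumes "homogeneous x" "homogeneous y"
  shows "x \<otimes> y = y \<otimes> x \<or> x \<otimes> y = \<ominus> (y \<otimes> x)"
proof -
  consider "ev x = x" | "ev y = y" | "od x = x" "od y = y" using assms by (auto simp: homogeneous_def)
  then show ?thesis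
  proof cases
    case 1
    then show ?thesis using even_comm[of x y] assms by simp
  next
    case 2
    then show ?thesis using even_comm[of y x] assms by simp
  next
    case 3
    then show ?thesis using od_anti[of x y] assms by simp
  qed
qed

lemma homogeneous_even: "\<lbrakk>x \<in> carrier A; ev x = x\<rbrakk> \<Longrightarrow> od x = \<zero>"
  using od_of_ev[of x] by simp
lemma homogeneous_odd: "\<lbrakk>x \<in> carrier A; od x = x\<rbrakk> \<Longrightarrow> ev x = \<zero>"
  using ev_of_od[of x] by simp

lemma homogeneous_mult: "\<lbrakk>homogeneous x; homogeneous y\<rbrakk> \<Longrightarrow> homogeneous (x \<otimes> y)"
  unfolding homogeneous_def by (auto simp: ev_mult od_mult homogeneous_even homogeneous_odd)

lemma even_pow: "\<lbrakk>ev x = x; x \<in> carrier A\<rbrakk> \<Longrightarrow> ev (x [^] (n::nat)) = x [^] n"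
  by (induction n) (simp_all add: ev_F ev_mult homogeneous_even)

lemma homogeneous_pow: "homogeneous x \<Longrightarrow> homogeneous (x [^] (n::nat))"
proof (induction n)
  case 0
  then show ?case by (simp add: homogeneous_def ev_F)
next
  case (Suc n)
  then show ?case by (simp add: homogeneous_mult)
qed

lemma even_pow_distrib:
  assumes "ev x = x" "x \<in> carrier A" "y \<in> carrier A"
  shows "(x \<otimes> y) [^] (n::nat) = x [^] n \<otimes> y [^] n"
proof -
  have "x \<otimes> y = y \<otimes> x" by (rule even_comm[OF assms])
  then show ?thesis using assms by (intro pow_mult_distrib)
qed

lemma B_pow: "b \<in> B \<Longrightarrow> b [^] (n::nat) \<in> B"
  by (induction n) auto

text \<open>
  A left multiple of \<open>x\<close> is the square of the even part of \<open>x\<close>; the odd part has disappeared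
  because it squares to zero.
\<close>

lemma th_mult_self: "x \<in> carrier A \<Longrightarrow> th x \<otimes> x = ev x \<otimes> ev x"
proof -
  assume x: "x \<in> carrier A"
  have "th x \<otimes> x = th x \<otimes> ev x \<oplus> th x \<otimes> od x"
    using x r_distr[of "ev x" "od x" "th x"] by (simp add: ev_od)
  also have "th x \<otimes> od x = od x \<otimes> ev x"
    using x od_comm[of x x] r_distr[of "ev x" "od x" "od x"] by (simp add: ev_od od_square)
  also have "th x \<otimes> ev x = ev x \<otimes> ev x \<ominus> od x \<otimes> ev x"
    using x by (simp add: th_def a_minus_def l_distr l_minus)
  finally show ?thesis using x by (simp add: a_minus_def a_assoc l_neg)
qed

text \<open>
  A column \<open>y\<close> with \<open>f y = N y\<close>, where the entries of \<open>N\<close> lie in the ideal generated by the elements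
  \<open>f y\<^sub>s\<^sub>i\<close>, up to a power of \<open>f\<close>. Their homogeneous components are nilpotent and
  normal, so if no power of \<open>f\<close> killed \<open>y\<close>, there would be a homogeneous \<open>g\<close> such that no power
  of \<open>f\<close> kills \<open>g y\<close>, while for each of the finitely many components \<open>x\<close> some power of \<open>f\<close> kills
  \<open>g x y\<close>. But then \<open>f (f\<^sup>n g y) = f\<^sup>n g N y\<close> vanishes for large \<open>n\<close>, a contradiction.
\<close>

lemma nilpotent_system_vanishes:
  assumes I: "finite I" and Q: "finite Q" and fA: "f \<in> carrier A" and f: "ev f = f"
    and yA: "\<And>s l. \<lbrakk>s \<in> I; l \<in> Q\<rbrakk> \<Longrightarrow> y s l \<in> carrier A"
    and aQ: "\<And>s i. \<lbrakk>s \<in> I; i \<in> Q\<rbrakk> \<Longrightarrow> a s i \<in> carrier A"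
    and key: "\<And>s l. \<lbrakk>s \<in> I; l \<in> Q\<rbrakk> \<Longrightarrow>
      f \<otimes> y s l = (\<Oplus>s'\<in>I. (\<Oplus>i\<in>Q. y s i \<otimes> a s' i) \<otimes> y s' l)"
    and nil: "\<And>s i. \<lbrakk>s \<in> I; i \<in> Q\<rbrakk> \<Longrightarrow> \<exists>n::nat. (f \<otimes> ev (y s i)) [^] n = \<zero>"
  shows "\<exists>n::nat. \<forall>s\<in>I. \<forall>l\<in>Q. f [^] n \<otimes> y s l = \<zero>"
proof -
  have fc: "f [^] n \<otimes> x = x \<otimes> f [^] n" if "x \<in> carrier A" for x and n :: nat
    using that fA f by (intro even_comm) (auto simp: even_pow)
  define kills where "kills n g \<longleftrightarrow> (\<forall>s\<in>I. \<forall>l\<in>Q. g \<otimes> (f [^] n \<otimes> y s l) = \<zero>)" for g and n :: nat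
  define vanishes where "vanishes g \<longleftrightarrow> (\<exists>n. kills n g)" for g
  have kills_mono: "kills m g" if "kills n g" "n \<le> m" "g \<in> carrier A" for n m g
    unfolding kills_def
  proof (intro ballI)
    fix s l assume sl: "s \<in> I" "l \<in> Q"
    have "f [^] m = f [^] (m - n) \<otimes> f [^] n" using that(2) fA by (simp add: nat_pow_mult)
    then have "g \<otimes> (f [^] m \<otimes> y s l) = (g \<otimes> f [^] (m - n)) \<otimes> (f [^] n \<otimes> y s l)"
      using that sl fA yA by (simp add: m_assoc)
    also have "\<dots> = f [^] (m - n) \<otimes> (g \<otimes> (f [^] n \<otimes> y s l))"
      using fc[of g "m - n"] that sl fA yA by (simp add: m_assoc[symmetric])
    also have "\<dots> = \<zero>" using that(1) sl fA by (simp add: kills_def)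
    finally show "g \<otimes> (f [^] m \<otimes> y s l) = \<zero>" .
  qed
  have vanishes_mult: "vanishes (p \<otimes> g)" if kg: "vanishes g" and "g \<in> carrier A" "p \<in> carrier A" for p g
  proof -
    obtain n where n: "kills n g" using kg unfolding vanishes_def by blast
    have "kills n (p \<otimes> g)"
      unfolding kills_def
    proof (intro ballI)
      fix s l assume sl: "s \<in> I" "l \<in> Q"
      show "p \<otimes> g \<otimes> (f [^] n \<otimes> y s l) = \<zero>"
        using n[unfolded kills_def] sl that fA yA by (simp add: m_assoc)
    qed
    then show ?thesis by (auto simp: vanishes_def)
  qed
  have vanishes_zero: "vanishes \<zero>" using yA fA by (auto simp: vanishes_def kills_def)
  have vanishes_minus: "vanishes (\<ominus> g)" if "vanishes g" "g \<in> carrier A" for g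
    using vanishes_mult[OF that, of "\<ominus> \<one>"] that by (simp add: l_minus)
  have ex_max: "\<exists>g. homogeneous g \<and> \<not> vanishes g \<and> (\<forall>x\<in>Y. vanishes (g \<otimes> x))"
    if "finite Y" "\<forall>x\<in>Y. homogeneous x \<and> (\<exists>n::nat. x [^] n = \<zero>)" "\<not> vanishes \<one>" for Y
    using that
  proof (induction Y)
    case empty
    have "homogeneous \<one>" by (simp add: homogeneous_def ev_F)
    then show ?case using empty by blast
  next
    case (insert x Y)
    then obtain g where g: "homogeneous g" "\<not> vanishes g" "\<And>y. y \<in> Y \<Longrightarrow> vanishes (g \<otimes> y)" by auto
    have x: "homogeneous x" using insert by simp
    obtain n :: nat where n: "x [^] n = \<zero>" using insert by auto
    have kn: "vanishes (g \<otimes> x [^] n)" using g vanishes_zero by (simp add: n)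
    \<comment> \<open>Multiply \<open>g\<close> by the largest power of \<open>x\<close> that still survives.\<close>
    define m where "m = (LEAST k::nat. vanishes (g \<otimes> x [^] k))"
    have m: "vanishes (g \<otimes> x [^] m)"
      unfolding m_def by (rule LeastI[of "\<lambda>k. vanishes (g \<otimes> x [^] k)", OF kn])
    have m': "\<not> vanishes (g \<otimes> x [^] k)" if "k < m" for k
      using that not_less_Least unfolding m_def by blast
    have "m \<noteq> 0"
    proof
      assume "m = 0"
      then show False using m g by simp
    qed
    then obtain k where k: "m = Suc k" by (cases m) auto
    let ?p = "x [^] k"
    have p: "homogeneous ?p" by (rule homogeneous_pow[OF x])
    have "vanishes (g \<otimes> ?p \<otimes> x)" using m k g x by (simp add: m_assoc)
    moreover have "vanishes (g \<otimes> ?p \<otimes> y)" if y: "y \<in> Y" for y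
    proof -
      have yA': "y \<in> carrier A" using insert y by auto
      have 1: "vanishes (?p \<otimes> (g \<otimes> y))" using vanishes_mult[OF g(3)[OF y], of ?p] g yA' x by simp
      from homogeneous_comm[OF g(1) p] show ?thesis
      proof
        assume "g \<otimes> ?p = ?p \<otimes> g"
        then show ?thesis using 1 g yA' x by (simp add: m_assoc)
      next
        assume "g \<otimes> ?p = \<ominus> (?p \<otimes> g)"
        then have "g \<otimes> ?p \<otimes> y = \<ominus> (?p \<otimes> (g \<otimes> y))" using g yA' x by (simp add: m_assoc l_minus)
        then show ?thesis using vanishes_minus[OF 1] g yA' x by simp
      qed
    qed
    moreover have "\<not> vanishes (g \<otimes> ?p)" using m'[of k] k by simp
    moreover have "homogeneous (g \<otimes> ?p)" by (rule homogeneous_mult[OF g(1) p])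
    ultimately show ?case by blast
  qed
  define Y0 where "Y0 = (\<Union>s\<in>I. \<Union>i\<in>Q. {ev (f \<otimes> y s i), od (f \<otimes> y s i)})"
  have Y0fin: "finite Y0" using I Q by (simp add: Y0_def)
  have Y0in: "ev (f \<otimes> y s i) \<in> Y0" "od (f \<otimes> y s i) \<in> Y0" if "s \<in> I" "i \<in> Q" for s i
    using that unfolding Y0_def by blast+
  have Y0nil: "homogeneous x \<and> (\<exists>n::nat. x [^] n = \<zero>)" if xY: "x \<in> Y0" for x
  proof -
    obtain s i where si: "s \<in> I" "i \<in> Q" and x: "x = ev (f \<otimes> y s i) \<or> x = od (f \<otimes> y s i)"
      using xY unfolding Y0_def by blast
    have fy: "f \<otimes> y s i \<in> carrier A" using fA yA si by simp
    from x show ?thesis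
    proof
      assume x: "x = ev (f \<otimes> y s i)"
      have "x = f \<otimes> ev (y s i)" using x fA f yA si by (simp add: ev_mult homogeneous_even)
      moreover have "\<exists>n::nat. (f \<otimes> ev (y s i)) [^] n = \<zero>" by (rule nil[OF si])
      moreover have "homogeneous x" using x fy by (simp add: homogeneous_def)
      ultimately show ?thesis by simp
    next
      assume x: "x = od (f \<otimes> y s i)"
      have "x [^] (Suc (Suc 0)) = \<zero>" using x fy od_square[OF fy] by simp
      moreover have "homogeneous x" using x fy by (simp add: homogeneous_def)
      ultimately show ?thesis by blast
    qed
  qed
  have step: "vanishes g" if g: "homogeneous g" and gY: "\<forall>x\<in>Y0. vanishes (g \<otimes> x)" for g
  proof -
    have "\<forall>x\<in>Y0. \<exists>n. kills n (g \<otimes> x)" using gY by (auto simp: vanishes_def)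
    then have "\<exists>n. \<forall>x\<in>Y0. kills (n x) (g \<otimes> x)" by (rule bchoice)
    then obtain n where n: "\<And>x. x \<in> Y0 \<Longrightarrow> kills (n x) (g \<otimes> x)" by blast
    \<comment> \<open>One exponent that serves all of the finitely many components.\<close>
    define N where "N = Max (insert 0 (n ` Y0))"
    have kN: "kills N (g \<otimes> x)" if "x \<in> Y0" for x
    proof (rule kills_mono[OF n[OF that]])
      show "n x \<le> N" using Y0fin that by (simp add: N_def)
      show "g \<otimes> x \<in> carrier A" using g Y0nil[OF that] by simp
    qed
    have gxa: "g \<otimes> (x \<otimes> (b \<otimes> (f [^] N \<otimes> y s l))) = \<zero>"
      if "x \<in> Y0" and bA: "b \<in> carrier A" and "s \<in> I" "l \<in> Q" for x b s l
    proof -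
      let ?v = "f [^] N \<otimes> y s l"
      have vA: "?v \<in> carrier A" using fA yA that by simp
      have x: "homogeneous x" using Y0nil[OF that(1)] by simp
      obtain b1 where b1: "b1 \<in> carrier A" "x \<otimes> b = b1 \<otimes> x" using homogeneous_normal[OF x bA] by blast
      obtain b2 where b2: "b2 \<in> carrier A" "g \<otimes> b1 = b2 \<otimes> g" using homogeneous_normal[OF g b1(1)] by blast
      have "g \<otimes> (x \<otimes> (b \<otimes> ?v)) = g \<otimes> (x \<otimes> b) \<otimes> ?v" using g x vA that by (simp add: m_assoc)
      also have "\<dots> = (g \<otimes> b1) \<otimes> (x \<otimes> ?v)" using g x vA b1 by (simp add: m_assoc)
      also have "\<dots> = b2 \<otimes> (g \<otimes> x \<otimes> ?v)" using g x vA b1 b2 by (simp add: m_assoc)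
      also have "\<dots> = \<zero>" using kN[OF that(1)] that b2 by (simp add: kills_def)
      finally show ?thesis .
    qed
    have "kills (N + 2) g"
      unfolding kills_def
    proof (intro ballI)
      fix s l assume sl: "s \<in> I" "l \<in> Q"
      define W where "W s' i = g \<otimes> (f \<otimes> y s i \<otimes> (a s' i \<otimes> (f [^] N \<otimes> y s' l)))" for s' i
      have W0: "W s' i = \<zero>" if "s' \<in> I" "i \<in> Q" for s' i
      proof -
        have fy: "f \<otimes> y s i \<in> carrier A" using fA yA sl that by simp
        have aA: "a s' i \<in> carrier A" using aQ that by simp
        let ?u = "a s' i \<otimes> (f [^] N \<otimes> y s' l)"
        have u: "?u \<in> carrier A" using aA fA yA that sl by simp
        have "f \<otimes> y s i \<otimes> ?u = ev (f \<otimes> y s i) \<otimes> ?u \<oplus> od (f \<otimes> y s i) \<otimes> ?u"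
          using fy u by (simp add: l_distr[symmetric] ev_od)
        then have "W s' i = g \<otimes> (ev (f \<otimes> y s i) \<otimes> ?u) \<oplus> g \<otimes> (od (f \<otimes> y s i) \<otimes> ?u)"
          using g fy u by (simp add: W_def r_distr)
        then show ?thesis using gxa[OF Y0in(1)[OF sl(1) that(2)] aA that(1) sl(2)]
            gxa[OF Y0in(2)[OF sl(1) that(2)] aA that(1) sl(2)] by simp
      qed
      have aA: "a s' i \<in> carrier A" if "s' \<in> I" "i \<in> Q"  for s' i using aQ that by simp
      have "f [^] (N + 2) = f [^] N \<otimes> f \<otimes> f" using fA by (simp add: numeral_2_eq_2)
      then have "f [^] (N + 2) \<otimes> y s l = f [^] N \<otimes> f \<otimes> (f \<otimes> y s l)"
        using fA yA sl by (simp add: m_assoc)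
      also have "f \<otimes> y s l = (\<Oplus>s'\<in>I. (\<Oplus>i\<in>Q. y s i \<otimes> a s' i) \<otimes> y s' l)"
        by (rule key[OF sl])
      also have "\<dots> = (\<Oplus>s'\<in>I. \<Oplus>i\<in>Q. y s i \<otimes> a s' i \<otimes> y s' l)"
        using Q sl yA aA by (intro finsum_cong' finsum_ldistr) (auto intro!: finsum_closed)
      finally have "g \<otimes> (f [^] (N + 2) \<otimes> y s l) = g \<otimes> (f [^] N \<otimes> f) \<otimes> (\<Oplus>s'\<in>I. \<Oplus>i\<in>Q. y s i \<otimes> a s' i \<otimes> y s' l)"
        using g fA sl yA aA by (simp add: m_assoc finsum_closed)
      also have "\<dots> = (\<Oplus>s'\<in>I. g \<otimes> (f [^] N \<otimes> f) \<otimes> (\<Oplus>i\<in>Q. y s i \<otimes> a s' i \<otimes> y s' l))"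
        using g fA sl yA aA I by (intro finsum_rdistr) (auto intro!: finsum_closed)
      also have "\<dots> = (\<Oplus>s'\<in>I. \<Oplus>i\<in>Q. g \<otimes> (f [^] N \<otimes> f) \<otimes> (y s i \<otimes> a s' i \<otimes> y s' l))"
        using g fA sl yA aA I Q by (intro finsum_cong' finsum_rdistr) (auto intro!: finsum_closed)
      also have "\<dots> = (\<Oplus>s'\<in>I. \<Oplus>i\<in>Q. W s' i)"
      proof (intro finsum_cong')
        fix s' i assume si: "s' \<in> I" "i \<in> Q"
        have c: "f [^] N \<otimes> u = u \<otimes> f [^] N" if "u \<in> carrier A" for u by (rule fc[OF that])
        let ?q = "f \<otimes> y s i \<otimes> a s' i"
        have q: "?q \<in> carrier A" using fA sl yA aA si by simp
        have "g \<otimes> (f [^] N \<otimes> f) \<otimes> (y s i \<otimes> a s' i \<otimes> y s' l) = g \<otimes> ((f [^] N \<otimes> ?q) \<otimes> y s' l)"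
          using g fA sl yA aA si by (simp add: m_assoc)
        also have "f [^] N \<otimes> ?q = ?q \<otimes> f [^] N" by (rule c[OF q])
        also have "g \<otimes> (?q \<otimes> f [^] N \<otimes> y s' l) = W s' i"
          using g fA sl yA aA si by (simp add: m_assoc W_def)
        finally show "g \<otimes> (f [^] N \<otimes> f) \<otimes> (y s i \<otimes> a s' i \<otimes> y s' l) = W s' i" .
      qed (auto simp: W0 cong: finsum_cong)
      also have "\<dots> = (\<Oplus>s'\<in>I. \<Oplus>i\<in>Q. \<zero>)"
        by (intro finsum_cong') (auto simp: W0 cong: finsum_cong')
      also have "\<dots> = \<zero>" by (simp add: finsum_zero)
      finally show "g \<otimes> (f [^] (N + 2) \<otimes> y s l) = \<zero>" .
    qed
    then show ?thesis by (auto simp: vanishes_def)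
  qed
  have "vanishes \<one>"
  proof (rule ccontr)
    assume "\<not> vanishes \<one>"
    then obtain g where "homogeneous g" "\<not> vanishes g" "\<forall>x\<in>Y0. vanishes (g \<otimes> x)"
      using ex_max[OF Y0fin] Y0nil by blast
    then show False using step by blast
  qed
  then obtain n where kn: "kills n \<one>" unfolding vanishes_def by blast
  then have "\<one> \<otimes> (f [^] n \<otimes> y s l) = \<zero>" if "s \<in> I" "l \<in> Q" for s l
    using that unfolding kills_def by blast
  then have "\<forall>s\<in>I. \<forall>l\<in>Q. f [^] n \<otimes> y s l = \<zero>" using fA yA by simp
  then show ?thesis ..
qed

end

context coideal_comatrix begin

text \<open>
  Even elements of \<open>B\<close> that may be inverted without killing \<open>B\<close>.
\<close>

definition nonnil :: "'a \<Rightarrow> bool" where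
  "nonnil f \<longleftrightarrow> f \<in> B \<and> ev f = f \<and> (\<forall>n::nat. f [^] n \<noteq> \<zero>)"

text \<open>
  After inverting \<open>f\<close>, the set \<open>Q\<close> generates the same \<open>B\<close>-module as \<open>D\<close>.
\<close>

definition reduces :: "'a set \<Rightarrow> 'a \<Rightarrow> bool" where
  "reduces Q f \<longleftrightarrow> Q \<subseteq> D \<and> nonnil f \<and>
    (\<forall>j\<in>D. \<exists>c. (\<forall>l\<in>Q. c l \<in> B) \<and> f \<otimes> j = (\<Oplus>l\<in>Q. c l \<otimes> l))"

lemma reduces_D: "reduces D \<one>"
  unfolding reduces_def nonnil_def
proof (intro conjI ballI)
  fix j assume j: "j \<in> D"
  have "(\<Oplus>l\<in>D. (if j = l then \<one> else \<zero>) \<otimes> l) = (\<Oplus>l\<in>D. if j = l then l else \<zero>)"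
    by (intro finsum_cong') auto
  also have "\<dots> = \<one> \<otimes> j" using j by (subst finsum_delta) auto
  finally show "\<exists>c. (\<forall>l\<in>D. c l \<in> B) \<and> \<one> \<otimes> j = (\<Oplus>l\<in>D. c l \<otimes> l)"
    by (intro exI[of _ "\<lambda>l. if j = l then \<one> else \<zero>"]) auto
qed (auto simp: ev_F one_not_zero)

text \<open>
  Let \<open>w\<close> be the even part of \<open>z\<^sub>i\<close>. Multiplying the relation by the parity conjugate of \<open>z\<^sub>i\<close> makes
  its coefficient at \<open>i\<close> equal to \<open>w\<^sup>2\<close>, which is even. If \<open>f w\<close> is not nilpotent, then \<open>f w\<^sup>2\<close> may be
  inverted as well, and the relation expresses \<open>i\<close> by the other elements of \<open>Q\<close>.
\<close>

lemma reduces_step: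
  assumes red: "reduces Q f" and z: "\<And>l. l \<in> Q \<Longrightarrow> z l \<in> B" "(\<Oplus>l\<in>Q. z l \<otimes> l) = \<zero>"
    and i: "i \<in> Q" and nn: "\<And>n::nat. (f \<otimes> ev (z i)) [^] n \<noteq> \<zero>"
  shows "\<exists>g. reduces (Q - {i}) g"
proof -
  have QD: "Q \<subseteq> D" and f: "f \<in> B" "ev f = f" using red by (auto simp: reduces_def nonnil_def)
  have fA: "f \<in> carrier A" using f by simp
  have finQ: "finite Q" using QD finite_subset fin_D by blast
  have QA: "l \<in> carrier A" if "l \<in> Q" for l using that QD by auto
  define w where "w = ev (z i)"
  have zi: "z i \<in> B" by (rule z(1)[OF i])
  have w: "w \<in> B" "ev w = w" "w \<in> carrier A" using zi ev_B by (auto simp: w_def)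
  have ww: "w \<otimes> w \<in> B" "ev (w \<otimes> w) = w \<otimes> w" using w by (auto simp: ev_mult homogeneous_even)
  let ?g = "f \<otimes> (w \<otimes> w)"
  have "nonnil ?g"
    unfolding nonnil_def
  proof (intro conjI allI)
    show "?g \<in> B" using f w by auto
    show "ev ?g = ?g" using f w fA ww by (simp add: ev_mult homogeneous_even)
    fix n :: nat
    show "?g [^] n \<noteq> \<zero>"
    proof
      assume g0: "?g [^] n = \<zero>"
      have "(f \<otimes> w) [^] (n + n) = f [^] n \<otimes> w [^] n \<otimes> (f [^] n \<otimes> w [^] n)"
        using fA w f by (simp add: nat_pow_mult[symmetric] even_pow_distrib)
      also have "\<dots> = f [^] n \<otimes> (w [^] n \<otimes> f [^] n) \<otimes> w [^] n"
        using fA w by (simp add: m_assoc)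
      also have "w [^] n \<otimes> f [^] n = f [^] n \<otimes> w [^] n"
        using fA w f by (intro even_comm[symmetric]) (auto simp: even_pow)
      also have "f [^] n \<otimes> (f [^] n \<otimes> w [^] n) \<otimes> w [^] n = f [^] n \<otimes> (f [^] n \<otimes> (w [^] n \<otimes> w [^] n))"
        using fA w by (simp add: m_assoc)
      also have "f [^] n \<otimes> (w [^] n \<otimes> w [^] n) = ?g [^] n"
        using fA w f by (simp add: even_pow_distrib)
      finally show False using nn[of "n + n"] g0 fA by (simp add: w_def)
    qed
  qed
  moreover have "\<exists>c. (\<forall>l\<in>Q - {i}. c l \<in> B) \<and> ?g \<otimes> j = (\<Oplus>l\<in>Q - {i}. c l \<otimes> l)" if j: "j \<in> D" for j
  proof -
    obtain c where c: "\<And>l. l \<in> Q \<Longrightarrow> c l \<in> B" "f \<otimes> j = (\<Oplus>l\<in>Q. c l \<otimes> l)"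
      using red j unfolding reduces_def by blast
    have split: "(\<Oplus>l\<in>Q. h l) = h i \<oplus> (\<Oplus>l\<in>Q - {i}. h l)" if "\<And>l. l \<in> Q \<Longrightarrow> h l \<in> carrier A" for h
      using finsum_insert[of "Q - {i}" i h] finQ i that by (simp add: insert_absorb)
    define s where "s = (\<Oplus>l\<in>Q - {i}. z l \<otimes> l)"
    have sA: "s \<in> carrier A" using z QA by (auto simp: s_def intro!: finsum_closed)
    have "z i \<otimes> i \<oplus> s = \<zero>" using split[of "\<lambda>l. z l \<otimes> l"] z QA by (simp add: s_def)
    then have zis: "z i \<otimes> i = \<ominus> s" using sA zi QA[OF i] by (simp add: minus_equality)
    have wwi: "w \<otimes> w \<otimes> i = \<ominus> (th (z i) \<otimes> s)"
    proof -
      have "w \<otimes> w \<otimes> i = th (z i) \<otimes> (z i \<otimes> i)"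
        using zi QA[OF i] th_mult_self[of "z i"] by (simp add: w_def m_assoc[symmetric])
      then show ?thesis using zi sA by (simp add: zis r_minus)
    qed
    \<comment> \<open>Eliminates \<open>i\<close> from \<open>w\<^sup>2 f j\<close> by means of \<open>w\<^sup>2 i = - th(z\<^sub>i) s\<close>.\<close>
    define c' where "c' l = w \<otimes> w \<otimes> c l \<oplus> c i \<otimes> (\<ominus> (th (z i)) \<otimes> z l)" for l
    have c'B: "c' l \<in> B" if "l \<in> Q" for l using that c z w i zi by (auto simp: c'_def intro!: B_closed)
    have "?g \<otimes> j = w \<otimes> w \<otimes> (f \<otimes> j)"
      using fA w j even_comm[of f "w \<otimes> w"] f by (simp add: m_assoc)
    also have "\<dots> = w \<otimes> w \<otimes> (c i \<otimes> i \<oplus> (\<Oplus>l\<in>Q - {i}. c l \<otimes> l))"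
      using split[of "\<lambda>l. c l \<otimes> l"] c QA by simp
    also have "\<dots> = w \<otimes> w \<otimes> (c i \<otimes> i) \<oplus> w \<otimes> w \<otimes> (\<Oplus>l\<in>Q - {i}. c l \<otimes> l)"
      using w c QA i by (intro r_distr) (auto intro!: finsum_closed)
    also have "w \<otimes> w \<otimes> (c i \<otimes> i) = c i \<otimes> (w \<otimes> w \<otimes> i)"
    proof -
      have "w \<otimes> w \<otimes> (c i \<otimes> i) = (w \<otimes> w \<otimes> c i) \<otimes> i" using w c i QA by (simp add: m_assoc)
      also have "w \<otimes> w \<otimes> c i = c i \<otimes> (w \<otimes> w)" using even_comm[OF ww(2)] w c i by simp
      finally show ?thesis using w c i QA by (simp add: m_assoc)
    qed
    also have "\<dots> = c i \<otimes> (\<ominus> (th (z i)) \<otimes> s)" using sA zi by (simp add: wwi l_minus)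
    also have "\<dots> = (\<Oplus>l\<in>Q - {i}. c i \<otimes> (\<ominus> (th (z i)) \<otimes> z l) \<otimes> l)"
    proof -
      have "c i \<otimes> (\<ominus> (th (z i)) \<otimes> s) = c i \<otimes> (\<ominus> (th (z i))) \<otimes> s" using c i zi sA by (simp add: m_assoc)
      also have "\<dots> = (\<Oplus>l\<in>Q - {i}. c i \<otimes> (\<ominus> (th (z i))) \<otimes> (z l \<otimes> l))"
        unfolding s_def using finQ c i zi z QA by (intro finsum_rdistr) auto
      also have "\<dots> = (\<Oplus>l\<in>Q - {i}. c i \<otimes> (\<ominus> (th (z i)) \<otimes> z l) \<otimes> l)"
        using c i zi z QA by (intro finsum_cong') (auto simp: m_assoc)
      finally show ?thesis .
    qed
    also have "w \<otimes> w \<otimes> (\<Oplus>l\<in>Q - {i}. c l \<otimes> l) = (\<Oplus>l\<in>Q - {i}. w \<otimes> w \<otimes> c l \<otimes> l)"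
    proof -
      have "w \<otimes> w \<otimes> (\<Oplus>l\<in>Q - {i}. c l \<otimes> l) = (\<Oplus>l\<in>Q - {i}. w \<otimes> w \<otimes> (c l \<otimes> l))"
        using finQ c w QA by (intro finsum_rdistr) auto
      also have "\<dots> = (\<Oplus>l\<in>Q - {i}. w \<otimes> w \<otimes> c l \<otimes> l)"
        using c w QA by (intro finsum_cong') (auto simp: m_assoc)
      finally show ?thesis .
    qed
    also have "(\<Oplus>l\<in>Q - {i}. c i \<otimes> (\<ominus> (th (z i)) \<otimes> z l) \<otimes> l) \<oplus> (\<Oplus>l\<in>Q - {i}. w \<otimes> w \<otimes> c l \<otimes> l)
        = (\<Oplus>l\<in>Q - {i}. c i \<otimes> (\<ominus> (th (z i)) \<otimes> z l) \<otimes> l \<oplus> w \<otimes> w \<otimes> c l \<otimes> l)"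
      using c i zi z w QA by (intro finsum_addf[symmetric]) auto
    also have "\<dots> = (\<Oplus>l\<in>Q - {i}. c' l \<otimes> l)"
      using c i zi z w QA by (intro finsum_cong') (auto simp: c'_def l_distr a_comm)
    finally show ?thesis using c'B by blast
  qed
  ultimately show ?thesis using QD unfolding reduces_def by blast
qed

lemma ex_minimal_reduction:
  "\<exists>Q f. reduces Q f \<and>
    (\<forall>z. (\<forall>l\<in>Q. z l \<in> B) \<longrightarrow> (\<Oplus>l\<in>Q. z l \<otimes> l) = \<zero> \<longrightarrow> (\<forall>i\<in>Q. \<exists>n::nat. (f \<otimes> ev (z i)) [^] n = \<zero>))"
proof -
  define P where "P Q \<longleftrightarrow> (\<exists>f. reduces Q f)" for Q
  have "P D" using reduces_D by (auto simp: P_def)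
  then obtain Q where Q: "P Q" and min: "\<And>Q'. P Q' \<Longrightarrow> card Q \<le> card Q'"
    using ex_has_least_nat[of P D card] by blast
  then obtain f where f: "reduces Q f" by (auto simp: P_def)
  have finQ: "finite Q" using f finite_subset[OF _ fin_D] by (auto simp: reduces_def)
  have "\<exists>n::nat. (f \<otimes> ev (z i)) [^] n = \<zero>"
    if "\<And>l. l \<in> Q \<Longrightarrow> z l \<in> B" "(\<Oplus>l\<in>Q. z l \<otimes> l) = \<zero>" "i \<in> Q" for z i
  proof (rule ccontr)
    assume "\<not> ?thesis"
    then have "\<And>n::nat. (f \<otimes> ev (z i)) [^] n \<noteq> \<zero>" by auto
    from reduces_step[OF f that this] have "P (Q - {i})" by (simp add: P_def)
    from min[OF this] that(3) finQ show False by (metis card_Diff1_less not_le)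
  qed
  then show ?thesis using f by blast
qed

text \<open>
  Let \<open>Q\<close> and \<open>f\<close> be a minimal reduction and \<open>f j = (\<Sum>l\<in>Q. c\<^sub>j\<^sub>l l)\<close>. For \<open>z \<in> Z\<close>, the vector
  \<open>zc z = z c\<close> is a relation between the elements of \<open>Q\<close>, so its coefficients are nilpotent up to
  \<open>f\<close>. Splitting \<open>z c\<close>, extended by zero to \<open>D\<close>, with \<open>relations_split\<close> and multiplying by \<open>c\<close>
  gives a system to which \<open>nilpotent_system_vanishes\<close> applies. So a power \<open>h\<close> of \<open>f\<close> satisfies
  \<open>h (z c) = 0\<close> for all \<open>z \<in> Z\<close>, and \<open>F0 = h f\<close>, \<open>C = h c\<close> are as required.
\<close>

lemma ex_generic_coordinates:
  "\<exists>Q F0 C. finite Q \<and> Q \<subseteq> D \<and> F0 \<in> B \<and> ev F0 = F0 \<and> F0 \<noteq> \<zero> \<and>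
    (\<forall>j\<in>D. \<forall>l\<in>Q. C j l \<in> B) \<and> (\<forall>j\<in>D. F0 \<otimes> j = (\<Oplus>l\<in>Q. C j l \<otimes> l)) \<and>
    (\<forall>z\<in>Z. \<forall>l\<in>Q. (\<Oplus>j\<in>D. z j \<otimes> C j l) = \<zero>)"
proof -
  obtain Q f where red: "reduces Q f" and nil: "\<And>z i. \<lbrakk>\<And>l. l \<in> Q \<Longrightarrow> z l \<in> B; (\<Oplus>l\<in>Q. z l \<otimes> l) = \<zero>; i \<in> Q\<rbrakk> \<Longrightarrow>
     \<exists>n::nat. (f \<otimes> ev (z i)) [^] n = \<zero>"
    using ex_minimal_reduction by auto
  have QD: "Q \<subseteq> D" and f: "f \<in> B" "ev f = f" and fnn: "\<And>n::nat. f [^] n \<noteq> \<zero>"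
    using red by (auto simp: reduces_def nonnil_def)
  have fA: "f \<in> carrier A" using f by simp
  have finQ: "finite Q" using QD finite_subset fin_D by blast
  have QA: "l \<in> carrier A" if "l \<in> Q" for l using that QD by auto
  have fc: "f [^] n \<otimes> x = x \<otimes> f [^] n" if "x \<in> carrier A" for x and n :: nat
    using that fA f by (intro even_comm) (auto simp: even_pow)
  have "\<exists>c. \<forall>j\<in>D. (\<forall>l\<in>Q. c j l \<in> B) \<and> f \<otimes> j = (\<Oplus>l\<in>Q. c j l \<otimes> l) \<and>
      (j \<in> Q \<longrightarrow> (\<forall>l\<in>Q. c j l = (if j = l then f else \<zero>)))"
  proof (rule bchoice, rule ballI)
    fix j assume j: "j \<in> D"
    show "\<exists>c. (\<forall>l\<in>Q. c l \<in> B) \<and> f \<otimes> j = (\<Oplus>l\<in>Q. c l \<otimes> l) \<and>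
      (j \<in> Q \<longrightarrow> (\<forall>l\<in>Q. c l = (if j = l then f else \<zero>)))"
    proof (cases "j \<in> Q")
      case True
      have "(\<Oplus>l\<in>Q. (if j = l then f else \<zero>) \<otimes> l) = (\<Oplus>l\<in>Q. if j = l then f \<otimes> l else \<zero>)"
        using QA fA by (intro finsum_cong') auto
      also have "\<dots> = f \<otimes> j" using True finQ QA fA by (subst finsum_delta) auto
      finally show ?thesis using f by (intro exI[of _ "\<lambda>l. if j = l then f else \<zero>"]) auto
    next
      case False
      then show ?thesis using red j unfolding reduces_def by blast
    qed
  qed
  then obtain c where cB: "\<And>j l. \<lbrakk>j \<in> D; l \<in> Q\<rbrakk> \<Longrightarrow> c j l \<in> B"
    and fj: "\<And>j. j \<in> D \<Longrightarrow> f \<otimes> j = (\<Oplus>l\<in>Q. c j l \<otimes> l)"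
    and cQ: "\<And>j l. \<lbrakk>j \<in> Q; l \<in> Q\<rbrakk> \<Longrightarrow> c j l = (if j = l then f else \<zero>)" using QD by blast
  have cA: "c j l \<in> carrier A" if "j \<in> D" "l \<in> Q" for j l using cB that by simp
  define zc where "zc z l = (\<Oplus>j\<in>D. z j \<otimes> c j l)" for z l
  \<comment> \<open>The relation \<open>z c\<close> between the elements of \<open>Q\<close>, extended by zero to \<open>D\<close>.\<close>
  define zx where "zx z d = (if d \<in> Q then zc z d else \<zero>)" for z d
  have zcB: "zc z l \<in> B" if "z \<in> Z" "l \<in> Q" for z l
    unfolding zc_def using that cB Z_B by (intro finsum_B B_closed) auto
  have zcA: "zc z l \<in> carrier A" if "z \<in> Z" "l \<in> Q" for z l using zcB[OF that] by simp
  have zc_rel: "(\<Oplus>l\<in>Q. zc z l \<otimes> l) = \<zero>" if z: "z \<in> Z" for z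
  proof -
    have "(\<Oplus>l\<in>Q. zc z l \<otimes> l) = (\<Oplus>j\<in>D. z j \<otimes> (\<Oplus>l\<in>Q. c j l \<otimes> l))"
      unfolding zc_def using z finQ cA QA by (intro vec_mat_assoc) (auto simp: Z_carr)
    also have "\<dots> = (\<Oplus>j\<in>D. f \<otimes> (z j \<otimes> j))"
    proof (rule finsum_cong')
      fix j assume j: "j \<in> D"
      have "z j \<otimes> (f \<otimes> j) = f \<otimes> (z j \<otimes> j)"
        using fc[of "z j" 1] z j fA by (simp add: Z_carr m_assoc[symmetric])
      then show "z j \<otimes> (\<Oplus>l\<in>Q. c j l \<otimes> l) = f \<otimes> (z j \<otimes> j)" using fj[OF j] by simp
    qed (use z fA in \<open>auto simp: Z_carr\<close>)
    also have "\<dots> = f \<otimes> (\<Oplus>j\<in>D. z j \<otimes> j)"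
      using z fA by (intro finsum_rdistr[symmetric]) (auto simp: Z_carr)
    finally show ?thesis using z fA by (simp add: Z_sum)
  qed
  have zxZ: "zx z \<in> Z" if z: "z \<in> Z" for z
  proof -
    have "(\<Oplus>d\<in>D. zx z d \<otimes> d) = (\<Oplus>d\<in>Q. zx z d \<otimes> d)"
      using QD zcA[OF z] by (intro add.finprod_mono_neutral_cong_right) (auto simp: zx_def)
    also have "\<dots> = (\<Oplus>l\<in>Q. zc z l \<otimes> l)"
      using zcA[OF z] QA by (intro finsum_cong') (auto simp: zx_def)
    finally show ?thesis using zc_rel[OF z] zcB[OF z] by (auto simp: Z_def zx_def)
  qed
  \<comment> \<open>On \<open>Q\<close> the matrix \<open>c\<close> is \<open>f\<close> times the identity, by the choice of \<open>c\<close>.\<close>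
  have zc_zx: "zc (zx z) l = f \<otimes> zc z l" if z: "z \<in> Z" and l: "l \<in> Q" for z l
  proof -
    have "zc (zx z) l = (\<Oplus>j\<in>D. if l = j then zc z j \<otimes> f else \<zero>)"
      unfolding zc_def[of "zx z"]
      using z l cQ cA zcA[OF z] fA by (intro finsum_cong') (auto simp: zx_def)
    also have "\<dots> = (\<Oplus>j\<in>Q. if l = j then zc z j \<otimes> f else \<zero>)"
      using QD zcA[OF z] fA l by (intro add.finprod_mono_neutral_cong_right) auto
    also have "\<dots> = zc z l \<otimes> f" using finQ l zcA[OF z] fA by (intro finsum_delta) auto
    finally show ?thesis using fc[of "zc z l" 1] zcA[OF z l] fA by simp
  qed
  obtain I :: "('a \<times> 'a) set" and zs a where W: "finite I \<and> (\<forall>s\<in>I. zs s \<in> Z) \<and> (\<forall>s\<in>I. \<forall>i\<in>D. a s i \<in> carrier A) \<and>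
    (\<forall>z\<in>Z. \<forall>k\<in>D. z k = (\<Oplus>s\<in>I. (\<Oplus>i\<in>D. z i \<otimes> a s i) \<otimes> zs s k))"
    using relations_split by (elim exE)
  note I = W[THEN conjunct1] W[THEN conjunct2, THEN conjunct1, rule_format]
    W[THEN conjunct2, THEN conjunct2, THEN conjunct1, rule_format]
    W[THEN conjunct2, THEN conjunct2, THEN conjunct2, rule_format]
  note I3 = I(1-3)
  have aQ: "a s i \<in> carrier A" if "s \<in> I" "i \<in> Q" for s i
    using I(3)[OF that(1)] that(2) QD by blast
  define y where "y s l = zc (zs s) l" for s l
  have yA: "y s l \<in> carrier A" if "s \<in> I" "l \<in> Q" for s l using zcA I3 that by (simp add: y_def)
  have key: "f \<otimes> zc z l = (\<Oplus>s\<in>I. (\<Oplus>i\<in>Q. zc z i \<otimes> a s i) \<otimes> y s l)" if z: "z \<in> Z" and l: "l \<in> Q" for z l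
  proof -
    have zxA: "zx z i \<in> carrier A" if "i \<in> D" for i using Z_carr[OF zxZ[OF z] that] .
    have "f \<otimes> zc z l = (\<Oplus>k\<in>D. (\<Oplus>s\<in>I. (\<Oplus>i\<in>D. zx z i \<otimes> a s i) \<otimes> zs s k) \<otimes> c k l)"
      unfolding zc_zx[OF z l, symmetric] zc_def[of "zx z"]
      using I(4)[OF zxZ[OF z]] zxA cA l by (intro finsum_cong') (auto simp: I(4)[OF zxZ[OF z], symmetric])
    also have "\<dots> = (\<Oplus>s\<in>I. (\<Oplus>i\<in>D. zx z i \<otimes> a s i) \<otimes> (\<Oplus>k\<in>D. zs s k \<otimes> c k l))"
      using I3 zxA cA l by (intro vec_mat_assoc) (auto simp: Z_carr intro!: finsum_closed)
    also have "\<dots> = (\<Oplus>s\<in>I. (\<Oplus>i\<in>Q. zc z i \<otimes> a s i) \<otimes> y s l)"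
    proof (rule finsum_cong')
      fix s assume s: "s \<in> I"
      have "(\<Oplus>i\<in>D. zx z i \<otimes> a s i) = (\<Oplus>i\<in>Q. zx z i \<otimes> a s i)"
        using QD zcA[OF z] I(3)[OF s] by (intro add.finprod_mono_neutral_cong_right) (auto simp: zx_def)
      also have "\<dots> = (\<Oplus>i\<in>Q. zc z i \<otimes> a s i)"
        using QD zcA[OF z] aQ[OF s] by (intro finsum_cong') (auto simp: zx_def)
      finally show "(\<Oplus>i\<in>D. zx z i \<otimes> a s i) \<otimes> (\<Oplus>k\<in>D. zs s k \<otimes> c k l) = (\<Oplus>i\<in>Q. zc z i \<otimes> a s i) \<otimes> y s l"
        by (simp add: y_def zc_def)
    next
      show "(\<lambda>s. (\<Oplus>i\<in>Q. zc z i \<otimes> a s i) \<otimes> y s l) \<in> I \<rightarrow> carrier A"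
        using zcA[OF z] aQ l yA by (intro Pi_I m_closed finsum_closed) auto
    qed simp
    finally show ?thesis .
  qed
  have "\<exists>n::nat. \<forall>s\<in>I. \<forall>l\<in>Q. f [^] n \<otimes> y s l = \<zero>"
  proof (rule nilpotent_system_vanishes[OF I(1) finQ fA f(2) yA aQ])
    show "f \<otimes> y s l = (\<Oplus>s'\<in>I. (\<Oplus>i\<in>Q. y s i \<otimes> a s' i) \<otimes> y s' l)" if "s \<in> I" "l \<in> Q" for s l
      using key[of "zs s" l] I3 that by (simp add: y_def)
    show "\<exists>n::nat. (f \<otimes> ev (y s i)) [^] n = \<zero>" if "s \<in> I" "i \<in> Q" for s i
      unfolding y_def using that I3 zcB zc_rel by (intro nil) auto
  qed
  then obtain n :: nat where n: "\<And>s l. \<lbrakk>s \<in> I; l \<in> Q\<rbrakk> \<Longrightarrow> f [^] n \<otimes> y s l = \<zero>" by blast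
  have vanish: "f [^] (Suc n) \<otimes> zc z l = \<zero>" if z: "z \<in> Z" and l: "l \<in> Q" for z l
  proof -
    have bA: "(\<Oplus>i\<in>Q. zc z i \<otimes> a s i) \<in> carrier A" if "s \<in> I" for s
      using zcA[OF z] aQ[OF that] by (intro finsum_closed) auto
    have "f [^] (Suc n) \<otimes> zc z l = f [^] n \<otimes> (f \<otimes> zc z l)" using fA zcA[OF z l] by (simp add: m_assoc)
    also have "\<dots> = (\<Oplus>s\<in>I. f [^] n \<otimes> ((\<Oplus>i\<in>Q. zc z i \<otimes> a s i) \<otimes> y s l))"
      unfolding key[OF z l] using I3 bA yA l fA by (intro finsum_rdistr) auto
    also have "\<dots> = (\<Oplus>s\<in>I. \<zero>)"
    proof (rule finsum_cong')
      fix s assume s: "s \<in> I"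
      let ?b = "\<Oplus>i\<in>Q. zc z i \<otimes> a s i"
      have "f [^] n \<otimes> (?b \<otimes> y s l) = ?b \<otimes> f [^] n \<otimes> y s l"
        using fc[OF bA[OF s], of n] bA[OF s] yA s l fA by (simp add: m_assoc[symmetric])
      then show "f [^] n \<otimes> (?b \<otimes> y s l) = \<zero>" using bA[OF s] yA s l fA n[OF s l] by (simp add: m_assoc)
    qed auto
    finally show ?thesis by (simp add: finsum_zero)
  qed
  define h where "h = f [^] (Suc n)"
  have h: "h \<in> B" "h \<in> carrier A" using f B_pow[of f "Suc n"] by (simp_all add: h_def del: nat_pow_Suc)
  show ?thesis
  proof (intro exI conjI ballI)
    show "finite Q" "Q \<subseteq> D" by fact+
    show "h \<otimes> f \<in> B" using h f by auto
    have "h \<otimes> f = f [^] (Suc (Suc n))" by (simp add: h_def)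
    then show "ev (h \<otimes> f) = h \<otimes> f" "h \<otimes> f \<noteq> \<zero>"
      using even_pow[of f "Suc (Suc n)"] f fA fnn[of "Suc (Suc n)"] by simp_all
    show "h \<otimes> c j l \<in> B" if "j \<in> D" "l \<in> Q" for j l using h cB that by auto
    show "h \<otimes> f \<otimes> j = (\<Oplus>l\<in>Q. h \<otimes> c j l \<otimes> l)" if j: "j \<in> D" for j
    proof -
      have "h \<otimes> f \<otimes> j = h \<otimes> (\<Oplus>l\<in>Q. c j l \<otimes> l)" using h fA j fj[OF j] by (simp add: m_assoc)
      also have "\<dots> = (\<Oplus>l\<in>Q. h \<otimes> (c j l \<otimes> l))" using finQ h j cA QA by (intro finsum_rdistr) auto
      also have "\<dots> = (\<Oplus>l\<in>Q. h \<otimes> c j l \<otimes> l)" using h j cA QA by (intro finsum_cong') (auto simp: m_assoc)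
      finally show ?thesis .
    qed
    show "(\<Oplus>j\<in>D. z j \<otimes> (h \<otimes> c j l)) = \<zero>" if z: "z \<in> Z" and l: "l \<in> Q" for z l
    proof -
      have "(\<Oplus>j\<in>D. z j \<otimes> (h \<otimes> c j l)) = (\<Oplus>j\<in>D. h \<otimes> (z j \<otimes> c j l))"
      proof (rule finsum_cong')
        fix j assume j: "j \<in> D"
        have "z j \<otimes> h = h \<otimes> z j" using fc[of "z j" "Suc n"] z j by (simp add: h_def Z_carr del: nat_pow_Suc)
        then show "z j \<otimes> (h \<otimes> c j l) = h \<otimes> (z j \<otimes> c j l)"
          using h z j l cA by (simp add: Z_carr m_assoc[symmetric])
      qed (use h z l cA in \<open>auto simp: Z_carr\<close>)
      also have "\<dots> = h \<otimes> zc z l"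
        unfolding zc_def using h z l cA by (intro finsum_rdistr[symmetric]) (auto simp: Z_carr)
      finally show ?thesis using vanish[OF z l] by (simp add: h_def del: nat_pow_Suc)
    qed
  qed
qed

end

context super_hopf_coideal begin


section \<open>Translation\<close>

text \<open>
  The maps \<open>\<Phi>(x \<otimes> y) = (x \<otimes> 1) dl(y)\<close> and \<open>G(x \<otimes> y) = (x \<otimes> 1) (S \<otimes> id)(dl y)\<close> are mutually
  inverse, and \<open>\<Phi>\<close> turns right multiplication by \<open>1 \<otimes> y\<close> into right multiplication by \<open>dl y\<close>. Both
  compositions are computed on a subcomodule containing \<open>y\<close>, where they amount to
  \<open>\<tau> S(\<tau>) = 1\<close> and \<open>S(\<tau>) \<tau> = 1\<close>.
\<close>

lemma ex_shear:
  "\<exists>G \<Phi>. G \<in> Hom R R \<and> \<Phi> \<in> Hom R R \<and> (\<forall>r\<in>RB. G r \<in> RB) \<and>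
    (\<forall>r\<in>carrier R. \<Phi> (G r) = r) \<and>
    (\<forall>r\<in>carrier R. \<forall>y\<in>carrier A. G (r \<otimes>\<^bsub>R\<^esub> dl y) = G r \<otimes>\<^bsub>R\<^esub> rt y)"
proof -
  obtain K where K: "K \<in> Hom R R" "\<And>x y. \<lbrakk>x \<in> carrier A; y \<in> carrier A\<rbrakk> \<Longrightarrow> K (t x y) = t (S x) y"
    using lift_t_l[OF S_Hom S_lin] by blast
  note Kc = Hom_closed[OF K(1)] and Ka = Hom_add[OF K(1)]
  have KF: "K (lf c \<otimes>\<^bsub>R\<^esub> r) = lf c \<otimes>\<^bsub>R\<^esub> K r" if c: "c \<in> F" and r: "r \<in> carrier R" for c r
    using r
  proof (induction rule: R_induct)
    case (pure a b)
    then show ?case using c by (simp add: lf_t K S_lin)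
  next
    case (add u v)
    then show ?case using c by (simp add: R.r_distr Ka Kc)
  qed
  have "\<exists>G\<in>Hom R R. \<forall>x\<in>carrier A. \<forall>y\<in>carrier A. G (t x y) = lf x \<otimes>\<^bsub>R\<^esub> K (dl y)"
  proof (rule lift_R)
    fix c x y assume *: "c \<in> F" "x \<in> carrier A" "y \<in> carrier A"
    then show "lf (c \<otimes> x) \<otimes>\<^bsub>R\<^esub> K (dl y) = lf x \<otimes>\<^bsub>R\<^esub> K (dl (c \<otimes> y))"
      using F_central[of c x] lf_mult[of x c] by (simp add: dl_lin KF Kc R.m_assoc)
  qed (simp_all add: Kc Ka lf_add R.l_distr R.r_distr)
  then obtain G where G: "G \<in> Hom R R" "\<And>x y. \<lbrakk>x \<in> carrier A; y \<in> carrier A\<rbrakk> \<Longrightarrow> G (t x y) = lf x \<otimes>\<^bsub>R\<^esub> K (dl y)"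
    by blast
  note Gc = Hom_closed[OF G(1)] and Ga = Hom_add[OF G(1)]
  have "\<exists>\<Phi>\<in>Hom R R. \<forall>x\<in>carrier A. \<forall>y\<in>carrier A. \<Phi> (t x y) = lf x \<otimes>\<^bsub>R\<^esub> dl y"
  proof (rule lift_R)
    fix c x y assume *: "c \<in> F" "x \<in> carrier A" "y \<in> carrier A"
    then show "lf (c \<otimes> x) \<otimes>\<^bsub>R\<^esub> dl y = lf x \<otimes>\<^bsub>R\<^esub> dl (c \<otimes> y)"
      using F_central[of c x] lf_mult[of x c] by (simp add: dl_lin R.m_assoc)
  qed (simp_all add: lf_add R.l_distr R.r_distr)
  then obtain \<Phi> where \<Phi>: "\<Phi> \<in> Hom R R" "\<And>x y. \<lbrakk>x \<in> carrier A; y \<in> carrier A\<rbrakk> \<Longrightarrow> \<Phi> (t x y) = lf x \<otimes>\<^bsub>R\<^esub> dl y"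
    by blast
  note \<Phi>c = Hom_closed[OF \<Phi>(1)] and \<Phi>a = Hom_add[OF \<Phi>(1)]
  have Glf: "G (lf x \<otimes>\<^bsub>R\<^esub> r) = lf x \<otimes>\<^bsub>R\<^esub> G r" if x: "x \<in> carrier A" and r: "r \<in> carrier R" for x r
    using r
  proof (induction rule: R_induct)
    case (pure a b)
    then have "G (lf x \<otimes>\<^bsub>R\<^esub> t a b) = lf (x \<otimes> a) \<otimes>\<^bsub>R\<^esub> K (dl b)" using x by (simp add: lf_t G)
    then show ?case
      using R.m_assoc[of "lf x" "lf a" "K (dl b)"] lf_mult[of x a] pure x Kc[of "dl b"] by (simp add: G)
  next
    case (add u v)
    then show ?case using x by (simp add: R.r_distr Ga Gc)
  qed
  have \<Phi>lf: "\<Phi> (lf x \<otimes>\<^bsub>R\<^esub> r) = lf x \<otimes>\<^bsub>R\<^esub> \<Phi> r" if x: "x \<in> carrier A" and r: "r \<in> carrier R" for x r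
    using r
  proof (induction rule: R_induct)
    case (pure a b)
    then have "\<Phi> (lf x \<otimes>\<^bsub>R\<^esub> t a b) = lf (x \<otimes> a) \<otimes>\<^bsub>R\<^esub> dl b" using x by (simp add: lf_t \<Phi>)
    then show ?case
      using R.m_assoc[of "lf x" "lf a" "dl b"] lf_mult[of x a] pure x by (simp add: \<Phi>)
  next
    case (add u v)
    then show ?case using x by (simp add: R.r_distr \<Phi>a \<Phi>c)
  qed
  have main: "G (dl y) = rt y \<and> \<Phi> (K (dl y)) = rt y" if y: "y \<in> carrier A" for y
  proof -
    obtain D \<tau> \<phi> where D: "dual D \<phi>" "comatrix D \<tau>" "spans D \<phi> y"
      using ex_comatrix[of "{y}"] y by auto
    note d = dualD[OF D(1)] and cm = comatrixD[OF D(2)]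
    have Kdl: "K (dl k) = (\<Oplus>\<^bsub>R\<^esub>l\<in>D. t (S (\<tau> k l)) l)" if k: "k \<in> D" for k
    proof -
      have "K (dl k) = (\<Oplus>\<^bsub>R\<^esub>l\<in>D. K (t (\<tau> k l) l))"
        unfolding cm(4)[OF k] using cm k by (intro Hom_finsum[OF abR abR K(1)]) auto
      also have "\<dots> = (\<Oplus>\<^bsub>R\<^esub>l\<in>D. t (S (\<tau> k l)) l)"
        using cm k by (intro R.finsum_cong') (auto simp: K)
      finally show ?thesis .
    qed
    have 1: "G (dl k) = rt k" if k: "k \<in> D" for k
    proof -
      have "G (dl k) = (\<Oplus>\<^bsub>R\<^esub>l\<in>D. G (t (\<tau> k l) l))"
        unfolding cm(4)[OF k] using cm k by (intro Hom_finsum[OF abR abR G(1)]) auto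
      also have "\<dots> = (\<Oplus>\<^bsub>R\<^esub>l\<in>D. \<Oplus>\<^bsub>R\<^esub>m\<in>D. t (\<tau> k l \<otimes> S (\<tau> l m)) m)"
      proof (rule R.finsum_cong')
        fix l assume l: "l \<in> D"
        have "G (t (\<tau> k l) l) = lf (\<tau> k l) \<otimes>\<^bsub>R\<^esub> (\<Oplus>\<^bsub>R\<^esub>m\<in>D. t (S (\<tau> l m)) m)"
          using k l cm(1-3) by (simp add: G Kdl)
        also have "\<dots> = (\<Oplus>\<^bsub>R\<^esub>m\<in>D. lf (\<tau> k l) \<otimes>\<^bsub>R\<^esub> t (S (\<tau> l m)) m)"
          using k l cm(1-3) by (intro R.finsum_rdistr) auto
        also have "\<dots> = (\<Oplus>\<^bsub>R\<^esub>m\<in>D. t (\<tau> k l \<otimes> S (\<tau> l m)) m)"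
          using k l cm(1-3) by (intro R.finsum_cong') (auto simp: lf_t)
        finally show "G (t (\<tau> k l) l) = (\<Oplus>\<^bsub>R\<^esub>m\<in>D. t (\<tau> k l \<otimes> S (\<tau> l m)) m)" .
      qed (use k cm(1-3) in \<open>auto intro!: R.finsum_closed\<close>)
      also have "\<dots> = (\<Oplus>\<^bsub>R\<^esub>m\<in>D. \<Oplus>\<^bsub>R\<^esub>l\<in>D. t (\<tau> k l \<otimes> S (\<tau> l m)) m)"
        using k cm(1-3) by (intro R.finsum_swap) auto
      also have "\<dots> = (\<Oplus>\<^bsub>R\<^esub>m\<in>D. if k = m then rt m else \<zero>\<^bsub>R\<^esub>)"
      proof (rule R.finsum_cong')
        fix m assume m: "m \<in> D"
        have "(\<Oplus>\<^bsub>R\<^esub>l\<in>D. t (\<tau> k l \<otimes> S (\<tau> l m)) m) = t (\<Oplus>l\<in>D. \<tau> k l \<otimes> S (\<tau> l m)) m"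
          using k m cm(1-3) by (intro t_sum_l[symmetric]) auto
        then show "(\<Oplus>\<^bsub>R\<^esub>l\<in>D. t (\<tau> k l \<otimes> S (\<tau> l m)) m) = (if k = m then rt m else \<zero>\<^bsub>R\<^esub>)"
          using comatrix_inverse(2)[OF D(2) k m] cm(2)[OF m] by simp
      qed (use cm(1-3) in auto)
      also have "\<dots> = rt k" using k cm(1-3) by (intro R.finsum_delta) auto
      finally show ?thesis .
    qed
    have 2: "\<Phi> (K (dl k)) = rt k" if k: "k \<in> D" for k
    proof -
      have "\<Phi> (K (dl k)) = (\<Oplus>\<^bsub>R\<^esub>l\<in>D. \<Phi> (t (S (\<tau> k l)) l))"
        unfolding Kdl[OF k] using cm(1-3) k by (intro Hom_finsum[OF abR abR \<Phi>(1)]) auto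
      also have "\<dots> = (\<Oplus>\<^bsub>R\<^esub>l\<in>D. lf (S (\<tau> k l)) \<otimes>\<^bsub>R\<^esub> dl l)"
        using cm(1-3) k by (intro R.finsum_cong') (auto simp: \<Phi>)
      finally show ?thesis using comatrix_rt[OF D(2) k] by simp
    qed
    have ext: "h y = rt y" if h: "h \<in> Hom A R" and hF: "\<And>c x. \<lbrakk>c \<in> F; x \<in> carrier A\<rbrakk> \<Longrightarrow> h (c \<otimes> x) = lf c \<otimes>\<^bsub>R\<^esub> h x"
      and hD: "\<And>k. k \<in> D \<Longrightarrow> h k = rt k" for h
    proof -
      have "h y = h (\<Oplus>k\<in>D. \<phi> k y \<otimes> k)" using D(3) by (simp add: spans_def)
      also have "\<dots> = (\<Oplus>\<^bsub>R\<^esub>k\<in>D. h (\<phi> k y \<otimes> k))"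
        using d y by (intro Hom_finsum[OF abA abR h]) auto
      also have "\<dots> = (\<Oplus>\<^bsub>R\<^esub>k\<in>D. rt (\<phi> k y \<otimes> k))"
      proof (rule R.finsum_cong')
        fix k assume k: "k \<in> D"
        have "t (\<phi> k y) k = rt (\<phi> k y \<otimes> k)" using t_bal[of "\<phi> k y" \<one> k] k d y by simp
        then show "h (\<phi> k y \<otimes> k) = rt (\<phi> k y \<otimes> k)" using k d y by (simp add: hF hD lf_rt)
      qed (use d y in auto)
      also have "\<dots> = rt (\<Oplus>k\<in>D. \<phi> k y \<otimes> k)"
        using d y by (intro t_sum_r[symmetric]) auto
      finally show ?thesis using D(3) by (simp add: spans_def)
    qed
    show ?thesis
    proof
      show "G (dl y) = rt y"
        by (rule ext[OF Hom_comp[OF dl_Hom G(1)]]) (simp_all add: dl_lin Glf 1)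
      show "\<Phi> (K (dl y)) = rt y"
        by (rule ext[OF Hom_comp[OF Hom_comp[OF dl_Hom K(1)] \<Phi>(1)]]) (simp_all add: dl_lin KF \<Phi>lf Kc 2)
    qed
  qed
  have \<Phi>G: "\<Phi> (G r) = r" if "r \<in> carrier R" for r
  proof (rule Hom_R_eqI[OF Hom_comp[OF G(1) \<Phi>(1)] _ that])
    show "(\<lambda>r. r) \<in> Hom R R" by (simp add: hom_def)
    show "\<Phi> (G (t x y)) = t x y" if "x \<in> carrier A" "y \<in> carrier A" for x y
      using that main[of y] by (simp add: G \<Phi>lf Kc lf_rt)
  qed
  have G\<Phi>: "G (\<Phi> r \<otimes>\<^bsub>R\<^esub> dl y) = r \<otimes>\<^bsub>R\<^esub> rt y" if "r \<in> carrier R" "y \<in> carrier A" for r y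
  proof (rule Hom_R_eqI[OF Hom_comp[OF Hom_comp[OF \<Phi>(1) R_finsum_mult_Hom(2)] G(1)] R_finsum_mult_Hom(2) that(1)])
    show "dl y \<in> carrier R" "rt y \<in> carrier R" using that by auto
    show "G (\<Phi> (t x u) \<otimes>\<^bsub>R\<^esub> dl y) = t x u \<otimes>\<^bsub>R\<^esub> rt y" if "x \<in> carrier A" "u \<in> carrier A" for x u
    proof -
      have "\<Phi> (t x u) \<otimes>\<^bsub>R\<^esub> dl y = lf x \<otimes>\<^bsub>R\<^esub> dl (u \<otimes> y)"
        using that \<open>y \<in> carrier A\<close> by (simp add: \<Phi> dl_mult R.m_assoc)
      then show ?thesis using that \<open>y \<in> carrier A\<close> main[of "u \<otimes> y"] by (simp add: Glf t_rt lf_rt)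
    qed
  qed
  have "G (r \<otimes>\<^bsub>R\<^esub> dl y) = G r \<otimes>\<^bsub>R\<^esub> rt y" if "r \<in> carrier R" "y \<in> carrier A" for r y
    using G\<Phi>[of "G r" y] \<Phi>G[of r] that Gc by simp
  moreover have "G r \<in> RB" if "r \<in> RB" for r
  proof -
    have KRB: "K r \<in> RB" if "r \<in> RB" for r
      using that by (induction rule: RB.induct) (auto simp: K Ka RB_R intro: RB.intros)
    show ?thesis
      using that by (induction rule: RB.induct) (auto simp: G Ga RB_R KRB RB_dl intro!: RB_lf_l intro: RB_add)
  qed
  ultimately show ?thesis using G(1) \<Phi>(1) \<Phi>G by blast
qed

end

context coideal_comatrix begin

text \<open>
  Vectors annihilating \<open>Z\<close> on the right, that is, linear forms on the \<open>B\<close>-module generated by \<open>D\<close>.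
\<close>

definition orth :: "('a \<Rightarrow> 'a) \<Rightarrow> bool" where
  "orth C \<longleftrightarrow> (\<forall>d\<in>D. C d \<in> B) \<and> (\<forall>z\<in>Z. (\<Oplus>d\<in>D. z d \<otimes> C d) = \<zero>)"

text \<open>
  The span of the vectors \<open>C u\<close> with \<open>C\<close> annihilating \<open>Z\<close> and \<open>u \<in> A\<close>. Vectors matter only on \<open>D\<close>,
  so both rules are closed under changing values outside \<open>D\<close>.
\<close>

inductive span_orth :: "('a \<Rightarrow> 'a) \<Rightarrow> bool" where
  base: "\<lbrakk>orth C; u \<in> carrier A; \<And>d. d \<in> D \<Longrightarrow> v d = C d \<otimes> u\<rbrakk> \<Longrightarrow> span_orth v"
| add: "\<lbrakk>span_orth v; span_orth w; \<And>d. d \<in> D \<Longrightarrow> x d = v d \<oplus> w d\<rbrakk> \<Longrightarrow> span_orth x"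

lemma span_orth_carr: "\<lbrakk>span_orth v; d \<in> D\<rbrakk> \<Longrightarrow> v d \<in> carrier A"
  by (induction rule: span_orth.induct) (auto simp: orth_def)

lemma span_orth_zero: "span_orth (\<lambda>d. \<zero>)"
proof -
  have "orth (\<lambda>d. \<zero>)"
    by (auto simp: orth_def Z_carr intro!: add.finprod_one_eqI)
  then show "span_orth (\<lambda>d. \<zero>)" by (rule base[where u = \<zero>]) auto
qed

lemma span_orth_cong: assumes "span_orth v" "\<And>d. d \<in> D \<Longrightarrow> w d = v d" shows "span_orth w"
  using add[OF assms(1) span_orth_zero] assms span_orth_carr by simp

lemma span_orth_finsum:
  assumes "finite I" "\<And>i. i \<in> I \<Longrightarrow> span_orth (v i)"
  shows "span_orth (\<lambda>d. \<Oplus>i\<in>I. v i d)"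
  using assms
proof (induction I)
  case empty
  then show ?case by (simp add: span_orth_zero)
next
  case (insert i I)
  show ?case
  proof (rule add[of "v i" "\<lambda>d. \<Oplus>i\<in>I. v i d"])
    show "(\<Oplus>i\<in>insert i I. v i d) = v i d \<oplus> (\<Oplus>i\<in>I. v i d)" if "d \<in> D" for d
      using insert that span_orth_carr by (intro finsum_insert) auto
  qed (use insert in auto)
qed

text \<open>
  The column \<open>(S \<tau> \<otimes> 1) dl(v)\<close>, the coaction on \<open>v\<close> corrected by that on \<open>D\<close>: it sends the
  tautological vector \<open>(d)\<^sub>d\<close> to \<open>(1 \<otimes> d)\<^sub>d\<close>.
\<close>

definition translate where "translate v k = (\<Oplus>\<^bsub>R\<^esub>j\<in>D. lf (S (\<tau> k j)) \<otimes>\<^bsub>R\<^esub> dl (v j))"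

lemma translate_RB: "\<lbrakk>\<And>j. j \<in> D \<Longrightarrow> C j \<in> B; k \<in> D\<rbrakk> \<Longrightarrow> translate C k \<in> RB"
  unfolding translate_def by (intro RB_finsum RB_lf_l RB_dl) auto

lemma translate_closed: "\<lbrakk>\<And>j. j \<in> D \<Longrightarrow> v j \<in> carrier A; k \<in> D\<rbrakk> \<Longrightarrow> translate v k \<in> carrier R"
  unfolding translate_def by (intro R.finsum_closed) auto

text \<open>
  Put \<open>\<Psi>\<^sub>j = (\<Sum>k. (1 \<otimes> z\<^sub>k) (S \<tau>\<^sub>k\<^sub>j \<otimes> 1))\<close>. The sum of the \<open>\<Psi>\<^sub>j dl(j)\<close> is \<open>1 \<otimes> (\<Sum>k. z\<^sub>k k) = 0\<close>.
  Under \<open>G\<close> this becomes a relation between the \<open>1 \<otimes> j\<close>, whose slices lie in \<open>Z\<close> and therefore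
  annihilate \<open>C\<close>. Going back with \<open>\<Phi>\<close> shows that the sum of the \<open>\<Psi>\<^sub>j dl(C\<^sub>j)\<close> is zero.
\<close>

lemma translate_orth:
  assumes C: "orth C" and z: "z \<in> Z"
  shows "(\<Oplus>\<^bsub>R\<^esub>k\<in>D. rt (z k) \<otimes>\<^bsub>R\<^esub> translate C k) = \<zero>\<^bsub>R\<^esub>"
proof -
  obtain G \<Phi> where G: "G \<in> Hom R R" and \<Phi>: "\<Phi> \<in> Hom R R" and GRB: "\<And>r. r \<in> RB \<Longrightarrow> G r \<in> RB"
    and \<Phi>G: "\<And>r. r \<in> carrier R \<Longrightarrow> \<Phi> (G r) = r"
    and Gdl: "\<And>r y. \<lbrakk>r \<in> carrier R; y \<in> carrier A\<rbrakk> \<Longrightarrow> G (r \<otimes>\<^bsub>R\<^esub> dl y) = G r \<otimes>\<^bsub>R\<^esub> rt y"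
    using ex_shear by auto
  have CB: "C d \<in> B" if "d \<in> D" for d using C that by (simp add: orth_def)
  define \<Psi> where "\<Psi> j = (\<Oplus>\<^bsub>R\<^esub>k\<in>D. rt (z k) \<otimes>\<^bsub>R\<^esub> lf (S (\<tau> k j)))" for j
  have \<Psi>RB: "\<Psi> j \<in> RB" if "j \<in> D" for j
    unfolding \<Psi>_def using that z by (intro RB_finsum RB_lf RB_t) (auto simp: Z_B)
  have \<Psi>R: "\<Psi> j \<in> carrier R" if "j \<in> D" for j using RB_R[OF \<Psi>RB[OF that]] .
  have qR: "G (\<Psi> j) \<in> carrier R" if "j \<in> D" for j using Hom_closed[OF G \<Psi>R[OF that]] .
  have \<Psi>sum: "(\<Oplus>\<^bsub>R\<^esub>j\<in>D. \<Psi> j \<otimes>\<^bsub>R\<^esub> dl (v j)) = (\<Oplus>\<^bsub>R\<^esub>k\<in>D. rt (z k) \<otimes>\<^bsub>R\<^esub> translate v k)"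
    if v: "\<And>j. j \<in> D \<Longrightarrow> v j \<in> carrier A" for v
    unfolding \<Psi>_def translate_def using v z by (intro R.vec_mat_assoc) (auto simp: Z_carr)
  have Gsum: "G (\<Oplus>\<^bsub>R\<^esub>j\<in>D. \<Psi> j \<otimes>\<^bsub>R\<^esub> dl (v j)) = (\<Oplus>\<^bsub>R\<^esub>j\<in>D. G (\<Psi> j) \<otimes>\<^bsub>R\<^esub> rt (v j))"
    if v: "\<And>j. j \<in> D \<Longrightarrow> v j \<in> carrier A" for v
  proof -
    have "G (\<Oplus>\<^bsub>R\<^esub>j\<in>D. \<Psi> j \<otimes>\<^bsub>R\<^esub> dl (v j)) = (\<Oplus>\<^bsub>R\<^esub>j\<in>D. G (\<Psi> j \<otimes>\<^bsub>R\<^esub> dl (v j)))"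
      using v \<Psi>R by (intro Hom_finsum[OF abR abR G]) auto
    also have "\<dots> = (\<Oplus>\<^bsub>R\<^esub>j\<in>D. G (\<Psi> j) \<otimes>\<^bsub>R\<^esub> rt (v j))"
      using v \<Psi>R qR by (intro R.finsum_cong') (auto simp: Gdl)
    finally show ?thesis .
  qed
  have "(\<Oplus>\<^bsub>R\<^esub>k\<in>D. rt (z k) \<otimes>\<^bsub>R\<^esub> translate (\<lambda>d. d) k) = (\<Oplus>\<^bsub>R\<^esub>k\<in>D. rt (z k \<otimes> k))"
    using z by (intro R.finsum_cong') (auto simp: translate_def comatrix_rt[OF comatrix] Z_carr rt_mult)
  also have "\<dots> = rt (\<Oplus>k\<in>D. z k \<otimes> k)"
    using z by (intro t_sum_r[symmetric]) (auto simp: Z_carr)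
  also have "\<dots> = \<zero>\<^bsub>R\<^esub>" using z by (simp add: Z_sum)
  finally have "(\<Oplus>\<^bsub>R\<^esub>j\<in>D. \<Psi> j \<otimes>\<^bsub>R\<^esub> dl j) = \<zero>\<^bsub>R\<^esub>" using \<Psi>sum[of "\<lambda>d. d"] by simp
  then have q0: "(\<Oplus>\<^bsub>R\<^esub>j\<in>D. G (\<Psi> j) \<otimes>\<^bsub>R\<^esub> rt j) = \<zero>\<^bsub>R\<^esub>"
    using Gsum[of "\<lambda>d. d"] Hom_zero[OF abR abR G] by simp
  have "(\<Oplus>\<^bsub>R\<^esub>j\<in>D. G (\<Psi> j) \<otimes>\<^bsub>R\<^esub> rt (C j)) = \<zero>\<^bsub>R\<^esub>"
  proof (rule sl_separates)
    show "(\<Oplus>\<^bsub>R\<^esub>j\<in>D. G (\<Psi> j) \<otimes>\<^bsub>R\<^esub> rt (C j)) \<in> carrier R"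
      using qR CB by (intro R.finsum_closed) auto
    fix \<psi> assume \<psi>: "functional \<psi>"
    have sZ: "(\<lambda>j. sl \<psi> (G (\<Psi> j))) \<in> Z"
      by (rule slice_Z[OF _ q0 \<psi>]) (rule GRB[OF \<Psi>RB])
    have "sl \<psi> (\<Oplus>\<^bsub>R\<^esub>j\<in>D. G (\<Psi> j) \<otimes>\<^bsub>R\<^esub> rt (C j)) = (\<Oplus>j\<in>D. sl \<psi> (G (\<Psi> j) \<otimes>\<^bsub>R\<^esub> rt (C j)))"
      using qR CB by (intro Hom_finsum[OF abR abA sl_Hom[OF \<psi>]]) auto
    also have "\<dots> = (\<Oplus>j\<in>D. sl \<psi> (G (\<Psi> j)) \<otimes> C j)"
      using qR CB Z_carr[OF sZ] by (intro finsum_cong') (auto simp: sl_rt[OF \<psi>])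
    also have "\<dots> = \<zero>" using C sZ by (simp add: orth_def)
    finally show "sl \<psi> (\<Oplus>\<^bsub>R\<^esub>j\<in>D. G (\<Psi> j) \<otimes>\<^bsub>R\<^esub> rt (C j)) = \<zero>" .
  qed
  then have "G (\<Oplus>\<^bsub>R\<^esub>j\<in>D. \<Psi> j \<otimes>\<^bsub>R\<^esub> dl (C j)) = \<zero>\<^bsub>R\<^esub>" using Gsum[of C] CB by simp
  moreover have "(\<Oplus>\<^bsub>R\<^esub>j\<in>D. \<Psi> j \<otimes>\<^bsub>R\<^esub> dl (C j)) \<in> carrier R" using \<Psi>R CB by (intro R.finsum_closed) auto
  ultimately have "(\<Oplus>\<^bsub>R\<^esub>j\<in>D. \<Psi> j \<otimes>\<^bsub>R\<^esub> dl (C j)) = \<zero>\<^bsub>R\<^esub>"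
    using \<Phi>G Hom_zero[OF abR abR \<Phi>] by metis
  then show ?thesis using \<Psi>sum[of C] CB by simp
qed

text \<open>
  For \<open>v = C u\<close>, expand \<open>translate C\<close> along a dual family; the coefficients \<open>C'\<close> are slices with
  values in \<open>B\<close> and annihilate \<open>Z\<close> by \<open>translate_orth\<close>. Linearity of \<open>h\<close> brings them out in front.
\<close>

lemma translate_span_orth:
  assumes v: "span_orth v" and h: "h \<in> Hom R A"
    and hl: "\<And>r y. \<lbrakk>r \<in> carrier R; y \<in> carrier A\<rbrakk> \<Longrightarrow> h (rt y \<otimes>\<^bsub>R\<^esub> r) = y \<otimes> h r"
  shows "span_orth (\<lambda>k. h (translate v k))"
  using v
proof (induction rule: span_orth.induct)
  case (base C u v)
  have CB: "C d \<in> B" if "d \<in> D" for d using base that by (simp add: orth_def)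
  have "\<exists>E \<phi>. dual E \<phi> \<and> (\<forall>k\<in>D. xl E \<phi> (translate C k) = translate C k \<and> xr E \<phi> (translate C k) = translate C k)"
    using CB by (intro ex_expansion) (auto intro!: translate_closed)
  then obtain E \<phi> where E: "dual E \<phi>" and xp: "\<And>k. k \<in> D \<Longrightarrow> xr E \<phi> (translate C k) = translate C k" by blast
  note d = dualD[OF E]
  have TR: "translate C k \<in> carrier R" if "k \<in> D" for k using CB that by (intro translate_closed) auto
  define C' where "C' \<epsilon> k = sr (\<phi> \<epsilon>) (translate C k)" for \<epsilon> k
  have C'B: "C' \<epsilon> k \<in> B" if "\<epsilon> \<in> E" "k \<in> D" for \<epsilon> k
    unfolding C'_def using that d CB by (intro sr_B translate_RB) auto
  have C'o: "orth (C' \<epsilon>)" if \<epsilon>: "\<epsilon> \<in> E" for \<epsilon>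
    unfolding orth_def
  proof (intro conjI ballI)
    fix z assume z: "z \<in> Z"
    note f = d(3)[OF \<epsilon>]
    have "(\<Oplus>k\<in>D. z k \<otimes> C' \<epsilon> k) = (\<Oplus>k\<in>D. sr (\<phi> \<epsilon>) (rt (z k) \<otimes>\<^bsub>R\<^esub> translate C k))"
      using z TR by (intro finsum_cong') (auto simp: Z_carr sr_rt[OF f] C'_def Hom_closed[OF sr_Hom[OF f]])
    also have "\<dots> = sr (\<phi> \<epsilon>) (\<Oplus>\<^bsub>R\<^esub>k\<in>D. rt (z k) \<otimes>\<^bsub>R\<^esub> translate C k)"
      using z TR by (intro Hom_finsum[OF abR abA sr_Hom[OF f], symmetric]) (auto simp: Z_carr)
    also have "\<dots> = \<zero>" using translate_orth[OF base(1) z] Hom_zero[OF abR abA sr_Hom[OF f]] by simp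
    finally show "(\<Oplus>k\<in>D. z k \<otimes> C' \<epsilon> k) = \<zero>" .
  qed (use C'B \<epsilon> in auto)
  have eq: "h (translate v k) = (\<Oplus>\<epsilon>\<in>E. C' \<epsilon> k \<otimes> h (lf \<epsilon> \<otimes>\<^bsub>R\<^esub> dl u))" if k: "k \<in> D" for k
  proof -
    have C'A: "C' \<epsilon> k \<in> carrier A" if "\<epsilon> \<in> E" for \<epsilon> using C'B[OF that k] by simp
    have "translate v k = (\<Oplus>\<^bsub>R\<^esub>j\<in>D. lf (S (\<tau> k j)) \<otimes>\<^bsub>R\<^esub> dl (C j) \<otimes>\<^bsub>R\<^esub> dl u)"
      unfolding translate_def using base CB k by (intro R.finsum_cong') (auto simp: dl_mult R.m_assoc)
    also have "\<dots> = translate C k \<otimes>\<^bsub>R\<^esub> dl u"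
      unfolding translate_def using base CB k by (intro R.finsum_ldistr[symmetric]) auto
    also have "translate C k = (\<Oplus>\<^bsub>R\<^esub>\<epsilon>\<in>E. rt (C' \<epsilon> k) \<otimes>\<^bsub>R\<^esub> lf \<epsilon>)"
      using xp[OF k] by (simp add: xr_def C'_def)
    also have "(\<Oplus>\<^bsub>R\<^esub>\<epsilon>\<in>E. rt (C' \<epsilon> k) \<otimes>\<^bsub>R\<^esub> lf \<epsilon>) \<otimes>\<^bsub>R\<^esub> dl u = (\<Oplus>\<^bsub>R\<^esub>\<epsilon>\<in>E. rt (C' \<epsilon> k) \<otimes>\<^bsub>R\<^esub> lf \<epsilon> \<otimes>\<^bsub>R\<^esub> dl u)"
      using d C'A base by (intro R.finsum_ldistr) auto
    finally have "h (translate v k) = h (\<Oplus>\<^bsub>R\<^esub>\<epsilon>\<in>E. rt (C' \<epsilon> k) \<otimes>\<^bsub>R\<^esub> lf \<epsilon> \<otimes>\<^bsub>R\<^esub> dl u)" by simp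
    also have "\<dots> = (\<Oplus>\<epsilon>\<in>E. h (rt (C' \<epsilon> k) \<otimes>\<^bsub>R\<^esub> lf \<epsilon> \<otimes>\<^bsub>R\<^esub> dl u))"
      using d C'A base by (intro Hom_finsum[OF abR abA h]) auto
    also have "\<dots> = (\<Oplus>\<epsilon>\<in>E. C' \<epsilon> k \<otimes> h (lf \<epsilon> \<otimes>\<^bsub>R\<^esub> dl u))"
    proof (rule finsum_cong')
      fix \<epsilon> assume \<epsilon>: "\<epsilon> \<in> E"
      have "rt (C' \<epsilon> k) \<otimes>\<^bsub>R\<^esub> lf \<epsilon> \<otimes>\<^bsub>R\<^esub> dl u = rt (C' \<epsilon> k) \<otimes>\<^bsub>R\<^esub> (lf \<epsilon> \<otimes>\<^bsub>R\<^esub> dl u)"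
        using d C'A base \<epsilon> by (intro R.m_assoc) auto
      then show "h (rt (C' \<epsilon> k) \<otimes>\<^bsub>R\<^esub> lf \<epsilon> \<otimes>\<^bsub>R\<^esub> dl u) = C' \<epsilon> k \<otimes> h (lf \<epsilon> \<otimes>\<^bsub>R\<^esub> dl u)"
        using d C'A base \<epsilon> by (simp add: hl)
    qed (use d C'A base Hom_closed[OF h] in auto)
    finally show ?thesis .
  qed
  have "span_orth (\<lambda>k. \<Oplus>\<epsilon>\<in>E. C' \<epsilon> k \<otimes> h (lf \<epsilon> \<otimes>\<^bsub>R\<^esub> dl u))"
  proof (rule span_orth_finsum)
    fix \<epsilon> assume \<epsilon>: "\<epsilon> \<in> E"
    have "h (lf \<epsilon> \<otimes>\<^bsub>R\<^esub> dl u) \<in> carrier A" using Hom_closed[OF h] d \<epsilon> base by simp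
    then show "span_orth (\<lambda>k. C' \<epsilon> k \<otimes> h (lf \<epsilon> \<otimes>\<^bsub>R\<^esub> dl u))"
      by (intro span_orth.base[OF C'o[OF \<epsilon>]]) auto
  qed (rule d)
  then show ?case by (rule span_orth_cong) (rule eq)
next
  case (add v w x)
  have vA: "v d \<in> carrier A" "w d \<in> carrier A" if "d \<in> D" for d
    using add that span_orth_carr by auto
  show ?case
  proof (rule span_orth.add[OF add(4,5)])
    fix k assume k: "k \<in> D"
    have "translate x k = (\<Oplus>\<^bsub>R\<^esub>j\<in>D. lf (S (\<tau> k j)) \<otimes>\<^bsub>R\<^esub> dl (v j) \<oplus>\<^bsub>R\<^esub> lf (S (\<tau> k j)) \<otimes>\<^bsub>R\<^esub> dl (w j))"
      unfolding translate_def using vA k by (intro R.finsum_cong') (auto simp: add(3) R.r_distr)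
    also have "\<dots> = translate v k \<oplus>\<^bsub>R\<^esub> translate w k"
      unfolding translate_def using vA k by (intro R.finsum_addf) auto
    finally show "h (translate x k) = h (translate v k) \<oplus> h (translate w k)"
      using vA k by (simp add: Hom_add[OF h] translate_closed)
  qed
qed

lemma span_orth_translate_mult:
  assumes p: "p \<in> carrier A" and v: "span_orth (\<lambda>d. d \<otimes> p)" and h: "h \<in> Hom R A"
    and hl: "\<And>r y. \<lbrakk>r \<in> carrier R; y \<in> carrier A\<rbrakk> \<Longrightarrow> h (rt y \<otimes>\<^bsub>R\<^esub> r) = y \<otimes> h r"
  shows "span_orth (\<lambda>d. d \<otimes> h (dl p))"
proof (rule span_orth_cong[OF translate_span_orth[OF v h hl]])
  fix k assume k: "k \<in> D"
  have "translate (\<lambda>d. d \<otimes> p) k = (\<Oplus>\<^bsub>R\<^esub>j\<in>D. lf (S (\<tau> k j)) \<otimes>\<^bsub>R\<^esub> dl j \<otimes>\<^bsub>R\<^esub> dl p)"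
    unfolding translate_def using p k by (intro R.finsum_cong') (auto simp: dl_mult R.m_assoc)
  also have "\<dots> = (\<Oplus>\<^bsub>R\<^esub>j\<in>D. lf (S (\<tau> k j)) \<otimes>\<^bsub>R\<^esub> dl j) \<otimes>\<^bsub>R\<^esub> dl p"
    using p k by (intro R.finsum_ldistr[symmetric]) auto
  also have "\<dots> = rt k \<otimes>\<^bsub>R\<^esub> dl p" by (simp add: comatrix_rt[OF comatrix k])
  finally show "k \<otimes> h (dl p) = h (translate (\<lambda>d. d \<otimes> p) k)" using p k by (simp add: hl)
qed auto

text \<open>
  Translation with \<open>sr \<psi>\<close>, where \<open>\<psi> F0 = 1\<close>, replaces \<open>F0\<close> by an element \<open>p\<close> with
  \<open>e p = \<psi> F0 = 1\<close>; translation with \<open>mS\<close> replaces \<open>p\<close> by \<open>mS (dl p) = e p = 1\<close>.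
\<close>

lemma span_orth_id: "span_orth (\<lambda>d. d)"
proof -
  obtain Q F0 C where W: "finite Q \<and> Q \<subseteq> D \<and> F0 \<in> B \<and> ev F0 = F0 \<and> F0 \<noteq> \<zero> \<and>
    (\<forall>j\<in>D. \<forall>l\<in>Q. C j l \<in> B) \<and> (\<forall>j\<in>D. F0 \<otimes> j = (\<Oplus>l\<in>Q. C j l \<otimes> l)) \<and>
    (\<forall>z\<in>Z. \<forall>l\<in>Q. (\<Oplus>j\<in>D. z j \<otimes> C j l) = \<zero>)"
    using ex_generic_coordinates by (elim exE)
  have QA: "l \<in> carrier A" if "l \<in> Q" for l using W that by auto
  have F0: "F0 \<in> carrier A" "ev F0 = F0" "F0 \<noteq> \<zero>" using W by auto
  have "span_orth (\<lambda>j. \<Oplus>l\<in>Q. C j l \<otimes> l)"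
  proof (rule span_orth_finsum)
    fix l assume l: "l \<in> Q"
    have "orth (\<lambda>j. C j l)" using W l by (simp add: orth_def)
    then show "span_orth (\<lambda>j. C j l \<otimes> l)" using QA[OF l] by (rule base) simp
  qed (use W in simp)
  then have 1: "span_orth (\<lambda>d. d \<otimes> F0)"
  proof (rule span_orth_cong)
    fix d assume d: "d \<in> D"
    have "d \<otimes> F0 = F0 \<otimes> d" using even_comm[OF F0(2,1), of d] d by simp
    then show "d \<otimes> F0 = (\<Oplus>l\<in>Q. C d l \<otimes> l)" using W d by simp
  qed
  obtain \<psi> where \<psi>: "functional \<psi>" "\<psi> F0 = \<one>" using ex_functional F0 by blast
  let ?p = "sr \<psi> (dl F0)"
  have p: "?p \<in> carrier A" using Hom_closed[OF sr_Hom[OF \<psi>(1)]] F0 by simp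
  have "span_orth (\<lambda>d. d \<otimes> ?p)"
    by (rule span_orth_translate_mult[OF F0(1) 1 sr_Hom[OF \<psi>(1)]]) (rule sr_rt[OF \<psi>(1)])
  then have "span_orth (\<lambda>d. d \<otimes> mS (dl ?p))"
    by (rule span_orth_translate_mult[OF p _ mS_Hom]) (rule mS_rt_l)
  moreover have "mS (dl ?p) = \<one>"
    using p F0 e_sr[OF \<psi>(1), of "dl F0"] \<psi>(2) by (simp add: dl_antipode dl_counit)
  ultimately have "span_orth (\<lambda>d. d \<otimes> \<one>)" by simp
  then show ?thesis by (rule span_orth_cong) simp
qed

lemma span_orth_factor:
  "span_orth v \<Longrightarrow> \<exists>N (C :: nat \<Rightarrow> 'a \<Rightarrow> 'a) u. (\<forall>l<N. orth (C l) \<and> u l \<in> carrier A) \<and>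
    (\<forall>d\<in>D. v d = (\<Oplus>l\<in>{..<N}. C l d \<otimes> u l))"
proof (induction rule: span_orth.induct)
  case (base C u v)
  then show ?case
    by (intro exI[of _ 1] exI[of _ "\<lambda>_. C"] exI[of _ "\<lambda>_. u"])
      (auto simp: lessThan_Suc orth_def)
next
  case (add v w x)
  then obtain N C u where 1: "\<And>l. l < N \<Longrightarrow> orth (C l) \<and> u l \<in> carrier A"
     "\<And>d. d \<in> D \<Longrightarrow> v d = (\<Oplus>l\<in>{..<N::nat}. C l d \<otimes> u l)" by blast
  from add obtain M C' u' where 2: "\<And>l. l < M \<Longrightarrow> orth (C' l) \<and> u' l \<in> carrier A"
     "\<And>d. d \<in> D \<Longrightarrow> w d = (\<Oplus>l\<in>{..<M::nat}. C' l d \<otimes> u' l)" by blast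
  \<comment> \<open>The second family is appended to the first, with its indices shifted.\<close>
  define C2 where "C2 l = (if l < N then C l else C' (l - N))" for l
  define u2 where "u2 l = (if l < N then u l else u' (l - N))" for l
  have "x d = (\<Oplus>l\<in>{..<N + M}. C2 l d \<otimes> u2 l)" if d: "d \<in> D" for d
  proof -
    have c: "C l d \<otimes> u l \<in> carrier A" if "l < N" for l using 1(1)[OF that] d by (auto simp: orth_def)
    have c': "C' l d \<otimes> u' l \<in> carrier A" if "l < M" for l using 2(1)[OF that] d by (auto simp: orth_def)
    have im: "{N..<N + M} = (\<lambda>l. l + N) ` {..<M}"
      using image_add_atLeastLessThan'[of N 0 M] by (simp add: lessThan_atLeast0 add.commute)
    have "(\<Oplus>l\<in>{..<N + M}. C2 l d \<otimes> u2 l) = (\<Oplus>l\<in>{..<N} \<union> {N..<N + M}. C2 l d \<otimes> u2 l)"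
      by (simp add: ivl_disj_un_one)
    also have "\<dots> = (\<Oplus>l\<in>{..<N}. C2 l d \<otimes> u2 l) \<oplus> (\<Oplus>l\<in>{N..<N + M}. C2 l d \<otimes> u2 l)"
      using c c' by (intro finsum_Un_disjoint) (auto simp: C2_def u2_def)
    also have "(\<Oplus>l\<in>{N..<N + M}. C2 l d \<otimes> u2 l) = (\<Oplus>l\<in>{..<M}. C' l d \<otimes> u' l)"
      unfolding im using c' by (subst finsum_reindex) (auto simp: C2_def u2_def intro!: finsum_cong')
    also have "(\<Oplus>l\<in>{..<N}. C2 l d \<otimes> u2 l) = (\<Oplus>l\<in>{..<N}. C l d \<otimes> u l)"
      using c by (intro finsum_cong') (auto simp: C2_def u2_def)
    finally show ?thesis using add(3)[OF d] 1(2)[OF d] 2(2)[OF d] by simp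
  qed
  moreover have "orth (C2 l) \<and> u2 l \<in> carrier A" if "l < N + M" for l
    using 1(1)[of l] 2(1)[of "l - N"] that by (auto simp: C2_def u2_def)
  ultimately show ?case by (intro exI[of _ "N + M"] exI[of _ C2] exI[of _ u2]) auto
qed

end

context super_hopf_coideal begin

text \<open>
  The matrix \<open>C\<close> induces a well-defined linear map from the \<open>B\<close>-module generated by \<open>D\<close> to \<open>B\<^sup>N\<close>, and
  \<open>u\<close> maps this free module back to \<open>A\<close> such that the composition is the inclusion.
\<close>

theorem locally_factors_through_free:
  assumes "finite Y" "Y \<subseteq> carrier A"
  shows "\<exists>D. finite D \<and> D \<subseteq> carrier A \<and>
    (\<forall>y\<in>Y. \<exists>c. (\<forall>d\<in>D. c d \<in> B) \<and> y = (\<Oplus>d\<in>D. c d \<otimes> d)) \<and>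
    (\<exists>N (C :: nat \<Rightarrow> 'a \<Rightarrow> 'a) u. (\<forall>l<N. (\<forall>d\<in>D. C l d \<in> B) \<and> u l \<in> carrier A) \<and>
      (\<forall>d\<in>D. d = (\<Oplus>l\<in>{..<N}. C l d \<otimes> u l)) \<and>
      (\<forall>z. (\<forall>d\<in>D. z d \<in> B) \<longrightarrow> (\<Oplus>d\<in>D. z d \<otimes> d) = \<zero> \<longrightarrow> (\<forall>l<N. (\<Oplus>d\<in>D. z d \<otimes> C l d) = \<zero>)))"
proof -
  obtain D \<tau> \<phi> where D: "dual D \<phi>" "comatrix D \<tau>" "\<forall>y\<in>Y. spans D \<phi> y"
    using ex_comatrix[OF assms] by blast
  interpret coideal_comatrix A R F B ev od e S dl t D \<tau>
    by unfold_locales (rule D)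
  note d = dualD[OF D(1)]
  from span_orth_factor[OF span_orth_id] obtain N C u where
    W: "(\<forall>l<N. orth (C l) \<and> u l \<in> carrier A) \<and> (\<forall>d\<in>D. d = (\<Oplus>l\<in>{..<N::nat}. C l d \<otimes> u l))"
    by (elim exE)
  have "\<exists>c. (\<forall>d\<in>D. c d \<in> B) \<and> y = (\<Oplus>d\<in>D. c d \<otimes> d)" if y: "y \<in> Y" for y
    using D(3) y d assms by (intro exI[of _ "\<lambda>d. \<phi> d y"]) (auto simp: spans_def)
  moreover have "(\<forall>l<N. (\<forall>d\<in>D. C l d \<in> B) \<and> u l \<in> carrier A)" using W by (auto simp: orth_def)
  moreover have "(\<forall>z. (\<forall>d\<in>D. z d \<in> B) \<longrightarrow> (\<Oplus>d\<in>D. z d \<otimes> d) = \<zero> \<longrightarrow> (\<forall>l<N. (\<Oplus>d\<in>D. z d \<otimes> C l d) = \<zero>))"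
    using W by (auto simp: orth_def Z_def)
  ultimately show ?thesis using d W by (intro exI[of _ D] conjI exI[of _ N] exI[of _ C] exI[of _ u]) auto
qed

end


section \<open>Tensor products of abelian groups\<close>

lemma hom_frag_eq:
  assumes G: "group G" and h: "h \<in> hom (free_Abelian_group S) G" and k: "k \<in> hom (free_Abelian_group S) G"
    and u: "Poly_Mapping.keys u \<subseteq> S'" and S': "S' \<subseteq> S" and eq: "\<And>x. x \<in> S' \<Longrightarrow> h (frag_of x) = k (frag_of x)"
  shows "h u = k u"
proof -
  interpret h: group_hom "free_Abelian_group S" G h
    using G h by (simp add: group_hom_def group_hom_axioms_def)
  interpret k: group_hom "free_Abelian_group S" G k
    using G k by (simp add: group_hom_def group_hom_axioms_def)
  show ?thesis
    using u
  proof (induction rule: free_Abelian_group_induct[consumes 1, case_names zero diff single])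
    case zero
    then show ?case using h.hom_one k.hom_one by simp
  next
    case (diff x y)
    then have *: "Poly_Mapping.keys x \<subseteq> S" "Poly_Mapping.keys y \<subseteq> S" "Poly_Mapping.keys (- y) \<subseteq> S" using S' by auto
    have "h (x - y) = h x \<otimes>\<^bsub>G\<^esub> inv\<^bsub>G\<^esub> h y"
      using h.hom_mult[of x "- y"] h.hom_inv[of y] * by simp
    moreover have "k (x - y) = k x \<otimes>\<^bsub>G\<^esub> inv\<^bsub>G\<^esub> k y"
      using k.hom_mult[of x "- y"] k.hom_inv[of y] * by simp
    ultimately show ?case using diff by simp
  next
    case (single a)
    then show ?case by (rule eq)
  qed
qed

lemma (in group) generate_finite:
  assumes "a \<in> generate G H"
  shows "\<exists>H0. finite H0 \<and> H0 \<subseteq> H \<and> a \<in> generate G H0"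
  using assms
proof (induction rule: generate.induct)
  case one
  then show ?case by (intro exI[of _ "{}"]) (auto intro: generate.one)
next
  case (incl h)
  then show ?case by (intro exI[of _ "{h}"]) (auto intro: generate.incl)
next
  case (inv h)
  then show ?case by (intro exI[of _ "{h}"]) (auto intro: generate.inv)
next
  case (eng h1 h2)
  then obtain H1 H2 where "finite H1" "H1 \<subseteq> H" "h1 \<in> generate G H1" "finite H2" "H2 \<subseteq> H" "h2 \<in> generate G H2" by blast
  then show ?case
    using mono_generate[of H1 "H1 \<union> H2"] mono_generate[of H2 "H1 \<union> H2"]
    by (intro exI[of _ "H1 \<union> H2"]) (auto intro: generate.eng)
qed

text \<open>
  The common setting of \<open>M \<otimes>\<^sub>B A\<close> for modules and of \<open>A \<otimes>\<^sub>K A\<close> for superalgebras.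
\<close>

locale tensor_data = G: comm_group G + H: comm_group H
  for Sc :: "'r set" and G :: "('m, 'x) monoid_scheme" and ra :: "'m \<Rightarrow> 'r \<Rightarrow> 'm"
    and H :: "('n, 'y) monoid_scheme" and la :: "'r \<Rightarrow> 'n \<Rightarrow> 'n" +
  assumes ra_closed: "\<lbrakk>x \<in> carrier G; r \<in> Sc\<rbrakk> \<Longrightarrow> ra x r \<in> carrier G"
    and la_closed: "\<lbrakk>r \<in> Sc; y \<in> carrier H\<rbrakk> \<Longrightarrow> la r y \<in> carrier H"
begin

abbreviation "Fr \<equiv> free_Abelian_group (carrier G \<times> carrier H)"
abbreviation "Ker \<equiv> tensor_kernel Sc G ra H la"
abbreviation "Tn \<equiv> tensor_group Sc G ra H la"
abbreviation "pt \<equiv> pure_tensor Sc G ra H la"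

definition cl where "cl u = Ker #>\<^bsub>Fr\<^esub> u"

sublocale Fr: comm_group Fr by (rule abelian_free_Abelian_group)

lemma relations_Fr: "tensor_relations Sc G ra H la \<subseteq> carrier Fr"
  unfolding tensor_relations_def using ra_closed la_closed
  by (auto dest!: subsetD[OF keys_diff] split: if_splits)

lemma Ker_subgroup: "subgroup Ker Fr"
  unfolding tensor_kernel_def by (rule Fr.generate_is_subgroup[OF relations_Fr])

lemma Ker_normal: "Ker \<lhd> Fr"
  by (rule Fr.subgroup_imp_normal[OF Ker_subgroup])

sublocale Tn: comm_group Tn
  unfolding tensor_group_def by (rule Fr.abelian_FactGroup[OF Ker_subgroup])

lemma cl_hom: "cl \<in> hom Fr Tn"
  unfolding cl_def[abs_def] tensor_group_def by (rule normal.r_coset_hom_Mod[OF Ker_normal])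

sublocale cl: group_hom Fr Tn cl
  by (simp add: group_hom_def group_hom_axioms_def cl_hom)

lemma one_Tn: "\<one>\<^bsub>Tn\<^esub> = Ker" by (simp add: tensor_group_def)

lemma cl_eq_one: "u \<in> carrier Fr \<Longrightarrow> cl u = \<one>\<^bsub>Tn\<^esub> \<longleftrightarrow> u \<in> Ker"
  unfolding one_Tn cl_def
  using Fr.coset_join1[OF _ _ Ker_subgroup, of u] Fr.coset_join2[OF _ Ker_subgroup, of u]
    subgroup.subset[OF Ker_subgroup] by auto

lemma Tn_cases: assumes "U \<in> carrier Tn" obtains u where "u \<in> carrier Fr" "U = cl u"
  using assms by (auto simp: tensor_group_def FactGroup_def RCOSETS_def cl_def)

lemma pt_cl: "pt x y = cl (frag_of (x, y))" by (simp add: pure_tensor_def cl_def)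

lemma pt_closed [simp]: "\<lbrakk>x \<in> carrier G; y \<in> carrier H\<rbrakk> \<Longrightarrow> pt x y \<in> carrier Tn"
  unfolding pt_cl by (rule cl.hom_closed) simp

lemma cl_diff: "\<lbrakk>u \<in> carrier Fr; v \<in> carrier Fr\<rbrakk> \<Longrightarrow> cl (u - v) = cl u \<otimes>\<^bsub>Tn\<^esub> inv\<^bsub>Tn\<^esub> cl v"
  using cl.hom_mult[of u "- v"] cl.hom_inv[of v] by simp

lemma cl_relation: "u \<in> tensor_relations Sc G ra H la \<Longrightarrow> cl u = \<one>\<^bsub>Tn\<^esub>"
  using relations_Fr by (subst cl_eq_one) (auto simp: tensor_kernel_def intro: generate.incl simp del: carrier_free_Abelian_group_iff)

lemma cl_relation3:
  assumes "frag_of p - frag_of q - frag_of r \<in> tensor_relations Sc G ra H la"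
    "p \<in> carrier G \<times> carrier H" "q \<in> carrier G \<times> carrier H" "r \<in> carrier G \<times> carrier H"
  shows "cl (frag_of p) = cl (frag_of q) \<otimes>\<^bsub>Tn\<^esub> cl (frag_of r)"
proof -
  have fr: "frag_of s \<in> carrier Fr" if "s \<in> carrier G \<times> carrier H" for s using that by simp
  have eq: "frag_of p = (frag_of p - frag_of q - frag_of r) \<otimes>\<^bsub>Fr\<^esub> (frag_of q \<otimes>\<^bsub>Fr\<^esub> frag_of r)" by simp
  have rel: "frag_of p - frag_of q - frag_of r \<in> carrier Fr" using relations_Fr assms(1) by blast
  have "cl (frag_of p) = cl (frag_of p - frag_of q - frag_of r) \<otimes>\<^bsub>Tn\<^esub> (cl (frag_of q) \<otimes>\<^bsub>Tn\<^esub> cl (frag_of r))"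
    by (subst eq) (simp only: cl.hom_mult rel fr[OF assms(3)] fr[OF assms(4)] Fr.m_closed)
  then show ?thesis
    using fr assms by (simp only: cl_relation[OF assms(1)] Tn.l_one cl.hom_closed Tn.m_closed)
qed

lemma pt_add_l: "\<lbrakk>x \<in> carrier G; x' \<in> carrier G; y \<in> carrier H\<rbrakk> \<Longrightarrow>
    pt (x \<otimes>\<^bsub>G\<^esub> x') y = pt x y \<otimes>\<^bsub>Tn\<^esub> pt x' y"
  unfolding pt_cl by (rule cl_relation3) (auto simp: tensor_relations_def)

lemma pt_add_r: "\<lbrakk>x \<in> carrier G; y \<in> carrier H; y' \<in> carrier H\<rbrakk> \<Longrightarrow>
    pt x (y \<otimes>\<^bsub>H\<^esub> y') = pt x y \<otimes>\<^bsub>Tn\<^esub> pt x y'"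
  unfolding pt_cl by (rule cl_relation3) (auto simp: tensor_relations_def)

lemma pt_bal:
  assumes "x \<in> carrier G" "r \<in> Sc" "y \<in> carrier H"
  shows "pt (ra x r) y = pt x (la r y)"
proof -
  have rel: "frag_of (ra x r, y) - frag_of (x, la r y) \<in> tensor_relations Sc G ra H la"
    using assms by (auto simp: tensor_relations_def)
  have "frag_of (ra x r, y) \<in> carrier Fr" "frag_of (x, la r y) \<in> carrier Fr"
    using assms ra_closed la_closed by auto
  then show ?thesis using cl_relation[OF rel]
    unfolding pt_cl cl_diff[OF \<open>frag_of (ra x r, y) \<in> carrier Fr\<close> \<open>frag_of (x, la r y) \<in> carrier Fr\<close>]
    by (metis Tn.inv_closed Tn.inv_equality Tn.inv_inv cl.hom_closed)
qed

lemma pt_hom_l: "y \<in> carrier H \<Longrightarrow> (\<lambda>x. pt x y) \<in> hom G Tn"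
  by (rule homI) (auto simp: pt_add_l)
lemma pt_hom_r: "x \<in> carrier G \<Longrightarrow> pt x \<in> hom H Tn"
  by (rule homI) (auto simp: pt_add_r)

lemma pt_one_l [simp]: "y \<in> carrier H \<Longrightarrow> pt \<one>\<^bsub>G\<^esub> y = \<one>\<^bsub>Tn\<^esub>"
  using group_hom.hom_one[of G Tn "\<lambda>x. pt x y"] pt_hom_l by (simp add: group_hom_def group_hom_axioms_def)
lemma pt_inv_l: "\<lbrakk>x \<in> carrier G; y \<in> carrier H\<rbrakk> \<Longrightarrow> pt (inv\<^bsub>G\<^esub> x) y = inv\<^bsub>Tn\<^esub> pt x y"
  using group_hom.hom_inv[of G Tn "\<lambda>x. pt x y"] pt_hom_l by (simp add: group_hom_def group_hom_axioms_def)

lemma Tn_induct [consumes 1, case_names pure mult]: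
  assumes U: "U \<in> carrier Tn" and p: "\<And>x y. \<lbrakk>x \<in> carrier G; y \<in> carrier H\<rbrakk> \<Longrightarrow> P (pt x y)"
    and m: "\<And>u v. \<lbrakk>u \<in> carrier Tn; v \<in> carrier Tn; P u; P v\<rbrakk> \<Longrightarrow> P (u \<otimes>\<^bsub>Tn\<^esub> v)"
  shows "P U"
proof -
  obtain u where u: "u \<in> carrier Fr" "U = cl u" using Tn_cases[OF U] by blast
  have "Poly_Mapping.keys u \<subseteq> carrier G \<times> carrier H" using u by simp
  then have "P (cl u) \<and> P (inv\<^bsub>Tn\<^esub> cl u)"
  proof (induction rule: free_Abelian_group_induct[consumes 1, case_names zero diff single])
    case zero
    have "P \<one>\<^bsub>Tn\<^esub>" using p[of "\<one>\<^bsub>G\<^esub>" "\<one>\<^bsub>H\<^esub>"] by simp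
    then show ?case using cl.hom_one by simp
  next
    case (diff x y)
    then have c: "cl x \<in> carrier Tn" "cl y \<in> carrier Tn" by (auto intro!: cl.hom_closed)
    have "inv\<^bsub>Tn\<^esub> (cl x \<otimes>\<^bsub>Tn\<^esub> inv\<^bsub>Tn\<^esub> cl y) = inv\<^bsub>Tn\<^esub> cl x \<otimes>\<^bsub>Tn\<^esub> cl y"
      using c by (simp add: Tn.inv_mult)
    then show ?case using diff m c by (simp add: cl_diff)
  next
    case (single a)
    then obtain x y where "a = (x, y)" "x \<in> carrier G" "y \<in> carrier H" by auto
    then show ?case using p[of x y] p[of "inv\<^bsub>G\<^esub> x" y] by (simp add: pt_cl[symmetric] pt_inv_l)
  qed
  then show ?thesis using u by simp
qed

lemma hom_Tn_eqI:
  assumes h: "h \<in> hom Tn L" and k: "k \<in> hom Tn L" and U: "U \<in> carrier Tn"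
    and eq: "\<And>x y. \<lbrakk>x \<in> carrier G; y \<in> carrier H\<rbrakk> \<Longrightarrow> h (pt x y) = k (pt x y)"
  shows "h U = k U"
  using U by (induction rule: Tn_induct) (simp_all add: eq hom_mult[OF h] hom_mult[OF k])

lemma
  fixes L :: "('l, 'z) monoid_scheme" and f
  assumes L: "comm_group L"
    and f: "\<And>x y. \<lbrakk>x \<in> carrier G; y \<in> carrier H\<rbrakk> \<Longrightarrow> f x y \<in> carrier L"
    and fl: "\<And>x x' y. \<lbrakk>x \<in> carrier G; x' \<in> carrier G; y \<in> carrier H\<rbrakk> \<Longrightarrow> f (x \<otimes>\<^bsub>G\<^esub> x') y = f x y \<otimes>\<^bsub>L\<^esub> f x' y"
    and fr: "\<And>x y y'. \<lbrakk>x \<in> carrier G; y \<in> carrier H; y' \<in> carrier H\<rbrakk> \<Longrightarrow> f x (y \<otimes>\<^bsub>H\<^esub> y') = f x y \<otimes>\<^bsub>L\<^esub> f x y'"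
    and fb: "\<And>x r y. \<lbrakk>x \<in> carrier G; r \<in> Sc; y \<in> carrier H\<rbrakk> \<Longrightarrow> f (ra x r) y = f x (la r y)"
  shows tensor_lift_hom: "tensor_lift L f \<in> hom Tn L"
    and tensor_lift_pt: "\<lbrakk>x \<in> carrier G; y \<in> carrier H\<rbrakk> \<Longrightarrow> tensor_lift L f (pt x y) = f x y"
proof -
  interpret L: comm_group L by (rule L)
  define hh where "hh u = finprod L (\<lambda>(x, y). f x y [^]\<^bsub>L\<^esub> Poly_Mapping.lookup u (x, y)) (Poly_Mapping.keys u)" for u :: "('m \<times> 'n) \<Rightarrow>\<^sub>0 int"
  have hh_J: "hh u = finprod L (\<lambda>(x, y). f x y [^]\<^bsub>L\<^esub> Poly_Mapping.lookup u (x, y)) J"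
    if "finite J" "Poly_Mapping.keys u \<subseteq> J" "J \<subseteq> carrier G \<times> carrier H" for u J
    unfolding hh_def using that f
    by (intro L.finprod_mono_neutral_cong_left) (auto simp: in_keys_iff)
  have hh_hom: "hh \<in> hom Fr L"
  proof (rule homI)
    fix u assume "u \<in> carrier Fr"
    then show "hh u \<in> carrier L" unfolding hh_def using f by (intro L.finprod_closed) auto
  next
    fix u v assume uv: "u \<in> carrier Fr" "v \<in> carrier Fr"
    let ?J = "Poly_Mapping.keys u \<union> Poly_Mapping.keys v"
    have J: "finite ?J" "?J \<subseteq> carrier G \<times> carrier H" using uv by auto
    have "hh (u + v) = finprod L (\<lambda>(x, y). f x y [^]\<^bsub>L\<^esub> Poly_Mapping.lookup (u + v) (x, y)) ?J"
      using J keys_add[of u v] by (intro hh_J) auto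
    also have "\<dots> = finprod L (\<lambda>p. (\<lambda>(x, y). f x y [^]\<^bsub>L\<^esub> Poly_Mapping.lookup u (x, y)) p \<otimes>\<^bsub>L\<^esub>
        (\<lambda>(x, y). f x y [^]\<^bsub>L\<^esub> Poly_Mapping.lookup v (x, y)) p) ?J"
      using J f by (intro L.finprod_cong') (auto simp: lookup_add L.int_pow_mult)
    also have "\<dots> = finprod L (\<lambda>(x, y). f x y [^]\<^bsub>L\<^esub> Poly_Mapping.lookup u (x, y)) ?J \<otimes>\<^bsub>L\<^esub>
        finprod L (\<lambda>(x, y). f x y [^]\<^bsub>L\<^esub> Poly_Mapping.lookup v (x, y)) ?J"
      using J f by (intro L.finprod_multf) auto
    also have "\<dots> = hh u \<otimes>\<^bsub>L\<^esub> hh v" using J by (simp add: hh_J[symmetric])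
    finally show "hh (u \<otimes>\<^bsub>Fr\<^esub> v) = hh u \<otimes>\<^bsub>L\<^esub> hh v" by simp
  qed
  interpret hh: group_hom Fr L hh by (simp add: group_hom_def group_hom_axioms_def hh_hom)
  have hh_frag: "hh (frag_of (x, y)) = f x y" if "x \<in> carrier G" "y \<in> carrier H" for x y
    using f[OF that] by (simp add: hh_def L.finprod_insert)
  have hh_diff: "hh (u - v) = hh u \<otimes>\<^bsub>L\<^esub> inv\<^bsub>L\<^esub> hh v" if "u \<in> carrier Fr" "v \<in> carrier Fr" for u v
    using hh.hom_mult[of u "- v"] hh.hom_inv[of v] that by simp
  have rel: "hh u = \<one>\<^bsub>L\<^esub>" if "u \<in> tensor_relations Sc G ra H la" for u
  proof -
    have fr': "frag_of s \<in> carrier Fr" if "s \<in> carrier G \<times> carrier H" for s using that by simp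
    have d3: "hh (frag_of p - frag_of q - frag_of r) = hh (frag_of p) \<otimes>\<^bsub>L\<^esub> inv\<^bsub>L\<^esub> (hh (frag_of q) \<otimes>\<^bsub>L\<^esub> hh (frag_of r))"
      if "p \<in> carrier G \<times> carrier H" "q \<in> carrier G \<times> carrier H" "r \<in> carrier G \<times> carrier H" for p q r
    proof -
      have "frag_of p - frag_of q - frag_of r = frag_of p - (frag_of q + frag_of r)" by simp
      then show ?thesis
        using hh_diff[of "frag_of p" "frag_of q \<otimes>\<^bsub>Fr\<^esub> frag_of r"] hh.hom_mult[of "frag_of q" "frag_of r"] fr'[OF that(1)] fr'[OF that(2)] fr'[OF that(3)]
          Fr.m_closed[OF fr'[OF that(2)] fr'[OF that(3)]]
        by (simp only: mult_free_Abelian_group)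
    qed
    from that consider (1) x x' y where "u = frag_of (x \<otimes>\<^bsub>G\<^esub> x', y) - frag_of (x, y) - frag_of (x', y)"
        "x \<in> carrier G" "x' \<in> carrier G" "y \<in> carrier H"
      | (2) x y y' where "u = frag_of (x, y \<otimes>\<^bsub>H\<^esub> y') - frag_of (x, y) - frag_of (x, y')"
        "x \<in> carrier G" "y \<in> carrier H" "y' \<in> carrier H"
      | (3) x r y where "u = frag_of (ra x r, y) - frag_of (x, la r y)" "x \<in> carrier G" "r \<in> Sc" "y \<in> carrier H"
      unfolding tensor_relations_def by blast
    then show ?thesis
    proof cases
      case 1
      then show ?thesis using f by (simp add: d3 hh_frag fl)
    next
      case 2
      then show ?thesis using f by (simp add: d3 hh_frag fr)
    next
      case 3
      then show ?thesis using f ra_closed la_closed by (simp add: hh_diff hh_frag fb)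
    qed
  qed
  have "Ker \<subseteq> kernel Fr L hh"
    unfolding tensor_kernel_def
    using relations_Fr rel by (intro Fr.generate_subgroup_incl hh.subgroup_kernel)
      (auto simp: kernel_def simp del: carrier_free_Abelian_group_iff)
  then have Ker1: "hh u = \<one>\<^bsub>L\<^esub>" if "u \<in> Ker" for u using that by (auto simp: kernel_def)
  have lift_cl: "tensor_lift L f (cl u) = hh u" if u: "u \<in> carrier Fr" for u
  proof -
    have "hh v = hh u" if v: "v \<in> cl u" for v
    proof -
      obtain k where k: "k \<in> Ker" "v = k \<otimes>\<^bsub>Fr\<^esub> u" using v by (auto simp: cl_def r_coset_def)
      have "k \<in> carrier Fr" using k(1) subgroup.subset[OF Ker_subgroup] by blast
      then show ?thesis using k u hh.hom_mult[of k u] Ker1[of k] hh.hom_closed[OF u] by simp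
    qed
    moreover have "u \<in> cl u"
      using subgroup.one_closed[OF Ker_subgroup] by (auto simp: cl_def r_coset_def intro!: bexI[of _ 0])
    ultimately have "hh ` cl u = {hh u}" by blast
    moreover have "tensor_lift L f (cl u) = the_elem (hh ` cl u)"
      unfolding tensor_lift_def hh_def[abs_def] ..
    ultimately show ?thesis by simp
  qed
  show "tensor_lift L f \<in> hom Tn L"
  proof (rule homI)
    fix U assume "U \<in> carrier Tn"
    then obtain u where "u \<in> carrier Fr" "U = cl u" by (rule Tn_cases)
    then show "tensor_lift L f U \<in> carrier L" by (simp add: lift_cl hh.hom_closed del: carrier_free_Abelian_group_iff)
  next
    fix U V assume U: "U \<in> carrier Tn" and V: "V \<in> carrier Tn"
    obtain u where u: "u \<in> carrier Fr" "U = cl u" using U by (rule Tn_cases)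
    obtain v where v: "v \<in> carrier Fr" "V = cl v" using V by (rule Tn_cases)
    have "U \<otimes>\<^bsub>Tn\<^esub> V = cl (u \<otimes>\<^bsub>Fr\<^esub> v)" by (simp only: u v cl.hom_mult)
    then show "tensor_lift L f (U \<otimes>\<^bsub>Tn\<^esub> V) = tensor_lift L f U \<otimes>\<^bsub>L\<^esub> tensor_lift L f V"
      by (simp only: u v lift_cl Fr.m_closed hh.hom_mult)
  qed
  show "tensor_lift L f (pt x y) = f x y" if "x \<in> carrier G" "y \<in> carrier H"
    using that by (simp add: pt_cl lift_cl hh_frag)
qed

end


section \<open>A criterion for flatness\<close>

text \<open>
  The forms \<open>\<phi>\<close> are linear only on the submodule \<open>M\<close>. Their values outside \<open>M\<close> are arbitrary,
  hence all conditions are relativized to \<open>M\<close>.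
\<close>

definition locally_dual_basis :: "('r, 'x) ring_scheme \<Rightarrow> ('r, 'n, 'y) module_scheme \<Rightarrow> bool" where
  "locally_dual_basis R N \<longleftrightarrow>
    (\<forall>Y. finite Y \<longrightarrow> Y \<subseteq> carrier N \<longrightarrow>
      (\<exists>M (k :: nat) (\<phi> :: nat \<Rightarrow> 'n \<Rightarrow> 'r) u. Y \<subseteq> M \<and> M \<subseteq> carrier N \<and>
        (\<forall>y\<in>M. \<forall>y'\<in>M. y \<oplus>\<^bsub>N\<^esub> y' \<in> M) \<and> (\<forall>r\<in>carrier R. \<forall>y\<in>M. r \<odot>\<^bsub>N\<^esub> y \<in> M) \<and>
        (\<forall>l<k. u l \<in> carrier N \<and> (\<forall>y\<in>M. \<phi> l y \<in> carrier R) \<and>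
          (\<forall>y\<in>M. \<forall>y'\<in>M. \<phi> l (y \<oplus>\<^bsub>N\<^esub> y') = \<phi> l y \<oplus>\<^bsub>R\<^esub> \<phi> l y') \<and>
          (\<forall>r\<in>carrier R. \<forall>y\<in>M. \<phi> l (r \<odot>\<^bsub>N\<^esub> y) = r \<otimes>\<^bsub>R\<^esub> \<phi> l y)) \<and>
        (\<forall>y\<in>M. y = (\<Oplus>\<^bsub>N\<^esub>l\<in>{..<k}. \<phi> l y \<odot>\<^bsub>N\<^esub> u l))))"

lemma tensor_data_modules:
  assumes "left_module R N" "right_module R M"
  shows "tensor_data (carrier R) (add_monoid M) (ract M) (add_monoid N) (smult N)"
proof -
  interpret N: left_module R N by fact
  interpret M: right_module R M by fact
  show ?thesis
    unfolding tensor_data_def tensor_data_axioms_def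
    using N.smult_closed M.ract_closed
    by (auto intro: N.N.a_comm_group M.M.a_comm_group)
qed

lemma right_module_homD:
  assumes "f \<in> right_module_hom R M N"
  shows "f \<in> hom (add_monoid M) (add_monoid N)"
    "x \<in> carrier M \<Longrightarrow> f x \<in> carrier N"
    "\<lbrakk>x \<in> carrier M; y \<in> carrier M\<rbrakk> \<Longrightarrow> f (x \<oplus>\<^bsub>M\<^esub> y) = f x \<oplus>\<^bsub>N\<^esub> f y"
    "\<lbrakk>x \<in> carrier M; r \<in> carrier R\<rbrakk> \<Longrightarrow> f (x \<triangleleft>\<^bsub>M\<^esub> r) = f x \<triangleleft>\<^bsub>N\<^esub> r"
  using assms by (auto simp: right_module_hom_def hom_def Pi_def)

lemma module_tensor_map_props:
  assumes N: "left_module R N" and M1: "right_module R M1" and M2: "right_module R M2"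
    and f: "f \<in> right_module_hom R M1 M2"
  shows "module_tensor_map R M2 N f \<in> hom (module_tensor R M1 N) (module_tensor R M2 N)"
    and "\<lbrakk>x \<in> carrier M1; y \<in> carrier N\<rbrakk> \<Longrightarrow> module_tensor_map R M2 N f
        (pure_tensor (carrier R) (add_monoid M1) (ract M1) (add_monoid N) (smult N) x y) =
      pure_tensor (carrier R) (add_monoid M2) (ract M2) (add_monoid N) (smult N) (f x) y"
proof -
  interpret T1: tensor_data "carrier R" "add_monoid M1" "ract M1" "add_monoid N" "smult N"
    by (rule tensor_data_modules[OF N M1])
  interpret T2: tensor_data "carrier R" "add_monoid M2" "ract M2" "add_monoid N" "smult N"
    by (rule tensor_data_modules[OF N M2])
  note f' = right_module_homD[OF f]
  have a: "f x \<in> carrier (add_monoid M2)" if "x \<in> carrier (add_monoid M1)" for x using that f' by simp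
  have b: "T2.pt (f (x \<otimes>\<^bsub>add_monoid M1\<^esub> x')) y = T2.pt (f x) y \<otimes>\<^bsub>T2.Tn\<^esub> T2.pt (f x') y"
    if "x \<in> carrier (add_monoid M1)" "x' \<in> carrier (add_monoid M1)" "y \<in> carrier (add_monoid N)" for x x' y
    using that f' T2.pt_add_l[of "f x" "f x'" y] by simp
  have c: "T2.pt (f (x \<triangleleft>\<^bsub>M1\<^esub> r)) y = T2.pt (f x) (r \<odot>\<^bsub>N\<^esub> y)"
    if "x \<in> carrier (add_monoid M1)" "r \<in> carrier R" "y \<in> carrier (add_monoid N)" for x r y
    using that f' T2.pt_bal[of "f x" r y] by simp
  show "module_tensor_map R M2 N f \<in> hom (module_tensor R M1 N) (module_tensor R M2 N)"
    unfolding module_tensor_map_def module_tensor_def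
    by (rule T1.tensor_lift_hom[OF T2.Tn.comm_group_axioms]) (use a b c T2.pt_closed T2.pt_add_r in auto)
  show "module_tensor_map R M2 N f (T1.pt x y) = T2.pt (f x) y" if "x \<in> carrier M1" "y \<in> carrier N"
    unfolding module_tensor_map_def module_tensor_def
    by (rule T1.tensor_lift_pt[OF T2.Tn.comm_group_axioms]) (use a b c T2.pt_closed T2.pt_add_r that in auto)
qed

text \<open>
  Finitely many relations of \<open>G \<otimes> H\<close> are relations of \<open>G \<otimes> M\<close> for every \<open>M \<subseteq> H\<close> that contains
  the finitely many second components occurring in them.
\<close>

lemma relations_support:
  assumes "finite S0" "S0 \<subseteq> tensor_relations Sc G ra H la"
  shows "\<exists>Y. finite Y \<and> Y \<subseteq> carrier H \<and> (\<forall>M. Y \<subseteq> M \<longrightarrow> S0 \<subseteq> tensor_relations Sc G ra (H\<lparr>carrier := M\<rparr>) la)"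
  using assms
proof (induction S0)
  case empty
  then show ?case by (intro exI[of _ "{}"]) auto
next
  case (insert s S0)
  then obtain Y where Y: "finite Y" "Y \<subseteq> carrier H"
    "\<And>M. Y \<subseteq> M \<Longrightarrow> S0 \<subseteq> tensor_relations Sc G ra (H\<lparr>carrier := M\<rparr>) la" by auto
  have "\<exists>Y'. finite Y' \<and> Y' \<subseteq> carrier H \<and> (\<forall>M. Y' \<subseteq> M \<longrightarrow> s \<in> tensor_relations Sc G ra (H\<lparr>carrier := M\<rparr>) la)"
  proof -
    have "s \<in> tensor_relations Sc G ra H la" using insert.prems by simp
    then consider (1) x x' y where "s = frag_of (x \<otimes>\<^bsub>G\<^esub> x', y) - frag_of (x, y) - frag_of (x', y)"
        "x \<in> carrier G" "x' \<in> carrier G" "y \<in> carrier H"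
      | (2) x y y' where "s = frag_of (x, y \<otimes>\<^bsub>H\<^esub> y') - frag_of (x, y) - frag_of (x, y')"
        "x \<in> carrier G" "y \<in> carrier H" "y' \<in> carrier H"
      | (3) x r y where "s = frag_of (ra x r, y) - frag_of (x, la r y)" "x \<in> carrier G" "r \<in> Sc" "y \<in> carrier H"
      unfolding tensor_relations_def by blast
    then show ?thesis
    proof cases
      case 1
      then show ?thesis by (intro exI[of _ "{y}"]) (auto simp: tensor_relations_def)
    next
      case 2
      then show ?thesis by (intro exI[of _ "{y, y'}"]) (auto simp: tensor_relations_def)
    next
      case 3
      then show ?thesis by (intro exI[of _ "{y}"]) (auto simp: tensor_relations_def)
    qed
  qed
  then obtain Y' where Y': "finite Y'" "Y' \<subseteq> carrier H"
    "\<And>M. Y' \<subseteq> M \<Longrightarrow> s \<in> tensor_relations Sc G ra (H\<lparr>carrier := M\<rparr>) la" by blast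
  show ?case
    by (intro exI[of _ "Y \<union> Y'"]) (use Y Y' in auto)
qed

text \<open>
  The map \<open>id \<otimes> \<phi>\<close> on formal combinations, for a linear form \<open>\<phi>\<close> on a submodule \<open>L\<close> of \<open>N\<close>. Pairs
  with second component outside \<open>L\<close> are sent to zero; no relation over \<open>L\<close> involves them.
\<close>

lemma ex_coordinate_hom:
  assumes "right_module R M" and \<phi>: "\<And>y. y \<in> L \<Longrightarrow> \<phi> y \<in> carrier R"
  shows "\<exists>h \<in> hom (free_Abelian_group (carrier M \<times> carrier N)) (add_monoid M).
    \<forall>p\<in>carrier M \<times> carrier N.
      h (frag_of p) = (if snd p \<in> L then fst p \<triangleleft>\<^bsub>M\<^esub> \<phi> (snd p) else \<zero>\<^bsub>M\<^esub>)"
proof -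
  interpret M: right_module R M by fact
  have cM: "comm_group (add_monoid M)" by (rule abelian_group.a_comm_group) (rule M.M.abelian_group_axioms)
  let ?g = "\<lambda>p. if snd p \<in> L then fst p \<triangleleft>\<^bsub>M\<^esub> \<phi> (snd p) else \<zero>\<^bsub>M\<^esub>"
  have im: "?g ` (carrier M \<times> carrier N) \<subseteq> carrier (add_monoid M)"
    using M.ract_closed \<phi> M.M.zero_closed by auto
  obtain h where h: "h \<in> hom (free_Abelian_group (carrier M \<times> carrier N)) (add_monoid M)"
    "\<And>p. p \<in> carrier M \<times> carrier N \<Longrightarrow> h (frag_of p) = ?g p"
    by (rule comm_group.free_Abelian_group_universal[OF cM im], rule that)
  show ?thesis
    by (rule bexI[OF _ h(1)], rule ballI) (rule h(2))
qed

lemma coordinate_hom_relation: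
  assumes N: "left_module R N" and M: "right_module R M"
    and L: "L \<subseteq> carrier N" "\<And>y y'. \<lbrakk>y \<in> L; y' \<in> L\<rbrakk> \<Longrightarrow> y \<oplus>\<^bsub>N\<^esub> y' \<in> L"
      "\<And>r y. \<lbrakk>r \<in> carrier R; y \<in> L\<rbrakk> \<Longrightarrow> r \<odot>\<^bsub>N\<^esub> y \<in> L"
    and \<phi>: "\<And>y. y \<in> L \<Longrightarrow> \<phi> y \<in> carrier R"
      "\<And>y y'. \<lbrakk>y \<in> L; y' \<in> L\<rbrakk> \<Longrightarrow> \<phi> (y \<oplus>\<^bsub>N\<^esub> y') = \<phi> y \<oplus>\<^bsub>R\<^esub> \<phi> y'"
      "\<And>r y. \<lbrakk>r \<in> carrier R; y \<in> L\<rbrakk> \<Longrightarrow> \<phi> (r \<odot>\<^bsub>N\<^esub> y) = r \<otimes>\<^bsub>R\<^esub> \<phi> y"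
    and h: "h \<in> hom (free_Abelian_group (carrier M \<times> carrier N)) (add_monoid M)"
      "\<And>p. p \<in> carrier M \<times> carrier N \<Longrightarrow>
        h (frag_of p) = (if snd p \<in> L then fst p \<triangleleft>\<^bsub>M\<^esub> \<phi> (snd p) else \<zero>\<^bsub>M\<^esub>)"
    and a: "a \<in> tensor_relations (carrier R) (add_monoid M) (ract M) ((add_monoid N)\<lparr>carrier := L\<rparr>) (smult N)"
  shows "h a = \<zero>\<^bsub>M\<^esub>"
proof -
  interpret NN: left_module R N by fact
  interpret R2: right_module R M by fact
  interpret T2: tensor_data "carrier R" "add_monoid M" "ract M" "add_monoid N" "smult N"
    by (rule tensor_data_modules[OF N M])
  interpret h2: group_hom T2.Fr "add_monoid M" h
    using h(1) by (simp add: group_hom_def group_hom_axioms_def abelian_group.a_group[OF R2.M.abelian_group_axioms])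
  have d: "h (a - b) = h a \<oplus>\<^bsub>M\<^esub> \<ominus>\<^bsub>M\<^esub> h b" if "a \<in> carrier T2.Fr" "b \<in> carrier T2.Fr" for a b
    using h2.hom_mult[of a "- b"] h2.hom_inv[of b] that by (simp add: a_inv_def)
  have fr: "frag_of p \<in> carrier T2.Fr" if "p \<in> carrier M \<times> carrier N" for p using that by simp
  have d3: "h (frag_of p - frag_of q - frag_of r) = h (frag_of p) \<oplus>\<^bsub>M\<^esub> \<ominus>\<^bsub>M\<^esub> h (frag_of q) \<oplus>\<^bsub>M\<^esub> \<ominus>\<^bsub>M\<^esub> h (frag_of r)"
    if "p \<in> carrier M \<times> carrier N" "q \<in> carrier M \<times> carrier N" "r \<in> carrier M \<times> carrier N" for p q r
  proof -
    have "frag_of p - frag_of q \<in> carrier T2.Fr"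
      using T2.Fr.m_closed[OF fr[OF that(1)] T2.Fr.inv_closed[OF fr[OF that(2)]]] that by simp
    then show ?thesis using d fr that by metis
  qed
  have canc: "p \<oplus>\<^bsub>M\<^esub> q \<oplus>\<^bsub>M\<^esub> \<ominus>\<^bsub>M\<^esub> p \<oplus>\<^bsub>M\<^esub> \<ominus>\<^bsub>M\<^esub> q = \<zero>\<^bsub>M\<^esub>"
    if "p \<in> carrier M" "q \<in> carrier M" for p q
  proof -
    have "p \<oplus>\<^bsub>M\<^esub> q \<oplus>\<^bsub>M\<^esub> \<ominus>\<^bsub>M\<^esub> p \<oplus>\<^bsub>M\<^esub> \<ominus>\<^bsub>M\<^esub> q = (p \<oplus>\<^bsub>M\<^esub> q) \<oplus>\<^bsub>M\<^esub> (\<ominus>\<^bsub>M\<^esub> p \<oplus>\<^bsub>M\<^esub> \<ominus>\<^bsub>M\<^esub> q)"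
      using that by (simp add: R2.M.a_assoc)
    also have "\<dots> = (p \<oplus>\<^bsub>M\<^esub> q) \<oplus>\<^bsub>M\<^esub> \<ominus>\<^bsub>M\<^esub> (p \<oplus>\<^bsub>M\<^esub> q)"
      using that by (simp only: R2.M.minus_add)
    finally show ?thesis using that R2.M.r_neg by simp
  qed
  from a consider (1) x x' y where "a = frag_of (x \<oplus>\<^bsub>M\<^esub> x', y) - frag_of (x, y) - frag_of (x', y)"
      "x \<in> carrier M" "x' \<in> carrier M" "y \<in> L"
    | (2) x y y' where "a = frag_of (x, y \<oplus>\<^bsub>N\<^esub> y') - frag_of (x, y) - frag_of (x, y')"
      "x \<in> carrier M" "y \<in> L" "y' \<in> L"
    | (3) x r y where "a = frag_of (x \<triangleleft>\<^bsub>M\<^esub> r, y) - frag_of (x, r \<odot>\<^bsub>N\<^esub> y)" "x \<in> carrier M" "r \<in> carrier R" "y \<in> L"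
    unfolding tensor_relations_def by auto
  then show ?thesis
  proof cases
    case 1
    then have "y \<in> carrier N" using L(1) by auto
    then show ?thesis using 1 \<phi>(1) R2.ract_closed
      by (simp add: d3 h(2) R2.ract_l_distr canc)
  next
    case 2
    then have "y \<in> carrier N" "y' \<in> carrier N" using L(1) by auto
    then show ?thesis using 2 L(2) \<phi> R2.ract_closed
      by (simp add: d3 h(2) R2.ract_r_distr canc)
  next
    case 3
    then have y: "y \<in> carrier N" using L(1) by auto
    have "frag_of (x \<triangleleft>\<^bsub>M\<^esub> r, y) \<in> carrier T2.Fr" "frag_of (x, r \<odot>\<^bsub>N\<^esub> y) \<in> carrier T2.Fr"
      using 3 y R2.ract_closed NN.smult_closed by auto
    from d[OF this] show ?thesis using 3 y L(3) \<phi> R2.ract_closed NN.smult_closed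
      by (simp add: h(2) R2.ract_assoc R2.M.r_neg)
  qed
qed

text \<open>
  Let \<open>u\<close> represent an element of \<open>M1 \<otimes> N\<close> that dies in \<open>M2 \<otimes> N\<close>. The relations responsible for
  this and the representative live over a submodule \<open>M\<close> with a dual basis \<open>\<phi>\<^sub>l\<close>, \<open>uu\<^sub>l\<close>. Applying
  \<open>\<phi>\<^sub>l\<close> shows that \<open>f\<close> kills the coordinate \<open>h1 l u \<in> M1\<close>, hence this coordinate is zero, and
  \<open>u\<close> equals \<open>(\<Sum>l. h1 l u \<otimes> uu\<^sub>l) = 0\<close> in \<open>M1 \<otimes> N\<close>.
\<close>

lemma tensor_map_inj:
  assumes N: "left_module R N" and M1: "right_module R M1" and M2: "right_module R M2"
    and f: "f \<in> right_module_hom R M1 M2" and inj: "inj_on f (carrier M1)"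
    and ldb: "locally_dual_basis R N"
  shows "inj_on (module_tensor_map R M2 N f) (carrier (module_tensor R M1 N))"
proof -
  interpret NN: left_module R N by fact
  interpret R1: right_module R M1 by fact
  interpret R2: right_module R M2 by fact
  interpret T1: tensor_data "carrier R" "add_monoid M1" "ract M1" "add_monoid N" "smult N"
    by (rule tensor_data_modules[OF N M1])
  interpret T2: tensor_data "carrier R" "add_monoid M2" "ract M2" "add_monoid N" "smult N"
    by (rule tensor_data_modules[OF N M2])
  have cM1: "comm_group (add_monoid M1)" by (rule abelian_group.a_comm_group) (rule R1.M.abelian_group_axioms)
  have cM2: "comm_group (add_monoid M2)" by (rule abelian_group.a_comm_group) (rule R2.M.abelian_group_axioms)
  have cN: "comm_group (add_monoid N)" by (rule abelian_group.a_comm_group) (rule NN.N.abelian_group_axioms)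
  have gM1: "group (add_monoid M1)" and gM2: "group (add_monoid M2)" and gN: "group (add_monoid N)"
    using cM1 cM2 cN by (auto simp: comm_group_def)
  have mN: "comm_monoid (add_monoid N)" using cN by (simp add: comm_group_def)
  note f' = right_module_homD[OF f]
  let ?f = "module_tensor_map R M2 N f"
  have fh: "?f \<in> hom T1.Tn T2.Tn" and fp: "\<And>x y. \<lbrakk>x \<in> carrier M1; y \<in> carrier N\<rbrakk> \<Longrightarrow> ?f (T1.pt x y) = T2.pt (f x) y"
    using module_tensor_map_props[OF N M1 M2 f] by (auto simp: module_tensor_def)
  interpret F: group_hom T1.Tn T2.Tn ?f by (simp add: group_hom_def group_hom_axioms_def fh)
  interpret f: group_hom "add_monoid M1" "add_monoid M2" f
    using f'(1) by (simp add: group_hom_def group_hom_axioms_def gM1 gM2)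
  have main: "t = \<one>\<^bsub>T1.Tn\<^esub>" if t: "t \<in> carrier T1.Tn" "?f t = \<one>\<^bsub>T2.Tn\<^esub>" for t
  proof -
    obtain u where u: "u \<in> carrier T1.Fr" "t = T1.cl u" using T1.Tn_cases[OF t(1)] by blast
    obtain fs where fs: "fs \<in> hom T1.Fr T2.Fr" "\<And>p. p \<in> carrier M1 \<times> carrier N \<Longrightarrow> fs (frag_of p) = frag_of (f (fst p), snd p)"
      using T2.Fr.free_Abelian_group_universal[of "\<lambda>p. frag_of (f (fst p), snd p)" "carrier M1 \<times> carrier N"] f'
      by (auto simp: image_subset_iff)
    interpret fs: group_hom T1.Fr T2.Fr fs using fs(1) by (simp add: group_hom_def group_hom_axioms_def)
    have "?f (T1.cl u) = T2.cl (fs u)"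
    proof -
      have "(?f \<circ> T1.cl) u = (T2.cl \<circ> fs) u"
      proof (rule hom_frag_eq[OF T2.Tn.group_axioms, where S' = "carrier M1 \<times> carrier N"])
        show "?f \<circ> T1.cl \<in> hom T1.Fr T2.Tn" by (rule Group.hom_compose[OF T1.cl_hom fh])
        show "T2.cl \<circ> fs \<in> hom T1.Fr T2.Tn" by (rule Group.hom_compose[OF fs(1) T2.cl_hom])
        show "(?f \<circ> T1.cl) (frag_of p) = (T2.cl \<circ> fs) (frag_of p)" if "p \<in> carrier M1 \<times> carrier N" for p
          using that fs(2)[OF that] fp[of "fst p" "snd p"] by (auto simp: T1.pt_cl T2.pt_cl)
      qed (use u in auto)
      then show ?thesis by simp
    qed
    then have "fs u \<in> T2.Ker" using t u T2.cl_eq_one[OF fs.hom_closed[OF u(1)]] by simp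
    then obtain S0 where S0: "finite S0" "S0 \<subseteq> tensor_relations (carrier R) (add_monoid M2) (ract M2) (add_monoid N) (smult N)"
      "fs u \<in> generate T2.Fr S0"
      using T2.Fr.generate_finite unfolding tensor_kernel_def by blast
    from relations_support[OF S0(1,2)] obtain Y where Y: "finite Y" "Y \<subseteq> carrier N"
      "\<And>M. Y \<subseteq> M \<Longrightarrow> S0 \<subseteq> tensor_relations (carrier R) (add_monoid M2) (ract M2) ((add_monoid N)\<lparr>carrier := M\<rparr>) (smult N)"
      by auto
    let ?Y = "Y \<union> snd ` Poly_Mapping.keys u"
    have Yf: "finite ?Y" "?Y \<subseteq> carrier N" using Y u by auto
    from ldb[unfolded locally_dual_basis_def, rule_format, OF Yf] obtain M k \<phi> uu where W: "?Y \<subseteq> M \<and> M \<subseteq> carrier N \<and>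
        (\<forall>y\<in>M. \<forall>y'\<in>M. y \<oplus>\<^bsub>N\<^esub> y' \<in> M) \<and> (\<forall>r\<in>carrier R. \<forall>y\<in>M. r \<odot>\<^bsub>N\<^esub> y \<in> M) \<and>
        (\<forall>l<(k :: nat). uu l \<in> carrier N \<and> (\<forall>y\<in>M. \<phi> l y \<in> carrier R) \<and>
          (\<forall>y\<in>M. \<forall>y'\<in>M. \<phi> l (y \<oplus>\<^bsub>N\<^esub> y') = \<phi> l y \<oplus>\<^bsub>R\<^esub> \<phi> l y') \<and>
          (\<forall>r\<in>carrier R. \<forall>y\<in>M. \<phi> l (r \<odot>\<^bsub>N\<^esub> y) = r \<otimes>\<^bsub>R\<^esub> \<phi> l y)) \<and>
        (\<forall>y\<in>M. y = (\<Oplus>\<^bsub>N\<^esub>l\<in>{..<k}. \<phi> l y \<odot>\<^bsub>N\<^esub> uu l))"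
      by (elim exE)
    have M: "?Y \<subseteq> M" "M \<subseteq> carrier N" "\<And>y y'. \<lbrakk>y \<in> M; y' \<in> M\<rbrakk> \<Longrightarrow> y \<oplus>\<^bsub>N\<^esub> y' \<in> M"
      "\<And>r y. \<lbrakk>r \<in> carrier R; y \<in> M\<rbrakk> \<Longrightarrow> r \<odot>\<^bsub>N\<^esub> y \<in> M" using W by auto
    have uu: "uu l \<in> carrier N" and \<phi>: "\<And>y. y \<in> M \<Longrightarrow> \<phi> l y \<in> carrier R"
      "\<And>y y'. \<lbrakk>y \<in> M; y' \<in> M\<rbrakk> \<Longrightarrow> \<phi> l (y \<oplus>\<^bsub>N\<^esub> y') = \<phi> l y \<oplus>\<^bsub>R\<^esub> \<phi> l y'"
      "\<And>r y. \<lbrakk>r \<in> carrier R; y \<in> M\<rbrakk> \<Longrightarrow> \<phi> l (r \<odot>\<^bsub>N\<^esub> y) = r \<otimes>\<^bsub>R\<^esub> \<phi> l y" if "l < k" for l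
      using W that by auto
    have ysum: "y = (\<Oplus>\<^bsub>N\<^esub>l\<in>{..<k}. \<phi> l y \<odot>\<^bsub>N\<^esub> uu l)" if "y \<in> M" for y
      using W[THEN conjunct2, THEN conjunct2, THEN conjunct2, THEN conjunct2, THEN conjunct2] that by (rule bspec)
    have "\<forall>l\<in>{..<k}. \<exists>h. h \<in> hom T2.Fr (add_monoid M2) \<and> (\<forall>p\<in>carrier M2 \<times> carrier N.
        h (frag_of p) = (if snd p \<in> M then fst p \<triangleleft>\<^bsub>M2\<^esub> \<phi> l (snd p) else \<zero>\<^bsub>M2\<^esub>))"
    proof
      fix l assume "l \<in> {..<k}"
      then have l: "l < k" by simp
      show "\<exists>h. h \<in> hom T2.Fr (add_monoid M2) \<and> (\<forall>p\<in>carrier M2 \<times> carrier N.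
          h (frag_of p) = (if snd p \<in> M then fst p \<triangleleft>\<^bsub>M2\<^esub> \<phi> l (snd p) else \<zero>\<^bsub>M2\<^esub>))"
        using ex_coordinate_hom[OF M2, where L = M and N = N and \<phi> = "\<phi> l", OF \<phi>(1)[OF l]] by auto
    qed
    from bchoice[OF this] obtain h2 where H2: "\<forall>l\<in>{..<k}. h2 l \<in> hom T2.Fr (add_monoid M2) \<and> (\<forall>p\<in>carrier M2 \<times> carrier N.
        h2 l (frag_of p) = (if snd p \<in> M then fst p \<triangleleft>\<^bsub>M2\<^esub> \<phi> l (snd p) else \<zero>\<^bsub>M2\<^esub>))"
      by (elim exE)
    have h2: "\<And>l. l < k \<Longrightarrow> h2 l \<in> hom T2.Fr (add_monoid M2)"
      "\<And>l p. \<lbrakk>l < k; p \<in> carrier M2 \<times> carrier N\<rbrakk> \<Longrightarrow>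
        h2 l (frag_of p) = (if snd p \<in> M then fst p \<triangleleft>\<^bsub>M2\<^esub> \<phi> l (snd p) else \<zero>\<^bsub>M2\<^esub>)"
      using H2 by auto
    have "\<forall>l\<in>{..<k}. \<exists>h. h \<in> hom T1.Fr (add_monoid M1) \<and> (\<forall>p\<in>carrier M1 \<times> carrier N.
        h (frag_of p) = (if snd p \<in> M then fst p \<triangleleft>\<^bsub>M1\<^esub> \<phi> l (snd p) else \<zero>\<^bsub>M1\<^esub>))"
    proof
      fix l assume "l \<in> {..<k}"
      then have l: "l < k" by simp
      show "\<exists>h. h \<in> hom T1.Fr (add_monoid M1) \<and> (\<forall>p\<in>carrier M1 \<times> carrier N.
          h (frag_of p) = (if snd p \<in> M then fst p \<triangleleft>\<^bsub>M1\<^esub> \<phi> l (snd p) else \<zero>\<^bsub>M1\<^esub>))"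
        using ex_coordinate_hom[OF M1, where L = M and N = N and \<phi> = "\<phi> l", OF \<phi>(1)[OF l]] by auto
    qed
    from bchoice[OF this] obtain h1 where H1: "\<forall>l\<in>{..<k}. h1 l \<in> hom T1.Fr (add_monoid M1) \<and> (\<forall>p\<in>carrier M1 \<times> carrier N.
        h1 l (frag_of p) = (if snd p \<in> M then fst p \<triangleleft>\<^bsub>M1\<^esub> \<phi> l (snd p) else \<zero>\<^bsub>M1\<^esub>))"
      by (elim exE)
    have h1: "\<And>l. l < k \<Longrightarrow> h1 l \<in> hom T1.Fr (add_monoid M1)"
      "\<And>l p. \<lbrakk>l < k; p \<in> carrier M1 \<times> carrier N\<rbrakk> \<Longrightarrow>
        h1 l (frag_of p) = (if snd p \<in> M then fst p \<triangleleft>\<^bsub>M1\<^esub> \<phi> l (snd p) else \<zero>\<^bsub>M1\<^esub>)"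
      using H1 by auto
    have h1u: "h1 l u = \<zero>\<^bsub>M1\<^esub>" if l: "l < k" for l
    proof -
      interpret h2: group_hom T2.Fr "add_monoid M2" "h2 l"
        using h2(1)[OF l] by (simp add: group_hom_def group_hom_axioms_def gM2)
      interpret h1: group_hom T1.Fr "add_monoid M1" "h1 l"
        using h1(1)[OF l] by (simp add: group_hom_def group_hom_axioms_def gM1)
      have rel: "h2 l a = \<zero>\<^bsub>M2\<^esub>" if "a \<in> S0" for a
      proof (rule coordinate_hom_relation[OF N M2 M(2-4) \<phi>[OF l] _ h2(2)[OF l]])
        show "h2 l \<in> hom (free_Abelian_group (carrier M2 \<times> carrier N)) (add_monoid M2)"
          using h2(1)[OF l] by simp
        show "a \<in> tensor_relations (carrier R) (add_monoid M2) (ract M2) ((add_monoid N)\<lparr>carrier := M\<rparr>) (smult N)"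
          using Y(3)[of M] M(1) that by auto
      qed
      have "S0 \<subseteq> carrier T2.Fr" using S0(2) T2.relations_Fr by blast
      then have "generate T2.Fr S0 \<subseteq> kernel T2.Fr (add_monoid M2) (h2 l)"
        using rel by (intro T2.Fr.generate_subgroup_incl h2.subgroup_kernel) (auto simp: kernel_def simp del: carrier_free_Abelian_group_iff)
      then have z: "h2 l (fs u) = \<zero>\<^bsub>M2\<^esub>" using S0(3) by (auto simp: kernel_def)
      have "(f \<circ> h1 l) u = (h2 l \<circ> fs) u"
      proof (rule hom_frag_eq[OF gM2, where S' = "carrier M1 \<times> carrier N"])
        show "f \<circ> h1 l \<in> hom T1.Fr (add_monoid M2)" by (rule Group.hom_compose[OF h1(1)[OF l] f'(1)])
        show "h2 l \<circ> fs \<in> hom T1.Fr (add_monoid M2)" by (rule Group.hom_compose[OF fs(1) h2(1)[OF l]])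
        show "(f \<circ> h1 l) (frag_of p) = (h2 l \<circ> fs) (frag_of p)" if p: "p \<in> carrier M1 \<times> carrier N" for p
        proof -
          have "(f (fst p), snd p) \<in> carrier M2 \<times> carrier N" using p f' by auto
          then show ?thesis using p f' \<phi>(1)[OF l] f.hom_one
            by (auto simp: h1(2)[OF l p] h2(2)[OF l] fs(2)[OF p])
        qed
      qed (use u in auto)
      then have "f (h1 l u) = f \<zero>\<^bsub>M1\<^esub>" using z f.hom_one by simp
      then show ?thesis using inj h1.hom_closed[OF u(1)] R1.M.zero_closed by (simp add: inj_on_def)
    qed
    \<comment> \<open>On formal combinations over \<open>M\<close>, the class of \<open>v\<close> is recovered from its coordinates.\<close>
    define \<Psi> where "\<Psi> v = finprod T1.Tn (\<lambda>l. T1.pt (h1 l v) (uu l)) {..<k}" for v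
    have h1c: "h1 l v \<in> carrier M1" if "l < k" "v \<in> carrier T1.Fr" for l v
      using h1(1)[OF that(1)] that(2) by (auto simp: hom_def Pi_def)
    have \<Psi>hom: "\<Psi> \<in> hom T1.Fr T1.Tn"
    proof (rule homI)
      fix v assume v: "v \<in> carrier T1.Fr"
      show "\<Psi> v \<in> carrier T1.Tn" unfolding \<Psi>_def
        using h1c[OF _ v] uu by (intro T1.Tn.finprod_closed) (auto intro!: T1.pt_closed)
    next
      fix v w assume v: "v \<in> carrier T1.Fr" and w: "w \<in> carrier T1.Fr"
      have "\<Psi> (v \<otimes>\<^bsub>T1.Fr\<^esub> w) = finprod T1.Tn (\<lambda>l. T1.pt (h1 l v) (uu l) \<otimes>\<^bsub>T1.Tn\<^esub> T1.pt (h1 l w) (uu l)) {..<k}"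
        unfolding \<Psi>_def
      proof (rule T1.Tn.finprod_cong')
        fix l assume l: "l \<in> {..<k}"
        then have "h1 l (v \<otimes>\<^bsub>T1.Fr\<^esub> w) = h1 l v \<oplus>\<^bsub>M1\<^esub> h1 l w" using hom_mult[OF h1(1) v w] by simp
        then show "T1.pt (h1 l (v \<otimes>\<^bsub>T1.Fr\<^esub> w)) (uu l) = T1.pt (h1 l v) (uu l) \<otimes>\<^bsub>T1.Tn\<^esub> T1.pt (h1 l w) (uu l)"
          using T1.pt_add_l[of "h1 l v" "h1 l w" "uu l"] l h1c[OF _ v] h1c[OF _ w] uu by simp
      qed (use h1c[OF _ v] h1c[OF _ w] uu in \<open>auto intro!: T1.Tn.m_closed T1.pt_closed\<close>)
      also have "\<dots> = \<Psi> v \<otimes>\<^bsub>T1.Tn\<^esub> \<Psi> w" unfolding \<Psi>_def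
        using h1c[OF _ v] h1c[OF _ w] uu by (intro T1.Tn.finprod_multf) (auto intro!: T1.pt_closed)
      finally show "\<Psi> (v \<otimes>\<^bsub>T1.Fr\<^esub> w) = \<Psi> v \<otimes>\<^bsub>T1.Tn\<^esub> \<Psi> w" .
    qed
    have "T1.cl u = \<Psi> u"
    proof (rule hom_frag_eq[OF T1.Tn.group_axioms T1.cl_hom \<Psi>hom, where S' = "carrier M1 \<times> M"])
      show "Poly_Mapping.keys u \<subseteq> carrier M1 \<times> M" using u M(1) by fastforce
      show "carrier M1 \<times> M \<subseteq> carrier (add_monoid M1) \<times> carrier (add_monoid N)" using M by auto
      fix p assume "p \<in> carrier M1 \<times> M"
      then obtain x y where p: "p = (x, y)" "x \<in> carrier M1" "y \<in> M" by auto
      have y: "y \<in> carrier N" using p M by auto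
      have "\<Psi> (frag_of p) = finprod T1.Tn (\<lambda>l. T1.pt x (\<phi> l y \<odot>\<^bsub>N\<^esub> uu l)) {..<k}"
        unfolding \<Psi>_def
      proof (rule T1.Tn.finprod_cong')
        fix l assume "l \<in> {..<k}"
        then have l: "l < k" by simp
        have "h1 l (frag_of p) = x \<triangleleft>\<^bsub>M1\<^esub> \<phi> l y" using h1(2)[OF l] p y by simp
        then show "T1.pt (h1 l (frag_of p)) (uu l) = T1.pt x (\<phi> l y \<odot>\<^bsub>N\<^esub> uu l)"
          using T1.pt_bal[of x "\<phi> l y" "uu l"] p \<phi>(1)[OF l] uu[OF l] by simp
      qed (use p \<phi>(1) uu NN.smult_closed in \<open>auto intro!: T1.pt_closed\<close>)
      also have "\<dots> = T1.pt x (finprod (add_monoid N) (\<lambda>l. \<phi> l y \<odot>\<^bsub>N\<^esub> uu l) {..<k})"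
      proof -
        interpret px: group_hom "add_monoid N" T1.Tn "T1.pt x"
          using T1.pt_hom_r[of x] p by (simp add: group_hom_def group_hom_axioms_def gN)
        have "finite J \<Longrightarrow> J \<subseteq> {..<k} \<Longrightarrow> finprod T1.Tn (\<lambda>l. T1.pt x (\<phi> l y \<odot>\<^bsub>N\<^esub> uu l)) J =
          T1.pt x (finprod (add_monoid N) (\<lambda>l. \<phi> l y \<odot>\<^bsub>N\<^esub> uu l) J)" for J
        proof (induction J rule: finite_induct)
          case empty
          then show ?case using px.hom_one by (simp add: comm_monoid.finprod_empty[OF mN])
        next
          case (insert l J)
          have c: "\<phi> i y \<odot>\<^bsub>N\<^esub> uu i \<in> carrier N" if "i \<in> insert l J" for i
            using that insert.prems p \<phi>(1) uu NN.smult_closed by auto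
          have "finprod T1.Tn (\<lambda>l. T1.pt x (\<phi> l y \<odot>\<^bsub>N\<^esub> uu l)) (insert l J) =
              T1.pt x (\<phi> l y \<odot>\<^bsub>N\<^esub> uu l) \<otimes>\<^bsub>T1.Tn\<^esub> finprod T1.Tn (\<lambda>l. T1.pt x (\<phi> l y \<odot>\<^bsub>N\<^esub> uu l)) J"
            using insert c p by (intro T1.Tn.finprod_insert) (auto intro!: T1.pt_closed)
          moreover have "finprod (add_monoid N) (\<lambda>l. \<phi> l y \<odot>\<^bsub>N\<^esub> uu l) (insert l J) =
             (\<phi> l y \<odot>\<^bsub>N\<^esub> uu l) \<otimes>\<^bsub>add_monoid N\<^esub> finprod (add_monoid N) (\<lambda>l. \<phi> l y \<odot>\<^bsub>N\<^esub> uu l) J"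
            using insert c by (intro comm_monoid.finprod_insert[OF mN]) auto
          moreover have "finprod (add_monoid N) (\<lambda>l. \<phi> l y \<odot>\<^bsub>N\<^esub> uu l) J \<in> carrier (add_monoid N)"
            using c by (intro comm_monoid.finprod_closed[OF mN]) auto
          ultimately show ?case using insert c px.hom_mult by simp
        qed
        then show ?thesis by simp
      qed
      also have "finprod (add_monoid N) (\<lambda>l. \<phi> l y \<odot>\<^bsub>N\<^esub> uu l) {..<k} = y"
        using ysum[OF p(3)] by (simp add: finsum_def)
      finally show "T1.cl (frag_of p) = \<Psi> (frag_of p)" by (simp add: p T1.pt_cl)
    qed
    also have "\<Psi> u = \<one>\<^bsub>T1.Tn\<^esub>"
      unfolding \<Psi>_def
    proof (rule T1.Tn.finprod_one_eqI)
      fix l assume "l \<in> {..<k}"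
      then show "T1.pt (h1 l u) (uu l) = \<one>\<^bsub>T1.Tn\<^esub>" using h1u T1.pt_one_l[of "uu l"] uu by simp
    qed
    finally show ?thesis using u by simp
  qed
  show ?thesis
    unfolding module_tensor_def
    by (rule F.inj_on_one_iff[THEN iffD2]) (use main in blast)
qed

text \<open>
  The inverse of the map from the cokernel of \<open>M1 \<otimes> N \<rightarrow> M2 \<otimes> N\<close> to \<open>M3 \<otimes> N\<close> sends \<open>x \<otimes> y\<close> to the
  class of \<open>x' \<otimes> y\<close> for any preimage \<open>x'\<close> of \<open>x\<close>; two preimages differ by an element of \<open>M1\<close>.
\<close>

lemma tensor_right_exact:
  assumes N: "left_module R N" and M1: "right_module R M1" and M2: "right_module R M2" and M3: "right_module R M3"
    and f: "f \<in> right_module_hom R M1 M2" and g: "g \<in> right_module_hom R M2 M3"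
    and ker: "f ` carrier M1 = kernel (add_monoid M2) (add_monoid M3) g"
    and surj: "g ` carrier M2 = carrier M3"
  shows "module_tensor_map R M2 N f ` carrier (module_tensor R M1 N) =
      kernel (module_tensor R M2 N) (module_tensor R M3 N) (module_tensor_map R M3 N g)"
    and "module_tensor_map R M3 N g ` carrier (module_tensor R M2 N) = carrier (module_tensor R M3 N)"
proof -
  interpret NN: left_module R N by fact
  interpret R1: right_module R M1 by fact
  interpret R2: right_module R M2 by fact
  interpret R3: right_module R M3 by fact
  interpret T1: tensor_data "carrier R" "add_monoid M1" "ract M1" "add_monoid N" "smult N"
    by (rule tensor_data_modules[OF N M1])
  interpret T2: tensor_data "carrier R" "add_monoid M2" "ract M2" "add_monoid N" "smult N"
    by (rule tensor_data_modules[OF N M2])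
  interpret T3: tensor_data "carrier R" "add_monoid M3" "ract M3" "add_monoid N" "smult N"
    by (rule tensor_data_modules[OF N M3])
  note f' = right_module_homD[OF f] and g' = right_module_homD[OF g]
  let ?f = "module_tensor_map R M2 N f" and ?g = "module_tensor_map R M3 N g"
  have fh: "?f \<in> hom T1.Tn T2.Tn" and fp: "\<And>x y. \<lbrakk>x \<in> carrier M1; y \<in> carrier N\<rbrakk> \<Longrightarrow> ?f (T1.pt x y) = T2.pt (f x) y"
    using module_tensor_map_props[OF N M1 M2 f] by (auto simp: module_tensor_def)
  have gh: "?g \<in> hom T2.Tn T3.Tn" and gp: "\<And>x y. \<lbrakk>x \<in> carrier M2; y \<in> carrier N\<rbrakk> \<Longrightarrow> ?g (T2.pt x y) = T3.pt (g x) y"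
    using module_tensor_map_props[OF N M2 M3 g] by (auto simp: module_tensor_def)
  interpret F: group_hom T1.Tn T2.Tn ?f by (simp add: group_hom_def group_hom_axioms_def fh)
  interpret G: group_hom T2.Tn T3.Tn ?g by (simp add: group_hom_def group_hom_axioms_def gh)
  have gf: "g (f x) = \<zero>\<^bsub>M3\<^esub>" if "x \<in> carrier M1" for x
    using ker that by (auto simp: kernel_def)
  show surjT: "?g ` carrier (module_tensor R M2 N) = carrier (module_tensor R M3 N)"
    unfolding module_tensor_def
  proof
    show "?g ` carrier T2.Tn \<subseteq> carrier T3.Tn" using G.hom_closed by blast
    show "carrier T3.Tn \<subseteq> ?g ` carrier T2.Tn"
    proof
      fix t assume "t \<in> carrier T3.Tn"
      then show "t \<in> ?g ` carrier T2.Tn"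
      proof (induction rule: T3.Tn_induct)
        case (pure x y)
        then obtain x' where "x' \<in> carrier M2" "x = g x'" using surj by auto
        then show ?case using gp[of x' y] pure by (intro image_eqI[of _ _ "T2.pt x' y"]) auto
      next
        case (mult u v)
        then obtain a b where ab: "a \<in> carrier T2.Tn" "b \<in> carrier T2.Tn" "u = ?g a" "v = ?g b" by blast
        then have "u \<otimes>\<^bsub>T3.Tn\<^esub> v = ?g (a \<otimes>\<^bsub>T2.Tn\<^esub> b)" by simp
        then show ?case using ab by blast
      qed
    qed
  qed
  have gf1: "?g (?f t) = \<one>\<^bsub>T3.Tn\<^esub>" if "t \<in> carrier T1.Tn" for t
    using that
  proof (induction rule: T1.Tn_induct)
    case (pure x y)
    then show ?case using f' gf T3.pt_one_l[of y] by (simp add: fp gp)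
  next
    case (mult u v)
    then show ?case by simp
  qed
  let ?I = "?f ` carrier T1.Tn"
  have I: "subgroup ?I T2.Tn" by (rule F.img_is_subgroup)
  let ?Q = "T2.Tn Mod ?I"
  have Q: "comm_group ?Q" by (rule T2.Tn.abelian_FactGroup[OF I])
  interpret Q: comm_group ?Q by (rule Q)
  have nI: "?I \<lhd> T2.Tn" by (rule T2.Tn.subgroup_imp_normal[OF I])
  define q where "q t = ?I #>\<^bsub>T2.Tn\<^esub> t" for t
  have qh: "q \<in> hom T2.Tn ?Q" unfolding q_def[abs_def] by (rule normal.r_coset_hom_Mod[OF nI])
  interpret q: group_hom T2.Tn ?Q q by (simp add: group_hom_def group_hom_axioms_def qh)
  have q1: "q t = \<one>\<^bsub>?Q\<^esub>" if "t \<in> ?I" for t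
    using T2.Tn.coset_join2[OF _ I that] subgroup.subset[OF I] that by (auto simp: q_def FactGroup_def)
  have q1D: "t \<in> ?I" if "q t = \<one>\<^bsub>?Q\<^esub>" "t \<in> carrier T2.Tn" for t
    using T2.Tn.coset_join1[OF _ that(2) I] subgroup.subset[OF I] that by (auto simp: q_def FactGroup_def)
  define s where "s x = (SOME x'. x' \<in> carrier M2 \<and> g x' = x)" for x
  have s: "s x \<in> carrier M2" "g (s x) = x" if "x \<in> carrier M3" for x
  proof -
    have "x \<in> g ` carrier M2" using surj that by simp
    then have "\<exists>x'. x' \<in> carrier M2 \<and> g x' = x" by blast
    from someI_ex[OF this] show "s x \<in> carrier M2" "g (s x) = x" by (auto simp: s_def)
  qed
  have indep: "q (T2.pt x y) = q (T2.pt x' y)" if x: "x \<in> carrier M2" "x' \<in> carrier M2" "g x = g x'" and y: "y \<in> carrier N" for x x' y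
  proof -
    have "g (x \<oplus>\<^bsub>M2\<^esub> \<ominus>\<^bsub>M2\<^esub> x') = \<zero>\<^bsub>M3\<^esub>"
    proof -
      have "g (x \<oplus>\<^bsub>M2\<^esub> \<ominus>\<^bsub>M2\<^esub> x') \<oplus>\<^bsub>M3\<^esub> g x' = g x"
        using x g' by (simp add: g'(3)[symmetric] R2.M.a_assoc R2.M.l_neg)
      then show ?thesis using x g' R3.M.add.r_cancel_one[of "g x'" "g (x \<oplus>\<^bsub>M2\<^esub> \<ominus>\<^bsub>M2\<^esub> x')"] by simp
    qed
    then have "x \<oplus>\<^bsub>M2\<^esub> \<ominus>\<^bsub>M2\<^esub> x' \<in> f ` carrier M1" unfolding ker using x by (auto simp: kernel_def)
    then obtain w where w: "w \<in> carrier M1" "x \<oplus>\<^bsub>M2\<^esub> \<ominus>\<^bsub>M2\<^esub> x' = f w" by blast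
    have "x = (x \<oplus>\<^bsub>M2\<^esub> \<ominus>\<^bsub>M2\<^esub> x') \<oplus>\<^bsub>M2\<^esub> x'" using x by (simp add: R2.M.a_assoc R2.M.l_neg)
    then have "x = f w \<oplus>\<^bsub>M2\<^esub> x'" using w by simp
    then have eq: "T2.pt x y = T2.pt (f w) y \<otimes>\<^bsub>T2.Tn\<^esub> T2.pt x' y"
      using T2.pt_add_l[of "f w" x' y] w x y f' by simp
    have m1: "T2.pt (f w) y \<in> ?I" using fp[OF w(1) y] T1.pt_closed[of w y] w y by auto
    have m2: "T2.pt (f w) y \<in> carrier T2.Tn" "T2.pt x' y \<in> carrier T2.Tn"
      using T2.pt_closed w x y f' by auto
    have "q (T2.pt x y) = \<one>\<^bsub>?Q\<^esub> \<otimes>\<^bsub>?Q\<^esub> q (T2.pt x' y)"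
      by (simp only: eq q.hom_mult[OF m2] q1[OF m1])
    then show ?thesis by (simp only: Q.l_one[OF q.hom_closed[OF m2(2)]])
  qed
  have lift: "tensor_lift ?Q (\<lambda>x y. q (T2.pt (s x) y)) \<in> hom T3.Tn ?Q"
    "\<And>x y. \<lbrakk>x \<in> carrier M3; y \<in> carrier N\<rbrakk> \<Longrightarrow> tensor_lift ?Q (\<lambda>x y. q (T2.pt (s x) y)) (T3.pt x y) = q (T2.pt (s x) y)"
  proof -
    have a: "q (T2.pt (s x) y) \<in> carrier ?Q" if "x \<in> carrier (add_monoid M3)" "y \<in> carrier (add_monoid N)" for x y
      using that s by (intro q.hom_closed T2.pt_closed) auto
    have b: "q (T2.pt (s (x \<otimes>\<^bsub>add_monoid M3\<^esub> x')) y) = q (T2.pt (s x) y) \<otimes>\<^bsub>?Q\<^esub> q (T2.pt (s x') y)"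
      if "x \<in> carrier (add_monoid M3)" "x' \<in> carrier (add_monoid M3)" "y \<in> carrier (add_monoid N)" for x x' y
    proof -
      have "q (T2.pt (s (x \<oplus>\<^bsub>M3\<^esub> x')) y) = q (T2.pt (s x \<oplus>\<^bsub>M2\<^esub> s x') y)"
        using that s g' by (intro indep) auto
      also have "T2.pt (s x \<oplus>\<^bsub>M2\<^esub> s x') y = T2.pt (s x) y \<otimes>\<^bsub>T2.Tn\<^esub> T2.pt (s x') y"
        using T2.pt_add_l[of "s x" "s x'" y] that s by simp
      also have "q \<dots> = q (T2.pt (s x) y) \<otimes>\<^bsub>?Q\<^esub> q (T2.pt (s x') y)"
        using that s by (intro q.hom_mult T2.pt_closed) auto
      finally show ?thesis by simp
    qed
    have c: "q (T2.pt (s x) (y \<otimes>\<^bsub>add_monoid N\<^esub> y')) = q (T2.pt (s x) y) \<otimes>\<^bsub>?Q\<^esub> q (T2.pt (s x) y')"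
      if "x \<in> carrier (add_monoid M3)" "y \<in> carrier (add_monoid N)" "y' \<in> carrier (add_monoid N)" for x y y'
    proof -
      have sx: "s x \<in> carrier (add_monoid M2)" using that s by simp
      show ?thesis
        unfolding T2.pt_add_r[OF sx that(2,3)] by (rule q.hom_mult[OF T2.pt_closed[OF sx that(2)] T2.pt_closed[OF sx that(3)]])
    qed
    have d: "q (T2.pt (s (x \<triangleleft>\<^bsub>M3\<^esub> r)) y) = q (T2.pt (s x) (r \<odot>\<^bsub>N\<^esub> y))"
      if "x \<in> carrier (add_monoid M3)" "r \<in> carrier R" "y \<in> carrier (add_monoid N)" for x r y
    proof -
      have "q (T2.pt (s (x \<triangleleft>\<^bsub>M3\<^esub> r)) y) = q (T2.pt (s x \<triangleleft>\<^bsub>M2\<^esub> r) y)"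
        using that s g' R3.ract_closed R2.ract_closed by (intro indep) auto
      then show ?thesis using T2.pt_bal[of "s x" r y] that s by simp
    qed
    show "tensor_lift ?Q (\<lambda>x y. q (T2.pt (s x) y)) \<in> hom T3.Tn ?Q"
      by (rule T3.tensor_lift_hom[OF Q a b c d])
    show "tensor_lift ?Q (\<lambda>x y. q (T2.pt (s x) y)) (T3.pt x y) = q (T2.pt (s x) y)"
      if "x \<in> carrier M3" "y \<in> carrier N" for x y
      by (rule T3.tensor_lift_pt[OF Q a b c d]) (use that in auto)
  qed
  let ?\<beta> = "tensor_lift ?Q (\<lambda>x y. q (T2.pt (s x) y))"
  interpret \<beta>: group_hom T3.Tn ?Q ?\<beta> by (simp add: group_hom_def group_hom_axioms_def lift(1))
  have \<beta>g: "?\<beta> (?g t) = q t" if t: "t \<in> carrier T2.Tn" for t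
  proof -
    have "(?\<beta> \<circ> ?g) t = q t"
    proof (rule T2.hom_Tn_eqI[OF Group.hom_compose[OF gh lift(1)] qh t])
      fix x y assume xy: "x \<in> carrier (add_monoid M2)" "y \<in> carrier (add_monoid N)"
      have "?\<beta> (?g (T2.pt x y)) = q (T2.pt (s (g x)) y)" using xy gp g' lift(2) by simp
      also have "\<dots> = q (T2.pt x y)" using xy g' s[of "g x"] by (intro indep) auto
      finally show "(?\<beta> \<circ> ?g) (T2.pt x y) = q (T2.pt x y)" by simp
    qed
    then show ?thesis by simp
  qed
  show "?f ` carrier (module_tensor R M1 N) = kernel (module_tensor R M2 N) (module_tensor R M3 N) ?g"
    unfolding module_tensor_def
  proof
    show "?I \<subseteq> kernel T2.Tn T3.Tn ?g" using gf1 F.hom_closed by (auto simp: kernel_def)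
    show "kernel T2.Tn T3.Tn ?g \<subseteq> ?I"
    proof
      fix t assume "t \<in> kernel T2.Tn T3.Tn ?g"
      then have t: "t \<in> carrier T2.Tn" "?g t = \<one>\<^bsub>T3.Tn\<^esub>" by (auto simp: kernel_def)
      have "q t = \<one>\<^bsub>?Q\<^esub>" using \<beta>g[OF t(1)] t(2) \<beta>.hom_one by simp
      then show "t \<in> ?I" using q1D t by blast
    qed
  qed
qed

theorem locally_dual_basis_imp_flat:
  assumes N: "left_module R N" and ldb: "locally_dual_basis R N"
  shows "flat_left_module TYPE('m1) TYPE('m2) TYPE('m3) R N"
  unfolding flat_left_module_def
proof (intro conjI allI impI)
  show "left_module R N" by (rule N)
  fix M1 :: "('a, 'm1) right_module" and M2 :: "('a, 'm2) right_module" and M3 :: "('a, 'm3) right_module" and f g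
  assume H: "right_module R M1 \<and> right_module R M2 \<and> right_module R M3 \<and>
      f \<in> right_module_hom R M1 M2 \<and> g \<in> right_module_hom R M2 M3 \<and>
      short_exact (add_monoid M1) (add_monoid M2) (add_monoid M3) f g"
  then have M: "right_module R M1" "right_module R M2" "right_module R M3"
    and fg: "f \<in> right_module_hom R M1 M2" "g \<in> right_module_hom R M2 M3"
    and ex: "inj_on f (carrier M1)" "f ` carrier M1 = kernel (add_monoid M2) (add_monoid M3) g"
      "g ` carrier M2 = carrier M3"
    by (auto simp: short_exact_def)
  show "short_exact (module_tensor R M1 N) (module_tensor R M2 N) (module_tensor R M3 N)
        (module_tensor_map R M2 N f) (module_tensor_map R M3 N g)"
    unfolding short_exact_def
    using module_tensor_map_props(1)[OF N M(1,2) fg(1)] module_tensor_map_props(1)[OF N M(2,3) fg(2)]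
      tensor_map_inj[OF N M(1,2) fg(1) ex(1) ldb] tensor_right_exact[OF N M fg ex(2,3)]
    by blast
qed


section \<open>Superalgebras and their tensor squares\<close>

locale super_alg = A?: ring A for A :: "('k, 'a, 'y) superalgebra_scheme" (structure) +
  fixes K :: "('k, 'x) ring_scheme"
  assumes super: "superalgebra K A"
begin

lemma field_K: "field K" using super by (simp add: superalgebra_def)
sublocale K: field K by (rule field_K)
lemma module_A: "module K A" using super by (simp add: superalgebra_def)
sublocale Mo: module K A by (rule module_A)

abbreviation "ev \<equiv> hom_comp A 0"
abbreviation "od \<equiv> hom_comp A 1"
abbreviation "sc k \<equiv> k \<odot> \<one>"

lemma smult_mult:
  "\<lbrakk>k \<in> carrier K; x \<in> carrier A; y \<in> carrier A\<rbrakk> \<Longrightarrow> (k \<odot> x) \<otimes> y = k \<odot> (x \<otimes> y)"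
  "\<lbrakk>k \<in> carrier K; x \<in> carrier A; y \<in> carrier A\<rbrakk> \<Longrightarrow> x \<otimes> (k \<odot> y) = k \<odot> (x \<otimes> y)"
  using super by (auto simp: superalgebra_def)

lemma sc_mult: "\<lbrakk>k \<in> carrier K; x \<in> carrier A\<rbrakk> \<Longrightarrow> sc k \<otimes> x = k \<odot> x"
  using smult_mult(1)[of k \<one> x] by simp

lemma homog_sub: "subgroup (homog A i) (add_monoid A)"
  using super unfolding superalgebra_def by blast

lemma homog_carr: "x \<in> homog A i \<Longrightarrow> x \<in> carrier A"
  using subgroup.subset[OF homog_sub] by fastforce
lemma homog_add: "\<lbrakk>x \<in> homog A i; y \<in> homog A i\<rbrakk> \<Longrightarrow> x \<oplus> y \<in> homog A i"
  using subgroup.m_closed[OF homog_sub] by fastforce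
lemma homog_zero: "\<zero> \<in> homog A i"
  using subgroup.one_closed[OF homog_sub] by fastforce
lemma homog_minus: "x \<in> homog A i \<Longrightarrow> \<ominus> x \<in> homog A i"
  using subgroup.m_inv_closed[OF homog_sub] by (simp add: a_inv_def)
lemma homog_smult: "\<lbrakk>k \<in> carrier K; x \<in> homog A i\<rbrakk> \<Longrightarrow> k \<odot> x \<in> homog A i"
  using super unfolding superalgebra_def by blast
lemma homog_one: "\<one> \<in> homog A 0" using super unfolding superalgebra_def by blast
lemma homog_mult: "\<lbrakk>x \<in> homog A i; y \<in> homog A j\<rbrakk> \<Longrightarrow> x \<otimes> y \<in> homog A (i + j)"
  using super unfolding superalgebra_def by blast
lemma homog_disj: "\<lbrakk>x \<in> homog A 0; x \<in> homog A 1\<rbrakk> \<Longrightarrow> x = \<zero>"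
  using super unfolding superalgebra_def by blast
lemma homog_cases: assumes "x \<in> carrier A" obtains a b where "a \<in> homog A 0" "b \<in> homog A 1" "x = a \<oplus> b"
proof -
  have "carrier A = homog A 0 <+> homog A 1" using super unfolding superalgebra_def by blast
  then have "x \<in> homog A 0 <+> homog A 1" using assms by simp
  then show ?thesis using that by (auto simp: set_add_def set_mult_def)
qed

lemma homog_unique:
  assumes "a \<in> homog A 0" "b \<in> homog A 1" "a' \<in> homog A 0" "b' \<in> homog A 1" "a \<oplus> b = a' \<oplus> b'"
  shows "a = a'" "b = b'"
proof -
  note c = homog_carr[OF assms(1)] homog_carr[OF assms(2)] homog_carr[OF assms(3)] homog_carr[OF assms(4)]
  have "a \<oplus> \<ominus> a' = (a \<oplus> b) \<oplus> \<ominus> b \<oplus> \<ominus> a'" using c by (simp add: a_assoc r_neg)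
  also have "\<dots> = (a' \<oplus> b') \<oplus> \<ominus> b \<oplus> \<ominus> a'" using assms(5) by simp
  also have "\<dots> = b' \<oplus> \<ominus> b"
  proof -
    have "(a' \<oplus> b') \<oplus> \<ominus> b \<oplus> \<ominus> a' = \<ominus> a' \<oplus> (a' \<oplus> (b' \<oplus> \<ominus> b))"
      using c by (simp add: a_assoc a_comm[of _ "\<ominus> a'"])
    then show ?thesis using c by (simp add: r_neg1)
  qed
  finally have eq: "a \<oplus> \<ominus> a' = b' \<oplus> \<ominus> b" .
  have "a \<oplus> \<ominus> a' \<in> homog A 0" "b' \<oplus> \<ominus> b \<in> homog A 1"
    using assms homog_add homog_minus by auto
  then have z: "a \<oplus> \<ominus> a' = \<zero>" "b' \<oplus> \<ominus> b = \<zero>" using homog_disj eq by auto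
  then show "a = a'" "b = b'" using c by (metis a_minus_def r_right_minus_eq)+
qed

lemma comp_eq:
  assumes "a \<in> homog A 0" "b \<in> homog A 1"
  shows "ev (a \<oplus> b) = a" "od (a \<oplus> b) = b"
proof -
  note c = homog_carr[OF assms(1)] homog_carr[OF assms(2)]
  show "ev (a \<oplus> b) = a"
    unfolding hom_comp_def
  proof (rule the_equality)
    show "a \<in> homog A 0 \<and> (\<exists>z\<in>homog A (0 + 1). a \<oplus> b = a \<oplus> z)" using assms by auto
    fix y assume "y \<in> homog A 0 \<and> (\<exists>z\<in>homog A (0 + 1). a \<oplus> b = y \<oplus> z)"
    then obtain z where "y \<in> homog A 0" "z \<in> homog A 1" "a \<oplus> b = y \<oplus> z" by auto
    then show "y = a" using homog_unique(1)[OF assms] by metis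
  qed
  show "od (a \<oplus> b) = b"
    unfolding hom_comp_def
  proof (rule the_equality)
    show "b \<in> homog A 1 \<and> (\<exists>z\<in>homog A (1 + 1). a \<oplus> b = b \<oplus> z)" using assms c a_comm by auto
    fix y assume "y \<in> homog A 1 \<and> (\<exists>z\<in>homog A (1 + 1). a \<oplus> b = y \<oplus> z)"
    then obtain z where z: "y \<in> homog A 1" "z \<in> homog A 0" "a \<oplus> b = y \<oplus> z" by auto
    then have "a \<oplus> b = z \<oplus> y" using a_comm homog_carr by metis
    then show "y = b" using homog_unique(2)[OF assms z(2,1)] by simp
  qed
qed

lemma comp:
  assumes "x \<in> carrier A"
  shows "ev x \<in> homog A 0" "od x \<in> homog A 1" "ev x \<oplus> od x = x"
proof -
  obtain a b where "a \<in> homog A 0" "b \<in> homog A 1" "x = a \<oplus> b" by (rule homog_cases[OF assms])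
  then show "ev x \<in> homog A 0" "od x \<in> homog A 1" "ev x \<oplus> od x = x" using comp_eq by auto
qed

lemma comp_carr [simp]: "x \<in> carrier A \<Longrightarrow> ev x \<in> carrier A" "x \<in> carrier A \<Longrightarrow> od x \<in> carrier A"
  by (simp_all add: homog_carr[OF comp(1)] homog_carr[OF comp(2)])

lemma comp_uniq: "\<lbrakk>a \<in> homog A 0; b \<in> homog A 1; x = a \<oplus> b\<rbrakk> \<Longrightarrow> ev x = a \<and> od x = b"
  using comp_eq by simp

lemma comp_homog0: "x \<in> homog A 0 \<Longrightarrow> ev x = x \<and> od x = \<zero>"
  by (rule comp_uniq) (auto simp: homog_zero homog_carr)
lemma comp_homog1: "x \<in> homog A 1 \<Longrightarrow> ev x = \<zero> \<and> od x = x"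
  by (rule comp_uniq) (auto simp: homog_zero homog_carr)

lemma comp_add:
  assumes "x \<in> carrier A" "y \<in> carrier A"
  shows "ev (x \<oplus> y) = ev x \<oplus> ev y" "od (x \<oplus> y) = od x \<oplus> od y"
proof -
  have "x \<oplus> y = (ev x \<oplus> od x) \<oplus> (ev y \<oplus> od y)" using assms by (simp add: comp)
  also have "\<dots> = (ev x \<oplus> ev y) \<oplus> (od x \<oplus> od y)" using assms comp_carr by (simp add: a_ac)
  finally have "ev (x \<oplus> y) = ev x \<oplus> ev y \<and> od (x \<oplus> y) = od x \<oplus> od y"
    by (intro comp_uniq homog_add comp assms)
  then show "ev (x \<oplus> y) = ev x \<oplus> ev y" "od (x \<oplus> y) = od x \<oplus> od y" by auto
qed

lemma comp_smult:
  assumes "k \<in> carrier K" "x \<in> carrier A"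
  shows "ev (k \<odot> x) = k \<odot> ev x" "od (k \<odot> x) = k \<odot> od x"
proof -
  have "k \<odot> x = k \<odot> (ev x \<oplus> od x)" using assms by (simp add: comp)
  also have "\<dots> = k \<odot> ev x \<oplus> k \<odot> od x" using assms by (simp add: Mo.smult_r_distr)
  finally have "ev (k \<odot> x) = k \<odot> ev x \<and> od (k \<odot> x) = k \<odot> od x"
    by (intro comp_uniq homog_smult comp assms)
  then show "ev (k \<odot> x) = k \<odot> ev x" "od (k \<odot> x) = k \<odot> od x" by auto
qed

lemma comp_mult:
  assumes "x \<in> carrier A" "y \<in> carrier A"
  shows "ev (x \<otimes> y) = ev x \<otimes> ev y \<oplus> od x \<otimes> od y" "od (x \<otimes> y) = ev x \<otimes> od y \<oplus> od x \<otimes> ev y"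
proof -
  have "x \<otimes> y = (ev x \<oplus> od x) \<otimes> (ev y \<oplus> od y)" using assms by (simp add: comp)
  also have "\<dots> = (ev x \<otimes> ev y \<oplus> od x \<otimes> od y) \<oplus> (ev x \<otimes> od y \<oplus> od x \<otimes> ev y)"
    using assms by (simp add: l_distr r_distr a_ac)
  finally have eq: "x \<otimes> y = (ev x \<otimes> ev y \<oplus> od x \<otimes> od y) \<oplus> (ev x \<otimes> od y \<oplus> od x \<otimes> ev y)" .
  have "ev x \<otimes> ev y \<in> homog A 0" "od x \<otimes> od y \<in> homog A 0" "ev x \<otimes> od y \<in> homog A 1" "od x \<otimes> ev y \<in> homog A 1"
    using homog_mult[OF comp(1) comp(1), of x y] homog_mult[OF comp(2) comp(2), of x y]
      homog_mult[OF comp(1) comp(2), of x y] homog_mult[OF comp(2) comp(1), of x y] assms by auto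
  then have "ev (x \<otimes> y) = ev x \<otimes> ev y \<oplus> od x \<otimes> od y \<and> od (x \<otimes> y) = ev x \<otimes> od y \<oplus> od x \<otimes> ev y"
    by (intro comp_uniq[OF _ _ eq] homog_add)
  then show "ev (x \<otimes> y) = ev x \<otimes> ev y \<oplus> od x \<otimes> od y" "od (x \<otimes> y) = ev x \<otimes> od y \<oplus> od x \<otimes> ev y" by auto
qed

definition th where "th x = ev x \<ominus> od x"

lemma th_carr [simp]: "x \<in> carrier A \<Longrightarrow> th x \<in> carrier A" by (simp add: th_def)

lemma comp_comp [simp]:
  "x \<in> carrier A \<Longrightarrow> ev (ev x) = ev x" "x \<in> carrier A \<Longrightarrow> od (ev x) = \<zero>"
  "x \<in> carrier A \<Longrightarrow> ev (od x) = \<zero>" "x \<in> carrier A \<Longrightarrow> od (od x) = od x"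
  using comp_homog0 comp_homog1 comp by auto

lemma th_add: "\<lbrakk>x \<in> carrier A; y \<in> carrier A\<rbrakk> \<Longrightarrow> th (x \<oplus> y) = th x \<oplus> th y"
  by (simp add: th_def comp_add a_minus_def minus_add a_ac)

lemma th_smult: "\<lbrakk>k \<in> carrier K; x \<in> carrier A\<rbrakk> \<Longrightarrow> th (k \<odot> x) = k \<odot> th x"
  by (simp add: th_def comp_smult a_minus_def Mo.smult_r_distr Mo.smult_r_minus)

lemma comp_minus: "x \<in> carrier A \<Longrightarrow> ev (\<ominus> x) = \<ominus> ev x" "x \<in> carrier A \<Longrightarrow> od (\<ominus> x) = \<ominus> od x"
proof -
  assume x: "x \<in> carrier A"
  have "\<ominus> x = \<ominus> (ev x \<oplus> od x)" using x by (simp add: comp)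
  also have "\<dots> = \<ominus> ev x \<oplus> \<ominus> od x" using x by (simp add: minus_add)
  finally have "ev (\<ominus> x) = \<ominus> ev x \<and> od (\<ominus> x) = \<ominus> od x"
    using x by (intro comp_uniq homog_minus comp)
  then show "ev (\<ominus> x) = \<ominus> ev x" "od (\<ominus> x) = \<ominus> od x" by auto
qed

lemma comp_th: "x \<in> carrier A \<Longrightarrow> ev (th x) = ev x" "x \<in> carrier A \<Longrightarrow> od (th x) = \<ominus> od x"
  by (simp_all add: th_def a_minus_def comp_add comp_minus)

lemma th_th: "x \<in> carrier A \<Longrightarrow> th (th x) = x"
  unfolding th_def[of "th x"] by (simp add: comp_th a_minus_def comp)

lemma th_mult: "\<lbrakk>x \<in> carrier A; y \<in> carrier A\<rbrakk> \<Longrightarrow> th (x \<otimes> y) = th x \<otimes> th y"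
  by (simp add: th_def comp_mult a_minus_def l_distr r_distr l_minus r_minus minus_add a_ac)

abbreviation "RR \<equiv> super_tensor K A A"
abbreviation "TT \<equiv> super_tensor_group K A A"
abbreviation "tt \<equiv> super_pure K A A"

sublocale T: tensor_data "carrier K" "add_monoid A" "\<lambda>x k. k \<odot> x" "add_monoid A" "smult A"
  unfolding tensor_data_def tensor_data_axioms_def by (auto intro: A.a_comm_group)

lemma TT_eq: "T.Tn = TT" by (simp add: super_tensor_group_def)
lemma tt_eq: "T.pt = tt" by (simp add: super_pure_def)

lemma RR_simps:
  "carrier RR = carrier TT" "ring.add RR = monoid.mult TT" "ring.zero RR = monoid.one TT" "monoid.one RR = tt \<one> \<one>"
  by (simp_all add: super_tensor_def Let_def)

lemma TT_comm_group: "comm_group TT" using T.Tn.comm_group_axioms by (simp add: TT_eq)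

lemma add_monoid_cong_comm_group:
  assumes "comm_group G" "carrier H = carrier G" "monoid.mult H = monoid.mult G" "monoid.one H = monoid.one G"
  shows "comm_group H"
proof -
  interpret comm_group G by fact
  show ?thesis
    by (rule comm_groupI) (use assms m_assoc m_comm l_inv_ex in auto)
qed

lemma RR_abelian_group: "abelian_group RR"
proof -
  have "comm_group (add_monoid RR)"
    by (rule add_monoid_cong_comm_group[OF TT_comm_group]) (simp_all add: RR_simps)
  then show ?thesis
    by (simp add: abelian_group_def abelian_group_axioms_def abelian_monoid_def comm_group_def)
qed

sublocale RR: abelian_group RR by (rule RR_abelian_group)

lemma hom_RR: "hom TT H = hom (add_monoid RR) H"
  by (simp add: hom_def RR_simps)

lemma tt_closed [simp]: "\<lbrakk>x \<in> carrier A; y \<in> carrier A\<rbrakk> \<Longrightarrow> tt x y \<in> carrier RR"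
  using T.pt_closed by (simp add: TT_eq tt_eq RR_simps)
lemma tt_add_l: "\<lbrakk>x \<in> carrier A; x' \<in> carrier A; y \<in> carrier A\<rbrakk> \<Longrightarrow> tt (x \<oplus> x') y = tt x y \<oplus>\<^bsub>RR\<^esub> tt x' y"
  using T.pt_add_l[of x x' y] by (simp add: TT_eq tt_eq RR_simps)
lemma tt_add_r: "\<lbrakk>x \<in> carrier A; y \<in> carrier A; y' \<in> carrier A\<rbrakk> \<Longrightarrow> tt x (y \<oplus> y') = tt x y \<oplus>\<^bsub>RR\<^esub> tt x y'"
  using T.pt_add_r[of x y y'] by (simp add: TT_eq tt_eq RR_simps)
lemma tt_bal: "\<lbrakk>k \<in> carrier K; x \<in> carrier A; y \<in> carrier A\<rbrakk> \<Longrightarrow> tt (k \<odot> x) y = tt x (k \<odot> y)"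
  using T.pt_bal[of x k y] by (simp add: tt_eq)

lemma RR_induct [consumes 1, case_names pure add]:
  assumes "r \<in> carrier RR" "\<And>x y. \<lbrakk>x \<in> carrier A; y \<in> carrier A\<rbrakk> \<Longrightarrow> P (tt x y)"
    "\<And>u v. \<lbrakk>u \<in> carrier RR; v \<in> carrier RR; P u; P v\<rbrakk> \<Longrightarrow> P (u \<oplus>\<^bsub>RR\<^esub> v)"
  shows "P r"
  using T.Tn_induct[of r P] assms by (simp add: TT_eq tt_eq RR_simps)

lemma
  assumes L: "comm_group L"
    and f: "\<And>x y. \<lbrakk>x \<in> carrier A; y \<in> carrier A\<rbrakk> \<Longrightarrow> f x y \<in> carrier L"
    and fl: "\<And>x x' y. \<lbrakk>x \<in> carrier A; x' \<in> carrier A; y \<in> carrier A\<rbrakk> \<Longrightarrow> f (x \<oplus> x') y = f x y \<otimes>\<^bsub>L\<^esub> f x' y"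
    and fr: "\<And>x y y'. \<lbrakk>x \<in> carrier A; y \<in> carrier A; y' \<in> carrier A\<rbrakk> \<Longrightarrow> f x (y \<oplus> y') = f x y \<otimes>\<^bsub>L\<^esub> f x y'"
    and fb: "\<And>x k y. \<lbrakk>x \<in> carrier A; k \<in> carrier K; y \<in> carrier A\<rbrakk> \<Longrightarrow> f (k \<odot> x) y = f x (k \<odot> y)"
  shows RR_lift_hom: "tensor_lift L f \<in> hom (add_monoid RR) L"
    and RR_lift_tt: "\<lbrakk>x \<in> carrier A; y \<in> carrier A\<rbrakk> \<Longrightarrow> tensor_lift L f (tt x y) = f x y"
  using T.tensor_lift_hom[OF L, of f] T.tensor_lift_pt[OF L, of f] f fl fr fb
  by (simp_all add: TT_eq tt_eq hom_RR)

lemma hom_RR_eqI: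
  assumes "h \<in> hom (add_monoid RR) L" "k \<in> hom (add_monoid RR) L" "r \<in> carrier RR"
    "\<And>x y. \<lbrakk>x \<in> carrier A; y \<in> carrier A\<rbrakk> \<Longrightarrow> h (tt x y) = k (tt x y)"
  shows "h r = k r"
  using T.hom_Tn_eqI[of h L k r] assms by (simp add: TT_eq tt_eq hom_RR RR_simps)

text \<open>
  The product of two pure tensors, as a function of four arguments that is lifted first in the
  last two of them and then in the first two.
\<close>

definition pure_mult where
  "pure_mult a b c d = finprod TT (\<lambda>(i, j). tt (super_sign A i j (a \<otimes> hom_comp A j c)) (hom_comp A i b \<otimes> d)) UNIV"

lemma UNIV_bit_bit: "(UNIV :: (bit \<times> bit) set) = {(0, 0), (1, 0), (0, 1), (1, 1)}"
proof -
  have "p \<in> {(0, 0), (1, 0), (0, 1), (1, 1)}" for p :: "bit \<times> bit"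
    by (cases p; cases "fst p"; cases "snd p") auto
  then show ?thesis by auto
qed

lemma pure_mult_eq:
  assumes "a \<in> carrier A" "b \<in> carrier A" "c \<in> carrier A" "d \<in> carrier A"
  shows "pure_mult a b c d = tt (a \<otimes> ev c) (b \<otimes> d) \<oplus>\<^bsub>RR\<^esub> tt (a \<otimes> od c) (th b \<otimes> d)"
proof -
  interpret TT: comm_group TT by (rule TT_comm_group)
  let ?f = "\<lambda>(i, j). tt (super_sign A i j (a \<otimes> hom_comp A j c)) (hom_comp A i b \<otimes> d)"
  have cl: "tt x y \<in> carrier TT" if "x \<in> carrier A" "y \<in> carrier A" for x y
    using tt_closed[OF that] by (simp add: RR_simps)
  define g where "g = ?f"
  have g: "g p \<in> carrier TT" for p
  proof (cases p)
    case (Pair i j)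
    then show ?thesis
      by (cases i; cases j) (use assms in \<open>auto simp: g_def super_sign_def intro!: cl\<close>)
  qed
  have "pure_mult a b c d = finprod TT g UNIV" by (simp add: pure_mult_def g_def)
  also have "\<dots> = g (0, 0) \<otimes>\<^bsub>TT\<^esub> (g (1, 0) \<otimes>\<^bsub>TT\<^esub> (g (0, 1) \<otimes>\<^bsub>TT\<^esub> g (1, 1)))"
    unfolding UNIV_bit_bit using g by (simp add: TT.finprod_insert Pi_def)
  also have "\<dots> = tt (a \<otimes> ev c) (ev b \<otimes> d) \<oplus>\<^bsub>RR\<^esub> (tt (a \<otimes> ev c) (od b \<otimes> d) \<oplus>\<^bsub>RR\<^esub>
      (tt (a \<otimes> od c) (ev b \<otimes> d) \<oplus>\<^bsub>RR\<^esub> tt (\<ominus> (a \<otimes> od c)) (od b \<otimes> d)))"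
    by (simp add: g_def super_sign_def RR_simps)
  also have "tt (\<ominus> (a \<otimes> od c)) (od b \<otimes> d) = tt (a \<otimes> od c) (\<ominus> (od b \<otimes> d))"
    using tt_bal[of "\<ominus>\<^bsub>K\<^esub> \<one>\<^bsub>K\<^esub>" "a \<otimes> od c" "od b \<otimes> d"] assms by (simp add: Mo.smult_l_minus)
  also have "tt (a \<otimes> od c) (ev b \<otimes> d) \<oplus>\<^bsub>RR\<^esub> tt (a \<otimes> od c) (\<ominus> (od b \<otimes> d)) = tt (a \<otimes> od c) (th b \<otimes> d)"
    using assms by (simp add: tt_add_r[symmetric] th_def a_minus_def l_distr l_minus)
  also have "tt (a \<otimes> ev c) (ev b \<otimes> d) \<oplus>\<^bsub>RR\<^esub> (tt (a \<otimes> ev c) (od b \<otimes> d) \<oplus>\<^bsub>RR\<^esub> tt (a \<otimes> od c) (th b \<otimes> d)) =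
      tt (a \<otimes> ev c) (b \<otimes> d) \<oplus>\<^bsub>RR\<^esub> tt (a \<otimes> od c) (th b \<otimes> d)"
  proof -
    have "tt (a \<otimes> ev c) (b \<otimes> d) = tt (a \<otimes> ev c) (ev b \<otimes> d) \<oplus>\<^bsub>RR\<^esub> tt (a \<otimes> ev c) (od b \<otimes> d)"
      using assms by (simp add: tt_add_r[symmetric] l_distr[symmetric] comp)
    then show ?thesis using assms by (simp add: RR.a_assoc)
  qed
  finally show ?thesis .
qed

lemma pure_mult_closed [simp]: "\<lbrakk>a \<in> carrier A; b \<in> carrier A; c \<in> carrier A; d \<in> carrier A\<rbrakk> \<Longrightarrow> pure_mult a b c d \<in> carrier RR"
  by (simp add: pure_mult_eq)

lemma pure_mult_add:
  assumes "a \<in> carrier A" "b \<in> carrier A" "c \<in> carrier A" "d \<in> carrier A" "x \<in> carrier A"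
  shows "pure_mult (a \<oplus> x) b c d = pure_mult a b c d \<oplus>\<^bsub>RR\<^esub> pure_mult x b c d"
    "pure_mult a (b \<oplus> x) c d = pure_mult a b c d \<oplus>\<^bsub>RR\<^esub> pure_mult a x c d"
    "pure_mult a b (c \<oplus> x) d = pure_mult a b c d \<oplus>\<^bsub>RR\<^esub> pure_mult a b x d"
    "pure_mult a b c (d \<oplus> x) = pure_mult a b c d \<oplus>\<^bsub>RR\<^esub> pure_mult a b c x"
  using assms
  by (simp_all add: pure_mult_eq l_distr r_distr tt_add_l tt_add_r comp_add th_add RR.a_ac)

lemma pure_mult_bal:
  assumes "a \<in> carrier A" "b \<in> carrier A" "c \<in> carrier A" "d \<in> carrier A" "k \<in> carrier K"
  shows "pure_mult (k \<odot> a) b c d = pure_mult a (k \<odot> b) c d" "pure_mult a b (k \<odot> c) d = pure_mult a b c (k \<odot> d)"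
    "pure_mult a b c (k \<odot> d) = pure_mult a (k \<odot> b) c d"
  using assms by (simp_all add: pure_mult_eq smult_mult comp_smult th_smult tt_bal)

lemma inner_lift:
  assumes "a \<in> carrier A" "b \<in> carrier A"
  shows "tensor_lift TT (pure_mult a b) \<in> Hom RR RR"
    and "\<lbrakk>c \<in> carrier A; d \<in> carrier A\<rbrakk> \<Longrightarrow> tensor_lift TT (pure_mult a b) (tt c d) = pure_mult a b c d"
  using RR_lift_hom[OF TT_comm_group, of "pure_mult a b"] RR_lift_tt[OF TT_comm_group, of "pure_mult a b"] assms pure_mult_add pure_mult_bal(2) pure_mult_closed
  by (simp_all add: RR_simps hom_def)

lemma RR_mult_def: "U \<otimes>\<^bsub>RR\<^esub> V = tensor_lift TT (\<lambda>a b. tensor_lift TT (pure_mult a b) V) U"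
  by (simp add: super_tensor_def Let_def pure_mult_def[abs_def])

text \<open>
  For fixed \<open>V\<close>, the lift in the last two arguments is again balanced in the first two.
\<close>

lemma outer_lift:
  assumes V: "V \<in> carrier RR"
  shows "(\<lambda>U. U \<otimes>\<^bsub>RR\<^esub> V) \<in> Hom RR RR"
    and "\<lbrakk>a \<in> carrier A; b \<in> carrier A\<rbrakk> \<Longrightarrow> tt a b \<otimes>\<^bsub>RR\<^esub> V = tensor_lift TT (pure_mult a b) V"
proof -
  let ?g = "\<lambda>a b. tensor_lift TT (pure_mult a b) V"
  have 1: "?g a b \<in> carrier RR" if "a \<in> carrier A" "b \<in> carrier A" for a b
    using Hom_closed[OF inner_lift(1)[OF that] V] .
  have 2: "?g (a \<oplus> x) b = ?g a b \<oplus>\<^bsub>RR\<^esub> ?g x b" if "a \<in> carrier A" "x \<in> carrier A" "b \<in> carrier A" for a x b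
    using V
  proof (induction V rule: RR_induct)
    case (pure c d)
    then show ?case using that by (simp add: inner_lift pure_mult_add)
  next
    case (add u v)
    then show ?case using that Hom_closed[OF inner_lift(1)]
      by (simp add: Hom_add[OF inner_lift(1)] RR.a_ac)
  qed
  have 3: "?g a (b \<oplus> x) = ?g a b \<oplus>\<^bsub>RR\<^esub> ?g a x" if "a \<in> carrier A" "b \<in> carrier A" "x \<in> carrier A" for a x b
    using V
  proof (induction V rule: RR_induct)
    case (pure c d)
    then show ?case using that by (simp add: inner_lift pure_mult_add)
  next
    case (add u v)
    then show ?case using that Hom_closed[OF inner_lift(1)]
      by (simp add: Hom_add[OF inner_lift(1)] RR.a_ac)
  qed
  have 4: "?g (k \<odot> a) b = ?g a (k \<odot> b)" if "a \<in> carrier A" "k \<in> carrier K" "b \<in> carrier A" for a k b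
    using V
  proof (induction V rule: RR_induct)
    case (pure c d)
    then show ?case using that by (simp add: inner_lift pure_mult_bal)
  next
    case (add u v)
    then show ?case using that by (simp add: Hom_add[OF inner_lift(1)])
  qed
  have "tensor_lift TT ?g \<in> Hom RR RR"
    using RR_lift_hom[OF TT_comm_group, of ?g] 1 2 3 4 by (simp add: RR_simps hom_def)
  then show "(\<lambda>U. U \<otimes>\<^bsub>RR\<^esub> V) \<in> Hom RR RR" by (simp add: RR_mult_def)
  show "tt a b \<otimes>\<^bsub>RR\<^esub> V = tensor_lift TT (pure_mult a b) V" if "a \<in> carrier A" "b \<in> carrier A"
    using RR_lift_tt[OF TT_comm_group, of ?g a b] 1 2 3 4 that by (simp add: RR_simps RR_mult_def)
qed

lemma RR_m_closed: "\<lbrakk>U \<in> carrier RR; V \<in> carrier RR\<rbrakk> \<Longrightarrow> U \<otimes>\<^bsub>RR\<^esub> V \<in> carrier RR"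
  using Hom_closed[OF outer_lift(1)] by blast
lemma RR_l_distr: "\<lbrakk>U \<in> carrier RR; U' \<in> carrier RR; V \<in> carrier RR\<rbrakk> \<Longrightarrow>
    (U \<oplus>\<^bsub>RR\<^esub> U') \<otimes>\<^bsub>RR\<^esub> V = U \<otimes>\<^bsub>RR\<^esub> V \<oplus>\<^bsub>RR\<^esub> U' \<otimes>\<^bsub>RR\<^esub> V"
  using Hom_add[OF outer_lift(1)] by blast
lemma RR_r_distr:
  assumes "U \<in> carrier RR" "V \<in> carrier RR" "V' \<in> carrier RR"
  shows "U \<otimes>\<^bsub>RR\<^esub> (V \<oplus>\<^bsub>RR\<^esub> V') = U \<otimes>\<^bsub>RR\<^esub> V \<oplus>\<^bsub>RR\<^esub> U \<otimes>\<^bsub>RR\<^esub> V'"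
  using assms(1)
proof (induction rule: RR_induct)
  case (pure a b)
  then show ?case using assms by (simp add: outer_lift Hom_add[OF inner_lift(1)])
next
  case (add u v)
  then show ?case using assms by (simp add: RR_l_distr RR_m_closed RR.a_ac)
qed

lemma RR_mult_tt:
  "\<lbrakk>a \<in> carrier A; b \<in> carrier A; c \<in> carrier A; d \<in> carrier A\<rbrakk> \<Longrightarrow>
    tt a b \<otimes>\<^bsub>RR\<^esub> tt c d = tt (a \<otimes> ev c) (b \<otimes> d) \<oplus>\<^bsub>RR\<^esub> tt (a \<otimes> od c) (th b \<otimes> d)"
  by (simp add: outer_lift inner_lift pure_mult_eq)

lemma tt_zero [simp]: "y \<in> carrier A \<Longrightarrow> tt \<zero> y = \<zero>\<^bsub>RR\<^esub>" "x \<in> carrier A \<Longrightarrow> tt x \<zero> = \<zero>\<^bsub>RR\<^esub>"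
  using tt_add_l[of \<zero> \<zero> y] tt_add_r[of x \<zero> \<zero>] tt_closed by auto

text \<open>
  On pure tensors associativity is the multiplicativity of the parity automorphism together with
  its being an involution.
\<close>

lemma RR_assoc:
  assumes "U \<in> carrier RR" "V \<in> carrier RR" "W \<in> carrier RR"
  shows "U \<otimes>\<^bsub>RR\<^esub> V \<otimes>\<^bsub>RR\<^esub> W = U \<otimes>\<^bsub>RR\<^esub> (V \<otimes>\<^bsub>RR\<^esub> W)"
  using assms(1)
proof (induction rule: RR_induct)
  case (pure a b)
  then have ab: "a \<in> carrier A" "b \<in> carrier A" by auto
  show ?case using assms(2)
  proof (induction rule: RR_induct)
    case (pure c d)
    then have cd: "c \<in> carrier A" "d \<in> carrier A" by auto
    show ?case using assms(3)
    proof (induction rule: RR_induct)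
      case (pure x y)
      then show ?case using ab cd
        by (simp add: RR_mult_tt RR_l_distr RR_r_distr comp_mult comp_add th_mult th_th m_assoc RR.a_ac)
    next
      case (add u v)
      then show ?case using ab cd by (simp add: RR_r_distr RR_m_closed)
    qed
  next
    case (add u v)
    then show ?case using ab assms by (simp add: RR_l_distr RR_r_distr RR_m_closed)
  qed
next
  case (add u v)
  then show ?case using assms by (simp add: RR_l_distr RR_m_closed)
qed

lemma comp_one [simp]: "ev \<one> = \<one>" "od \<one> = \<zero>"
  using comp_homog0[OF homog_one] by auto

lemma RR_ring: "ring RR"
proof (rule ringI[OF RR_abelian_group _ RR_l_distr RR_r_distr])
  show "Group.monoid RR"
  proof (rule monoidI)
    fix U assume U: "U \<in> carrier RR"
    show "\<one>\<^bsub>RR\<^esub> \<otimes>\<^bsub>RR\<^esub> U = U" using U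
    proof (induction rule: RR_induct)
      case (pure a b)
      then show ?case by (simp add: RR_simps(4) RR_mult_tt th_def a_minus_def tt_add_l[symmetric] comp)
    next
      case (add u v)
      then show ?case by (simp add: RR_simps(4) RR_r_distr)
    qed
    show "U \<otimes>\<^bsub>RR\<^esub> \<one>\<^bsub>RR\<^esub> = U" using U
    proof (induction rule: RR_induct)
      case (pure a b)
      then show ?case by (simp add: RR_simps(4) RR_mult_tt)
    next
      case (add u v)
      then show ?case by (simp add: RR_simps(4) RR_l_distr)
    qed
  qed (simp_all add: RR_m_closed RR_assoc RR_simps(4))
qed

lemma sc_carr [simp]: "k \<in> carrier K \<Longrightarrow> sc k \<in> carrier A" by simp


section \<open>Hopf superalgebras as instances of the abstract setting\<close>

text \<open>
  The image \<open>K 1\<close> of the ground field in \<open>A\<close>.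
\<close>

definition FF where "FF = sc ` carrier K"

lemma FF_cases: assumes "c \<in> FF" obtains k where "k \<in> carrier K" "c = sc k"
  using assms by (auto simp: FF_def)

lemma FF_carr: "c \<in> FF \<Longrightarrow> c \<in> carrier A" by (auto simp: FF_def)

lemma sc_hom: "\<lbrakk>k \<in> carrier K; l \<in> carrier K\<rbrakk> \<Longrightarrow> sc k \<otimes> sc l = sc (k \<otimes>\<^bsub>K\<^esub> l)"
  "\<lbrakk>k \<in> carrier K; l \<in> carrier K\<rbrakk> \<Longrightarrow> sc k \<oplus> sc l = sc (k \<oplus>\<^bsub>K\<^esub> l)"
  "k \<in> carrier K \<Longrightarrow> \<ominus> sc k = sc (\<ominus>\<^bsub>K\<^esub> k)"
  by (simp_all add: sc_mult Mo.smult_assoc1 Mo.smult_l_distr Mo.smult_l_minus)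

lemma FF_subring: "subring FF A"
proof (rule subringI)
  show "FF \<subseteq> carrier A" using FF_carr by blast
  show "\<one> \<in> FF" unfolding FF_def using Mo.smult_one by (intro image_eqI[of _ _ "\<one>\<^bsub>K\<^esub>"]) auto
  show "\<ominus> h \<in> FF" if "h \<in> FF" for h using that by (auto simp: FF_def sc_hom)
  show "h1 \<otimes> h2 \<in> FF" if "h1 \<in> FF" "h2 \<in> FF" for h1 h2 using that by (auto simp: FF_def sc_hom)
  show "h1 \<oplus> h2 \<in> FF" if "h1 \<in> FF" "h2 \<in> FF" for h1 h2 using that by (auto simp: FF_def sc_hom)
qed

lemma FF_inv:
  assumes "c \<in> FF" "c \<noteq> \<zero>" shows "\<exists>d\<in>FF. c \<otimes> d = \<one>"
proof -
  obtain k where k: "k \<in> carrier K" "c = sc k" using FF_cases[OF assms(1)] by blast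
  have "k \<noteq> \<zero>\<^bsub>K\<^esub>" using k assms by auto
  then have "k \<in> Units K" using k K.field_Units by auto
  then have "inv\<^bsub>K\<^esub> k \<in> carrier K" "k \<otimes>\<^bsub>K\<^esub> inv\<^bsub>K\<^esub> k = \<one>\<^bsub>K\<^esub>" by auto
  then have "c \<otimes> sc (inv\<^bsub>K\<^esub> k) = \<one>" using k by (simp add: sc_hom)
  then show ?thesis using \<open>inv\<^bsub>K\<^esub> k \<in> carrier K\<close> by (auto simp: FF_def)
qed

lemma FF_ev: "c \<in> FF \<Longrightarrow> ev c = c"
  by (auto simp: FF_def comp_smult)

lemma RR_smult_def: "k \<odot>\<^bsub>RR\<^esub> U = tensor_lift TT (\<lambda>a b. tt (k \<odot> a) b) U"
  by (simp add: super_tensor_def Let_def)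

lemma RR_smult:
  assumes k: "k \<in> carrier K"
  shows "(\<lambda>U. k \<odot>\<^bsub>RR\<^esub> U) \<in> Hom RR RR"
    and "\<lbrakk>a \<in> carrier A; b \<in> carrier A\<rbrakk> \<Longrightarrow> k \<odot>\<^bsub>RR\<^esub> tt a b = tt (k \<odot> a) b"
    and "U \<in> carrier RR \<Longrightarrow> k \<odot>\<^bsub>RR\<^esub> U \<in> carrier RR"
    and "U \<in> carrier RR \<Longrightarrow> k \<odot>\<^bsub>RR\<^esub> U = tt (sc k) \<one> \<otimes>\<^bsub>RR\<^esub> U"
proof -
  interpret R: ring RR by (rule RR_ring)
  let ?f = "\<lambda>a b. tt (k \<odot> a) b"
  have f: "?f x y \<in> carrier TT" "?f (x \<oplus> x') y = ?f x y \<otimes>\<^bsub>TT\<^esub> ?f x' y" "?f x (y \<oplus> y') = ?f x y \<otimes>\<^bsub>TT\<^esub> ?f x y'"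
    if "x \<in> carrier A" "x' \<in> carrier A" "y \<in> carrier A" "y' \<in> carrier A" for x x' y y'
    using that k tt_closed[of "k \<odot> x" y] by (simp_all add: Mo.smult_r_distr tt_add_l tt_add_r RR_simps[symmetric])
  have fb: "?f (l \<odot> x) y = ?f x (l \<odot> y)" if "x \<in> carrier A" "l \<in> carrier K" "y \<in> carrier A" for x l y
  proof -
    have "k \<odot> (l \<odot> x) = l \<odot> (k \<odot> x)"
      using that k by (simp add: Mo.smult_assoc1[symmetric] K.m_comm)
    then show ?thesis using that k by (simp add: tt_bal)
  qed
  have h: "tensor_lift TT ?f \<in> hom (add_monoid RR) TT"
    by (rule RR_lift_hom[OF TT_comm_group]) (use f fb in auto)
  have p: "tensor_lift TT ?f (tt a b) = ?f a b" if "a \<in> carrier A" "b \<in> carrier A" for a b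
    by (rule RR_lift_tt[OF TT_comm_group]) (use f fb that in auto)
  show H: "(\<lambda>U. k \<odot>\<^bsub>RR\<^esub> U) \<in> Hom RR RR" using h by (simp add: RR_smult_def hom_def RR_simps)
  show P: "k \<odot>\<^bsub>RR\<^esub> tt a b = tt (k \<odot> a) b" if "a \<in> carrier A" "b \<in> carrier A" for a b
    using p[OF that] by (simp add: RR_smult_def)
  show "U \<in> carrier RR \<Longrightarrow> k \<odot>\<^bsub>RR\<^esub> U \<in> carrier RR" by (rule Hom_closed[OF H])
  show "k \<odot>\<^bsub>RR\<^esub> U = tt (sc k) \<one> \<otimes>\<^bsub>RR\<^esub> U" if "U \<in> carrier RR"
    using that
  proof (induction rule: RR_induct)
    case (pure a b)
    have "tt (sc k) \<one> \<otimes>\<^bsub>RR\<^esub> tt a b = tt (sc k \<otimes> ev a) b \<oplus>\<^bsub>RR\<^esub> tt (sc k \<otimes> od a) b"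
      using pure k by (simp add: RR_mult_tt th_def a_minus_def)
    also have "\<dots> = tt (sc k \<otimes> a) b"
      using pure k by (simp add: tt_add_l[symmetric] r_distr[symmetric] comp)
    finally show ?case using pure k by (simp add: P sc_mult)
  next
    case (add u v)
    then show ?case using k Hom_add[OF H] by (simp add: R.r_distr)
  qed
qed

end

locale hopf_coideal = super_alg A K
  for A :: "('k, 'a, 'y) hopf_superalgebra_scheme" (structure) and K :: "('k, 'x) ring_scheme" +
  fixes B :: "'a set"
  assumes char: "ring_characteristic K \<noteq> 2"
    and hopf: "commutative_hopf_superalgebra K A"
    and subalg: "supersubalgebra K A B"
    and coideal: "left_coideal K A B"
begin

abbreviation "\<delta> \<equiv> comult A"
abbreviation "\<epsilon> \<equiv> counit A"

sublocale R: ring RR by (rule RR_ring)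

lemma hopf_props: "hopf_superalgebra K A" "supercommutative A"
  using hopf by (auto simp: commutative_hopf_superalgebra_def)

lemma comult_hom: "\<delta> \<in> Hom A RR" "\<lbrakk>x \<in> carrier A; y \<in> carrier A\<rbrakk> \<Longrightarrow> \<delta> (x \<otimes> y) = \<delta> x \<otimes>\<^bsub>RR\<^esub> \<delta> y"
  "\<lbrakk>k \<in> carrier K; x \<in> carrier A\<rbrakk> \<Longrightarrow> \<delta> (k \<odot> x) = k \<odot>\<^bsub>RR\<^esub> \<delta> x"
proof -
  have *: "\<delta> \<in> superalgebra_hom K A RR" using hopf_props(1) unfolding hopf_superalgebra_def by blast
  then show "\<delta> \<in> Hom A RR" "\<lbrakk>k \<in> carrier K; x \<in> carrier A\<rbrakk> \<Longrightarrow> \<delta> (k \<odot> x) = k \<odot>\<^bsub>RR\<^esub> \<delta> x"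
    by (auto simp: superalgebra_hom_def super_linear_def)
  show "\<lbrakk>x \<in> carrier A; y \<in> carrier A\<rbrakk> \<Longrightarrow> \<delta> (x \<otimes> y) = \<delta> x \<otimes>\<^bsub>RR\<^esub> \<delta> y"
    using * ring_hom_mult[of \<delta> A RR x y] by (simp add: superalgebra_hom_def)
qed

lemma counit_hom:
  "x \<in> carrier A \<Longrightarrow> \<epsilon> x \<in> carrier K"
  "\<lbrakk>x \<in> carrier A; y \<in> carrier A\<rbrakk> \<Longrightarrow> \<epsilon> (x \<otimes> y) = \<epsilon> x \<otimes>\<^bsub>K\<^esub> \<epsilon> y"
  "\<lbrakk>x \<in> carrier A; y \<in> carrier A\<rbrakk> \<Longrightarrow> \<epsilon> (x \<oplus> y) = \<epsilon> x \<oplus>\<^bsub>K\<^esub> \<epsilon> y"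
  "\<lbrakk>k \<in> carrier K; x \<in> carrier A\<rbrakk> \<Longrightarrow> \<epsilon> (k \<odot> x) = k \<otimes>\<^bsub>K\<^esub> \<epsilon> x"
  "\<epsilon> \<one> = \<one>\<^bsub>K\<^esub>" "x \<in> homog A 1 \<Longrightarrow> \<epsilon> x = \<zero>\<^bsub>K\<^esub>"
proof -
  have *: "\<epsilon> \<in> superalgebra_hom K A (base_superalgebra K)" using hopf_props(1) unfolding hopf_superalgebra_def by blast
  then have r: "\<epsilon> \<in> ring_hom A (base_superalgebra K)" and l: "\<epsilon> \<in> super_linear K A (base_superalgebra K)"
    by (auto simp: superalgebra_hom_def)
  show "x \<in> carrier A \<Longrightarrow> \<epsilon> x \<in> carrier K"
    "\<lbrakk>x \<in> carrier A; y \<in> carrier A\<rbrakk> \<Longrightarrow> \<epsilon> (x \<otimes> y) = \<epsilon> x \<otimes>\<^bsub>K\<^esub> \<epsilon> y"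
    "\<lbrakk>x \<in> carrier A; y \<in> carrier A\<rbrakk> \<Longrightarrow> \<epsilon> (x \<oplus> y) = \<epsilon> x \<oplus>\<^bsub>K\<^esub> \<epsilon> y"
    "\<epsilon> \<one> = \<one>\<^bsub>K\<^esub>"
    using ring_hom_closed[OF r] ring_hom_mult[OF r] ring_hom_add[OF r] ring_hom_one[OF r]
    by (auto simp: base_superalgebra_def)
  show "\<lbrakk>k \<in> carrier K; x \<in> carrier A\<rbrakk> \<Longrightarrow> \<epsilon> (k \<odot> x) = k \<otimes>\<^bsub>K\<^esub> \<epsilon> x"
    using l by (auto simp: super_linear_def base_superalgebra_def)
  have "\<epsilon> ` homog A 1 \<subseteq> homog (base_superalgebra K) 1" using l unfolding super_linear_def by blast
  then show "x \<in> homog A 1 \<Longrightarrow> \<epsilon> x = \<zero>\<^bsub>K\<^esub>" by (auto simp: base_superalgebra_def)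
qed

lemma antipode_lin: "antipode A \<in> Hom A A"
  "\<lbrakk>k \<in> carrier K; x \<in> carrier A\<rbrakk> \<Longrightarrow> antipode A (k \<odot> x) = k \<odot> antipode A x"
  "x \<in> homog A i \<Longrightarrow> antipode A x \<in> homog A i"
proof -
  have *: "antipode A \<in> super_linear K A A" using hopf_props(1) unfolding hopf_superalgebra_def by blast
  then show "antipode A \<in> Hom A A" "\<lbrakk>k \<in> carrier K; x \<in> carrier A\<rbrakk> \<Longrightarrow> antipode A (k \<odot> x) = k \<odot> antipode A x"
    by (auto simp: super_linear_def)
  have "antipode A ` homog A i \<subseteq> homog A i" using * unfolding super_linear_def by blast
  then show "x \<in> homog A i \<Longrightarrow> antipode A x \<in> homog A i" by blast
qed

lemma hopf_axioms:
  assumes "a \<in> carrier A"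
  shows "super_assoc K A A A (super_tensor_map K RR A \<delta> id (\<delta> a)) = super_tensor_map K A RR id \<delta> (\<delta> a)"
    and "tensor_lift (add_monoid A) (\<lambda>x y. \<epsilon> x \<odot> y) (\<delta> a) = a"
    and "tensor_lift (add_monoid A) (\<lambda>x y. \<epsilon> y \<odot> x) (\<delta> a) = a"
    and "tensor_lift (add_monoid A) (\<lambda>x y. antipode A x \<otimes> y) (\<delta> a) = sc (\<epsilon> a)"
    and "tensor_lift (add_monoid A) (\<lambda>x y. x \<otimes> antipode A y) (\<delta> a) = sc (\<epsilon> a)"
  using hopf_props(1) assms unfolding hopf_superalgebra_def by blast+

lemma AA_comm_group: "comm_group (add_monoid A)" by (rule A.a_comm_group)

lemma lift_eq:
  assumes h: "h \<in> Hom RR A" and hf: "\<And>x y. \<lbrakk>x \<in> carrier A; y \<in> carrier A\<rbrakk> \<Longrightarrow> h (tt x y) = f x y"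
    and f: "\<And>x y. \<lbrakk>x \<in> carrier A; y \<in> carrier A\<rbrakk> \<Longrightarrow> f x y \<in> carrier A"
      "\<And>x x' y. \<lbrakk>x \<in> carrier A; x' \<in> carrier A; y \<in> carrier A\<rbrakk> \<Longrightarrow> f (x \<oplus> x') y = f x y \<oplus> f x' y"
      "\<And>x y y'. \<lbrakk>x \<in> carrier A; y \<in> carrier A; y' \<in> carrier A\<rbrakk> \<Longrightarrow> f x (y \<oplus> y') = f x y \<oplus> f x y'"
      "\<And>x k y. \<lbrakk>x \<in> carrier A; k \<in> carrier K; y \<in> carrier A\<rbrakk> \<Longrightarrow> f (k \<odot> x) y = f x (k \<odot> y)"
    and r: "r \<in> carrier RR"
  shows "h r = tensor_lift (add_monoid A) f r"
proof (rule hom_RR_eqI[OF h _ r])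
  show "tensor_lift (add_monoid A) f \<in> Hom RR A"
    by (rule RR_lift_hom[OF AA_comm_group]) (use f in auto)
  show "h (tt x y) = tensor_lift (add_monoid A) f (tt x y)" if "x \<in> carrier A" "y \<in> carrier A" for x y
  proof -
    have "tensor_lift (add_monoid A) f (tt x y) = f x y"
      by (rule RR_lift_tt[OF AA_comm_group]) (use f that in auto)
    then show ?thesis using hf[OF that] by simp
  qed
qed

lemma supercomm:
  assumes "x \<in> carrier A" "y \<in> carrier A"
  shows "ev x \<otimes> y = y \<otimes> ev x" and "od x \<otimes> od y = \<ominus> (od y \<otimes> od x)"
proof -
  have sc': "u \<otimes> v = super_sign A i j (v \<otimes> u)" if "u \<in> homog A i" "v \<in> homog A j" for u v i j
    using hopf_props(2) that unfolding supercommutative_def by blast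
  have "ev x \<otimes> ev y = ev y \<otimes> ev x" "ev x \<otimes> od y = od y \<otimes> ev x"
    using sc'[OF comp(1)[OF assms(1)] comp(1)[OF assms(2)]] sc'[OF comp(1)[OF assms(1)] comp(2)[OF assms(2)]]
    by (auto simp: super_sign_def)
  moreover have "y = ev y \<oplus> od y" using assms by (simp add: comp)
  ultimately show "ev x \<otimes> y = y \<otimes> ev x"
    using assms r_distr[of "ev y" "od y" "ev x"] l_distr[of "ev y" "od y" "ev x"] by simp
  show "od x \<otimes> od y = \<ominus> (od y \<otimes> od x)"
    using sc'[OF comp(2)[OF assms(1)] comp(2)[OF assms(2)]] by (simp add: super_sign_def)
qed

lemma two_nonzero: "\<one>\<^bsub>K\<^esub> \<oplus>\<^bsub>K\<^esub> \<one>\<^bsub>K\<^esub> \<noteq> \<zero>\<^bsub>K\<^esub>"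
proof
  assume two: "\<one>\<^bsub>K\<^esub> \<oplus>\<^bsub>K\<^esub> \<one>\<^bsub>K\<^esub> = \<zero>\<^bsub>K\<^esub>"
  have G: "group (add_monoid K)" by (rule abelian_group.a_group) (rule K.abelian_group_axioms)
  have o: "\<one>\<^bsub>K\<^esub> \<in> carrier (add_monoid K)" by simp
  have "\<one>\<^bsub>K\<^esub> [^]\<^bsub>add_monoid K\<^esub> (2 :: nat) = \<one>\<^bsub>add_monoid K\<^esub>"
    using two by (simp add: numeral_2_eq_2 nat_pow_def)
  then have "group.ord (add_monoid K) \<one>\<^bsub>K\<^esub> dvd 2" using group.pow_eq_id[OF G o, of 2] by simp
  then have "group.ord (add_monoid K) \<one>\<^bsub>K\<^esub> = 1 \<or> group.ord (add_monoid K) \<one>\<^bsub>K\<^esub> = 2"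
    using two_is_prime_nat prime_nat_iff by blast
  moreover have "group.ord (add_monoid K) \<one>\<^bsub>K\<^esub> \<noteq> 1" using group.ord_eq_1[OF G o] by simp
  ultimately show False using char by (simp add: ring_characteristic_def)
qed

text \<open>
  Supercommutativity gives \<open>x x = - x x\<close> for odd \<open>x\<close>, and \<open>2\<close> is invertible.
\<close>

lemma od_square: "x \<in> carrier A \<Longrightarrow> od x \<otimes> od x = \<zero>"
proof -
  assume x: "x \<in> carrier A"
  let ?s = "od x \<otimes> od x"
  have s: "?s \<in> carrier A" using x by simp
  have "?s \<oplus> ?s = \<zero>" using supercomm(2)[OF x x] s by (metis A.l_neg)
  moreover have "(\<one>\<^bsub>K\<^esub> \<oplus>\<^bsub>K\<^esub> \<one>\<^bsub>K\<^esub>) \<odot> ?s = ?s \<oplus> ?s" using s by (simp add: Mo.smult_l_distr)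
  ultimately have z: "(\<one>\<^bsub>K\<^esub> \<oplus>\<^bsub>K\<^esub> \<one>\<^bsub>K\<^esub>) \<odot> ?s = \<zero>" by simp
  let ?t = "\<one>\<^bsub>K\<^esub> \<oplus>\<^bsub>K\<^esub> \<one>\<^bsub>K\<^esub>"
  have "?t \<in> Units K" using two_nonzero K.field_Units by auto
  then have i: "inv\<^bsub>K\<^esub> ?t \<in> carrier K" "inv\<^bsub>K\<^esub> ?t \<otimes>\<^bsub>K\<^esub> ?t = \<one>\<^bsub>K\<^esub>" by auto
  have "?s = (inv\<^bsub>K\<^esub> ?t \<otimes>\<^bsub>K\<^esub> ?t) \<odot> ?s" using i s by simp
  also have "\<dots> = inv\<^bsub>K\<^esub> ?t \<odot> (?t \<odot> ?s)" using i s by (intro Mo.smult_assoc1) auto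
  also have "\<dots> = \<zero>" using z i by simp
  finally show ?thesis .
qed

lemma B_sub: "subring B A" "\<And>k b. \<lbrakk>k \<in> carrier K; b \<in> B\<rbrakk> \<Longrightarrow> k \<odot> b \<in> B"
  "b \<in> B \<Longrightarrow> ev b \<in> B"
proof -
  show 1: "subring B A" "\<And>k b. \<lbrakk>k \<in> carrier K; b \<in> B\<rbrakk> \<Longrightarrow> k \<odot> b \<in> B"
    using subalg unfolding supersubalgebra_def by blast+
  assume "b \<in> B"
  moreover have "B = (B \<inter> homog A 0) <+> (B \<inter> homog A 1)" using subalg unfolding supersubalgebra_def by blast
  ultimately have "b \<in> (B \<inter> homog A 0) <+> (B \<inter> homog A 1)" by simp
  then obtain c d where "c \<in> B \<inter> homog A 0" "d \<in> B \<inter> homog A 1" "b = c \<oplus> d"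
    by (auto simp: set_add_def set_mult_def)
  then show "ev b \<in> B" using comp_uniq[of c d b] by auto
qed

text \<open>
  The subgroup generated by the pure tensors in \<open>A \<otimes> B\<close> is already closed under negatives as a set
  of sums, since \<open>- (x \<otimes> y) = (- x) \<otimes> y\<close>.
\<close>

lemma coideal_induct:
  assumes b: "b \<in> B" and p: "\<And>x y. \<lbrakk>x \<in> carrier A; y \<in> B\<rbrakk> \<Longrightarrow> P (tt x y)"
    and a: "\<And>u v. \<lbrakk>u \<in> carrier RR; v \<in> carrier RR; P u; P v\<rbrakk> \<Longrightarrow> P (u \<oplus>\<^bsub>RR\<^esub> v)"
  shows "P (\<delta> b)"
proof -
  have BA: "y \<in> carrier A" if "y \<in> B" for y using subringE(1)[OF B_sub(1)] that by auto
  let ?S = "{tt a b | a b. a \<in> carrier A \<and> b \<in> B}"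
  have "\<delta> b \<in> generate TT ?S" using coideal b unfolding left_coideal_def by blast
  then have "\<delta> b \<in> carrier RR \<and> P (\<delta> b)"
  proof (induction rule: generate.induct)
    case one
    have "tt \<zero> \<zero> = \<one>\<^bsub>TT\<^esub>" using tt_zero(1)[of \<zero>] by (simp add: RR_simps)
    then show ?case using p[of \<zero> \<zero>] tt_closed[of \<zero> \<zero>] subringE(2)[OF B_sub(1)] by simp
  next
    case (incl h)
    then show ?case using p tt_closed BA by auto
  next
    case (inv h)
    then obtain x y where xy: "h = tt x y" "x \<in> carrier A" "y \<in> B" by blast
    then have "inv\<^bsub>TT\<^esub> h = tt (\<ominus> x) y"
      using T.pt_inv_l[of x y] BA by (simp add: TT_eq tt_eq a_inv_def)
    then show ?case using p[of "\<ominus> x" y] xy BA by simp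
  next
    case (eng h1 h2)
    then show ?case using a[of h1 h2] RR.a_closed[of h1 h2] by (simp add: RR_simps)
  qed
  then show ?thesis by simp
qed

abbreviation "TRA \<equiv> super_tensor_group K RR A"
abbreviation "TAR \<equiv> super_tensor_group K A RR"
abbreviation "pRA \<equiv> super_pure K RR A"
abbreviation "pAR \<equiv> super_pure K A RR"

lemma RR_smult_closed: "\<lbrakk>k \<in> carrier K; U \<in> carrier RR\<rbrakk> \<Longrightarrow> k \<odot>\<^bsub>RR\<^esub> U \<in> carrier RR"
  by (rule RR_smult)

sublocale RA: tensor_data "carrier K" "add_monoid RR" "\<lambda>x k. k \<odot>\<^bsub>RR\<^esub> x" "add_monoid A" "smult A"
  unfolding tensor_data_def tensor_data_axioms_def
  using RR_smult_closed by (auto intro: A.a_comm_group RR.a_comm_group)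

sublocale AR: tensor_data "carrier K" "add_monoid A" "\<lambda>x k. k \<odot> x" "add_monoid RR" "smult RR"
  unfolding tensor_data_def tensor_data_axioms_def
  using RR_smult_closed by (auto intro: A.a_comm_group RR.a_comm_group)

lemma RA_eq: "RA.Tn = TRA" "RA.pt = pRA" "AR.Tn = TAR" "AR.pt = pAR"
  by (simp_all add: super_tensor_group_def super_pure_def)

lemma TAR_comm_group: "comm_group TAR" using AR.Tn.comm_group_axioms by (simp add: RA_eq)
lemma TRA_comm_group: "comm_group TRA" using RA.Tn.comm_group_axioms by (simp add: RA_eq)

lemma pAR_props:
  "\<lbrakk>x \<in> carrier A; r \<in> carrier RR\<rbrakk> \<Longrightarrow> pAR x r \<in> carrier TAR"
  "\<lbrakk>x \<in> carrier A; x' \<in> carrier A; r \<in> carrier RR\<rbrakk> \<Longrightarrow> pAR (x \<oplus> x') r = pAR x r \<otimes>\<^bsub>TAR\<^esub> pAR x' r"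
  "\<lbrakk>x \<in> carrier A; r \<in> carrier RR; r' \<in> carrier RR\<rbrakk> \<Longrightarrow> pAR x (r \<oplus>\<^bsub>RR\<^esub> r') = pAR x r \<otimes>\<^bsub>TAR\<^esub> pAR x r'"
  "\<lbrakk>x \<in> carrier A; k \<in> carrier K; r \<in> carrier RR\<rbrakk> \<Longrightarrow> pAR (k \<odot> x) r = pAR x (k \<odot>\<^bsub>RR\<^esub> r)"
  using AR.pt_closed[of x r] AR.pt_add_l[of x x' r] AR.pt_add_r[of x r r'] AR.pt_bal[of x k r] by (simp_all add: RA_eq)

lemma pRA_props:
  "\<lbrakk>r \<in> carrier RR; x \<in> carrier A\<rbrakk> \<Longrightarrow> pRA r x \<in> carrier TRA"
  "\<lbrakk>r \<in> carrier RR; r' \<in> carrier RR; x \<in> carrier A\<rbrakk> \<Longrightarrow> pRA (r \<oplus>\<^bsub>RR\<^esub> r') x = pRA r x \<otimes>\<^bsub>TRA\<^esub> pRA r' x"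
  "\<lbrakk>r \<in> carrier RR; x \<in> carrier A; x' \<in> carrier A\<rbrakk> \<Longrightarrow> pRA r (x \<oplus> x') = pRA r x \<otimes>\<^bsub>TRA\<^esub> pRA r x'"
  "\<lbrakk>r \<in> carrier RR; k \<in> carrier K; x \<in> carrier A\<rbrakk> \<Longrightarrow> pRA (k \<odot>\<^bsub>RR\<^esub> r) x = pRA r (k \<odot> x)"
  using RA.pt_closed[of r x] RA.pt_add_l[of r r' x] RA.pt_add_r[of r x x'] RA.pt_bal[of r k x] by (simp_all add: RA_eq)

lemma comult_carr [simp]: "x \<in> carrier A \<Longrightarrow> \<delta> x \<in> carrier RR"
  by (rule Hom_closed[OF comult_hom(1)])

lemma map_l:
  "super_tensor_map K RR A \<delta> id \<in> hom (add_monoid RR) TRA"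
  "\<lbrakk>x \<in> carrier A; y \<in> carrier A\<rbrakk> \<Longrightarrow> super_tensor_map K RR A \<delta> id (tt x y) = pRA (\<delta> x) y"
  unfolding super_tensor_map_def id_def
  using RR_lift_hom[OF TRA_comm_group, of "\<lambda>a b. pRA (\<delta> a) b"] RR_lift_tt[OF TRA_comm_group, of "\<lambda>a b. pRA (\<delta> a) b"]
  by (simp_all add: pRA_props Hom_add[OF comult_hom(1)] comult_hom(3))

lemma map_r:
  "super_tensor_map K A RR id \<delta> \<in> hom (add_monoid RR) TAR"
  "\<lbrakk>x \<in> carrier A; y \<in> carrier A\<rbrakk> \<Longrightarrow> super_tensor_map K A RR id \<delta> (tt x y) = pAR x (\<delta> y)"
  unfolding super_tensor_map_def id_def
  using RR_lift_hom[OF TAR_comm_group, of "\<lambda>a b. pAR a (\<delta> b)"] RR_lift_tt[OF TAR_comm_group, of "\<lambda>a b. pAR a (\<delta> b)"]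
  by (simp_all add: pAR_props Hom_add[OF comult_hom(1)] comult_hom(3))

text \<open>
  The associativity isomorphism \<open>(A \<otimes> A) \<otimes> A \<rightarrow> A \<otimes> (A \<otimes> A)\<close>, as a function of the two factors.
\<close>

definition asc where "asc U c = tensor_lift TAR (\<lambda>a b. pAR a (tt b c)) U"

lemma asc:
  assumes "c \<in> carrier A"
  shows "(\<lambda>U. asc U c) \<in> hom (add_monoid RR) TAR"
    and "\<lbrakk>a \<in> carrier A; b \<in> carrier A\<rbrakk> \<Longrightarrow> asc (tt a b) c = pAR a (tt b c)"
  unfolding asc_def
  using RR_lift_hom[OF TAR_comm_group, of "\<lambda>a b. pAR a (tt b c)"] RR_lift_tt[OF TAR_comm_group, of "\<lambda>a b. pAR a (tt b c)"] assms
  by (simp_all add: pAR_props tt_add_l RR_smult(2))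

lemma assoc_pRA:
  assumes U: "U \<in> carrier RR" and c: "c \<in> carrier A"
  shows "super_assoc K A A A (pRA U c) = asc U c"
    and "super_assoc K A A A \<in> hom TRA TAR"
proof -
  interpret TAR: comm_group TAR by (rule TAR_comm_group)
  have asc_c: "asc U c \<in> carrier TAR" if "U \<in> carrier RR" "c \<in> carrier A" for U c
    using asc(1)[OF that(2)] that(1) by (simp add: hom_def Pi_def)
  have asc_add: "asc (U \<oplus>\<^bsub>RR\<^esub> V) c = asc U c \<otimes>\<^bsub>TAR\<^esub> asc V c" if "U \<in> carrier RR" "V \<in> carrier RR" "c \<in> carrier A" for U V c
    using hom_mult[OF asc(1)[OF that(3)], of U V] that by simp
  have asc_add_r: "asc U (c \<oplus> d) = asc U c \<otimes>\<^bsub>TAR\<^esub> asc U d" if "U \<in> carrier RR" "c \<in> carrier A" "d \<in> carrier A" for U c d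
    using that(1)
  proof (induction rule: RR_induct)
    case (pure a b)
    then show ?case using that by (simp add: asc tt_add_r pAR_props)
  next
    case (add u v)
    then show ?case using that asc_c by (simp add: asc_add TAR.m_ac)
  qed
  have asc_bal: "asc (k \<odot>\<^bsub>RR\<^esub> U) c = asc U (k \<odot> c)" if "U \<in> carrier RR" "k \<in> carrier K" "c \<in> carrier A" for U c k
    using that(1)
  proof (induction rule: RR_induct)
    case (pure a b)
    then show ?case using that by (simp add: asc RR_smult(2) pAR_props tt_bal)
  next
    case (add u v)
    then show ?case using that asc_c RR_smult_closed by (simp add: asc_add Hom_add[OF RR_smult(1)])
  qed
  have eq: "super_assoc K A A A = tensor_lift TAR asc"
    by (intro ext) (simp add: super_assoc_def Let_def asc_def[abs_def])
  show "super_assoc K A A A (pRA U c) = asc U c"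
    unfolding eq using RA.tensor_lift_pt[OF TAR_comm_group, of asc U c] asc_c asc_add asc_add_r asc_bal U c
    by (simp add: RA_eq)
  show "super_assoc K A A A \<in> hom TRA TAR"
    unfolding eq using RA.tensor_lift_hom[OF TAR_comm_group, of asc] asc_c asc_add asc_add_r asc_bal
    by (simp add: RA_eq)
qed

lemma assoc_map:
  assumes "x \<in> carrier A" "y \<in> carrier A"
  shows "super_assoc K A A A (super_tensor_map K RR A \<delta> id (tt x y)) = asc (\<delta> x) y"
  using assms by (simp add: map_l assoc_pRA)

lemma assoc_map_hom: "(\<lambda>r. super_assoc K A A A (super_tensor_map K RR A \<delta> id r)) \<in> hom (add_monoid RR) TAR"
  using Group.hom_compose[OF map_l(1) assoc_pRA(2)[of \<open>\<zero>\<^bsub>RR\<^esub>\<close> \<zero>]] by (simp add: comp_def)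

definition ee where "ee x = sc (\<epsilon> x)"

lemma ee_smult: "\<lbrakk>x \<in> carrier A; y \<in> carrier A\<rbrakk> \<Longrightarrow> ee x \<otimes> y = \<epsilon> x \<odot> y"
  by (simp add: ee_def sc_mult counit_hom)

text \<open>
  Coassociativity after a map \<open>L\<close> on \<open>A \<otimes> (A \<otimes> A)\<close> that contracts one tensor factor.
\<close>

lemma coassoc_transfer:
  assumes L: "L \<in> hom TAR (add_monoid RR)" and a: "a \<in> carrier A"
    and k1: "k1 \<in> Hom RR RR" and k2: "k2 \<in> Hom RR RR"
    and e1: "\<And>x y. \<lbrakk>x \<in> carrier A; y \<in> carrier A\<rbrakk> \<Longrightarrow> L (asc (\<delta> x) y) = k1 (tt x y)"
    and e2: "\<And>x y. \<lbrakk>x \<in> carrier A; y \<in> carrier A\<rbrakk> \<Longrightarrow> L (pAR x (\<delta> y)) = k2 (tt x y)"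
  shows "k1 (\<delta> a) = k2 (\<delta> a)"
proof -
  have "L (super_assoc K A A A (super_tensor_map K RR A \<delta> id r)) = k1 r" if r: "r \<in> carrier RR" for r
  proof -
    have "(L \<circ> (\<lambda>r. super_assoc K A A A (super_tensor_map K RR A \<delta> id r))) r = k1 r"
      by (rule hom_RR_eqI[OF Group.hom_compose[OF assoc_map_hom L] k1 r]) (simp add: assoc_map e1)
    then show ?thesis by simp
  qed
  moreover have "L (super_tensor_map K A RR id \<delta> r) = k2 r" if r: "r \<in> carrier RR" for r
  proof -
    have "(L \<circ> super_tensor_map K A RR id \<delta>) r = k2 r"
      by (rule hom_RR_eqI[OF Group.hom_compose[OF map_r(1) L] k2 r]) (simp add: map_r e2)
    then show ?thesis by simp
  qed
  ultimately show ?thesis using hopf_axioms(1)[OF a] a by (metis comult_carr)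
qed

lemma pAR_lift:
  assumes f: "\<And>x r. \<lbrakk>x \<in> carrier A; r \<in> carrier RR\<rbrakk> \<Longrightarrow> f x r \<in> carrier RR"
    "\<And>x x' r. \<lbrakk>x \<in> carrier A; x' \<in> carrier A; r \<in> carrier RR\<rbrakk> \<Longrightarrow> f (x \<oplus> x') r = f x r \<oplus>\<^bsub>RR\<^esub> f x' r"
    "\<And>x r r'. \<lbrakk>x \<in> carrier A; r \<in> carrier RR; r' \<in> carrier RR\<rbrakk> \<Longrightarrow> f x (r \<oplus>\<^bsub>RR\<^esub> r') = f x r \<oplus>\<^bsub>RR\<^esub> f x r'"
    "\<And>x k r. \<lbrakk>x \<in> carrier A; k \<in> carrier K; r \<in> carrier RR\<rbrakk> \<Longrightarrow> f (k \<odot> x) r = f x (k \<odot>\<^bsub>RR\<^esub> r)"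
  shows "\<exists>L \<in> hom TAR (add_monoid RR). \<forall>x\<in>carrier A. \<forall>r\<in>carrier RR. L (pAR x r) = f x r"
  using AR.tensor_lift_hom[OF RR.a_comm_group, where f = f] AR.tensor_lift_pt[OF RR.a_comm_group, where f = f] f
  by (intro bexI[of _ "tensor_lift (add_monoid RR) f"]) (simp_all add: RA_eq)

text \<open>
  Here \<open>L (x \<otimes> r) = \<phi> x r\<close> contracts the first factor, and \<open>\<phi> x\<close> passes through the
  comultiplication as a scalar.
\<close>

lemma coassoc_left:
  assumes \<phi>: "\<phi> \<in> Hom A A" "\<And>x. x \<in> carrier A \<Longrightarrow> \<phi> x \<in> FF"
      "\<And>c x. \<lbrakk>c \<in> FF; x \<in> carrier A\<rbrakk> \<Longrightarrow> \<phi> (c \<otimes> x) = c \<otimes> \<phi> x"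
    and h: "h \<in> Hom RR A" "\<And>x y. \<lbrakk>x \<in> carrier A; y \<in> carrier A\<rbrakk> \<Longrightarrow> h (tt x y) = \<phi> x \<otimes> y"
    and k: "k \<in> Hom RR RR" "\<And>x y. \<lbrakk>x \<in> carrier A; y \<in> carrier A\<rbrakk> \<Longrightarrow> k (tt x y) = tt (h (\<delta> x)) y"
    and a: "a \<in> carrier A"
  shows "\<delta> (h (\<delta> a)) = k (\<delta> a)"
proof -
  have \<phi>A: "\<phi> x \<in> carrier A" if "x \<in> carrier A" for x using \<phi>(2)[OF that] FF_carr by simp
  have FF_tt: "tt c \<one> \<otimes>\<^bsub>RR\<^esub> tt x y = tt (c \<otimes> x) y" if cF: "c \<in> FF" and "x \<in> carrier A" "y \<in> carrier A" for c x y
  proof -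
    obtain l where l: "l \<in> carrier K" "c = sc l" using FF_cases[OF cF] by blast
    then show ?thesis using that RR_smult(2)[of l x y] RR_smult(4)[of l "tt x y"] by (simp add: sc_mult)
  qed
  have "\<exists>L \<in> hom TAR (add_monoid RR). \<forall>x\<in>carrier A. \<forall>r\<in>carrier RR. L (pAR x r) = tt (\<phi> x) \<one> \<otimes>\<^bsub>RR\<^esub> r"
  proof (rule pAR_lift)
    fix x l r assume *: "x \<in> carrier A" "l \<in> carrier K" "r \<in> carrier RR"
    have lF: "sc l \<in> FF" using * by (auto simp: FF_def)
    obtain m where m: "m \<in> carrier K" "\<phi> x = sc m" using FF_cases[OF \<phi>(2)[OF *(1)]] by blast
    have "\<phi> (l \<odot> x) = sc l \<otimes> \<phi> x" using \<phi>(3)[OF lF *(1)] * by (simp add: sc_mult)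
    also have "\<dots> = \<phi> x \<otimes> sc l" using * m by (simp add: sc_hom K.m_comm)
    finally have "tt (\<phi> (l \<odot> x)) \<one> = tt (\<phi> x) \<one> \<otimes>\<^bsub>RR\<^esub> tt (sc l) \<one>"
      using FF_tt[OF \<phi>(2)[OF *(1)]] * by simp
    then show "tt (\<phi> (l \<odot> x)) \<one> \<otimes>\<^bsub>RR\<^esub> r = tt (\<phi> x) \<one> \<otimes>\<^bsub>RR\<^esub> (l \<odot>\<^bsub>RR\<^esub> r)"
      using * \<phi>A by (simp add: RR_smult(4) R.m_assoc)
  qed (simp_all add: \<phi>A Hom_add[OF \<phi>(1)] tt_add_l R.l_distr R.r_distr)
  then obtain L where L: "L \<in> hom TAR (add_monoid RR)"
    "\<And>x r. \<lbrakk>x \<in> carrier A; r \<in> carrier RR\<rbrakk> \<Longrightarrow> L (pAR x r) = tt (\<phi> x) \<one> \<otimes>\<^bsub>RR\<^esub> r" by blast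
  have k2: "(\<lambda>r. \<delta> (h r)) \<in> Hom RR RR" by (rule Hom_comp[OF h(1) comult_hom(1)])
  have "k (\<delta> a) = \<delta> (h (\<delta> a))"
  proof (rule coassoc_transfer[OF L(1) a k(1) k2])
    fix x y assume xy: "x \<in> carrier A" "y \<in> carrier A"
    have hc: "h U \<in> carrier A" if "U \<in> carrier RR" for U by (rule Hom_closed[OF h(1) that])
    have "(L \<circ> (\<lambda>U. asc U y)) U = tt (h U) y" if U: "U \<in> carrier RR" for U
    proof (rule hom_RR_eqI[OF Group.hom_compose[OF asc(1)[OF xy(2)] L(1)] _ U])
      show "(\<lambda>U. tt (h U) y) \<in> Hom RR RR"
        using xy by (intro HomI) (simp_all add: hc Hom_add[OF h(1)] tt_add_l)
      fix b c assume bc: "b \<in> carrier A" "c \<in> carrier A"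
      show "(L \<circ> (\<lambda>U. asc U y)) (tt b c) = tt (h (tt b c)) y"
        using xy bc by (simp add: asc L h(2) FF_tt \<phi>)
    qed
    then show "L (asc (\<delta> x) y) = k (tt x y)" using xy by (simp add: k)
    obtain l where l: "l \<in> carrier K" "\<phi> x = sc l" using FF_cases[OF \<phi>(2)[OF xy(1)]] by blast
    have "\<delta> (\<phi> x \<otimes> y) = tt (\<phi> x) \<one> \<otimes>\<^bsub>RR\<^esub> \<delta> y"
      using l xy by (simp add: sc_mult comult_hom(3) RR_smult(4))
    then show "L (pAR x (\<delta> y)) = \<delta> (h (tt x y))" using xy by (simp add: L h)
  qed
  then show ?thesis ..
qed

text \<open>
  Here \<open>L (x \<otimes> r) = x \<otimes> h r\<close> contracts the last factor.
\<close>

lemma coassoc_right: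
  assumes \<phi>: "\<phi> \<in> Hom A A" "\<And>x. x \<in> carrier A \<Longrightarrow> \<phi> x \<in> FF"
      "\<And>c x. \<lbrakk>c \<in> FF; x \<in> carrier A\<rbrakk> \<Longrightarrow> \<phi> (c \<otimes> x) = c \<otimes> \<phi> x"
    and h: "h \<in> Hom RR A" "\<And>x y. \<lbrakk>x \<in> carrier A; y \<in> carrier A\<rbrakk> \<Longrightarrow> h (tt x y) = \<phi> y \<otimes> x"
    and k: "k \<in> Hom RR RR" "\<And>x y. \<lbrakk>x \<in> carrier A; y \<in> carrier A\<rbrakk> \<Longrightarrow> k (tt x y) = tt x (h (\<delta> y))"
    and a: "a \<in> carrier A"
  shows "\<delta> (h (\<delta> a)) = k (\<delta> a)"
proof -
  have hc: "h U \<in> carrier A" if "U \<in> carrier RR" for U by (rule Hom_closed[OF h(1) that])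
  have \<phi>A: "\<phi> x \<in> carrier A" if "x \<in> carrier A" for x using \<phi>(2)[OF that] FF_carr by simp
  have hs: "h (l \<odot>\<^bsub>RR\<^esub> U) = l \<odot> h U" if "l \<in> carrier K" "U \<in> carrier RR" for l U
    using that(2)
  proof (induction rule: RR_induct)
    case (pure x y)
    then show ?case using that(1) \<phi>A by (simp add: RR_smult(2) h(2) smult_mult)
  next
    case (add u v)
    then show ?case using that(1) RR_smult_closed hc
      by (simp add: Hom_add[OF RR_smult(1)] Hom_add[OF h(1)] Mo.smult_r_distr)
  qed
  have "\<exists>L \<in> hom TAR (add_monoid RR). \<forall>x\<in>carrier A. \<forall>r\<in>carrier RR. L (pAR x r) = tt x (h r)"
    by (rule pAR_lift) (simp_all add: hc Hom_add[OF h(1)] tt_add_l tt_add_r hs tt_bal)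
  then obtain L where L: "L \<in> hom TAR (add_monoid RR)"
    "\<And>x r. \<lbrakk>x \<in> carrier A; r \<in> carrier RR\<rbrakk> \<Longrightarrow> L (pAR x r) = tt x (h r)" by blast
  have k1: "(\<lambda>r. \<delta> (h r)) \<in> Hom RR RR" by (rule Hom_comp[OF h(1) comult_hom(1)])
  show ?thesis
  proof (rule coassoc_transfer[OF L(1) a k1 k(1)])
    fix x y assume xy: "x \<in> carrier A" "y \<in> carrier A"
    obtain l where l: "l \<in> carrier K" "\<phi> y = sc l" using FF_cases[OF \<phi>(2)[OF xy(2)]] by blast
    have "(L \<circ> (\<lambda>U. asc U y)) U = l \<odot>\<^bsub>RR\<^esub> U" if U: "U \<in> carrier RR" for U
    proof (rule hom_RR_eqI[OF Group.hom_compose[OF asc(1)[OF xy(2)] L(1)] RR_smult(1)[OF l(1)] U])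
      fix b c assume bc: "b \<in> carrier A" "c \<in> carrier A"
      show "(L \<circ> (\<lambda>U. asc U y)) (tt b c) = l \<odot>\<^bsub>RR\<^esub> tt b c"
        using xy bc l by (simp add: asc L h(2) RR_smult(2) sc_mult tt_bal)
    qed
    then have "L (asc (\<delta> x) y) = l \<odot>\<^bsub>RR\<^esub> \<delta> x" using xy by simp
    also have "\<dots> = \<delta> (h (tt x y))" using xy l by (simp add: h(2) sc_mult comult_hom(3))
    finally show "L (asc (\<delta> x) y) = \<delta> (h (tt x y))" .
    show "L (pAR x (\<delta> y)) = k (tt x y)" using xy by (simp add: L k)
  qed
qed

lemma ee_Hom: "ee \<in> Hom A A"
  by (rule HomI) (simp_all add: ee_def counit_hom Mo.smult_l_distr)

lemma super_hopf_coideal_instance: "super_hopf_coideal A RR FF B ev od ee (antipode A) \<delta> tt"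
proof (rule super_hopf_coideal.intro[OF A.ring_axioms RR_ring], rule super_hopf_coideal_axioms.intro)
  note BA = subsetD[OF subringE(1)[OF B_sub(1)]]
  show "subring FF A" by (rule FF_subring)
  show "subring B A" by (rule B_sub)
  show "FF \<subseteq> B" using B_sub(2) subringE(3)[OF B_sub(1)] by (auto simp: FF_def)
  show "\<one> \<noteq> \<zero>"
  proof
    assume "\<one> = \<zero>"
    then have "\<zero>\<^bsub>K\<^esub> \<odot> \<one> = \<one>" by simp
    then have "\<epsilon> \<one> = \<zero>\<^bsub>K\<^esub> \<otimes>\<^bsub>K\<^esub> \<epsilon> \<one>" using counit_hom(4)[of "\<zero>\<^bsub>K\<^esub>" \<one>] by simp
    then show False using counit_hom(5) by simp
  qed
  show "\<exists>d\<in>FF. c \<otimes> d = \<one>" if "c \<in> FF" "c \<noteq> \<zero>" for c by (rule FF_inv[OF that])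
  show "ev \<in> Hom A A" "od \<in> Hom A A" by (auto intro!: HomI simp: comp_add)
  show "ev x \<oplus> od x = x" "ev (ev x) = ev x" "od (od x) = od x" if "x \<in> carrier A" for x using that by (simp_all add: comp)
  show "ev (x \<otimes> y) = ev x \<otimes> ev y \<oplus> od x \<otimes> od y" "od (x \<otimes> y) = ev x \<otimes> od y \<oplus> od x \<otimes> ev y"
    if "x \<in> carrier A" "y \<in> carrier A" for x y using that by (simp_all add: comp_mult)
  show "ev c = c" if "c \<in> FF" for c by (rule FF_ev[OF that])
  show "ev b \<in> B" if "b \<in> B" for b by (rule B_sub(3)[OF that])
  show "ev x \<otimes> y = y \<otimes> ev x" "od x \<otimes> od y = \<ominus> (od y \<otimes> od x)" if "x \<in> carrier A" "y \<in> carrier A" for x y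
    by (rule supercomm[OF that])+
  show "od x \<otimes> od x = \<zero>" if "x \<in> carrier A" for x by (rule od_square[OF that])
  show "ee \<in> Hom A A" by (rule ee_Hom)
  show "ee x \<in> FF" if "x \<in> carrier A" for x using that by (auto simp: ee_def FF_def counit_hom)
  show "ee (x \<otimes> y) = ee x \<otimes> ee y" if "x \<in> carrier A" "y \<in> carrier A" for x y
    using that by (simp add: ee_def counit_hom sc_hom)
  show "ee c = c" if "c \<in> FF" for c using that by (auto simp: ee_def FF_def counit_hom)
  show "ee (od x) = \<zero>" if "x \<in> carrier A" for x using that by (simp add: ee_def counit_hom(6) comp)
  show "antipode A \<in> Hom A A" by (rule antipode_lin)
  show "antipode A (c \<otimes> x) = c \<otimes> antipode A x" if cx: "c \<in> FF" "x \<in> carrier A" for c x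
  proof -
    obtain k where k: "k \<in> carrier K" "c = sc k" using FF_cases[OF cx(1)] by blast
    have "antipode A x \<in> carrier A" using cx by (intro Hom_closed[OF antipode_lin(1)])
    then show ?thesis using k cx by (simp add: sc_mult antipode_lin(2))
  qed
  show "antipode A (ev x) = ev (antipode A x)" if x: "x \<in> carrier A" for x
  proof -
    have "antipode A x = antipode A (ev x \<oplus> od x)" using x by (simp add: comp)
    also have "\<dots> = antipode A (ev x) \<oplus> antipode A (od x)" using x by (simp add: Hom_add[OF antipode_lin(1)])
    finally have "ev (antipode A x) = antipode A (ev x) \<and> od (antipode A x) = antipode A (od x)"
      using x by (intro comp_uniq antipode_lin comp)
    then show ?thesis by simp
  qed
  show "tt x y \<in> carrier RR" if "x \<in> carrier A" "y \<in> carrier A" for x y using that by simp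
  show "tt (x \<oplus> x') y = tt x y \<oplus>\<^bsub>RR\<^esub> tt x' y" if "x \<in> carrier A" "x' \<in> carrier A" "y \<in> carrier A" for x x' y
    using that by (rule tt_add_l)
  show "tt x (y \<oplus> y') = tt x y \<oplus>\<^bsub>RR\<^esub> tt x y'" if "x \<in> carrier A" "y \<in> carrier A" "y' \<in> carrier A" for x y y'
    using that by (rule tt_add_r)
  show "tt (c \<otimes> x) y = tt x (c \<otimes> y)" if cx: "c \<in> FF" "x \<in> carrier A" "y \<in> carrier A" for c x y
  proof -
    obtain k where k: "k \<in> carrier K" "c = sc k" using FF_cases[OF cx(1)] by blast
    show ?thesis using k cx by (simp add: sc_mult tt_bal)
  qed
  show "tt a b \<otimes>\<^bsub>RR\<^esub> tt x y = tt (a \<otimes> ev x) (b \<otimes> y) \<oplus>\<^bsub>RR\<^esub> tt (a \<otimes> od x) ((ev b \<ominus> od b) \<otimes> y)"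
    if "a \<in> carrier A" "b \<in> carrier A" "x \<in> carrier A" "y \<in> carrier A" for a b x y
    using RR_mult_tt[OF that] by (simp add: th_def)
  show "P r" if "r \<in> carrier RR" "\<And>x y. \<lbrakk>x \<in> carrier A; y \<in> carrier A\<rbrakk> \<Longrightarrow> P (tt x y)"
    "\<And>u v. \<lbrakk>u \<in> carrier RR; v \<in> carrier RR; P u; P v\<rbrakk> \<Longrightarrow> P (u \<oplus>\<^bsub>RR\<^esub> v)" for r P
    using that by (rule RR_induct)
  show "\<exists>h \<in> Hom RR A. \<forall>x\<in>carrier A. \<forall>y\<in>carrier A. h (tt x y) = f x y"
    if f: "\<And>x y. \<lbrakk>x \<in> carrier A; y \<in> carrier A\<rbrakk> \<Longrightarrow> f x y \<in> carrier A"
        "\<And>x x' y. \<lbrakk>x \<in> carrier A; x' \<in> carrier A; y \<in> carrier A\<rbrakk> \<Longrightarrow> f (x \<oplus> x') y = f x y \<oplus> f x' y"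
        "\<And>x y y'. \<lbrakk>x \<in> carrier A; y \<in> carrier A; y' \<in> carrier A\<rbrakk> \<Longrightarrow> f x (y \<oplus> y') = f x y \<oplus> f x y'"
        "\<And>c x y. \<lbrakk>c \<in> FF; x \<in> carrier A; y \<in> carrier A\<rbrakk> \<Longrightarrow> f (c \<otimes> x) y = f x (c \<otimes> y)" for f
  proof -
    have fb: "f (k \<odot> x) y = f x (k \<odot> y)" if "x \<in> carrier A" "k \<in> carrier K" "y \<in> carrier A" for x k y
      using f(4)[of "sc k" x y] that by (simp add: FF_def sc_mult)
    show ?thesis
      using RR_lift_hom[OF AA_comm_group, of f] RR_lift_tt[OF AA_comm_group, of f] f(1-3) fb
      by (intro bexI[of _ "tensor_lift (add_monoid A) f"]) simp_all
  qed
  show "\<exists>h \<in> Hom RR RR. \<forall>x\<in>carrier A. \<forall>y\<in>carrier A. h (tt x y) = g x y"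
    if g: "\<And>x y. \<lbrakk>x \<in> carrier A; y \<in> carrier A\<rbrakk> \<Longrightarrow> g x y \<in> carrier RR"
        "\<And>x x' y. \<lbrakk>x \<in> carrier A; x' \<in> carrier A; y \<in> carrier A\<rbrakk> \<Longrightarrow> g (x \<oplus> x') y = g x y \<oplus>\<^bsub>RR\<^esub> g x' y"
        "\<And>x y y'. \<lbrakk>x \<in> carrier A; y \<in> carrier A; y' \<in> carrier A\<rbrakk> \<Longrightarrow> g x (y \<oplus> y') = g x y \<oplus>\<^bsub>RR\<^esub> g x y'"
        "\<And>c x y. \<lbrakk>c \<in> FF; x \<in> carrier A; y \<in> carrier A\<rbrakk> \<Longrightarrow> g (c \<otimes> x) y = g x (c \<otimes> y)" for g
  proof -
    have fb: "g (k \<odot> x) y = g x (k \<odot> y)" if "x \<in> carrier A" "k \<in> carrier K" "y \<in> carrier A" for x k y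
      using g(4)[of "sc k" x y] that by (simp add: FF_def sc_mult)
    show ?thesis
      using RR_lift_hom[OF RR.a_comm_group, of g] RR_lift_tt[OF RR.a_comm_group, of g] g(1-3) fb
      by (intro bexI[of _ "tensor_lift (add_monoid RR) g"]) simp_all
  qed
  show "\<delta> \<in> Hom A RR" by (rule comult_hom)
  show "\<delta> (x \<otimes> y) = \<delta> x \<otimes>\<^bsub>RR\<^esub> \<delta> y" if "x \<in> carrier A" "y \<in> carrier A" for x y using that by (rule comult_hom)
  show "\<delta> (c \<otimes> x) = tt c \<one> \<otimes>\<^bsub>RR\<^esub> \<delta> x" if cx: "c \<in> FF" "x \<in> carrier A" for c x
  proof -
    obtain k where k: "k \<in> carrier K" "c = sc k" using FF_cases[OF cx(1)] by blast
    show ?thesis using k cx by (simp add: sc_mult comult_hom(3) RR_smult(4)[OF k(1)])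
  qed
  show "P (\<delta> b)" if "b \<in> B" "\<And>x y. \<lbrakk>x \<in> carrier A; y \<in> B\<rbrakk> \<Longrightarrow> P (tt x y)"
    "\<And>u v. \<lbrakk>u \<in> carrier RR; v \<in> carrier RR; P u; P v\<rbrakk> \<Longrightarrow> P (u \<oplus>\<^bsub>RR\<^esub> v)" for b P
    using that by (rule coideal_induct)
  show "\<delta> (h (\<delta> a)) = k (\<delta> a)"
    if "\<phi> \<in> Hom A A" "\<And>x. x \<in> carrier A \<Longrightarrow> \<phi> x \<in> FF" "\<And>c x. \<lbrakk>c \<in> FF; x \<in> carrier A\<rbrakk> \<Longrightarrow> \<phi> (c \<otimes> x) = c \<otimes> \<phi> x"
      "h \<in> Hom RR A" "\<And>x y. \<lbrakk>x \<in> carrier A; y \<in> carrier A\<rbrakk> \<Longrightarrow> h (tt x y) = \<phi> x \<otimes> y"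
      "k \<in> Hom RR RR" "\<And>x y. \<lbrakk>x \<in> carrier A; y \<in> carrier A\<rbrakk> \<Longrightarrow> k (tt x y) = tt (h (\<delta> x)) y" "a \<in> carrier A"
    for \<phi> h k a using that by (rule coassoc_left)
  show "\<delta> (h (\<delta> a)) = k (\<delta> a)"
    if "\<phi> \<in> Hom A A" "\<And>x. x \<in> carrier A \<Longrightarrow> \<phi> x \<in> FF" "\<And>c x. \<lbrakk>c \<in> FF; x \<in> carrier A\<rbrakk> \<Longrightarrow> \<phi> (c \<otimes> x) = c \<otimes> \<phi> x"
      "h \<in> Hom RR A" "\<And>x y. \<lbrakk>x \<in> carrier A; y \<in> carrier A\<rbrakk> \<Longrightarrow> h (tt x y) = \<phi> y \<otimes> x"
      "k \<in> Hom RR RR" "\<And>x y. \<lbrakk>x \<in> carrier A; y \<in> carrier A\<rbrakk> \<Longrightarrow> k (tt x y) = tt x (h (\<delta> y))" "a \<in> carrier A"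
    for \<phi> h k a using that by (rule coassoc_right)
  note Sc = Hom_closed[OF antipode_lin(1)] and Sa = Hom_add[OF antipode_lin(1)]
  show "h (\<delta> a) = a"
    if "h \<in> Hom RR A" "\<And>x y. \<lbrakk>x \<in> carrier A; y \<in> carrier A\<rbrakk> \<Longrightarrow> h (tt x y) = ee x \<otimes> y" "a \<in> carrier A" for h a
  proof -
    have "h (\<delta> a) = tensor_lift (add_monoid A) (\<lambda>x y. \<epsilon> x \<odot> y) (\<delta> a)"
      by (rule lift_eq[OF that(1)])
        (use that in \<open>auto simp: ee_smult counit_hom Mo.smult_l_distr Mo.smult_r_distr Mo.smult_assoc1[symmetric] K.m_comm\<close>)
    then show ?thesis using hopf_axioms(2) that by simp
  qed
  show "h (\<delta> a) = a"
    if "h \<in> Hom RR A" "\<And>x y. \<lbrakk>x \<in> carrier A; y \<in> carrier A\<rbrakk> \<Longrightarrow> h (tt x y) = ee y \<otimes> x" "a \<in> carrier A" for h a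
  proof -
    have "h (\<delta> a) = tensor_lift (add_monoid A) (\<lambda>x y. \<epsilon> y \<odot> x) (\<delta> a)"
      by (rule lift_eq[OF that(1)])
        (use that in \<open>auto simp: ee_smult counit_hom Mo.smult_l_distr Mo.smult_r_distr Mo.smult_assoc1[symmetric] K.m_comm\<close>)
    then show ?thesis using hopf_axioms(3) that by simp
  qed
  show "h (\<delta> a) = ee a"
    if "h \<in> Hom RR A" "\<And>x y. \<lbrakk>x \<in> carrier A; y \<in> carrier A\<rbrakk> \<Longrightarrow> h (tt x y) = antipode A x \<otimes> y" "a \<in> carrier A" for h a
  proof -
    have "h (\<delta> a) = tensor_lift (add_monoid A) (\<lambda>x y. antipode A x \<otimes> y) (\<delta> a)"
      by (rule lift_eq[OF that(1)])
        (use that in \<open>auto simp: Sc Sa antipode_lin smult_mult l_distr r_distr\<close>)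
    then show ?thesis using hopf_axioms(4) that by (simp add: ee_def)
  qed
  show "h (\<delta> a) = ee a"
    if "h \<in> Hom RR A" "\<And>x y. \<lbrakk>x \<in> carrier A; y \<in> carrier A\<rbrakk> \<Longrightarrow> h (tt x y) = x \<otimes> antipode A y" "a \<in> carrier A" for h a
  proof -
    have "h (\<delta> a) = tensor_lift (add_monoid A) (\<lambda>x y. x \<otimes> antipode A y) (\<delta> a)"
      by (rule lift_eq[OF that(1)])
        (use that in \<open>auto simp: Sc Sa antipode_lin smult_mult l_distr r_distr\<close>)
    then show ?thesis using hopf_axioms(5) that by (simp add: ee_def)
  qed
qed

end


section \<open>Flatness over the coideal\<close>

lemma (in ring) regular_module_over_subring:
  assumes B: "subring B R"
  shows "left_module (R\<lparr>carrier := B\<rparr>) (regular_left_module R)"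
proof -
  have BR: "b \<in> carrier R" if "b \<in> B" for b using subringE(1)[OF B] that by blast
  have ab: "abelian_group (regular_left_module R)"
  proof (rule abelian_groupI)
    show "\<exists>y\<in>carrier (regular_left_module R). y \<oplus>\<^bsub>regular_left_module R\<^esub> x = \<zero>\<^bsub>regular_left_module R\<^esub>"
      if "x \<in> carrier (regular_left_module R)" for x
      using that by (intro bexI[of _ "\<ominus> x"]) (simp_all add: regular_left_module_def l_neg)
  qed (simp_all add: regular_left_module_def a_ac)
  show ?thesis
    by (intro left_module.intro left_module_axioms.intro subring_is_ring[OF B] ab)
      (simp_all add: regular_left_module_def BR l_distr r_distr m_assoc)
qed

lemma (in ring) finsum_in_subring:
  assumes B: "subring B R" and f: "\<And>i. i \<in> I \<Longrightarrow> f i \<in> B"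
  shows "(\<Oplus>i\<in>I. f i) \<in> B"
proof (cases "finite I")
  case True
  then show ?thesis using f
  proof (induction I)
    case (insert x I)
    then have "(\<Oplus>i\<in>insert x I. f i) = f x \<oplus> (\<Oplus>i\<in>I. f i)"
      using subringE(1)[OF B] by (intro finsum_insert) auto
    with insert subringE(7)[OF B] show ?case by auto
  qed (simp add: subringE(2)[OF B])
qed (simp add: finsum_infinite subringE(2)[OF B])

text \<open>
  On the submodule \<open>M\<close> generated by \<open>D\<close>, the form \<open>\<phi> l\<close> sends \<open>(\<Sum>d. z\<^sub>d d)\<close> to \<open>(\<Sum>d. z\<^sub>d C\<^sub>l\<^sub>d)\<close>. An
  element of \<open>M\<close> has several coefficient vectors \<open>z\<close>, and one of them is chosen; any two differ by
  a relation, so the value does not depend on the choice.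
\<close>

lemma (in ring) subring_locally_dual_basis:
  assumes B: "subring B R"
    and factors: "\<And>Y. \<lbrakk>finite Y; Y \<subseteq> carrier R\<rbrakk> \<Longrightarrow>
      \<exists>D. finite D \<and> D \<subseteq> carrier R \<and>
        (\<forall>y\<in>Y. \<exists>c. (\<forall>d\<in>D. c d \<in> B) \<and> y = (\<Oplus>d\<in>D. c d \<otimes> d)) \<and>
        (\<exists>(N :: nat) C u. (\<forall>l<N. (\<forall>d\<in>D. C l d \<in> B) \<and> u l \<in> carrier R) \<and>
          (\<forall>d\<in>D. d = (\<Oplus>l\<in>{..<N}. C l d \<otimes> u l)) \<and>
          (\<forall>z. (\<forall>d\<in>D. z d \<in> B) \<longrightarrow> (\<Oplus>d\<in>D. z d \<otimes> d) = \<zero> \<longrightarrow>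
            (\<forall>l<N. (\<Oplus>d\<in>D. z d \<otimes> C l d) = \<zero>)))"
  shows "locally_dual_basis (R\<lparr>carrier := B\<rparr>) (regular_left_module R)"
  unfolding locally_dual_basis_def
proof (intro allI impI)
  interpret N: left_module "R\<lparr>carrier := B\<rparr>" "regular_left_module R"
    by (rule regular_module_over_subring[OF B])
  note BR = subsetD[OF subringE(1)[OF B]]
  have id: "(\<lambda>x. x) \<in> Hom R (regular_left_module R)" by (simp add: hom_def regular_left_module_def)
  have finsum_eq: "finsum (regular_left_module R) f I = finsum R f I"
    if "finite I" "\<And>i. i \<in> I \<Longrightarrow> f i \<in> carrier R" for f :: "nat \<Rightarrow> 'a" and I
    using Hom_finsum[OF abelian_group_axioms N.N.abelian_group_axioms id, of I f] that by simp
  fix Y assume Y: "finite Y" "Y \<subseteq> carrier (regular_left_module R)"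
  then have Y': "Y \<subseteq> carrier R" by (simp add: regular_left_module_def)
  obtain D and N :: nat and C u where D: "finite D" "D \<subseteq> carrier R"
    and Yc: "\<forall>y\<in>Y. \<exists>c. (\<forall>d\<in>D. c d \<in> B) \<and> y = (\<Oplus>d\<in>D. c d \<otimes> d)"
    and Cu: "\<forall>l<N. (\<forall>d\<in>D. C l d \<in> B) \<and> u l \<in> carrier R"
    and Du: "\<forall>d\<in>D. d = (\<Oplus>l\<in>{..<N}. C l d \<otimes> u l)"
    and rel: "\<forall>z. (\<forall>d\<in>D. z d \<in> B) \<longrightarrow> (\<Oplus>d\<in>D. z d \<otimes> d) = \<zero> \<longrightarrow>
            (\<forall>l<N. (\<Oplus>d\<in>D. z d \<otimes> C l d) = \<zero>)"
    using factors[OF Y(1) Y'] by (elim exE conjE)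
  let ?rep = "\<lambda>z y. (\<forall>d\<in>D. z d \<in> B) \<and> y = (\<Oplus>d\<in>D. z d \<otimes> d)"
  define M where "M = {y. \<exists>z. ?rep z y}"
  define \<phi> where "\<phi> l y = (\<Oplus>d\<in>D. (SOME z. ?rep z y) d \<otimes> C l d)" for l y
  have Dc: "d \<in> carrier R" if "d \<in> D" for d using D that by blast
  have Cc: "C l d \<in> carrier R" "C l d \<in> B" if "l < N" "d \<in> D" for l d using Cu that BR by blast+
  have uc: "u l \<in> carrier R" if "l < N" for l using Cu that by blast
  have \<phi>: "\<phi> l y = (\<Oplus>d\<in>D. z d \<otimes> C l d)" if z: "?rep z y" and l: "l < N" for z y l
  proof -
    \<comment> \<open>The chosen vector \<open>w\<close> may differ from \<open>z\<close>, but \<open>w - z\<close> is a relation.\<close>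
    define w where "w = (SOME z. ?rep z y)"
    have w: "?rep w y" unfolding w_def using z by (rule someI[of "\<lambda>z. ?rep z y"])
    have zc: "z d \<in> carrier R" "w d \<in> carrier R" "w d \<ominus> z d \<in> B" if "d \<in> D" for d
      using z w that BR subringE(5,7)[OF B] by (auto simp: a_minus_def)
    have split: "(\<Oplus>d\<in>D. w d \<otimes> g d) = (\<Oplus>d\<in>D. (w d \<ominus> z d) \<otimes> g d) \<oplus> (\<Oplus>d\<in>D. z d \<otimes> g d)"
      if g: "\<And>d. d \<in> D \<Longrightarrow> g d \<in> carrier R" for g
    proof -
      have "(w d \<ominus> z d) \<otimes> g d \<oplus> z d \<otimes> g d = w d \<otimes> g d" if "d \<in> D" for d
        using zc[OF that] g[OF that] by (simp add: l_distr[symmetric] a_minus_def a_assoc l_neg)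
      then have "(\<Oplus>d\<in>D. w d \<otimes> g d) = (\<Oplus>d\<in>D. (w d \<ominus> z d) \<otimes> g d \<oplus> z d \<otimes> g d)"
        using zc g by (intro finsum_cong') auto
      also have "\<dots> = (\<Oplus>d\<in>D. (w d \<ominus> z d) \<otimes> g d) \<oplus> (\<Oplus>d\<in>D. z d \<otimes> g d)"
        using zc g by (intro finsum_addf) auto
      finally show ?thesis .
    qed
    have yc: "y \<in> carrier R" using z zc Dc by (auto intro!: finsum_closed)
    have dc: "(\<Oplus>d\<in>D. (w d \<ominus> z d) \<otimes> d) \<in> carrier R"
      using zc(3) BR Dc by (auto intro!: finsum_closed)
    have "(\<Oplus>d\<in>D. w d \<otimes> d) = y" "(\<Oplus>d\<in>D. z d \<otimes> d) = y"
      using conjunct2[OF w] conjunct2[OF z] by simp_all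
    then have "y = (\<Oplus>d\<in>D. (w d \<ominus> z d) \<otimes> d) \<oplus> y" using split[of "\<lambda>d. d"] Dc by simp
    then have "(\<Oplus>d\<in>D. (w d \<ominus> z d) \<otimes> d) = \<zero>" using add.r_cancel_one'[OF yc dc] by simp
    then have "(\<Oplus>d\<in>D. (w d \<ominus> z d) \<otimes> C l d) = \<zero>"
      using rel[rule_format, of "\<lambda>d. w d \<ominus> z d"] zc(3) l by simp
    moreover have "(\<Oplus>d\<in>D. z d \<otimes> C l d) \<in> carrier R" using zc Cc l by (auto intro!: finsum_closed)
    ultimately show ?thesis
      using split[of "C l"] Cc l by (simp add: \<phi>_def w_def)
  qed
  have M_car: "y \<in> carrier R" if "y \<in> M" for y
    using that BR Dc by (auto simp: M_def intro!: finsum_closed)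
  have add: "?rep (\<lambda>d. z d \<oplus> z' d) (y \<oplus> y')" if z: "?rep z y" "?rep z' y'" for z z' y y'
  proof
    show "\<forall>d\<in>D. z d \<oplus> z' d \<in> B" using z subringE(7)[OF B] by blast
    have "(\<Oplus>d\<in>D. (z d \<oplus> z' d) \<otimes> d) = (\<Oplus>d\<in>D. z d \<otimes> d \<oplus> z' d \<otimes> d)"
      using z BR Dc by (intro finsum_cong') (auto simp: l_distr)
    also have "\<dots> = (\<Oplus>d\<in>D. z d \<otimes> d) \<oplus> (\<Oplus>d\<in>D. z' d \<otimes> d)"
      using z BR Dc by (intro finsum_addf) auto
    finally show "y \<oplus> y' = (\<Oplus>d\<in>D. (z d \<oplus> z' d) \<otimes> d)" using z by simp
  qed
  have smult: "?rep (\<lambda>d. r \<otimes> z d) (r \<otimes> y)" if z: "?rep z y" and r: "r \<in> B" for z r y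
  proof
    show "\<forall>d\<in>D. r \<otimes> z d \<in> B" using z r subringE(6)[OF B] by blast
    have "r \<otimes> (\<Oplus>d\<in>D. z d \<otimes> d) = (\<Oplus>d\<in>D. r \<otimes> (z d \<otimes> d))"
      using z r BR Dc D by (intro finsum_rdistr) auto
    also have "\<dots> = (\<Oplus>d\<in>D. (r \<otimes> z d) \<otimes> d)"
      using z r BR Dc by (intro finsum_cong') (auto simp: m_assoc)
    finally show "r \<otimes> y = (\<Oplus>d\<in>D. (r \<otimes> z d) \<otimes> d)" using z by simp
  qed
  have \<phi>_B: "\<phi> l y \<in> B" if yM: "y \<in> M" and l: "l < N" for l y
  proof -
    obtain z where z: "?rep z y" using yM by (auto simp: M_def)
    show ?thesis unfolding \<phi>[OF z l]
      by (rule finsum_in_subring[OF B]) (use z Cc(2)[OF l] subringE(6)[OF B] in simp)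
  qed
  have \<phi>_add: "\<phi> l (y \<oplus> y') = \<phi> l y \<oplus> \<phi> l y'" if yM: "y \<in> M" "y' \<in> M" and l: "l < N" for l y y'
  proof -
    obtain z z' where z: "?rep z y" "?rep z' y'" using yM by (auto simp: M_def)
    have "(\<Oplus>d\<in>D. (z d \<oplus> z' d) \<otimes> C l d) = (\<Oplus>d\<in>D. z d \<otimes> C l d \<oplus> z' d \<otimes> C l d)"
      using z BR Cc l by (intro finsum_cong') (auto simp: l_distr)
    also have "\<dots> = (\<Oplus>d\<in>D. z d \<otimes> C l d) \<oplus> (\<Oplus>d\<in>D. z' d \<otimes> C l d)"
      using z BR Cc l by (intro finsum_addf) auto
    finally show ?thesis using \<phi>[OF add[OF z] l] \<phi>[OF z(1) l] \<phi>[OF z(2) l] by simp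
  qed
  have \<phi>_smult: "\<phi> l (r \<otimes> y) = r \<otimes> \<phi> l y" if yM: "y \<in> M" and r: "r \<in> B" and l: "l < N" for l r y
  proof -
    obtain z where z: "?rep z y" using yM by (auto simp: M_def)
    have "r \<otimes> (\<Oplus>d\<in>D. z d \<otimes> C l d) = (\<Oplus>d\<in>D. r \<otimes> (z d \<otimes> C l d))"
      using z r BR Cc l D by (intro finsum_rdistr) auto
    also have "\<dots> = (\<Oplus>d\<in>D. (r \<otimes> z d) \<otimes> C l d)"
      using z r BR Cc l by (intro finsum_cong') (auto simp: m_assoc)
    finally show ?thesis using \<phi>[OF smult[OF z r] l] \<phi>[OF z l] by simp
  qed
  have basis: "y = (\<Oplus>l\<in>{..<N}. \<phi> l y \<otimes> u l)" if yM: "y \<in> M" for y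
  proof -
    obtain z where z: "?rep z y" using yM by (auto simp: M_def)
    have zc: "z d \<in> carrier R" if "d \<in> D" for d using z that BR by blast
    have "y = (\<Oplus>d\<in>D. z d \<otimes> d)" using z by blast
    also have "\<dots> = (\<Oplus>d\<in>D. \<Oplus>l\<in>{..<N}. z d \<otimes> C l d \<otimes> u l)"
    proof (rule finsum_cong')
      fix d assume d: "d \<in> D"
      have "z d \<otimes> d = z d \<otimes> (\<Oplus>l\<in>{..<N}. C l d \<otimes> u l)" using Du d by (intro arg_cong[where f = "(\<otimes>) (z d)"]) blast
      also have "\<dots> = (\<Oplus>l\<in>{..<N}. z d \<otimes> (C l d \<otimes> u l))"
        using zc[OF d] d Cc uc by (intro finsum_rdistr) auto
      also have "\<dots> = (\<Oplus>l\<in>{..<N}. z d \<otimes> C l d \<otimes> u l)"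
        using zc[OF d] d Cc uc by (intro finsum_cong') (auto simp: m_assoc)
      finally show "z d \<otimes> d = (\<Oplus>l\<in>{..<N}. z d \<otimes> C l d \<otimes> u l)" .
    qed (use zc Cc uc in \<open>auto intro!: finsum_closed\<close>)
    also have "\<dots> = (\<Oplus>l\<in>{..<N}. \<Oplus>d\<in>D. z d \<otimes> C l d \<otimes> u l)"
      by (rule finsum_swap) (use zc Cc uc D in auto)
    also have "\<dots> = (\<Oplus>l\<in>{..<N}. (\<Oplus>d\<in>D. z d \<otimes> C l d) \<otimes> u l)"
      by (rule finsum_cong'[OF refl]) (use zc Cc uc D in \<open>auto intro!: finsum_closed finsum_ldistr[symmetric]\<close>)
    also have "\<dots> = (\<Oplus>l\<in>{..<N}. \<phi> l y \<otimes> u l)"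
      by (rule finsum_cong') (use \<phi>[OF z] \<phi>_B[OF yM] BR uc in auto)
    finally show ?thesis .
  qed
  show "\<exists>M (k :: nat) \<phi> u. Y \<subseteq> M \<and> M \<subseteq> carrier (regular_left_module R) \<and>
      (\<forall>y\<in>M. \<forall>y'\<in>M. y \<oplus>\<^bsub>regular_left_module R\<^esub> y' \<in> M) \<and>
      (\<forall>r\<in>carrier (R\<lparr>carrier := B\<rparr>). \<forall>y\<in>M. r \<odot>\<^bsub>regular_left_module R\<^esub> y \<in> M) \<and>
      (\<forall>l<k. u l \<in> carrier (regular_left_module R) \<and> (\<forall>y\<in>M. \<phi> l y \<in> carrier (R\<lparr>carrier := B\<rparr>)) \<and>
        (\<forall>y\<in>M. \<forall>y'\<in>M. \<phi> l (y \<oplus>\<^bsub>regular_left_module R\<^esub> y') = \<phi> l y \<oplus>\<^bsub>R\<lparr>carrier := B\<rparr>\<^esub> \<phi> l y') \<and>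
        (\<forall>r\<in>carrier (R\<lparr>carrier := B\<rparr>). \<forall>y\<in>M.
          \<phi> l (r \<odot>\<^bsub>regular_left_module R\<^esub> y) = r \<otimes>\<^bsub>R\<lparr>carrier := B\<rparr>\<^esub> \<phi> l y)) \<and>
      (\<forall>y\<in>M. y = (\<Oplus>\<^bsub>regular_left_module R\<^esub>l\<in>{..<k}. \<phi> l y \<odot>\<^bsub>regular_left_module R\<^esub> u l))"
  proof (intro exI conjI ballI allI impI)
    show "Y \<subseteq> M" using Yc by (auto simp: M_def)
    show "M \<subseteq> carrier (regular_left_module R)" using M_car by (auto simp: regular_left_module_def)
    show "y \<oplus>\<^bsub>regular_left_module R\<^esub> y' \<in> M" if yM: "y \<in> M" "y' \<in> M" for y y'
    proof -
      obtain z z' where "?rep z y" "?rep z' y'" using yM by (auto simp: M_def)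
      then show ?thesis using add[of z y z' y'] by (auto simp: M_def regular_left_module_def)
    qed
    show "r \<odot>\<^bsub>regular_left_module R\<^esub> y \<in> M" if r: "r \<in> carrier (R\<lparr>carrier := B\<rparr>)" and yM: "y \<in> M" for r y
    proof -
      obtain z where "?rep z y" using yM by (auto simp: M_def)
      then show ?thesis using smult[of z y r] r by (auto simp: M_def regular_left_module_def)
    qed
    fix l assume l: "l < N"
    show "u l \<in> carrier (regular_left_module R)" using uc[OF l] by (simp add: regular_left_module_def)
    show "\<phi> l y \<in> carrier (R\<lparr>carrier := B\<rparr>)" if "y \<in> M" for y using \<phi>_B[OF that l] by simp
    show "\<phi> l (y \<oplus>\<^bsub>regular_left_module R\<^esub> y') = \<phi> l y \<oplus>\<^bsub>R\<lparr>carrier := B\<rparr>\<^esub> \<phi> l y'" if "y \<in> M" "y' \<in> M" for y y'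
      using \<phi>_add[OF that l] by (simp add: regular_left_module_def)
    show "\<phi> l (r \<odot>\<^bsub>regular_left_module R\<^esub> y) = r \<otimes>\<^bsub>R\<lparr>carrier := B\<rparr>\<^esub> \<phi> l y"
      if "r \<in> carrier (R\<lparr>carrier := B\<rparr>)" "y \<in> M" for r y
      using \<phi>_smult[OF that(2) _ l] that(1) by (simp add: regular_left_module_def)
  next
    fix y assume y: "y \<in> M"
    have "(\<Oplus>\<^bsub>regular_left_module R\<^esub>l\<in>{..<N}. \<phi> l y \<odot>\<^bsub>regular_left_module R\<^esub> u l) = (\<Oplus>l\<in>{..<N}. \<phi> l y \<otimes> u l)"
      using finsum_eq[of "{..<N}" "\<lambda>l. \<phi> l y \<otimes> u l"] \<phi>_B[OF y] BR uc by (simp add: regular_left_module_def)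
    then show "y = (\<Oplus>\<^bsub>regular_left_module R\<^esub>l\<in>{..<N}. \<phi> l y \<odot>\<^bsub>regular_left_module R\<^esub> u l)"
      using basis[OF y] by simp
  qed
qed

theorem theorem5p1:
  fixes K :: "('k, 'x) ring_scheme"
    and A :: "('k, 'a, 'y) hopf_superalgebra_scheme"
    and B :: "'a set"
  assumes "field K"
    and "ring_characteristic K \<noteq> 2"
    and "commutative_hopf_superalgebra K A"
    and "supersubalgebra K A B"
    and "left_coideal K A B"
  shows "flat_left_module TYPE('m1) TYPE('m2) TYPE('m3)
    (A\<lparr>carrier := B\<rparr>) (regular_left_module A)"
proof -
  have sa: "superalgebra K A"
    using assms(3) by (simp add: commutative_hopf_superalgebra_def hopf_superalgebra_def)
  then have "ring A" by (simp add: superalgebra_def)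
  then interpret hopf_coideal A K B
    using sa assms by (simp add: hopf_coideal_def hopf_coideal_axioms_def super_alg_def super_alg_axioms_def)
  interpret S: super_hopf_coideal A RR FF B ev od ee "antipode A" "comult A" tt by (rule super_hopf_coideal_instance)
  show ?thesis
    by (rule locally_dual_basis_imp_flat[OF A.regular_module_over_subring[OF B_sub(1)]
          A.subring_locally_dual_basis[OF B_sub(1) S.locally_factors_through_free]])
qed

end
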